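(* If $\tau,\sigma,\xi\in[\frac12,1]$ and $\tau=\xi$, then the semigroup $S(t)=e^{\mathcal{B}_2t}$ on $\mathcal H$ is analytic.
   Context: Let $L>0$; $\|\cdot\|$ and $\langle\cdot,\cdot\rangle$ denote the norm and inner product of the complex Hilbert space $L^2(0,L)$. Let $A=-\frac{d^2}{dx^2}$ with domain $D(A)=H^2(0,L)\cap H^1_0(0,L)$; $A$ is positive self-adjoint with compact inverse in $L^2(0,L)$, $A^\nu$ denotes its fractional powers, and $D(A^\nu)$ ($\nu\ge 0$) carries the norm $\|A^\nu u\|$, so $D(A^{1/2})=H^1_0(0,L)$ and $D(A^0)=L^2(0,L)$. The constants $\rho_1,\rho_2,\rho_3,\kappa,b,\gamma,\delta,\mu,\mu_1,\mu_2$ are positive reals and $\tau,\sigma,\xi\in[0,1]$. Let $\mathcal{H}=[D(A^{1/2})\times D(A^0)]^3$, with elements $U=(\phi,\Phi,\psi,\Psi,\theta,\Theta)$ and norm $$\|U\|_{\mathcal H}^2=\rho_1\|\Phi\|^2+\rho_2\|\Psi\|^2+\kappa\|\phi_x+\psi\|^2+b\|A^{1/2}\psi\|^2+\delta\|A^{1/2}\theta\|^2+\rho_3\|\Theta\|^2 .$$ The operator $\mathcal{B}_2$ is $$\mathcal{B}_2U=\Big(\Phi,\ \tfrac{1}{\rho_1}[\kappa(\phi_x+\psi)_x-\mu\Theta_x-\mu_1A^\tau\Phi],\ \Psi,\ \tfrac1{\rho_2}[-bA\psi-\kappa(\phi_x+\psi)+\mu\Theta-\mu_2A^\sigma\Psi],\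 \Theta,\ \tfrac1{\rho_3}[-\delta A\theta-\mu(\Phi_x+\Psi)-\gamma A^\xi\Theta]\Big)$$ with domain $\mathcal D(\mathcal B_2)=D(A)\times[D(A^{1/2})\cap D(A^\tau)]\times D(A)\times[D(A^{1/2})\cap D(A^\sigma)]\times D(A)\times[D(A^{1/2})\cap D(A^\xi)]$, and $e^{\mathcal B_2 t}$ denotes the $C_0$-semigroup of contractions on $\mathcal H$ generated by $\mathcal B_2$. With $\Phi=\phi_t,\Psi=\psi_t,\Theta=\theta_t$, the equation $U_t=\mathcal B_2U$ is the system $\rho_1\phi_{tt}-\kappa(\phi_x+\psi)_x+\mu\theta_{tx}+\mu_1A^\tau\phi_t=0$, $\rho_2\psi_{tt}+bA\psi+\kappa(\phi_x+\psi)-\mu\theta_t+\mu_2A^\sigma\psi_t=0$, $\rho_3\theta_{tt}+\delta A\theta+\mu(\phi_x+\psi)_t+\gamma A^\xi\theta_t=0$ on $(0,L)$ with homogeneous Dirichlet conditions for $\phi,\psi,\theta$. *)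

theory Defs
  imports "HOL-Analysis.Analysis"
begin

section \<open>Complex vector spaces\<close>

class complex_vector = real_vector +
  fixes scaleC :: "complex \<Rightarrow> 'a \<Rightarrow> 'a"  (infixr "*\<^sub>C" 75)
  assumes scaleC_add_right: "c *\<^sub>C (x + y) = c *\<^sub>C x + c *\<^sub>C y"
    and scaleC_add_left: "(c + d) *\<^sub>C x = c *\<^sub>C x + d *\<^sub>C x"
    and scaleC_scaleC: "c *\<^sub>C d *\<^sub>C x = (c * d) *\<^sub>C x"
    and scaleR_scaleC: "r *\<^sub>R x = complex_of_real r *\<^sub>C x"

instantiation prod :: (complex_vector, complex_vector) complex_vector
begin

definition scaleC_prod :: "complex \<Rightarrow> 'a \<times> 'b \<Rightarrow> 'a \<times> 'b"
  where "scaleC_prod c p = (c *\<^sub>C fst p, c *\<^sub>C snd p)"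

instance
  by standard
    (simp_all add: scaleC_prod_def prod_eq_iff scaleC_add_right scaleC_add_left
      scaleC_scaleC scaleR_scaleC)

end


section \<open>The space of square integrable functions\<close>

text \<open>
  The type \<open>l2\<close> is the complex space \<open>L\<^sup>2\<close> of the whole real line (functions modulo equality
  almost everywhere). Since a type cannot depend on the length \<open>L\<close>, the space \<open>L\<^sup>2(0,L)\<close> is the
  subspace of those classes that vanish almost everywhere outside \<open>(0,L)\<close>.
\<close>

definition square_integrable :: "(real \<Rightarrow> complex) \<Rightarrow> bool"
  where "square_integrable f \<longleftrightarrow>
    f \<in> borel_measurable lborel \<and> integrable lborel (\<lambda>x. (cmod (f x))\<^sup>2)"

definition l2_rel :: "(real \<Rightarrow> complex) \<Rightarrow> (real \<Rightarrow> complex) \<Rightarrow> bool"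
  where "l2_rel f g \<longleftrightarrow>
    square_integrable f \<and> square_integrable g \<and> (AE x in lborel. f x = g x)"

lemma square_integrable_add:
  assumes "square_integrable f" "square_integrable g"
  shows "square_integrable (\<lambda>x. f x + g x)"
proof -
  have m: "f \<in> borel_measurable lborel" "g \<in> borel_measurable lborel"
    and i: "integrable lborel (\<lambda>x. (cmod (f x))\<^sup>2)" "integrable lborel (\<lambda>x. (cmod (g x))\<^sup>2)"
    using assms by (auto simp: square_integrable_def)
  have "(cmod (f x + g x))\<^sup>2 \<le> 2 * (cmod (f x))\<^sup>2 + 2 * (cmod (g x))\<^sup>2" for x
  proof -
    have "(cmod (f x + g x))\<^sup>2 \<le> (cmod (f x) + cmod (g x))\<^sup>2"
      by (intro power_mono norm_triangle_ineq) auto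
    also have "\<dots> \<le> 2 * (cmod (f x))\<^sup>2 + 2 * (cmod (g x))\<^sup>2"
      using zero_le_power2[of "cmod (f x) - cmod (g x)"]
      by (simp add: power2_eq_square algebra_simps)
    finally show ?thesis .
  qed
  then have bound: "norm ((cmod (f x + g x))\<^sup>2) \<le> norm (2 * (cmod (f x))\<^sup>2 + 2 * (cmod (g x))\<^sup>2)" for x
    by (metis abs_ge_self abs_power2 order_trans real_norm_def)
  have mfg: "(\<lambda>x. f x + g x) \<in> borel_measurable lborel"
    using m by (rule borel_measurable_add)
  then have "(\<lambda>x. (cmod (f x + g x))\<^sup>2) \<in> borel_measurable lborel"
    by measurable
  moreover have "integrable lborel (\<lambda>x. 2 * (cmod (f x))\<^sup>2 + 2 * (cmod (g x))\<^sup>2)"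
    using i by simp
  ultimately have "integrable lborel (\<lambda>x. (cmod (f x + g x))\<^sup>2)"
    using bound by (blast intro: Bochner_Integration.integrable_bound AE_I2)
  with mfg show ?thesis by (simp add: square_integrable_def)
qed

lemma square_integrable_cmult:
  "square_integrable f \<Longrightarrow> square_integrable (\<lambda>x. c * f x)"
  by (auto simp: square_integrable_def norm_mult power_mult_distrib)

lemma square_integrable_zero: "square_integrable (\<lambda>_. 0)"
  by (auto simp: square_integrable_def)

lemma square_integrable_product:
  assumes "square_integrable f" "square_integrable g"
  shows "integrable lborel (\<lambda>x. f x * cnj (g x))"
proof -
  have m: "f \<in> borel_measurable lborel" "g \<in> borel_measurable lborel"
    and i: "integrable lborel (\<lambda>x. (cmod (f x))\<^sup>2)" "integrable lborel (\<lambda>x. (cmod (g x))\<^sup>2)"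
    using assms by (auto simp: square_integrable_def)
  have "cmod (f x * cnj (g x)) \<le> (cmod (f x))\<^sup>2 + (cmod (g x))\<^sup>2" for x
  proof -
    have "2 * (cmod (f x) * cmod (g x)) \<le> (cmod (f x))\<^sup>2 + (cmod (g x))\<^sup>2"
      using zero_le_power2[of "cmod (f x) - cmod (g x)"]
      by (simp add: power2_eq_square algebra_simps)
    moreover have "0 \<le> cmod (f x) * cmod (g x)" by simp
    ultimately show ?thesis unfolding norm_mult complex_mod_cnj by linarith
  qed
  then have bound: "norm (f x * cnj (g x)) \<le> norm ((cmod (f x))\<^sup>2 + (cmod (g x))\<^sup>2)" for x
    by (metis abs_ge_self order_trans real_norm_def)
  have "(\<lambda>x. cnj (g x)) \<in> borel_measurable lborel"
    by (rule measurable_compose[OF m(2)])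
      (rule borel_measurable_continuous_onI, rule continuous_on_cnj, rule continuous_on_id)
  with m(1) have "(\<lambda>x. f x * cnj (g x)) \<in> borel_measurable lborel"
    by (rule borel_measurable_times)
  then show ?thesis
    by (rule Bochner_Integration.integrable_bound[OF Bochner_Integration.integrable_add[OF i]])
      (rule AE_I2, rule bound)
qed

lemma l2_relI:
  assumes "square_integrable f" "\<And>x. f x = g x"
  shows "l2_rel f g"
proof -
  have "f = g" using assms(2) by (rule ext)
  with assms(1) show ?thesis by (simp add: l2_rel_def)
qed

lemmas square_integrable_intros =
  square_integrable_add square_integrable_cmult square_integrable_zero

lemma l2_rel_add:
  assumes "l2_rel f f'" "l2_rel g g'"
  shows "l2_rel (\<lambda>x. f x + g x) (\<lambda>x. f' x + g' x)"
proof -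
  have sq: "square_integrable f" "square_integrable f'" "square_integrable g" "square_integrable g'"
    and ae: "AE x in lborel. f x = f' x" "AE x in lborel. g x = g' x"
    using assms by (simp_all add: l2_rel_def)
  from ae have ae': "AE x in lborel. f x + g x = f' x + g' x"
    by (rule eventually_elim2) (simp only:)
  show ?thesis
    unfolding l2_rel_def by (rule conjI square_integrable_add sq ae')+
qed

lemma l2_rel_cmult:
  assumes "l2_rel f g"
  shows "l2_rel (\<lambda>x. c * f x) (\<lambda>x. c * g x)"
proof -
  have "AE x in lborel. f x = g x" using assms by (simp add: l2_rel_def)
  then have "AE x in lborel. c * f x = c * g x" by eventually_elim simp
  with assms show ?thesis by (simp add: l2_rel_def square_integrable_cmult)
qed

quotient_type l2 = "real \<Rightarrow> complex" / partial: l2_rel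
proof (rule part_equivpI)
  show "\<exists>f. l2_rel f f"
    by (rule exI[of _ "\<lambda>_. 0"]) (simp add: l2_rel_def square_integrable_zero)
  show "symp l2_rel"
  proof (rule sympI)
    fix f g assume fg: "l2_rel f g"
    then have "AE x in lborel. f x = g x" by (simp add: l2_rel_def)
    then have "AE x in lborel. g x = f x" by (rule eventually_mono) (rule sym)
    with fg show "l2_rel g f" by (simp only: l2_rel_def simp_thms)
  qed
  show "transp l2_rel"
  proof (rule transpI)
    fix f g h assume fgh: "l2_rel f g" "l2_rel g h"
    then have "AE x in lborel. f x = g x" "AE x in lborel. g x = h x"
      by (simp_all add: l2_rel_def)
    then have "AE x in lborel. f x = h x" by (rule eventually_elim2) (rule trans)
    with fgh show "l2_rel f h" by (simp only: l2_rel_def simp_thms)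
  qed
qed

lift_definition cinner_l2 :: "l2 \<Rightarrow> l2 \<Rightarrow> complex"
  is "\<lambda>f g. LINT x|lborel. f x * cnj (g x)"
proof -
  fix f f' g g' assume "l2_rel f f'" "l2_rel g g'"
  then have sq: "square_integrable f" "square_integrable f'"
      "square_integrable g" "square_integrable g'"
    and ae: "AE x in lborel. f x = f' x" "AE x in lborel. g x = g' x"
    by (simp_all add: l2_rel_def)
  from ae have ae': "AE x in lborel. f x * cnj (g x) = f' x * cnj (g' x)"
    by (rule eventually_elim2) (simp only:)
  show "(LINT x|lborel. f x * cnj (g x)) = (LINT x|lborel. f' x * cnj (g' x))"
    by (rule integral_cong_AE[OF _ _ ae'])
      (rule borel_measurable_integrable square_integrable_product sq)+
qed

instantiation l2 :: real_vector
begin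

lift_definition zero_l2 :: l2 is "\<lambda>_. 0"
  by (simp add: l2_rel_def square_integrable_zero)

lift_definition plus_l2 :: "l2 \<Rightarrow> l2 \<Rightarrow> l2" is "\<lambda>f g x. f x + g x"
  by (rule l2_rel_add)

lift_definition scaleR_l2 :: "real \<Rightarrow> l2 \<Rightarrow> l2" is "\<lambda>r f x. complex_of_real r * f x"
  by (rule l2_rel_cmult)

definition uminus_l2 :: "l2 \<Rightarrow> l2" where "uminus_l2 u = (-1) *\<^sub>R u"

definition minus_l2 :: "l2 \<Rightarrow> l2 \<Rightarrow> l2" where "minus_l2 u v = u + (-1) *\<^sub>R v"

instance
proof
  fix a b c :: l2 and r s :: real
  show "a + b + c = a + (b + c)"
    by transfer (intro l2_relI square_integrable_intros; simp add: l2_rel_def algebra_simps)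
  show "a + b = b + a"
    by transfer (intro l2_relI square_integrable_intros; simp add: l2_rel_def algebra_simps)
  show "0 + a = a"
    by transfer (intro l2_relI square_integrable_intros; simp add: l2_rel_def algebra_simps)
  show "- a + a = 0" unfolding uminus_l2_def
    by transfer (intro l2_relI square_integrable_intros; simp add: l2_rel_def algebra_simps)
  show "a - b = a + - b" by (simp add: minus_l2_def uminus_l2_def)
  show "r *\<^sub>R (a + b) = r *\<^sub>R a + r *\<^sub>R b"
    by transfer (intro l2_relI square_integrable_intros; simp add: l2_rel_def algebra_simps)
  show "(r + s) *\<^sub>R a = r *\<^sub>R a + s *\<^sub>R a"
    by transfer (intro l2_relI square_integrable_intros; simp add: l2_rel_def algebra_simps)
  show "r *\<^sub>R s *\<^sub>R a = (r * s) *\<^sub>R a"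
    by transfer (intro l2_relI square_integrable_intros; simp add: l2_rel_def algebra_simps)
  show "1 *\<^sub>R a = a"
    by transfer (intro l2_relI square_integrable_intros; simp add: l2_rel_def algebra_simps)
qed

end

instantiation l2 :: complex_vector
begin

lift_definition scaleC_l2 :: "complex \<Rightarrow> l2 \<Rightarrow> l2" is "\<lambda>c f x. c * f x"
  by (rule l2_rel_cmult)

instance
proof
  fix a b :: l2 and c d :: complex and r :: real
  show "c *\<^sub>C (a + b) = c *\<^sub>C a + c *\<^sub>C b"
    by transfer (intro l2_relI square_integrable_intros; simp add: l2_rel_def algebra_simps)
  show "(c + d) *\<^sub>C a = c *\<^sub>C a + d *\<^sub>C a"
    by transfer (intro l2_relI square_integrable_intros; simp add: l2_rel_def algebra_simps)
  show "c *\<^sub>C d *\<^sub>C a = (c * d) *\<^sub>C a"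
    by transfer (intro l2_relI square_integrable_intros; simp add: l2_rel_def algebra_simps)
  show "r *\<^sub>R a = complex_of_real r *\<^sub>C a"
    by transfer (intro l2_relI square_integrable_intros; simp add: l2_rel_def algebra_simps)
qed

end

lemma cinner_l2_commute: "cinner_l2 u v = cnj (cinner_l2 v u)"
proof transfer
  fix f g :: "real \<Rightarrow> complex"
  have "(\<lambda>x. f x * cnj (g x)) = (\<lambda>x. cnj (g x * cnj (f x)))"
    by (simp add: mult.commute)
  then show "(LINT x|lborel. f x * cnj (g x)) = cnj (LINT x|lborel. g x * cnj (f x))"
    by (simp only: Bochner_Integration.integral_cnj)
qed

lemma cinner_l2_add_left: "cinner_l2 (u + v) w = cinner_l2 u w + cinner_l2 v w"
proof transfer
  fix f g h assume "l2_rel f f" "l2_rel g g" "l2_rel h h"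
  then have "integrable lborel (\<lambda>x. f x * cnj (h x))" "integrable lborel (\<lambda>x. g x * cnj (h x))"
    by (simp_all add: l2_rel_def square_integrable_product)
  then show "(LINT x|lborel. (f x + g x) * cnj (h x)) =
      (LINT x|lborel. f x * cnj (h x)) + (LINT x|lborel. g x * cnj (h x))"
    by (simp only: distrib_right Bochner_Integration.integral_add)
qed

lemma cinner_l2_scaleC_left: "cinner_l2 (c *\<^sub>C u) v = c * cinner_l2 u v"
  by transfer (simp only: mult.assoc integral_mult_right_zero)

lemma cinner_l2_self_eq:
  "cinner_l2 (abs_l2 f) (abs_l2 f) = complex_of_real (LINT x|lborel. (cmod (f x))\<^sup>2)"
  if "square_integrable f"
proof -
  have "l2_rel f f" using that by (rule l2_relI) (rule refl)
  then have "cinner_l2 (abs_l2 f) (abs_l2 f) = (LINT x|lborel. f x * cnj (f x))"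
    by (simp add: cinner_l2.abs_eq)
  also have "\<dots> = (LINT x|lborel. complex_of_real ((cmod (f x))\<^sup>2))"
    by (simp only: complex_norm_square)
  finally show ?thesis by (simp only: integral_complex_of_real)
qed

lemma cinner_l2_self: "0 \<le> Re (cinner_l2 u u)" "Re (cinner_l2 u u) = 0 \<longleftrightarrow> u = 0"
proof -
  obtain f where u: "u = abs_l2 f" and f: "l2_rel f f"
    by (induct u rule: l2.abs_induct) blast
  have sq: "square_integrable f" using f by (simp add: l2_rel_def)
  have eq: "Re (cinner_l2 u u) = (LINT x|lborel. (cmod (f x))\<^sup>2)"
    unfolding u by (simp only: cinner_l2_self_eq[OF sq] Re_complex_of_real)
  show "0 \<le> Re (cinner_l2 u u)"
    unfolding eq by (rule integral_nonneg_AE) simp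
  have "(LINT x|lborel. (cmod (f x))\<^sup>2) = 0 \<longleftrightarrow> (AE x in lborel. (cmod (f x))\<^sup>2 = 0)"
    using sq by (intro integral_nonneg_eq_0_iff_AE) (simp_all add: square_integrable_def)
  also have "\<dots> \<longleftrightarrow> l2_rel f (\<lambda>_. 0)"
    using sq by (simp add: l2_rel_def square_integrable_zero)
  also have "\<dots> \<longleftrightarrow> u = 0"
    unfolding u zero_l2_def
    using Quotient3_rel[OF Quotient3_l2, of f "\<lambda>_. 0"] f
    by (simp add: l2_rel_def square_integrable_zero)
  finally show "Re (cinner_l2 u u) = 0 \<longleftrightarrow> u = 0" unfolding eq .
qed

instantiation l2 :: real_inner
begin

definition inner_l2 :: "l2 \<Rightarrow> l2 \<Rightarrow> real" where "inner_l2 u v = Re (cinner_l2 u v)"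
definition norm_l2 :: "l2 \<Rightarrow> real" where "norm_l2 u = sqrt (inner u u)"
definition dist_l2 :: "l2 \<Rightarrow> l2 \<Rightarrow> real" where "dist_l2 u v = norm (u - v)"
definition sgn_l2 :: "l2 \<Rightarrow> l2" where "sgn_l2 u = u /\<^sub>R norm u"
definition uniformity_l2 :: "(l2 \<times> l2) filter"
  where "uniformity_l2 = (INF e\<in>{0<..}. principal {(x, y). dist x y < e})"
definition open_l2 :: "l2 set \<Rightarrow> bool"
  where "open_l2 U \<longleftrightarrow> (\<forall>x\<in>U. \<forall>\<^sub>F (x', y) in uniformity. x' = x \<longrightarrow> y \<in> U)"

instance
proof
  fix a b c :: l2 and r :: real
  show "inner a b = inner b a"
    unfolding inner_l2_def by (subst cinner_l2_commute) simp
  show "inner (a + b) c = inner a c + inner b c"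
    by (simp add: inner_l2_def cinner_l2_add_left)
  show "inner (r *\<^sub>R a) b = r * inner a b"
    by (simp add: inner_l2_def scaleR_scaleC cinner_l2_scaleC_left)
  show "0 \<le> inner a a" "inner a a = 0 \<longleftrightarrow> a = 0"
    unfolding inner_l2_def by (rule cinner_l2_self)+
qed (simp_all only: dist_l2_def sgn_l2_def norm_l2_def uniformity_l2_def open_l2_def)

end

lift_definition vanishes_outside :: "real set \<Rightarrow> l2 \<Rightarrow> bool"
  is "\<lambda>A f. AE x in lborel. x \<notin> A \<longrightarrow> f x = 0"
proof -
  fix A :: "real set" and f g :: "real \<Rightarrow> complex" assume "l2_rel f g"
  then have "AE x in lborel. f x = g x" by (simp add: l2_rel_def)
  then have "AE x in lborel. (x \<notin> A \<longrightarrow> f x = 0) \<longleftrightarrow> (x \<notin> A \<longrightarrow> g x = 0)"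
    by (rule eventually_mono) simp
  then show "(AE x in lborel. x \<notin> A \<longrightarrow> f x = 0) \<longleftrightarrow> (AE x in lborel. x \<notin> A \<longrightarrow> g x = 0)"
    by (rule eventually_subst)
qed

definition L2 :: "real \<Rightarrow> l2 set"
  where "L2 L = {u. vanishes_outside {0<..<L} u}"


section \<open>Sobolev spaces on \<open>(0,L)\<close>\<close>

definition smooth :: "(real \<Rightarrow> complex) \<Rightarrow> bool"
  where "smooth f \<longleftrightarrow>
    (\<exists>F. F 0 = f \<and> (\<forall>n x. (F n has_vector_derivative F (Suc n) x) (at x)))"

definition test_function :: "real \<Rightarrow> (real \<Rightarrow> complex) \<Rightarrow> bool"
  where "test_function L f \<longleftrightarrow>
    smooth f \<and> (\<exists>a b. 0 < a \<and> b < L \<and> (\<forall>x. x \<notin> {a..b} \<longrightarrow> f x = 0))"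

lemma smooth_measurable:
  assumes "smooth f"
  shows "f \<in> borel_measurable borel" "(\<lambda>x. vector_derivative f (at x)) \<in> borel_measurable borel"
proof -
  obtain F where F: "F 0 = f" "\<And>n x. (F n has_vector_derivative F (Suc n) x) (at x)"
    using assms by (auto simp: smooth_def)
  have c: "continuous_on UNIV (F n)" for n
    by (auto simp: continuous_on_eq_continuous_at intro: has_vector_derivative_continuous F(2))
  have "vector_derivative f (at x) = F 1 x" for x
    using F(2)[of 0 x] F(1) by (simp add: vector_derivative_at)
  then have "(\<lambda>x. vector_derivative f (at x)) = F 1" by auto
  then show "(\<lambda>x. vector_derivative f (at x)) \<in> borel_measurable borel"
    using borel_measurable_continuous_onI[OF c[of 1]] by simp
  show "f \<in> borel_measurable borel"
    using borel_measurable_continuous_onI[OF c[of 0]] F(1) by simp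
qed

lift_definition integrates_by_parts :: "real \<Rightarrow> l2 \<Rightarrow> l2 \<Rightarrow> bool"
  is "\<lambda>L f g. \<forall>\<phi>. test_function L \<phi> \<longrightarrow>
        (LINT x:{0<..<L}|lborel. f x * vector_derivative \<phi> (at x)) =
        - (LINT x:{0<..<L}|lborel. g x * \<phi> x)"
proof -
  fix L :: real and f f' g g' :: "real \<Rightarrow> complex"
  assume "l2_rel f f'" "l2_rel g g'"
  then have m: "f \<in> borel_measurable borel" "f' \<in> borel_measurable borel"
      "g \<in> borel_measurable borel" "g' \<in> borel_measurable borel"
    and ae: "AE x in lborel. f x = f' x" "AE x in lborel. g x = g' x"
    by (simp_all add: l2_rel_def square_integrable_def)
  have eq: "(LINT x:{0<..<L}|lborel. h x * k x) = (LINT x:{0<..<L}|lborel. h' x * k x)"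
    if h: "h \<in> borel_measurable borel" "h' \<in> borel_measurable borel"
      and k: "k \<in> borel_measurable borel"
      and hh': "AE x in lborel. h x = h' x" for h h' k :: "real \<Rightarrow> complex"
    unfolding set_lebesgue_integral_def
  proof (rule integral_cong_AE)
    have s: "{0<..<L} \<in> sets borel" by simp
    show "(\<lambda>x. indicator {0<..<L} x *\<^sub>R (h x * k x)) \<in> borel_measurable lborel"
      "(\<lambda>x. indicator {0<..<L} x *\<^sub>R (h' x * k x)) \<in> borel_measurable lborel"
      unfolding measurable_lborel2
      by (rule borel_measurable_scaleR borel_measurable_times borel_measurable_indicator s h k)+
    show "AE x in lborel. indicator {0<..<L} x *\<^sub>R (h x * k x) = indicator {0<..<L} x *\<^sub>R (h' x * k x)"
      using hh' by (rule eventually_mono) simp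
  qed
  have "(LINT x:{0<..<L}|lborel. f x * vector_derivative \<phi> (at x)) =
        (LINT x:{0<..<L}|lborel. f' x * vector_derivative \<phi> (at x))"
    "(LINT x:{0<..<L}|lborel. g x * \<phi> x) = (LINT x:{0<..<L}|lborel. g' x * \<phi> x)"
    if "test_function L \<phi>" for \<phi>
  proof -
    have "smooth \<phi>" using that by (simp add: test_function_def)
    note k = smooth_measurable[OF this]
    show "(LINT x:{0<..<L}|lborel. f x * vector_derivative \<phi> (at x)) =
        (LINT x:{0<..<L}|lborel. f' x * vector_derivative \<phi> (at x))"
      by (rule eq[OF m(1,2) k(2) ae(1)])
    show "(LINT x:{0<..<L}|lborel. g x * \<phi> x) = (LINT x:{0<..<L}|lborel. g' x * \<phi> x)"
      by (rule eq[OF m(3,4) k(1) ae(2)])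
  qed
  then show
    "(\<forall>\<phi>. test_function L \<phi> \<longrightarrow>
        (LINT x:{0<..<L}|lborel. f x * vector_derivative \<phi> (at x)) =
        - (LINT x:{0<..<L}|lborel. g x * \<phi> x)) \<longleftrightarrow>
     (\<forall>\<phi>. test_function L \<phi> \<longrightarrow>
        (LINT x:{0<..<L}|lborel. f' x * vector_derivative \<phi> (at x)) =
        - (LINT x:{0<..<L}|lborel. g' x * \<phi> x))"
    by simp
qed

definition has_weak_derivative :: "real \<Rightarrow> l2 \<Rightarrow> l2 \<Rightarrow> bool"
  where "has_weak_derivative L u v \<longleftrightarrow> u \<in> L2 L \<and> v \<in> L2 L \<and> integrates_by_parts L u v"

definition weak_derivative :: "real \<Rightarrow> l2 \<Rightarrow> l2"
  where "weak_derivative L u = (THE v. has_weak_derivative L u v)"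

definition H1 :: "real \<Rightarrow> l2 set"
  where "H1 L = {u. \<exists>v. has_weak_derivative L u v}"

definition H2 :: "real \<Rightarrow> l2 set"
  where "H2 L = {u \<in> H1 L. weak_derivative L u \<in> H1 L}"

text \<open>The closure of the test functions in the norm of \<open>H1\<close>:\<close>

definition H10 :: "real \<Rightarrow> l2 set"
  where "H10 L = {u \<in> H1 L. \<exists>\<phi>. (\<forall>n::nat. test_function L (\<phi> n)) \<and>
    (\<lambda>n. abs_l2 (\<phi> n)) \<longlonglongrightarrow> u \<and>
    (\<lambda>n. weak_derivative L (abs_l2 (\<phi> n))) \<longlonglongrightarrow> weak_derivative L u}"


section \<open>The Dirichlet Laplacian and its fractional powers\<close>

definition dom_A :: "real \<Rightarrow> l2 set"
  where "dom_A L = H2 L \<inter> H10 L"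

definition op_A :: "real \<Rightarrow> l2 \<Rightarrow> l2"
  where "op_A L u = - weak_derivative L (weak_derivative L u)"

text \<open>
  The operator \<open>A\<close> is positive self-adjoint with compact inverse, so \<open>L\<^sup>2(0,L)\<close> is the orthogonal sum
  of its eigenspaces and the functional calculus reads
  \<open>A\<^sup>\<nu> u = \<Sum>\<lambda>. \<lambda>\<^sup>\<nu> P\<^sub>\<lambda> u\<close>, where \<open>\<lambda>\<close> ranges over the eigenvalues and \<open>P\<^sub>\<lambda>\<close> is the orthogonal
  projection onto the eigenspace of \<open>\<lambda>\<close>.
\<close>

definition eigenspace_A :: "real \<Rightarrow> real \<Rightarrow> l2 set"
  where "eigenspace_A L l = {u \<in> dom_A L. op_A L u = l *\<^sub>R u}"

definition eigenvalues_A :: "real \<Rightarrow> real set"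
  where "eigenvalues_A L = {l. \<exists>u \<in> eigenspace_A L l. u \<noteq> 0}"

definition eigenprojection_A :: "real \<Rightarrow> real \<Rightarrow> l2 \<Rightarrow> l2"
  where "eigenprojection_A L l u =
    (THE p. p \<in> eigenspace_A L l \<and> (\<forall>v \<in> eigenspace_A L l. cinner_l2 (u - p) v = 0))"

definition dom_A_pow :: "real \<Rightarrow> real \<Rightarrow> l2 set"
  where "dom_A_pow L \<nu> = {u \<in> L2 L.
    (\<lambda>l. (l powr \<nu> * norm (eigenprojection_A L l u))\<^sup>2) summable_on eigenvalues_A L}"

definition op_A_pow :: "real \<Rightarrow> real \<Rightarrow> l2 \<Rightarrow> l2"
  where "op_A_pow L \<nu> u =
    (\<Sum>\<^sub>\<infinity>l \<in> eigenvalues_A L. (l powr \<nu>) *\<^sub>R eigenprojection_A L l u)"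


section \<open>Semigroups on a complex normed space with carrier \<open>X\<close> and norm \<open>N\<close>\<close>

definition bounded_operator ::
    "'a::complex_vector set \<Rightarrow> ('a \<Rightarrow> real) \<Rightarrow> ('a \<Rightarrow> 'a) \<Rightarrow> bool"
  where "bounded_operator X N T \<longleftrightarrow>
    (\<forall>u \<in> X. T u \<in> X) \<and>
    (\<forall>u \<in> X. \<forall>v \<in> X. T (u + v) = T u + T v) \<and>
    (\<forall>c. \<forall>u \<in> X. T (c *\<^sub>C u) = c *\<^sub>C T u) \<and>
    (\<exists>M. \<forall>u \<in> X. N (T u) \<le> M * N u)"

definition C0_semigroup ::
    "'a::complex_vector set \<Rightarrow> ('a \<Rightarrow> real) \<Rightarrow> (real \<Rightarrow> 'a \<Rightarrow> 'a) \<Rightarrow> bool"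
  where "C0_semigroup X N S \<longleftrightarrow>
    (\<forall>t \<ge> 0. bounded_operator X N (S t)) \<and>
    (\<forall>u \<in> X. S 0 u = u) \<and>
    (\<forall>s \<ge> 0. \<forall>t \<ge> 0. \<forall>u \<in> X. S (s + t) u = S s (S t u)) \<and>
    (\<forall>u \<in> X. ((\<lambda>t. N (S t u - u)) \<longlongrightarrow> 0) (at_right 0))"

definition contraction_C0_semigroup ::
    "'a::complex_vector set \<Rightarrow> ('a \<Rightarrow> real) \<Rightarrow> (real \<Rightarrow> 'a \<Rightarrow> 'a) \<Rightarrow> bool"
  where "contraction_C0_semigroup X N S \<longleftrightarrow>
    C0_semigroup X N S \<and> (\<forall>t \<ge> 0. \<forall>u \<in> X. N (S t u) \<le> N u)"

definition generator_graph ::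
    "'a::complex_vector set \<Rightarrow> ('a \<Rightarrow> real) \<Rightarrow> (real \<Rightarrow> 'a \<Rightarrow> 'a) \<Rightarrow> ('a \<times> 'a) set"
  where "generator_graph X N S =
    {(u, v). u \<in> X \<and> v \<in> X \<and>
      ((\<lambda>t. N ((S t u - u) /\<^sub>R t - v)) \<longlongrightarrow> 0) (at_right 0)}"

definition graph_closure ::
    "'a::complex_vector set \<Rightarrow> ('a \<Rightarrow> real) \<Rightarrow> ('a \<times> 'a) set \<Rightarrow> ('a \<times> 'a) set"
  where "graph_closure X N G =
    {(u, v). u \<in> X \<and> v \<in> X \<and>
      (\<exists>w. (\<forall>n::nat. w n \<in> G) \<and>
        (\<lambda>n. N (fst (w n) - u)) \<longlonglongrightarrow> 0 \<and> (\<lambda>n. N (snd (w n) - v)) \<longlonglongrightarrow> 0)}"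

text \<open>
  A semigroup is generated by the operator \<open>B\<close> with domain \<open>D\<close> if its generator is the closure of
  \<open>B\<close>. As generators are closed, this includes the case that the generator is \<open>B\<close> itself. The
  closure matters: for \<open>\<tau> > 1/2\<close> the operator \<open>B2\<close> below is not closed on \<open>dom_B2\<close>, because
  cancellation between \<open>\<kappa> \<phi>\<^sub>x\<^sub>x\<close> and \<open>\<mu>\<^sub>1 A\<^sup>\<tau> \<Phi>\<close> is possible in the limit, and similarly for \<open>\<sigma>\<close> and \<open>\<xi>\<close>.
\<close>

definition generated_by ::
    "'a::complex_vector set \<Rightarrow> ('a \<Rightarrow> real) \<Rightarrow> (real \<Rightarrow> 'a \<Rightarrow> 'a) \<Rightarrow> 'a set \<Rightarrow> ('a \<Rightarrow> 'a) \<Rightarrow> bool"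
  where "generated_by X N S D B \<longleftrightarrow>
    generator_graph X N S = graph_closure X N {(u, B u) | u. u \<in> D}"

definition sector :: "real \<Rightarrow> complex set"
  where "sector \<alpha> = {z. z \<noteq> 0 \<and> \<bar>Arg z\<bar> < \<alpha>}"

text \<open>Complex differentiability in the operator norm:\<close>

definition operator_differentiable_at ::
    "'a::complex_vector set \<Rightarrow> ('a \<Rightarrow> real) \<Rightarrow> (complex \<Rightarrow> 'a \<Rightarrow> 'a) \<Rightarrow> complex \<Rightarrow> bool"
  where "operator_differentiable_at X N T z \<longleftrightarrow>
    (\<exists>T'. bounded_operator X N T' \<and>
      (\<forall>e > 0. \<forall>\<^sub>F h in at 0. \<forall>u \<in> X.
        N (inverse h *\<^sub>C (T (z + h) u - T z u) - T' u) \<le> e * N u))"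

definition analytic_semigroup ::
    "'a::complex_vector set \<Rightarrow> ('a \<Rightarrow> real) \<Rightarrow> (real \<Rightarrow> 'a \<Rightarrow> 'a) \<Rightarrow> bool"
  where "analytic_semigroup X N S \<longleftrightarrow>
    C0_semigroup X N S \<and>
    (\<exists>\<alpha> T. 0 < \<alpha> \<and> \<alpha> \<le> pi / 2 \<and>
      (\<forall>t \<ge> 0. \<forall>u \<in> X. T (complex_of_real t) u = S t u) \<and>
      (\<forall>z \<in> sector \<alpha>. bounded_operator X N (T z)) \<and>
      (\<forall>z \<in> sector \<alpha>. operator_differentiable_at X N T z) \<and>
      (\<forall>z \<in> sector \<alpha>. \<forall>w \<in> sector \<alpha>. \<forall>u \<in> X. T (z + w) u = T z (T w u)) \<and>
      (\<forall>u \<in> X. ((\<lambda>z. N (T z u - u)) \<longlongrightarrow> 0) (at 0 within sector \<alpha>)))"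


section \<open>The thermoelastic Timoshenko system\<close>

text \<open>States are the tuples \<open>(\<phi>, \<Phi>, \<psi>, \<Psi>, \<theta>, \<Theta>)\<close>.\<close>

type_synonym state = "l2 \<times> l2 \<times> l2 \<times> l2 \<times> l2 \<times> l2"

definition space_H :: "real \<Rightarrow> state set"
  where "space_H L =
    dom_A_pow L (1/2) \<times> dom_A_pow L 0 \<times>
    dom_A_pow L (1/2) \<times> dom_A_pow L 0 \<times>
    dom_A_pow L (1/2) \<times> dom_A_pow L 0"

definition norm_H ::
    "real \<Rightarrow> real \<Rightarrow> real \<Rightarrow> real \<Rightarrow> real \<Rightarrow> real \<Rightarrow> real \<Rightarrow> state \<Rightarrow> real"
  where "norm_H L \<rho>\<^sub>1 \<rho>\<^sub>2 \<rho>\<^sub>3 \<kappa> b \<delta> = (\<lambda>(\<phi>, \<Phi>, \<psi>, \<Psi>, \<theta>, \<Theta>).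
    sqrt (\<rho>\<^sub>1 * (norm \<Phi>)\<^sup>2 + \<rho>\<^sub>2 * (norm \<Psi>)\<^sup>2 + \<kappa> * (norm (weak_derivative L \<phi> + \<psi>))\<^sup>2
      + b * (norm (op_A_pow L (1/2) \<psi>))\<^sup>2 + \<delta> * (norm (op_A_pow L (1/2) \<theta>))\<^sup>2
      + \<rho>\<^sub>3 * (norm \<Theta>)\<^sup>2))"

definition dom_B2 :: "real \<Rightarrow> real \<Rightarrow> real \<Rightarrow> real \<Rightarrow> state set"
  where "dom_B2 L \<tau> \<sigma> \<xi> =
    dom_A L \<times> (dom_A_pow L (1/2) \<inter> dom_A_pow L \<tau>) \<times>
    dom_A L \<times> (dom_A_pow L (1/2) \<inter> dom_A_pow L \<sigma>) \<times>
    dom_A L \<times> (dom_A_pow L (1/2) \<inter> dom_A_pow L \<xi>)"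

definition B2 ::
    "real \<Rightarrow> real \<Rightarrow> real \<Rightarrow> real \<Rightarrow> real \<Rightarrow> real \<Rightarrow> real \<Rightarrow> real \<Rightarrow> real \<Rightarrow> real \<Rightarrow> real \<Rightarrow>
     real \<Rightarrow> real \<Rightarrow> real \<Rightarrow> state \<Rightarrow> state"
  where "B2 L \<rho>\<^sub>1 \<rho>\<^sub>2 \<rho>\<^sub>3 \<kappa> b \<gamma> \<delta> \<mu> \<mu>\<^sub>1 \<mu>\<^sub>2 \<tau> \<sigma> \<xi> = (\<lambda>(\<phi>, \<Phi>, \<psi>, \<Psi>, \<theta>, \<Theta>).
    (\<Phi>,
     (1 / \<rho>\<^sub>1) *\<^sub>R (\<kappa> *\<^sub>R weak_derivative L (weak_derivative L \<phi> + \<psi>)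
        - \<mu> *\<^sub>R weak_derivative L \<Theta> - \<mu>\<^sub>1 *\<^sub>R op_A_pow L \<tau> \<Phi>),
     \<Psi>,
     (1 / \<rho>\<^sub>2) *\<^sub>R (- (b *\<^sub>R op_A L \<psi>) - \<kappa> *\<^sub>R (weak_derivative L \<phi> + \<psi>)
        + \<mu> *\<^sub>R \<Theta> - \<mu>\<^sub>2 *\<^sub>R op_A_pow L \<sigma> \<Psi>),
     \<Theta>,
     (1 / \<rho>\<^sub>3) *\<^sub>R (- (\<delta> *\<^sub>R op_A L \<theta>) - \<mu> *\<^sub>R (weak_derivative L \<Phi> + \<Psi>)
        - \<gamma> *\<^sub>R op_A_pow L \<xi> \<Theta>)))"

end

theory Submission
  imports Defs
begin

text \<open>
  The semigroup is analytic because, up to a shift, its generator is sectorial with respect to an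
  equivalent inner product, and a semigroup with this property smooths at the rate \<open>1/t\<close>. The proof
  works with the semigroup alone; resolvents and spectra of the generator do not occur.

  For a single wave equation \<open>\<rho> \<phi>\<^sub>t\<^sub>t + k A \<phi> + d A\<^sup>\<tau> \<phi>\<^sub>t = F\<close> with \<open>\<Phi> = \<phi>\<^sub>t\<close> put
  \<open>x = A\<^sup>1\<^sup>-\<^sup>\<tau>\<^sup>/\<^sup>2 \<phi>\<close> and \<open>y = A\<^sup>\<tau>\<^sup>/\<^sup>2 \<Phi>\<close>. The energy dissipates only \<open>d \<parallel>y\<parallel>\<^sup>2\<close>, but the energy corrected by
  \<open>2 \<epsilon> \<rho> Re \<langle>A\<^sup>1\<^sup>-\<^sup>\<tau> \<phi>, \<Phi>\<rangle>\<close> dissipates \<open>\<epsilon> k \<parallel>x\<parallel>\<^sup>2\<close> as well. For \<open>\<tau> \<ge> 1/2\<close> the correction is bounded in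
  the energy norm, so that for small \<open>\<epsilon>\<close> the corrected energy \<open>p\<close> still is an equivalent inner
  product. Every principal term of \<open>p(B U, U')\<close> is a product of one of \<open>x, y\<close> with one of \<open>x', y'\<close>:
  for instance \<open>\<langle>A \<phi>, \<Phi>'\<rangle> = \<langle>x, y'\<rangle>\<close>. The form is therefore bounded by exactly those quantities
  that it dissipates.

  The three equations are coupled by \<open>\<mu> \<Theta>\<^sub>x\<close> and \<open>\<mu> \<Phi>\<^sub>x\<close>, which the energy norm does not control. The
  estimate \<open>\<bar>\<langle>u\<^sub>x, v\<rangle>\<bar> \<le> \<parallel>A\<^sup>1\<^sup>/\<^sup>4 u\<parallel> \<parallel>A\<^sup>1\<^sup>/\<^sup>4 v\<parallel>\<close> (\<open>derivative_quarter_bound\<close>) bounds them by the \<open>x\<close> and \<open>y\<close>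
  of the first and the third equation, again because the exponents are at least \<open>1/2\<close>; in the
  quadratic form they cancel up to the factor \<open>\<epsilon>\<close>. All other couplings are bounded. With
  \<open>K = B - \<omega>\<close> for large \<open>\<omega>\<close> this gives \<open>p(K U, U) \<le> 0\<close> and
  \<open>p(K U, U')\<^sup>2 \<le> C p(K U, U) p(K U', U')\<close> (\<open>sectorial_estimates\<close>). These estimates pass to the
  closure of \<open>B\<close>, which is the generator.

  For a bounded semigroup \<open>R\<close> with such a generator an energy argument yields
  \<open>\<parallel>K R(t)\<parallel> \<le> B/t\<close> (\<open>increment_energy_bound\<close>, \<open>smoothing\<close>). Then \<open>K\<^sup>n R(t) = (K R(t/n))\<^sup>n\<close> is bounded
  by a constant times \<open>n! (\<beta>/t)\<^sup>n\<close> (\<open>D_bound\<close>), so that the Taylor series of the orbits converge in a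
  cone about the positive half line. The binomial theorem gives the semigroup law for their sums
  (\<open>G_G\<close>), and Taylor's theorem identifies them with the semigroup on the half line (\<open>G_real\<close>).

  The sine functions lie in \<open>H\<^sup>1\<^sub>0\<close> and are complete (\<open>sine_class_in_H10\<close>,
  \<open>sine_class_complete\<close>); hence, up to factors, they are all eigenvectors of \<open>A\<close>, and the fractional powers act on
  Fourier coefficients by powers of the eigenvalues.
\<close>

section \<open>Completeness of the square integrable functions\<close>

class complex_normed_vector = complex_vector + real_normed_vector +
  assumes norm_scaleC: "norm (c *\<^sub>C x) = cmod c * norm x"

lemma scaleC_zero_right [simp]: "c *\<^sub>C 0 = (0 :: 'a :: complex_vector)"
  using scaleC_add_right[of c "0::'a" 0] by simp

lemma scaleC_zero_left [simp]: "0 *\<^sub>C x = (0 :: 'a :: complex_vector)"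
  using scaleC_add_left[of 0 0 x] by simp

lemma scaleC_one [simp]: "1 *\<^sub>C x = (x :: 'a :: complex_vector)"
  using scaleR_scaleC[of 1 x] by simp

lemma scaleC_minus_right: "c *\<^sub>C (- x) = - (c *\<^sub>C x :: 'a :: complex_vector)"
  using scaleC_add_right[of c x "- x"] by (simp add: eq_neg_iff_add_eq_0 add.commute)

lemma scaleC_diff_right: "c *\<^sub>C (x - y) = c *\<^sub>C x - (c *\<^sub>C y :: 'a :: complex_vector)"
  using scaleC_add_right[of c x "- y"] by (simp add: scaleC_minus_right)

lemma scaleC_scaleR: "c *\<^sub>C (r *\<^sub>R x) = r *\<^sub>R (c *\<^sub>C (x :: 'a :: complex_vector))"
  by (simp add: scaleR_scaleC scaleC_scaleC mult.commute)

lemma bounded_linear_scaleC: "bounded_linear (\<lambda>x :: 'a :: complex_normed_vector. c *\<^sub>C x)"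
  by (rule bounded_linear_intro[where K = "cmod c"])
    (simp_all add: scaleC_add_right scaleC_scaleR norm_scaleC mult.commute)

lemma cinner_l2_scaleC_right: "cinner_l2 u (c *\<^sub>C v) = cnj c * cinner_l2 u v"
  by (metis cinner_l2_commute cinner_l2_scaleC_left complex_cnj_mult)

lemma cinner_l2_add_right: "cinner_l2 u (v + w) = cinner_l2 u v + cinner_l2 u w"
  by (metis cinner_l2_commute cinner_l2_add_left complex_cnj_add)

lemma cinner_l2_self_norm: "cinner_l2 u u = complex_of_real ((norm u)\<^sup>2)"
proof -
  have "Im (cinner_l2 u u) = 0"
    using cinner_l2_commute[of u u] by (metis Reals_cnj_iff complex_is_Real_iff)
  moreover have "Re (cinner_l2 u u) = (norm u)\<^sup>2"
    by (simp add: power2_norm_eq_inner inner_l2_def)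
  ultimately show ?thesis by (simp add: complex_eq_iff)
qed

instance l2 :: complex_normed_vector
proof
  fix c and x :: l2
  have "complex_of_real ((norm (c *\<^sub>C x))\<^sup>2) = c * cnj c * complex_of_real ((norm x)\<^sup>2)"
    unfolding cinner_l2_self_norm[symmetric]
    by (simp add: cinner_l2_scaleC_left cinner_l2_scaleC_right)
  also have "\<dots> = complex_of_real ((cmod c * norm x)\<^sup>2)"
    by (simp add: complex_norm_square[symmetric] power_mult_distrib flip: of_real_power)
  finally have "(norm (c *\<^sub>C x))\<^sup>2 = (cmod c * norm x)\<^sup>2"
    by (simp only: of_real_eq_iff)
  then show "norm (c *\<^sub>C x) = cmod c * norm x"
    by (simp add: power2_eq_iff_nonneg)
qed

instance prod :: (complex_normed_vector, complex_normed_vector) complex_normed_vector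
proof
  fix c and x :: "'a \<times> 'b"
  have "(cmod c * norm (fst x))\<^sup>2 + (cmod c * norm (snd x))\<^sup>2
      = (cmod c)\<^sup>2 * ((norm (fst x))\<^sup>2 + (norm (snd x))\<^sup>2)"
    by (simp add: power_mult_distrib distrib_left)
  then show "norm (c *\<^sub>C x) = cmod c * norm x"
    by (simp add: scaleC_prod_def norm_prod_def norm_scaleC real_sqrt_mult)
qed

lemma cinner_l2_bound: "cmod (cinner_l2 u v) \<le> norm u * norm v"
proof -
  \<comment> \<open>Rotating \<open>u\<close> by the phase of the product makes the product real.\<close>
  obtain c where c: "cmod c = 1" "c * cinner_l2 u v = complex_of_real (cmod (cinner_l2 u v))"
  proof (cases "cinner_l2 u v = 0")
    case False
    let ?z = "cinner_l2 u v"
    have "cnj ?z / complex_of_real (cmod ?z) * ?z = complex_of_real (cmod ?z)"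
      using False complex_norm_square[of ?z]
      by (simp add: field_simps power2_eq_square)
    moreover have "cmod (cnj ?z / complex_of_real (cmod ?z)) = 1"
      using False by (simp add: norm_divide)
    ultimately show ?thesis using that by blast
  qed (use that[of 1] in auto)
  have "cmod (cinner_l2 u v) = Re (cinner_l2 (c *\<^sub>C u) v)"
    using c(2) by (simp add: cinner_l2_scaleC_left)
  also have "\<dots> \<le> norm (c *\<^sub>C u) * norm v"
    using norm_cauchy_schwarz[of "c *\<^sub>C u" v] by (simp add: inner_l2_def)
  finally show ?thesis using c(1) by (simp add: norm_scaleC)
qed

lemma bounded_bilinear_cinner_l2: "bounded_bilinear cinner_l2"
proof
  show "\<exists>K. \<forall>a b. norm (cinner_l2 a b) \<le> norm a * norm b * K"
    using cinner_l2_bound by (intro exI[of _ 1]) simp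
qed (simp_all add: cinner_l2_add_left cinner_l2_add_right scaleR_scaleC cinner_l2_scaleC_left
      cinner_l2_scaleC_right scaleR_conv_of_real)

lemmas cinner_l2_diff_left = bounded_bilinear.diff_left[OF bounded_bilinear_cinner_l2]
lemmas cinner_l2_minus_left = bounded_bilinear.minus_left[OF bounded_bilinear_cinner_l2]
lemmas cinner_l2_zero_left [simp] = bounded_bilinear.zero_left[OF bounded_bilinear_cinner_l2]
lemmas cinner_l2_zero_right [simp] = bounded_bilinear.zero_right[OF bounded_bilinear_cinner_l2]
lemmas tendsto_cinner_l2 = bounded_bilinear.tendsto[OF bounded_bilinear_cinner_l2]

lemma cinner_l2_scaleR_left: "cinner_l2 (r *\<^sub>R u) v = complex_of_real r * cinner_l2 u v"
  by (simp add: scaleR_scaleC cinner_l2_scaleC_left)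

lemma cinner_l2_scaleR_right: "cinner_l2 u (r *\<^sub>R v) = complex_of_real r * cinner_l2 u v"
  by (simp add: scaleR_scaleC cinner_l2_scaleC_right)

lemma l2_rel_refl: "l2_rel f f \<longleftrightarrow> square_integrable f"
  by (simp add: l2_rel_def)

lemma l2_representative:
  obtains f where "square_integrable f" "u = abs_l2 f"
  by (induct u rule: l2.abs_induct) (auto simp: l2_rel_def)

lemma abs_l2_eq_iff:
  assumes "square_integrable f" "square_integrable g"
  shows "abs_l2 f = abs_l2 g \<longleftrightarrow> (AE x in lborel. f x = g x)"
  using Quotient3_rel[OF Quotient3_l2, of f g] assms by (simp add: l2_rel_def)

lemma abs_l2_add:
  "square_integrable f \<Longrightarrow> square_integrable g \<Longrightarrow> abs_l2 f + abs_l2 g = abs_l2 (\<lambda>x. f x + g x)"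
  by (simp add: plus_l2.abs_eq l2_rel_refl)

lemma abs_l2_scaleC: "square_integrable f \<Longrightarrow> c *\<^sub>C abs_l2 f = abs_l2 (\<lambda>x. c * f x)"
  by (simp add: scaleC_l2.abs_eq l2_rel_refl)

lemma square_integrable_diff:
  assumes "square_integrable f" "square_integrable g"
  shows "square_integrable (\<lambda>x. f x - g x)"
  using square_integrable_add[OF assms(1) square_integrable_cmult[OF assms(2), of "-1"]] by simp

lemma abs_l2_diff:
  assumes "square_integrable f" "square_integrable g"
  shows "abs_l2 f - abs_l2 g = abs_l2 (\<lambda>x. f x - g x)"
proof -
  have "abs_l2 f - abs_l2 g = abs_l2 f + (-1) *\<^sub>C abs_l2 g"
    by (simp add: minus_l2_def scaleR_scaleC)
  also have "\<dots> = abs_l2 (\<lambda>x. f x + (-1) * g x)"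
    using assms by (simp only: abs_l2_scaleC abs_l2_add square_integrable_cmult)
  finally show ?thesis by simp
qed

lemma norm_abs_l2: "square_integrable f \<Longrightarrow> (norm (abs_l2 f))\<^sup>2 = (LINT x|lborel. (cmod (f x))\<^sup>2)"
  using cinner_l2_self_eq[of f] unfolding cinner_l2_self_norm by (simp only: of_real_eq_iff)

lemma nn_integral_abs_l2:
  assumes "square_integrable f"
  shows "(\<integral>\<^sup>+x. ennreal ((cmod (f x))\<^sup>2) \<partial>lborel) = ennreal ((norm (abs_l2 f))\<^sup>2)"
  using assms by (simp add: norm_abs_l2 square_integrable_def nn_integral_eq_integral)

lemma square_integrable_nn_integral:
  assumes "f \<in> borel_measurable lborel" "(\<integral>\<^sup>+x. ennreal ((cmod (f x))\<^sup>2) \<partial>lborel) < \<infinity>"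
  shows "square_integrable f"
  using assms by (auto simp: square_integrable_def intro!: integrableI_nonneg)

text \<open>
  A Cauchy sequence has a subsequence whose increments are summable with room to spare, so that the
  subsequence converges almost everywhere; Fatou's lemma turns this into convergence in the mean.
\<close>

instance l2 :: complete_space
proof
  fix X :: "nat \<Rightarrow> l2" assume "Cauchy X"
  then have "\<exists>N. \<forall>m\<ge>N. \<forall>k\<ge>N. norm (X m - X k) < (1/2) ^ n" for n :: nat
    unfolding Cauchy_def dist_norm by (rule spec[where x = "(1/2)^n", THEN mp]) simp
  then obtain N where N: "\<And>n m k. m \<ge> N n \<Longrightarrow> k \<ge> N n \<Longrightarrow> norm (X m - X k) < (1/2) ^ n"
    by metis
  define r where "r n = (\<Sum>i\<le>n. N i)" for n :: nat
  have rN: "r m \<ge> N n" if "m \<ge> n" for m n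
    unfolding r_def using that by (intro member_le_sum) auto
  have close: "norm (X (r m) - X (r n)) < (1/2) ^ n" if "m \<ge> n" for m n
    using that by (intro N rN) auto
  have "\<exists>g. square_integrable g \<and> X (r n) = abs_l2 g" for n
    using l2_representative by metis
  then obtain f where f: "\<And>n. square_integrable (f n)" "\<And>n. X (r n) = abs_l2 (f n)"
    by metis
  have meas [measurable]: "f n \<in> borel_measurable lborel" for n
    using f(1) by (simp add: square_integrable_def)
  have nn: "(\<integral>\<^sup>+x. ennreal ((cmod (f m x - f n x))\<^sup>2) \<partial>lborel) \<le> ennreal ((1/4) ^ n)"
    if "m \<ge> n" for m n
  proof -
    have "(norm (X (r m) - X (r n)))\<^sup>2 \<le> ((1/2) ^ n)\<^sup>2"
      using close[OF that] by (intro power_mono) auto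
    also have "((1/2) ^ n)\<^sup>2 = (1/4 :: real) ^ n"
      by (simp add: power2_eq_square flip: power_mult_distrib)
    finally have "ennreal ((norm (X (r m) - X (r n)))\<^sup>2) \<le> ennreal ((1/4) ^ n)"
      by (rule ennreal_leI)
    then show ?thesis
      unfolding f(2) abs_l2_diff[OF f(1) f(1)]
      by (simp add: nn_integral_abs_l2 square_integrable_diff f)
  qed
  have "AE x in lborel. (\<Sum>n. ennreal (2 ^ n * (cmod (f (Suc n) x - f n x))\<^sup>2)) \<noteq> \<infinity>"
  proof (rule nn_integral_PInf_AE)
    have "(\<integral>\<^sup>+x. (\<Sum>n. ennreal (2 ^ n * (cmod (f (Suc n) x - f n x))\<^sup>2)) \<partial>lborel)
        = (\<Sum>n. \<integral>\<^sup>+x. ennreal (2 ^ n * (cmod (f (Suc n) x - f n x))\<^sup>2) \<partial>lborel)"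
      by (rule nn_integral_suminf) measurable
    also have "\<dots> \<le> (\<Sum>n. ennreal ((1/2) ^ n))"
    proof (rule suminf_le)
      fix n
      have "(\<integral>\<^sup>+x. ennreal (2 ^ n * (cmod (f (Suc n) x - f n x))\<^sup>2) \<partial>lborel)
          = ennreal (2 ^ n) * (\<integral>\<^sup>+x. ennreal ((cmod (f (Suc n) x - f n x))\<^sup>2) \<partial>lborel)"
        by (simp add: ennreal_mult nn_integral_cmult)
      also have "\<dots> \<le> ennreal (2 ^ n) * ennreal ((1/4) ^ n)"
        by (intro mult_left_mono nn) auto
      also have "\<dots> = ennreal ((1/2) ^ n)"
        by (simp flip: ennreal_mult power_mult_distrib)
      finally show "(\<integral>\<^sup>+x. ennreal (2 ^ n * (cmod (f (Suc n) x - f n x))\<^sup>2) \<partial>lborel) \<le> ennreal ((1/2) ^ n)" .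
    qed auto
    also have "\<dots> = ennreal 2"
      using geometric_sums[of "1/2 :: real"] by (intro suminf_ennreal_eq) auto
    finally show "(\<integral>\<^sup>+x. (\<Sum>n. ennreal (2 ^ n * (cmod (f (Suc n) x - f n x))\<^sup>2)) \<partial>lborel) \<noteq> \<infinity>"
      by (auto simp: top_unique)
  qed measurable
  then have conv: "AE x in lborel. convergent (\<lambda>n. f n x)"
  proof eventually_elim
    case (elim x)
    let ?d = "\<lambda>n. f (Suc n) x - f n x"
    have "summable (\<lambda>n. 2 ^ n * (cmod (?d n))\<^sup>2)"
      using elim by (intro summable_suminf_not_top) auto
    then have "Bseq (\<lambda>n. 2 ^ n * (cmod (?d n))\<^sup>2)"
      by (intro convergent_imp_Bseq convergentI[OF summable_LIMSEQ_zero])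
    then obtain C where C: "\<And>n. 2 ^ n * (cmod (?d n))\<^sup>2 \<le> C" "C > 0"
      unfolding Bseq_def by (auto simp: norm_mult)
    have "summable ?d"
    proof (rule summable_comparison_test')
      show "summable (\<lambda>n. sqrt C * (1 / sqrt 2) ^ n)"
        by (intro summable_mult summable_geometric) simp
      fix n
      have "(cmod (?d n))\<^sup>2 \<le> C / 2 ^ n"
        using C(1)[of n] by (simp add: field_simps)
      then have "cmod (?d n) \<le> sqrt (C / 2 ^ n)"
        by (rule real_le_rsqrt)
      then show "norm (?d n) \<le> sqrt C * (1 / sqrt 2) ^ n"
        by (simp add: real_sqrt_divide real_sqrt_power power_divide)
    qed
    then have "convergent (\<lambda>n. \<Sum>k<n. ?d k)"
      by (simp add: summable_iff_convergent)
    then have "convergent (\<lambda>n. f n x - f 0 x)"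
      by (simp only: sum_lessThan_telescope[of "\<lambda>k. f k x"])
    then have "convergent (\<lambda>n. (f n x - f 0 x) + f 0 x)"
      by (intro convergent_add convergent_const)
    then show ?case by simp
  qed
  define g where "g x = lim (\<lambda>n. f n x)" for x
  have gm [measurable]: "g \<in> borel_measurable lborel"
    unfolding g_def by measurable
  have lim: "AE x in lborel. (\<lambda>n. f n x) \<longlonglongrightarrow> g x"
    using conv by eventually_elim (simp add: g_def convergent_LIMSEQ_iff)
  have est: "(\<integral>\<^sup>+x. ennreal ((cmod (g x - f n x))\<^sup>2) \<partial>lborel) \<le> ennreal ((1/4) ^ n)" for n
  proof -
    have "(\<integral>\<^sup>+x. ennreal ((cmod (g x - f n x))\<^sup>2) \<partial>lborel)
        = (\<integral>\<^sup>+x. liminf (\<lambda>m. ennreal ((cmod (f m x - f n x))\<^sup>2)) \<partial>lborel)"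
    proof (rule nn_integral_cong_AE)
      show "AE x in lborel. ennreal ((cmod (g x - f n x))\<^sup>2)
          = liminf (\<lambda>m. ennreal ((cmod (f m x - f n x))\<^sup>2))"
        using lim
      proof eventually_elim
        case (elim x)
        then have "(\<lambda>m. ennreal ((cmod (f m x - f n x))\<^sup>2)) \<longlonglongrightarrow> ennreal ((cmod (g x - f n x))\<^sup>2)"
          by (intro tendsto_ennrealI tendsto_intros)
        then show ?case by (rule lim_imp_Liminf[OF sequentially_bot, symmetric])
      qed
    qed
    also have "\<dots> \<le> liminf (\<lambda>m. \<integral>\<^sup>+x. ennreal ((cmod (f m x - f n x))\<^sup>2) \<partial>lborel)"
      by (rule nn_integral_liminf) measurable
    also have "\<dots> \<le> ennreal ((1/4) ^ n)"
      by (rule Liminf_le) (use nn in \<open>auto simp: eventually_sequentially\<close>)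
    finally show ?thesis .
  qed
  have sqd: "square_integrable (\<lambda>x. g x - f n x)" for n
    using est[of n] by (intro square_integrable_nn_integral) (auto simp: le_less_trans)
  have sqg: "square_integrable g"
    using square_integrable_add[OF sqd[of 0] f(1)[of 0]] by simp
  have dist_g: "norm (abs_l2 g - X (r n)) \<le> (1/2) ^ n" for n
  proof -
    have "ennreal ((norm (abs_l2 g - X (r n)))\<^sup>2) \<le> ennreal ((1/4) ^ n)"
      using est[of n] by (simp add: f(2) abs_l2_diff sqg f(1) nn_integral_abs_l2 sqd)
    then have "(norm (abs_l2 g - X (r n)))\<^sup>2 \<le> (1/4) ^ n"
      by (simp add: ennreal_le_iff)
    also have "(1/4 :: real) ^ n = ((1/2) ^ n)\<^sup>2"
      by (simp add: power2_eq_square flip: power_mult_distrib)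
    finally show ?thesis by (rule power2_le_imp_le) simp
  qed
  have "X \<longlonglongrightarrow> abs_l2 g"
  proof (rule metric_LIMSEQ_I)
    fix e :: real assume "e > 0"
    then obtain n where n: "(1/2 :: real) ^ n < e / 2"
      using real_arch_pow_inv[of "e/2" "1/2"] by auto
    have "dist (X m) (abs_l2 g) < e" if "m \<ge> r n" for m
    proof -
      have "norm (X m - X (r n)) < (1/2) ^ n"
        using that rN[of n n] by (intro N) auto
      then have "norm (X m - X (r n)) + norm (abs_l2 g - X (r n)) < e"
        using dist_g[of n] n by linarith
      then show ?thesis
        using norm_triangle_ineq4[of "X m - X (r n)" "abs_l2 g - X (r n)"] by (simp add: dist_norm)
    qed
    then show "\<exists>no. \<forall>m\<ge>no. dist (X m) (abs_l2 g) < e" by blast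
  qed
  then show "convergent X" by (rule convergentI)
qed

instance l2 :: banach ..

section \<open>Smooth cutoff functions\<close>

text \<open>
  Derivatives chosen within the class can be iterated, which yields all higher derivatives at once.
\<close>

lemma smooth_if_derivative_closed:
  assumes "f \<in> A" "\<And>g. g \<in> A \<Longrightarrow> \<exists>h\<in>A. \<forall>x. (g has_vector_derivative h x) (at x)"
  shows "smooth f"
proof -
  obtain d where d: "\<And>g. g \<in> A \<Longrightarrow> d g \<in> A \<and> (\<forall>x. (g has_vector_derivative d g x) (at x))"
    using assms(2) by metis
  define F where "F n = (d ^^ n) f" for n
  have "F n \<in> A" for n
    by (induction n) (simp_all add: F_def assms(1) d)
  then have "(F n has_vector_derivative F (Suc n) x) (at x)" for n x
    using d by (simp add: F_def)
  moreover have "F 0 = f" by (simp add: F_def)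
  ultimately show ?thesis unfolding smooth_def by blast
qed

text \<open>
  By the Leibniz rule it suffices to know the derivatives of generators of a ring of functions; this
  replaces all bookkeeping about higher derivatives of products and reciprocals.
\<close>

inductive ring_hull :: "(real \<Rightarrow> complex) set \<Rightarrow> (real \<Rightarrow> complex) \<Rightarrow> bool" for A where
  base: "f \<in> A \<Longrightarrow> ring_hull A f"
| add: "ring_hull A f \<Longrightarrow> ring_hull A g \<Longrightarrow> ring_hull A (\<lambda>x. f x + g x)"
| mult: "ring_hull A f \<Longrightarrow> ring_hull A g \<Longrightarrow> ring_hull A (\<lambda>x. f x * g x)"

lemma smooth_ring_hull:
  assumes "ring_hull A f"
    and "\<And>g. g \<in> A \<Longrightarrow> \<exists>h. ring_hull A h \<and> (\<forall>x. (g has_vector_derivative h x) (at x))"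
  shows "smooth f"
proof (rule smooth_if_derivative_closed[where A = "Collect (ring_hull A)"])
  fix g assume "g \<in> Collect (ring_hull A)"
  then have "ring_hull A g" by simp
  then have "\<exists>h. ring_hull A h \<and> (\<forall>x. (g has_vector_derivative h x) (at x))"
  proof (induction rule: ring_hull.induct)
    case (add f g)
    then obtain f' g' where "ring_hull A f'" "ring_hull A g'"
      "\<And>x. (f has_vector_derivative f' x) (at x)" "\<And>x. (g has_vector_derivative g' x) (at x)"
      by blast
    then show ?case
      by (intro exI[of _ "\<lambda>x. f' x + g' x"]) (auto intro!: ring_hull.add derivative_intros)
  next
    case (mult f g)
    then obtain f' g' where "ring_hull A f'" "ring_hull A g'"
      "\<And>x. (f has_vector_derivative f' x) (at x)" "\<And>x. (g has_vector_derivative g' x) (at x)"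
      by blast
    then show ?case using mult(1,2)
      by (intro exI[of _ "\<lambda>x. f x * g' x + f' x * g x"])
        (auto intro!: ring_hull.add ring_hull.mult has_vector_derivative_mult)
  qed (use assms(2) in blast)
  then show "\<exists>h\<in>Collect (ring_hull A). \<forall>x. (g has_vector_derivative h x) (at x)" by auto
qed (use assms(1) in simp)

lemma smooth_derivative:
  assumes "smooth f"
  shows "(f has_vector_derivative vector_derivative f (at x)) (at x)"
    and "smooth (\<lambda>x. vector_derivative f (at x))"
proof -
  obtain F where F: "F 0 = f" "\<And>n x. (F n has_vector_derivative F (Suc n) x) (at x)"
    using assms by (auto simp: smooth_def)
  have eq: "vector_derivative f (at x) = F 1 x" for x
    using F(2)[of 0 x] F(1) by (simp add: vector_derivative_at)
  show "(f has_vector_derivative vector_derivative f (at x)) (at x)"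
    using F(2)[of 0 x] F(1) by (simp add: eq)
  show "smooth (\<lambda>x. vector_derivative f (at x))"
    unfolding smooth_def eq by (intro exI[of _ "\<lambda>n. F (Suc n)"]) (use F in auto)
qed

lemma smooth_const: "smooth (\<lambda>_. c)"
proof (rule smooth_if_derivative_closed[where A = "range (\<lambda>c _. c)"])
  fix g :: "real \<Rightarrow> complex" assume "g \<in> range (\<lambda>c _. c)"
  then have "\<forall>x. (g has_vector_derivative (\<lambda>_. 0) x) (at x)" by auto
  then show "\<exists>h\<in>range (\<lambda>c _. c). \<forall>x. (g has_vector_derivative h x) (at x)"
    by (intro bexI[where x = "\<lambda>_. 0"]) auto
qed simp

lemma smooth_mult:
  assumes "smooth f" "smooth g"
  shows "smooth (\<lambda>x. f x * g x)"
proof -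
  obtain F G where F: "F 0 = f" "\<And>n x. (F n has_vector_derivative F (Suc n) x) (at x)"
    and G: "G 0 = g" "\<And>n x. (G n has_vector_derivative G (Suc n) x) (at x)"
    using assms by (auto simp: smooth_def)
  have "ring_hull (range F \<union> range G) (\<lambda>x. F 0 x * G 0 x)"
    by (intro ring_hull.mult ring_hull.base) auto
  then have "smooth (\<lambda>x. F 0 x * G 0 x)"
  proof (rule smooth_ring_hull)
    fix h assume "h \<in> range F \<union> range G"
    then consider n where "h = F n" | n where "h = G n" by auto
    then show "\<exists>k. ring_hull (range F \<union> range G) k \<and> (\<forall>x. (h has_vector_derivative k x) (at x))"
    proof cases
      case 1
      then show ?thesis by (intro exI[of _ "F (Suc n)"]) (auto intro: ring_hull.base F(2))
    next
      case 2
      then show ?thesis by (intro exI[of _ "G (Suc n)"]) (auto intro: ring_hull.base G(2))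
    qed
  qed
  then show ?thesis by (simp add: F(1) G(1))
qed

lemma smooth_add:
  assumes "smooth f" "smooth g"
  shows "smooth (\<lambda>x. f x + g x)"
proof -
  obtain F G where F: "F 0 = f" "\<And>n x. (F n has_vector_derivative F (Suc n) x) (at x)"
    and G: "G 0 = g" "\<And>n x. (G n has_vector_derivative G (Suc n) x) (at x)"
    using assms by (auto simp: smooth_def)
  show ?thesis
    unfolding smooth_def
    by (intro exI[of _ "\<lambda>n x. F n x + G n x"]) (auto simp: F(1) G(1) intro!: derivative_intros F(2) G(2))
qed

lemma smooth_inverse:
  assumes "smooth f" "\<And>x. f x \<noteq> 0"
  shows "smooth (\<lambda>x. inverse (f x))"
proof -
  obtain F where F: "F 0 = f" "\<And>n x. (F n has_vector_derivative F (Suc n) x) (at x)"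
    using assms by (auto simp: smooth_def)
  let ?g = "\<lambda>x. inverse (f x)"
  let ?A = "range F \<union> {?g, \<lambda>_. - 1, \<lambda>_. 0}"
  have "ring_hull ?A ?g" by (rule ring_hull.base) simp
  then show ?thesis
  proof (rule smooth_ring_hull)
    fix h assume "h \<in> ?A"
    moreover have "ring_hull ?A (\<lambda>x. (- 1) * (?g x * F 1 x * ?g x))"
      by (intro ring_hull.mult ring_hull.base) auto
    moreover have "(?g has_vector_derivative (- 1) * (?g x * F 1 x * ?g x)) (at x)" for x
    proof -
      have "(f has_derivative (\<lambda>t. t *\<^sub>R F 1 x)) (at x)"
        using F(2)[of 0 x] F(1) by (simp add: has_vector_derivative_def)
      from Deriv.has_derivative_inverse[OF assms(2) this]
      show ?thesis
        unfolding has_vector_derivative_def by (simp add: scaleR_conv_of_real mult_ac)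
    qed
    ultimately show "\<exists>k. ring_hull ?A k \<and> (\<forall>x. (h has_vector_derivative k x) (at x))"
      using F(2) by (auto intro: ring_hull.base)
  qed
qed

lemma smooth_affine:
  assumes "smooth f"
  shows "smooth (\<lambda>x. f (a * x + c))"
proof -
  obtain F where F: "F 0 = f" "\<And>n x. (F n has_vector_derivative F (Suc n) x) (at x)"
    using assms by (auto simp: smooth_def)
  have "((\<lambda>x. a ^ n *\<^sub>R F n (a * x + c)) has_vector_derivative a ^ Suc n *\<^sub>R F (Suc n) (a * x + c)) (at x)"
    for n x
  proof -
    have "((\<lambda>x. a * x + c) has_vector_derivative a) (at x)"
      by (auto intro!: derivative_eq_intros simp: has_real_derivative_iff_has_vector_derivative[symmetric])
    from vector_diff_chain_at[OF this F(2)]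
    have "((\<lambda>x. F n (a * x + c)) has_vector_derivative a *\<^sub>R F (Suc n) (a * x + c)) (at x)"
      by (simp add: o_def)
    from bounded_linear.has_vector_derivative[OF bounded_linear_scaleR_right this, of "a ^ n"]
    show ?thesis by (simp add: mult.commute)
  qed
  then show ?thesis
    unfolding smooth_def by (intro exI[of _ "\<lambda>n x. a ^ n *\<^sub>R F n (a * x + c)"]) (simp add: F(1))
qed

lemma smooth_cnj:
  assumes "smooth f"
  shows "smooth (\<lambda>x. cnj (f x))"
proof -
  obtain F where F: "F 0 = f" "\<And>n x. (F n has_vector_derivative F (Suc n) x) (at x)"
    using assms by (auto simp: smooth_def)
  show ?thesis
    unfolding smooth_def
    by (intro exI[of _ "\<lambda>n x. cnj (F n x)"])
      (auto simp: F(1) intro!: bounded_linear.has_vector_derivative[OF bounded_linear_cnj] F(2))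
qed

lemma smooth_continuous: "smooth f \<Longrightarrow> continuous_on S f"
  using smooth_derivative(1)[of f]
  by (meson continuous_at_imp_continuous_on has_vector_derivative_continuous)

lemma poly_times_exp_minus_tendsto_0: "((\<lambda>t. poly p t * exp (- t)) \<longlongrightarrow> (0 :: real)) at_top"
proof -
  have "((\<lambda>t. \<Sum>i\<le>degree p. coeff p i * (t ^ i / exp t)) \<longlongrightarrow> (\<Sum>i\<le>degree p. coeff p i * 0)) at_top"
    by (intro tendsto_sum tendsto_mult tendsto_const tendsto_power_div_exp_0)
  then show ?thesis
    by (simp add: poly_altdef sum_distrib_right exp_minus divide_inverse mult.assoc)
qed

text \<open>
  The functions \<open>p(1/x) exp(-1/x)\<close> on the positive half line, continued by \<open>0\<close>, form a class that is
  closed under differentiation.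
\<close>

definition flat_function :: "real poly \<Rightarrow> real \<Rightarrow> real"
  where "flat_function p x = (if x \<le> 0 then 0 else poly p (1 / x) * exp (- (1 / x)))"

text \<open>
  The polynomial is read off from \<open>d/dx (p(1/x) exp(-1/x)) = x\<^sup>-\<^sup>2 (p - p')(1/x) exp(-1/x)\<close>; at \<open>0\<close> the
  exponential beats every power.
\<close>

lemma flat_function_derivative:
  "(flat_function p has_real_derivative flat_function ([:0, 0, 1:] * (p - pderiv p)) x) (at x)"
proof (cases rule: linorder_cases[of x 0])
  case less
  have "((\<lambda>_. 0) has_real_derivative 0) (at x)" by simp
  then have "(flat_function p has_real_derivative 0) (at x)"
    by (rule has_field_derivative_transform_within_open[where S = "{..<0}"])
      (use less in \<open>auto simp: flat_function_def\<close>)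
  then show ?thesis using less by (simp add: flat_function_def)
next
  case greater
  have "((\<lambda>x. poly p (1 / x) * exp (- (1 / x))) has_real_derivative
      poly ([:0, 0, 1:] * (p - pderiv p)) (1 / x) * exp (- (1 / x))) (at x)"
    using greater
    by (auto intro!: derivative_eq_intros DERIV_chain'[OF _ poly_DERIV]
        simp: field_simps power2_eq_square)
  then have "(flat_function p has_real_derivative
      poly ([:0, 0, 1:] * (p - pderiv p)) (1 / x) * exp (- (1 / x))) (at x)"
    by (rule has_field_derivative_transform_within_open[where S = "{0<..}"])
      (use greater in \<open>auto simp: flat_function_def\<close>)
  then show ?thesis using greater by (simp add: flat_function_def)
next
  case equal
  have r: "((\<lambda>y. flat_function p y / y) \<longlongrightarrow> 0) (at_right 0)"
  proof -
    have "((\<lambda>y. poly (pCons 0 p) (inverse y) * exp (- inverse y)) \<longlongrightarrow> (0::real)) (at_right 0)"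
      by (rule filterlim_compose[OF poly_times_exp_minus_tendsto_0 filterlim_inverse_at_top_right])
    moreover have "\<forall>\<^sub>F y in at_right 0. poly (pCons 0 p) (inverse y) * exp (- inverse y)
        = flat_function p y / y"
      by (auto simp: eventually_at_right_field flat_function_def field_simps intro!: exI[of _ 1])
    ultimately show ?thesis by (rule Lim_transform_eventually)
  qed
  have l: "((\<lambda>y. flat_function p y / y) \<longlongrightarrow> 0) (at_left 0)"
  proof (rule Lim_transform_eventually[OF tendsto_const])
    show "\<forall>\<^sub>F y in at_left 0. 0 = flat_function p y / y"
      by (auto simp: eventually_at_left_field flat_function_def intro!: exI[of _ "-1"])
  qed
  have "((\<lambda>y. flat_function p y / y) \<longlongrightarrow> 0) (at 0)"
    using l r by (simp add: filterlim_split_at)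
  then show ?thesis
    using equal by (simp add: has_field_derivative_iff flat_function_def)
qed

lemma smooth_flat_function: "smooth (\<lambda>x. complex_of_real (flat_function p x))"
proof (rule smooth_if_derivative_closed[where A = "range (\<lambda>p x. complex_of_real (flat_function p x))"])
  fix g :: "real \<Rightarrow> complex" assume "g \<in> range (\<lambda>p x. complex_of_real (flat_function p x))"
  then obtain p where g: "g = (\<lambda>x. complex_of_real (flat_function p x))" by auto
  let ?q = "[:0, 0, 1:] * (p - pderiv p)"
  have "(g has_vector_derivative complex_of_real (flat_function ?q x)) (at x)" for x
    unfolding g using flat_function_derivative[of p x]
    by (intro bounded_linear.has_vector_derivative[OF bounded_linear_of_real])
      (simp add: has_real_derivative_iff_has_vector_derivative)
  then show "\<exists>h\<in>range (\<lambda>p x. complex_of_real (flat_function p x)).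
      \<forall>x. (g has_vector_derivative h x) (at x)"
    by (intro bexI[where x = "\<lambda>x. complex_of_real (flat_function ?q x)"]) auto
qed simp

text \<open>
  With \<open>h x = exp(-1/x)\<close> for \<open>x > 0\<close>, the quotient of \<open>h (x - 1)\<close> by \<open>h (x - 1) + h (2 - x)\<close> is such a
  step; the denominator is positive because one of its summands is.
\<close>

lemma smooth_step_exists:
  obtains \<eta> :: "real \<Rightarrow> real" and \<eta>' :: "real \<Rightarrow> complex" and M :: real
  where "smooth (\<lambda>x. complex_of_real (\<eta> x))"
    and "\<And>x. ((\<lambda>x. complex_of_real (\<eta> x)) has_vector_derivative \<eta>' x) (at x)"
    and "\<And>x. x \<le> 1 \<Longrightarrow> \<eta> x = 0" "\<And>x. x \<ge> 2 \<Longrightarrow> \<eta> x = 1" "\<And>x. 0 \<le> \<eta> x" "\<And>x. \<eta> x \<le> 1"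
    and "\<And>x. cmod (\<eta>' x) \<le> M" "\<And>x. x < 1 \<Longrightarrow> \<eta>' x = 0" "\<And>x. x > 2 \<Longrightarrow> \<eta>' x = 0"
proof -
  define h where "h = flat_function 1"
  have h: "h x \<ge> 0" "x > 0 \<Longrightarrow> h x > 0" "x \<le> 0 \<Longrightarrow> h x = 0" for x
    by (auto simp: h_def flat_function_def)
  have hs: "smooth (\<lambda>x. complex_of_real (h (a * x + c)))" for a c
    unfolding h_def by (rule smooth_affine[OF smooth_flat_function])
  define \<eta> where "\<eta> x = h (x - 1) * inverse (h (x - 1) + h (2 - x))" for x
  have pos: "h (x - 1) + h (2 - x) > 0" for x
  proof (cases "x > 1")
    case True
    then show ?thesis using h(2)[of "x - 1"] h(1)[of "2 - x"] by simp
  next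
    case False
    then show ?thesis using h(2)[of "2 - x"] h(1)[of "x - 1"] by simp
  qed
  have "smooth (\<lambda>x. complex_of_real (h (1 * x + (-1)))
      * inverse (complex_of_real (h (1 * x + (-1))) + complex_of_real (h ((-1) * x + 2))))"
  proof (rule smooth_mult[OF hs smooth_inverse[OF smooth_add[OF hs hs]]])
    fix x
    have "complex_of_real (h (x - 1) + h (2 - x)) \<noteq> 0"
      using pos[of x] by (simp only: of_real_eq_0_iff)
    then show "complex_of_real (h (1 * x + (-1))) + complex_of_real (h ((-1) * x + 2)) \<noteq> 0"
      by (simp add: add.commute)
  qed
  then have s: "smooth (\<lambda>x. complex_of_real (\<eta> x))"
    by (simp add: \<eta>_def)
  define \<eta>' where "\<eta>' x = vector_derivative (\<lambda>x. complex_of_real (\<eta> x)) (at x)" for x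
  have d: "((\<lambda>x. complex_of_real (\<eta> x)) has_vector_derivative \<eta>' x) (at x)" for x
    unfolding \<eta>'_def by (rule smooth_derivative(1)[OF s])
  have \<eta>0: "\<eta> x = 0" if "x \<le> 1" for x using that by (simp add: \<eta>_def h)
  have \<eta>1: "\<eta> x = 1" if "x \<ge> 2" for x
    using that h(2)[of "x - 1"] h(3)[of "2 - x"] by (simp add: \<eta>_def)
  have \<eta>b: "0 \<le> \<eta> x" "\<eta> x \<le> 1" for x
    using pos[of x] h(1) by (auto simp: \<eta>_def field_simps)
  have \<eta>'0: "\<eta>' x = 0" if "x < 1" for x
  proof -
    have "((\<lambda>x. complex_of_real (\<eta> x)) has_vector_derivative 0) (at x)"
      by (rule has_vector_derivative_transform_within_open[where S = "{..<1}" and f = "\<lambda>_. 0"])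
        (use that \<eta>0 in auto)
    then show ?thesis using d vector_derivative_unique_at by blast
  qed
  have \<eta>'1: "\<eta>' x = 0" if "x > 2" for x
  proof -
    have "((\<lambda>x. complex_of_real (\<eta> x)) has_vector_derivative 0) (at x)"
      by (rule has_vector_derivative_transform_within_open[where S = "{2<..}" and f = "\<lambda>_. 1"])
        (use that \<eta>1 in auto)
    then show ?thesis using d vector_derivative_unique_at by blast
  qed
  have "compact (\<eta>' ` {1..2})"
    unfolding \<eta>'_def
    by (intro compact_continuous_image smooth_continuous smooth_derivative(2)[OF s]) auto
  then obtain M where M: "\<And>x. x \<in> {1..2} \<Longrightarrow> cmod (\<eta>' x) \<le> M"
    using compact_imp_bounded bounded_iff by (metis imageI)
  have "cmod (\<eta>' x) \<le> max M 0" for x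
    using M[of x] \<eta>'0[of x] \<eta>'1[of x] by (cases "x < 1"; cases "x > 2") auto
  from that[OF s d \<eta>0 \<eta>1 \<eta>b this \<eta>'0 \<eta>'1] show ?thesis .
qed

section \<open>Weak derivatives\<close>

text \<open>
  The positive and the negative part of \<open>f\<close> are densities of finite measures that agree on all half
  lines, and half lines determine a finite measure.
\<close>

lemma AE_zero_if_tail_integrals_zero:
  fixes f :: "real \<Rightarrow> real"
  assumes f: "integrable lborel f"
    and tail: "\<And>x. (LINT y|lborel. indicator {x<..} y * f y) = 0"
  shows "AE x in lborel. f x = 0"
proof -
  have m [measurable]: "f \<in> borel_measurable borel" using f by auto
  let ?p = "\<lambda>x. ennreal (f x)" and ?n = "\<lambda>x. ennreal (- f x)"
  have fin: "integral\<^sup>N lborel ?p < \<infinity>" "integral\<^sup>N lborel ?n < \<infinity>"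
    using f by (auto simp: real_integrable_def top.not_eq_extremum)
  have le: "(\<integral>\<^sup>+y. g y * indicator A y \<partial>lborel) \<le> integral\<^sup>N lborel g" for g :: "real \<Rightarrow> ennreal" and A
    by (rule nn_integral_mono) (auto split: split_indicator)
  have "density lborel ?p = density lborel ?n"
  proof (rule measure_eqI_lessThan)
    fix x
    show "emeasure (density lborel ?p) {x<..} < \<infinity>"
      using le[of ?p "{x<..}"] fin by (simp add: emeasure_density le_less_trans)
    have i: "integrable lborel (\<lambda>y. indicator {x<..} y * f y)"
      using integrable_mult_indicator[OF _ f, of "{x<..}"] by simp
    have eqs: "ennreal (f y) * indicator {x<..} y = ennreal (indicator {x<..} y * f y)"
      "ennreal (- f y) * indicator {x<..} y = ennreal (- (indicator {x<..} y * f y))" for y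
      by (auto split: split_indicator)
    define P where "P = (\<integral>\<^sup>+y. ennreal (indicator {x<..} y * f y) \<partial>lborel)"
    define N where "N = (\<integral>\<^sup>+y. ennreal (- (indicator {x<..} y * f y)) \<partial>lborel)"
    have fin': "P < top" "N < top"
      using i by (auto simp: real_integrable_def P_def N_def top.not_eq_extremum)
    have "enn2real P = enn2real N"
      using tail[of x] real_lebesgue_integral_def[OF i] by (simp add: P_def N_def)
    then have "P = N"
      by (rule box_equals[OF arg_cong[where f = ennreal] ennreal_enn2real[OF fin'(1)]
            ennreal_enn2real[OF fin'(2)]])
    then show "emeasure (density lborel ?p) {x<..} = emeasure (density lborel ?n) {x<..}"
      by (simp add: emeasure_density eqs P_def N_def)
  qed auto
  then have "AE x in lborel. ?p x = ?n x"
    by (rule sigma_finite_measure.density_unique[OF lborel.sigma_finite_measure_axioms, rotated 2])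
      measurable
  then show ?thesis
  proof eventually_elim
    case (elim x)
    then show ?case
      by (cases "f x \<ge> 0") (auto simp: ennreal_neg ennreal_eq_0_iff)
  qed
qed

lemma test_function_mult:
  assumes "test_function L f" "smooth g"
  shows "test_function L (\<lambda>x. f x * g x)"
  using assms unfolding test_function_def by (metis mult_zero_left smooth_mult)

text \<open>
  Products of two rescaled smooth steps are test functions that converge boundedly to the indicator
  function of \<open>(a, L)\<close>, so the integrals of \<open>f\<close> over all these intervals vanish.
\<close>

lemma fundamental_lemma:
  fixes f :: "real \<Rightarrow> complex"
  assumes f: "set_integrable lborel {0<..<L} f"
    and test: "\<And>\<psi>. test_function L (\<lambda>x. complex_of_real (\<psi> x)) \<Longrightarrow>
      (LINT x:{0<..<L}|lborel. f x * complex_of_real (\<psi> x)) = 0"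
  shows "AE x in lborel. x \<in> {0<..<L} \<longrightarrow> f x = 0"
proof -
  obtain \<eta> \<eta>' M where \<eta>: "smooth (\<lambda>x. complex_of_real (\<eta> x))" "\<And>x. x \<le> 1 \<Longrightarrow> \<eta> x = (0::real)"
    "\<And>x. x \<ge> 2 \<Longrightarrow> \<eta> x = 1" "\<And>x. 0 \<le> \<eta> x" "\<And>x. \<eta> x \<le> 1"
    by (rule smooth_step_exists) blast
  define g where "g x = indicator {0<..<L} x *\<^sub>R f x" for x
  have g: "integrable lborel g" using f by (simp add: set_integrable_def g_def[abs_def])
  have gm [measurable]: "g \<in> borel_measurable borel" using g by auto
  have tail: "(LINT x|lborel. indicator {a<..} x *\<^sub>R g x) = 0" if a: "0 \<le> a" for a
  proof -
    define \<psi> where "\<psi> k x = \<eta> (real (Suc k) * (x - a)) * \<eta> (real (Suc k) * (L - x))" for k x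
    have s: "smooth (\<lambda>x. complex_of_real (\<psi> k x))" for k
      using smooth_mult[OF smooth_affine[OF \<eta>(1), of "real (Suc k)" "- real (Suc k) * a"]
          smooth_affine[OF \<eta>(1), of "- real (Suc k)" "real (Suc k) * L"]]
      by (simp add: \<psi>_def algebra_simps)
    have t: "test_function L (\<lambda>x. complex_of_real (\<psi> k x))" for k
      unfolding test_function_def
    proof (intro conjI s exI allI impI)
      let ?d = "1 / real (Suc k)"
      show "0 < a + ?d" "L - ?d < L" using a by (auto simp: add_nonneg_pos)
      fix x assume "x \<notin> {a + ?d..L - ?d}"
      then have "x < a + ?d \<or> x > L - ?d" by auto
      then have "real (Suc k) * (x - a) \<le> 1 \<or> real (Suc k) * (L - x) \<le> 1"
        by (auto simp: field_simps)
      then show "complex_of_real (\<psi> k x) = 0"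
        by (auto simp: \<psi>_def \<eta>(2))
    qed
    have "(\<lambda>k. LINT x|lborel. g x * complex_of_real (\<psi> k x))
        \<longlonglongrightarrow> (LINT x|lborel. indicator {a<..} x *\<^sub>R g x)"
    proof (rule integral_dominated_convergence[where w = "\<lambda>x. norm (g x)"])
      show "(\<lambda>x. g x * complex_of_real (\<psi> k x)) \<in> borel_measurable lborel" for k
        using smooth_measurable(1)[OF s[of k]] by auto
      show "AE x in lborel. (\<lambda>k. g x * complex_of_real (\<psi> k x)) \<longlonglongrightarrow> indicator {a<..} x *\<^sub>R g x"
      proof (rule AE_I2)
        fix x
        consider "x \<le> a" | "x > a" "x < L" | "x \<ge> L" by linarith
        then show "(\<lambda>k. g x * complex_of_real (\<psi> k x)) \<longlonglongrightarrow> indicator {a<..} x *\<^sub>R g x"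
        proof cases
          case 1
          have "\<eta> (real (Suc k) * (x - a)) = 0" for k
          proof (rule \<eta>(2))
            have "real (Suc k) * (x - a) \<le> 0"
              using 1 by (intro mult_nonneg_nonpos) auto
            then show "real (Suc k) * (x - a) \<le> 1" by linarith
          qed
          then show ?thesis using 1 by (simp add: \<psi>_def del: of_nat_Suc)
        next
          case 2
          obtain K where K: "real K \<ge> max (2 / (x - a)) (2 / (L - x))"
            using real_arch_simple by blast
          have "\<psi> k x = 1" if "k \<ge> K" for k
          proof -
            have "real (Suc k) \<ge> 2 / (x - a)" "real (Suc k) \<ge> 2 / (L - x)"
              using K that by auto
            then show ?thesis using 2 by (simp add: \<psi>_def \<eta>(3) field_simps)
          qed
          then have "\<forall>\<^sub>F k in sequentially. indicator {a<..} x *\<^sub>R g x = g x * complex_of_real (\<psi> k x)"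
            using 2 by (auto simp: eventually_sequentially intro!: exI[of _ K])
          then show ?thesis by (rule Lim_transform_eventually[OF tendsto_const])
        next
          case 3
          then show ?thesis by (simp add: g_def)
        qed
      qed
      show "AE x in lborel. norm (g x * complex_of_real (\<psi> k x)) \<le> norm (g x)" for k
      proof (rule AE_I2)
        fix x
        have "\<bar>\<psi> k x\<bar> \<le> 1"
          using \<eta>(4,5) by (auto simp: \<psi>_def abs_mult intro!: mult_le_one)
        then show "norm (g x * complex_of_real (\<psi> k x)) \<le> norm (g x)"
          by (simp add: norm_mult mult_left_le)
      qed
    qed (use g in auto)
    moreover have "(LINT x|lborel. g x * complex_of_real (\<psi> k x)) = 0" for k
      using test[OF t[of k]] by (simp add: g_def set_lebesgue_integral_def)
    ultimately show ?thesis by (simp add: LIMSEQ_const_iff)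
  qed
  have tail': "(LINT x|lborel. indicator {a<..} x *\<^sub>R g x) = 0" for a
  proof (cases "a \<ge> 0")
    case False
    have "(\<lambda>x. indicator {a<..} x *\<^sub>R g x) = (\<lambda>x. indicator {0<..} x *\<^sub>R g x)"
      using False by (auto simp: g_def split: split_indicator)
    then show ?thesis using tail[of 0] by (simp only: order_refl)
  qed (rule tail)
  have int: "integrable lborel (\<lambda>x. indicator {a<..} x *\<^sub>R g x)" for a
    by (rule integrable_mult_indicator[OF _ g]) simp
  have "AE x in lborel. Re (g x) = 0"
  proof (rule AE_zero_if_tail_integrals_zero)
    show "(LINT y|lborel. indicator {a<..} y * Re (g y)) = 0" for a
      using integral_Re[OF int[of a]] unfolding tail' by simp
  qed (use g in simp)
  moreover have "AE x in lborel. Im (g x) = 0"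
  proof (rule AE_zero_if_tail_integrals_zero)
    show "(LINT y|lborel. indicator {a<..} y * Im (g y)) = 0" for a
      using integral_Im[OF int[of a]] unfolding tail' by simp
  qed (use g in simp)
  ultimately show ?thesis
    by eventually_elim (auto simp: g_def complex_eq_iff)
qed

definition interval_class :: "real \<Rightarrow> (real \<Rightarrow> complex) \<Rightarrow> l2"
  where "interval_class L f = abs_l2 (\<lambda>x. indicator {0<..<L} x *\<^sub>R f x)"

lemma emeasure_lborel_Ioo_finite: "emeasure lborel {0<..<L :: real} < top"
  by (cases "0 \<le> L") auto

lemma square_integrable_interval:
  assumes "f \<in> borel_measurable borel" "\<And>x. x \<in> {0<..<L} \<Longrightarrow> cmod (f x) \<le> M"
  shows "square_integrable (\<lambda>x. indicator {0<..<L} x *\<^sub>R f x)"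
  unfolding square_integrable_def
proof
  show m: "(\<lambda>x. indicator {0<..<L} x *\<^sub>R f x) \<in> borel_measurable lborel"
    using assms(1) by measurable
  have "integrable lborel (\<lambda>x. indicator {0<..<L} x *\<^sub>R M\<^sup>2)"
    by (intro integrable_indicator integrable_scaleR_left)
      (auto simp: emeasure_lborel_Ioo_finite)
  then show "integrable lborel (\<lambda>x. (cmod (indicator {0<..<L} x *\<^sub>R f x))\<^sup>2)"
  proof (rule Bochner_Integration.integrable_bound)
    show "(\<lambda>x. (cmod (indicator {0<..<L} x *\<^sub>R f x))\<^sup>2) \<in> borel_measurable lborel"
      using m by measurable
    show "AE x in lborel. norm ((cmod (indicator {0<..<L} x *\<^sub>R f x))\<^sup>2)
        \<le> norm (indicator {0<..<L} x *\<^sub>R M\<^sup>2)"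
      using assms(2) by (intro AE_I2) (auto split: split_indicator intro!: power_mono)
  qed
qed

lemma square_integrable_interval_continuous:
  assumes "continuous_on UNIV f"
  shows "square_integrable (\<lambda>x. indicator {0<..<L} x *\<^sub>R f x)"
proof -
  have "compact (f ` {0..L})"
    by (intro compact_continuous_image continuous_on_subset[OF assms]) auto
  then obtain M where "\<And>x. x \<in> {0..L} \<Longrightarrow> cmod (f x) \<le> M"
    using compact_imp_bounded bounded_iff by (metis imageI)
  then show ?thesis
    by (intro square_integrable_interval[of _ _ M] borel_measurable_continuous_onI assms) auto
qed

lemma abs_l2_in_L2_iff:
  "square_integrable f \<Longrightarrow> abs_l2 f \<in> L2 L \<longleftrightarrow> (AE x in lborel. x \<notin> {0<..<L} \<longrightarrow> f x = 0)"
  by (simp add: L2_def vanishes_outside.abs_eq l2_rel_refl)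

lemma interval_class_in_L2:
  "square_integrable (\<lambda>x. indicator {0<..<L} x *\<^sub>R f x) \<Longrightarrow> interval_class L f \<in> L2 L"
  by (simp add: interval_class_def abs_l2_in_L2_iff)

lemma cinner_abs_l2:
  "square_integrable f \<Longrightarrow> square_integrable g \<Longrightarrow>
    cinner_l2 (abs_l2 f) (abs_l2 g) = (LINT x|lborel. f x * cnj (g x))"
  by (simp add: cinner_l2.abs_eq l2_rel_refl)

lemma interval_class_dominated_convergence:
  assumes m: "\<And>k. f k \<in> borel_measurable borel" "g \<in> borel_measurable borel"
    and b: "\<And>k x. x \<in> {0<..<L} \<Longrightarrow> cmod (f k x) \<le> M"
    and c: "\<And>x. x \<in> {0<..<L} \<Longrightarrow> (\<lambda>k. f k x) \<longlonglongrightarrow> g x"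
  shows "(\<lambda>k. interval_class L (f k)) \<longlonglongrightarrow> interval_class L g"
proof -
  let ?i = "\<lambda>f x. indicator {0<..<L} x *\<^sub>R (f x :: complex)"
  have bg: "cmod (g x) \<le> M" if "x \<in> {0<..<L}" for x
    using b c that by (intro Lim_bounded[OF tendsto_norm[OF c[OF that]]]) auto
  have sq: "square_integrable (?i (f k))" "square_integrable (?i g)" for k
    by (rule square_integrable_interval[OF m(1) b] square_integrable_interval[OF m(2) bg]; assumption)+
  have n: "(norm (interval_class L (f k) - interval_class L g))\<^sup>2
      = (LINT x|lborel. (cmod (?i (f k) x - ?i g x))\<^sup>2)" for k
    unfolding interval_class_def
    by (simp add: abs_l2_diff sq norm_abs_l2 square_integrable_diff)
  have "(\<lambda>k. LINT x|lborel. (cmod (?i (f k) x - ?i g x))\<^sup>2) \<longlonglongrightarrow> (LINT x::real|lborel. 0)"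
  proof (rule integral_dominated_convergence[where w = "\<lambda>x. indicator {0<..<L} x *\<^sub>R (2 * M)\<^sup>2"])
    show "(\<lambda>x. (cmod (?i (f k) x - ?i g x))\<^sup>2) \<in> borel_measurable lborel" for k
      using m by measurable
    show "integrable lborel (\<lambda>x::real. indicator {0<..<L} x *\<^sub>R (2 * M)\<^sup>2)"
      by (intro integrable_indicator integrable_scaleR_left)
        (auto simp: emeasure_lborel_Ioo_finite)
    show "AE x in lborel. (\<lambda>k. (cmod (?i (f k) x - ?i g x))\<^sup>2) \<longlonglongrightarrow> 0"
    proof (rule AE_I2)
      fix x
      show "(\<lambda>k. (cmod (?i (f k) x - ?i g x))\<^sup>2) \<longlonglongrightarrow> 0"
      proof (cases "x \<in> {0<..<L}")
        case True
        have "(\<lambda>k. (cmod (f k x - g x))\<^sup>2) \<longlonglongrightarrow> (cmod (g x - g x))\<^sup>2"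
          by (intro tendsto_intros c True)
        then show ?thesis using True by simp
      qed simp
    qed
    show "AE x in lborel. norm ((cmod (?i (f k) x - ?i g x))\<^sup>2)
        \<le> indicator {0<..<L} x *\<^sub>R (2 * M)\<^sup>2" for k
    proof (rule AE_I2)
      fix x
      show "norm ((cmod (?i (f k) x - ?i g x))\<^sup>2) \<le> indicator {0<..<L} x *\<^sub>R (2 * M)\<^sup>2"
      proof (cases "x \<in> {0<..<L}")
        case True
        have "cmod (f k x - g x) \<le> 2 * M"
          using norm_triangle_ineq4[of "f k x" "g x"] b[OF True, of k] bg[OF True] by linarith
        then have "(cmod (f k x - g x))\<^sup>2 \<le> (2 * M)\<^sup>2" by (intro power_mono) auto
        then show ?thesis using True by simp
      qed simp
    qed
  qed simp
  then have "(\<lambda>k. (norm (interval_class L (f k) - interval_class L g))\<^sup>2) \<longlonglongrightarrow> 0"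
    by (simp add: n)
  then have "(\<lambda>k. sqrt ((norm (interval_class L (f k) - interval_class L g))\<^sup>2)) \<longlonglongrightarrow> sqrt 0"
    by (rule tendsto_real_sqrt)
  then show ?thesis
    by (simp add: LIM_zero_cancel tendsto_norm_zero_iff)
qed

text \<open>
  \<open>L\<^sup>2(0,L)\<close> is the orthogonal complement of the classes that vanish on \<open>(0,L)\<close>, which makes it
  visibly a closed complex subspace.
\<close>

lemma L2_iff_orthogonal:
  "u \<in> L2 L \<longleftrightarrow> (\<forall>w. vanishes_outside (- {0<..<L}) w \<longrightarrow> cinner_l2 u w = 0)"
proof -
  obtain f where f: "square_integrable f" "u = abs_l2 f" by (rule l2_representative)
  have m [measurable]: "f \<in> borel_measurable borel" using f(1) by (simp add: square_integrable_def)
  show ?thesis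
  proof (intro iffI allI impI)
    fix w assume u: "u \<in> L2 L" and w: "vanishes_outside (- {0<..<L}) w"
    obtain g where g: "square_integrable g" "w = abs_l2 g" by (rule l2_representative)
    have "AE x in lborel. x \<in> {0<..<L} \<longrightarrow> g x = 0"
      using w by (simp add: g vanishes_outside.abs_eq l2_rel_refl)
    moreover have "AE x in lborel. x \<notin> {0<..<L} \<longrightarrow> f x = 0"
      using u f by (simp add: abs_l2_in_L2_iff)
    ultimately have "AE x in lborel. f x * cnj (g x) = 0"
      by eventually_elim auto
    then show "cinner_l2 u w = 0"
      by (simp add: f g cinner_abs_l2 integral_eq_zero_AE)
  next
    assume *: "\<forall>w. vanishes_outside (- {0<..<L}) w \<longrightarrow> cinner_l2 u w = 0"
    define h where "h x = indicator (- {0<..<L}) x *\<^sub>R f x" for x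
    have hm [measurable]: "h \<in> borel_measurable lborel" by (simp add: h_def[abs_def])
    have h: "square_integrable h"
      unfolding square_integrable_def
    proof
      have "integrable lborel (\<lambda>x. (cmod (f x))\<^sup>2)" using f(1) by (simp add: square_integrable_def)
      then show "integrable lborel (\<lambda>x. (cmod (h x))\<^sup>2)"
        by (rule Bochner_Integration.integrable_bound)
          (auto simp: h_def split: split_indicator)
    qed measurable
    have "vanishes_outside (- {0<..<L}) (abs_l2 h)"
      by (simp add: vanishes_outside.abs_eq l2_rel_refl h) (simp add: h_def)
    with * have "cinner_l2 (abs_l2 f) (abs_l2 h) = 0" by (simp add: f)
    moreover have "(\<lambda>x. f x * cnj (h x)) = (\<lambda>x. h x * cnj (h x))"
      by (auto simp: h_def split: split_indicator)
    ultimately have "cinner_l2 (abs_l2 h) (abs_l2 h) = 0"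
      by (simp add: cinner_abs_l2 f h)
    then have "abs_l2 h = abs_l2 (\<lambda>_. 0)"
      by (simp add: cinner_l2_self_norm zero_l2_def)
    then have "AE x in lborel. h x = 0"
      by (simp add: abs_l2_eq_iff h square_integrable_zero)
    then have "AE x in lborel. x \<notin> {0<..<L} \<longrightarrow> f x = 0"
      by eventually_elim (auto simp: h_def)
    then show "u \<in> L2 L" using f by (simp add: abs_l2_in_L2_iff)
  qed
qed

lemma L2_add: "u \<in> L2 L \<Longrightarrow> v \<in> L2 L \<Longrightarrow> u + v \<in> L2 L"
  by (simp add: L2_iff_orthogonal cinner_l2_add_left)

lemma L2_scaleC: "u \<in> L2 L \<Longrightarrow> c *\<^sub>C u \<in> L2 L"
  by (simp add: L2_iff_orthogonal cinner_l2_scaleC_left)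

lemma L2_scaleR: "u \<in> L2 L \<Longrightarrow> r *\<^sub>R u \<in> L2 L"
  by (simp add: scaleR_scaleC L2_scaleC)

lemma L2_zero: "0 \<in> L2 L"
  by (simp add: L2_iff_orthogonal)

lemma L2_minus: "u \<in> L2 L \<Longrightarrow> - u \<in> L2 L"
  using L2_scaleR[of u L "-1"] by simp

lemma L2_diff: "u \<in> L2 L \<Longrightarrow> v \<in> L2 L \<Longrightarrow> u - v \<in> L2 L"
  using L2_add[of u L "- v"] by (simp add: L2_minus)

lemma L2_closed: "closed (L2 L)"
proof (rule closed_sequential_limits[THEN iffD2], intro allI impI, elim conjE)
  fix x l assume x: "\<forall>n. x n \<in> L2 L" "x \<longlonglongrightarrow> l"
  show "l \<in> L2 L"
    unfolding L2_iff_orthogonal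
  proof (intro allI impI)
    fix w assume "vanishes_outside (- {0<..<L}) w"
    with x(1) have "cinner_l2 (x n) w = 0" for n
      by (simp add: L2_iff_orthogonal)
    moreover have "(\<lambda>n. cinner_l2 (x n) w) \<longlonglongrightarrow> cinner_l2 l w"
      by (intro tendsto_cinner_l2 x tendsto_const)
    ultimately show "cinner_l2 l w = 0" by (simp add: LIMSEQ_const_iff)
  qed
qed

lemma test_function_outside:
  assumes "test_function L \<phi>" "x \<notin> {0<..<L}"
  shows "\<phi> x = 0"
proof -
  obtain a b where "0 < a" "b < L" "\<And>x. x \<notin> {a..b} \<Longrightarrow> \<phi> x = 0"
    using assms(1) by (auto simp: test_function_def)
  then show ?thesis using assms(2) by auto
qed

lemma test_function_derivative:
  assumes "test_function L \<phi>"
  shows "test_function L (\<lambda>x. vector_derivative \<phi> (at x))"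
proof -
  obtain a b where ab: "0 < a" "b < L" "\<And>x. x \<notin> {a..b} \<Longrightarrow> \<phi> x = 0" and s: "smooth \<phi>"
    using assms by (auto simp: test_function_def)
  have "vector_derivative \<phi> (at x) = 0" if "x \<notin> {a..b}" for x
  proof -
    have "((\<lambda>_. 0) has_vector_derivative 0) (at x)" by simp
    then have "(\<phi> has_vector_derivative 0) (at x)"
      by (rule has_vector_derivative_transform_within_open[where S = "- {a..b}"])
        (use that ab(3) in auto)
    then show ?thesis by (rule vector_derivative_at)
  qed
  then show ?thesis
    unfolding test_function_def using ab smooth_derivative(2)[OF s] by blast
qed

lemma test_function_cnj: "test_function L \<phi> \<Longrightarrow> test_function L (\<lambda>x. cnj (\<phi> x))"
  unfolding test_function_def by (metis complex_cnj_zero smooth_cnj)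

lemma vector_derivative_cnj_smooth:
  "smooth \<phi> \<Longrightarrow> vector_derivative (\<lambda>x. cnj (\<phi> x)) (at x) = cnj (vector_derivative \<phi> (at x))"
  by (intro vector_derivative_at bounded_linear.has_vector_derivative[OF bounded_linear_cnj]
      smooth_derivative(1))

lemma test_function_restrict:
  "test_function L \<phi> \<Longrightarrow> (\<lambda>x. indicator {0<..<L} x *\<^sub>R \<phi> x) = \<phi>"
  using test_function_outside[of L \<phi>] by (auto split: split_indicator)

lemma abs_l2_test_function: "test_function L \<phi> \<Longrightarrow> abs_l2 \<phi> = interval_class L \<phi>"
  by (simp add: interval_class_def test_function_restrict)

lemma square_integrable_test_function: "test_function L \<phi> \<Longrightarrow> square_integrable \<phi>"
  using square_integrable_interval_continuous[of \<phi> L]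
  by (metis smooth_continuous test_function_def test_function_restrict)

lemma integral_test_function:
  assumes "test_function L \<phi>" "square_integrable f"
  shows "(LINT x:{0<..<L}|lborel. f x * \<phi> x) = cinner_l2 (abs_l2 f) (abs_l2 (\<lambda>x. cnj (\<phi> x)))"
proof -
  have "(\<lambda>x. indicator {0<..<L} x *\<^sub>R (f x * \<phi> x)) = (\<lambda>x. f x * cnj (cnj (\<phi> x)))"
    using test_function_outside[OF assms(1)] by (auto split: split_indicator)
  then show ?thesis
    using square_integrable_test_function[OF test_function_cnj[OF assms(1)]] assms(2)
    by (simp add: set_lebesgue_integral_def cinner_abs_l2)
qed

text \<open>
  Conjugation permutes the test functions, which turns the bilinear pairing of the definition into the
  inner product.
\<close>

lemma integrates_by_parts_iff:
  "integrates_by_parts L u v \<longleftrightarrow> (\<forall>\<phi>. test_function L \<phi> \<longrightarrow>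
    cinner_l2 u (abs_l2 (\<lambda>x. vector_derivative \<phi> (at x))) = - cinner_l2 v (abs_l2 \<phi>))"
proof -
  obtain f where f: "square_integrable f" "u = abs_l2 f" by (rule l2_representative)
  obtain g where g: "square_integrable g" "v = abs_l2 g" by (rule l2_representative)
  have eq: "(LINT x:{0<..<L}|lborel. f x * vector_derivative \<phi> (at x))
        = cinner_l2 u (abs_l2 (\<lambda>x. vector_derivative (\<lambda>x. cnj (\<phi> x)) (at x)))"
    "(LINT x:{0<..<L}|lborel. g x * \<phi> x) = cinner_l2 v (abs_l2 (\<lambda>x. cnj (\<phi> x)))"
    if "test_function L \<phi>" for \<phi>
    using that integral_test_function[OF test_function_derivative[OF that] f(1)]
      integral_test_function[OF that g(1)]
    by (simp_all add: f g test_function_def vector_derivative_cnj_smooth)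
  have "integrates_by_parts L u v \<longleftrightarrow> (\<forall>\<phi>. test_function L \<phi> \<longrightarrow>
    cinner_l2 u (abs_l2 (\<lambda>x. vector_derivative (\<lambda>x. cnj (\<phi> x)) (at x)))
      = - cinner_l2 v (abs_l2 (\<lambda>x. cnj (\<phi> x))))"
    using eq by (simp add: f g integrates_by_parts.abs_eq l2_rel_refl)
  also have "\<dots> \<longleftrightarrow> (\<forall>\<phi>. test_function L \<phi> \<longrightarrow>
    cinner_l2 u (abs_l2 (\<lambda>x. vector_derivative \<phi> (at x))) = - cinner_l2 v (abs_l2 \<phi>))"
  proof (intro iffI allI impI)
    fix \<phi> assume *: "\<forall>\<phi>. test_function L \<phi> \<longrightarrow>
      cinner_l2 u (abs_l2 (\<lambda>x. vector_derivative (\<lambda>x. cnj (\<phi> x)) (at x)))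
        = - cinner_l2 v (abs_l2 (\<lambda>x. cnj (\<phi> x)))" and t: "test_function L \<phi>"
    show "cinner_l2 u (abs_l2 (\<lambda>x. vector_derivative \<phi> (at x))) = - cinner_l2 v (abs_l2 \<phi>)"
      using *[rule_format, OF test_function_cnj[OF t]] by simp
  next
    fix \<phi> assume *: "\<forall>\<phi>. test_function L \<phi> \<longrightarrow>
      cinner_l2 u (abs_l2 (\<lambda>x. vector_derivative \<phi> (at x))) = - cinner_l2 v (abs_l2 \<phi>)"
      and t: "test_function L \<phi>"
    show "cinner_l2 u (abs_l2 (\<lambda>x. vector_derivative (\<lambda>x. cnj (\<phi> x)) (at x)))
        = - cinner_l2 v (abs_l2 (\<lambda>x. cnj (\<phi> x)))"
      using *[rule_format, OF test_function_cnj[OF t]] .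
  qed
  finally show ?thesis .
qed

lemma has_weak_derivative_add:
  "has_weak_derivative L u v \<Longrightarrow> has_weak_derivative L u' v' \<Longrightarrow> has_weak_derivative L (u + u') (v + v')"
  by (simp add: has_weak_derivative_def L2_add integrates_by_parts_iff cinner_l2_add_left)

lemma has_weak_derivative_scaleC:
  "has_weak_derivative L u v \<Longrightarrow> has_weak_derivative L (c *\<^sub>C u) (c *\<^sub>C v)"
  by (simp add: has_weak_derivative_def L2_scaleC integrates_by_parts_iff cinner_l2_scaleC_left)

lemma has_weak_derivative_scaleR:
  "has_weak_derivative L u v \<Longrightarrow> has_weak_derivative L (r *\<^sub>R u) (r *\<^sub>R v)"
  by (simp add: scaleR_scaleC has_weak_derivative_scaleC)

text \<open>
  Both sides of the formula for integration by parts are continuous, so weak differentiation is closed.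
\<close>

lemma has_weak_derivative_limit:
  assumes "\<And>n. has_weak_derivative L (u n) (v n)" "u \<longlonglongrightarrow> u'" "v \<longlonglongrightarrow> v'"
  shows "has_weak_derivative L u' v'"
  unfolding has_weak_derivative_def
proof (intro conjI)
  show "u' \<in> L2 L" "v' \<in> L2 L"
    using closed_sequentially[OF L2_closed _ assms(2)] closed_sequentially[OF L2_closed _ assms(3)]
      assms(1) by (auto simp: has_weak_derivative_def)
  show "integrates_by_parts L u' v'"
    unfolding integrates_by_parts_iff
  proof (intro allI impI)
    fix \<phi> assume t: "test_function L \<phi>"
    let ?d = "abs_l2 (\<lambda>x. vector_derivative \<phi> (at x))"
    have "(\<lambda>n. cinner_l2 (u n) ?d) \<longlonglongrightarrow> cinner_l2 u' ?d"
      by (intro tendsto_cinner_l2 assms tendsto_const)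
    moreover have "(\<lambda>n. - cinner_l2 (v n) (abs_l2 \<phi>)) \<longlonglongrightarrow> - cinner_l2 v' (abs_l2 \<phi>)"
      by (intro tendsto_cinner_l2 assms tendsto_const tendsto_minus)
    moreover have "cinner_l2 (u n) ?d = - cinner_l2 (v n) (abs_l2 \<phi>)" for n
      using assms(1)[of n] t by (simp add: has_weak_derivative_def integrates_by_parts_iff)
    ultimately show "cinner_l2 u' ?d = - cinner_l2 v' (abs_l2 \<phi>)"
      using LIMSEQ_unique by simp
  qed
qed

lemma has_weak_derivative_unique:
  assumes "has_weak_derivative L u v" "has_weak_derivative L u v'"
  shows "v = v'"
proof -
  obtain f where f: "square_integrable f" "v - v' = abs_l2 f" by (rule l2_representative)
  have d: "cinner_l2 (v - v') (abs_l2 \<phi>) = 0" if "test_function L \<phi>" for \<phi>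
    using assms that
    by (simp add: has_weak_derivative_def integrates_by_parts_iff cinner_l2_diff_left)
  have "AE x in lborel. x \<in> {0<..<L} \<longrightarrow> f x = 0"
  proof (rule fundamental_lemma)
    have "square_integrable (\<lambda>x. indicator {0<..<L} x *\<^sub>R 1)"
      by (rule square_integrable_interval[of _ _ 1]) auto
    from square_integrable_product[OF f(1) this]
    show "set_integrable lborel {0<..<L} f"
      unfolding set_integrable_def
      by (rule Bochner_Integration.integrable_cong[THEN iffD1, rotated 2])
        (auto split: split_indicator)
    fix \<psi> assume "test_function L (\<lambda>x. complex_of_real (\<psi> x))"
    then show "(LINT x:{0<..<L}|lborel. f x * complex_of_real (\<psi> x)) = 0"
      using d integral_test_function[OF _ f(1)] by (simp flip: f(2))
  qed
  moreover have "v - v' \<in> L2 L"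
    using assms by (simp add: has_weak_derivative_def L2_diff)
  then have "AE x in lborel. x \<notin> {0<..<L} \<longrightarrow> f x = 0"
    using f by (simp add: abs_l2_in_L2_iff)
  ultimately have "AE x in lborel. f x = 0" by eventually_elim auto
  then have "abs_l2 f = 0"
    by (simp add: zero_l2_def abs_l2_eq_iff f square_integrable_zero)
  then show ?thesis using f(2) by simp
qed

lemma weak_derivative_eq: "has_weak_derivative L u v \<Longrightarrow> weak_derivative L u = v"
  unfolding weak_derivative_def using has_weak_derivative_unique by blast

lemma H1_has_weak_derivative: "u \<in> H1 L \<longleftrightarrow> has_weak_derivative L u (weak_derivative L u)"
  unfolding H1_def using weak_derivative_eq by auto

lemma weak_derivative_add:
  assumes "u \<in> H1 L" "v \<in> H1 L"
  shows "u + v \<in> H1 L" "weak_derivative L (u + v) = weak_derivative L u + weak_derivative L v"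
  using has_weak_derivative_add[OF assms[unfolded H1_has_weak_derivative]]
  by (auto simp: weak_derivative_eq H1_def)

lemma weak_derivative_scaleC:
  assumes "u \<in> H1 L"
  shows "c *\<^sub>C u \<in> H1 L" "weak_derivative L (c *\<^sub>C u) = c *\<^sub>C weak_derivative L u"
  using has_weak_derivative_scaleC[OF assms[unfolded H1_has_weak_derivative], of c]
  by (auto simp: weak_derivative_eq H1_def)

lemma weak_derivative_scaleR:
  assumes "u \<in> H1 L"
  shows "r *\<^sub>R u \<in> H1 L" "weak_derivative L (r *\<^sub>R u) = r *\<^sub>R weak_derivative L u"
  using weak_derivative_scaleC[OF assms] by (auto simp: scaleR_scaleC)

lemma weak_derivative_in_L2: "u \<in> H1 L \<Longrightarrow> weak_derivative L u \<in> L2 L"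
  by (simp add: H1_has_weak_derivative has_weak_derivative_def)

lemma H1_in_L2: "u \<in> H1 L \<Longrightarrow> u \<in> L2 L"
  by (simp add: H1_has_weak_derivative has_weak_derivative_def)

lemma has_weak_derivative_classical:
  assumes "0 < L" and F: "\<And>x. (F has_vector_derivative f x) (at x)" and f: "continuous_on UNIV f"
  shows "has_weak_derivative L (interval_class L F) (interval_class L f)"
proof -
  have cF: "continuous_on UNIV F"
    using F by (meson continuous_at_imp_continuous_on has_vector_derivative_continuous)
  note sq = square_integrable_interval_continuous[OF cF, of L]
    square_integrable_interval_continuous[OF f, of L]
  show ?thesis
    unfolding has_weak_derivative_def
  proof (intro conjI)
    show "interval_class L F \<in> L2 L" "interval_class L f \<in> L2 L"
      using sq by (auto intro: interval_class_in_L2)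
    show "integrates_by_parts L (interval_class L F) (interval_class L f)"
      unfolding integrates_by_parts_iff
    proof (intro allI impI)
      fix \<phi> assume t: "test_function L \<phi>"
      define g where "g x = cnj (\<phi> x)" for x
      define g' where "g' x = vector_derivative g (at x)" for x
      have tg: "test_function L g" unfolding g_def by (rule test_function_cnj[OF t])
      then have s: "smooth g" by (simp add: test_function_def)
      have g': "(g has_vector_derivative g' x) (at x)" "continuous_on UNIV g'" for x
        unfolding g'_def by (rule smooth_derivative(1)[OF s])
          (rule smooth_continuous[OF smooth_derivative(2)[OF s]])
      have tg': "test_function L g'" unfolding g'_def by (rule test_function_derivative[OF tg])
      have cong: "cnj (vector_derivative \<phi> (at x)) = g' x" for x
        using t unfolding g'_def g_def
        by (simp add: vector_derivative_cnj_smooth test_function_def)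
      let ?i = "\<lambda>x. indicator {0<..<L} x :: real"
      have int: "integrable lborel (\<lambda>x. (?i x *\<^sub>R F x) * g' x)" "integrable lborel (\<lambda>x. (?i x *\<^sub>R f x) * g x)"
        using square_integrable_product[OF sq(1) square_integrable_test_function[OF test_function_derivative[OF t]]]
          square_integrable_product[OF sq(2) square_integrable_test_function[OF t]]
        by (simp_all add: cong g_def)
      have "has_bochner_integral lborel
          (\<lambda>x. indicator {0..L} x *\<^sub>R (F x * g' x + f x * g x)) (F L * g L - F 0 * g 0)"
      proof (rule has_bochner_integral_FTC_Icc)
        show "((\<lambda>x. F x * g x) has_vector_derivative F x * g' x + f x * g x) (at x within {0..L})" for x
          by (rule has_vector_derivative_at_within[OF has_vector_derivative_mult[OF F g'(1)]])
        show "continuous_on {0..L} (\<lambda>x. F x * g' x + f x * g x)"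
          by (intro continuous_intros continuous_on_subset[OF cF] continuous_on_subset[OF f]
              continuous_on_subset[OF g'(2)] smooth_continuous[OF s]) auto
      qed (use assms(1) in simp)
      moreover have "(\<lambda>x. indicator {0..L} x *\<^sub>R (F x * g' x + f x * g x))
          = (\<lambda>x. (?i x *\<^sub>R F x) * g' x + (?i x *\<^sub>R f x) * g x)"
      proof
        fix x
        show "indicator {0..L} x *\<^sub>R (F x * g' x + f x * g x)
          = (?i x *\<^sub>R F x) * g' x + (?i x *\<^sub>R f x) * g x"
        proof (cases "x \<in> {0<..<L}")
          case False
          then show ?thesis
            using test_function_outside[OF tg False] test_function_outside[OF tg' False] by simp
        qed auto
      qed
      moreover have "g L = 0" "g 0 = 0"
        using test_function_outside[OF tg] by auto
      ultimately have "(LINT x|lborel. (?i x *\<^sub>R F x) * g' x + (?i x *\<^sub>R f x) * g x) = 0"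
        by (simp add: has_bochner_integral_integral_eq)
      then have "(LINT x|lborel. (?i x *\<^sub>R F x) * g' x) = - (LINT x|lborel. (?i x *\<^sub>R f x) * g x)"
        using int by (simp add: add_eq_0_iff2)
      then show "cinner_l2 (interval_class L F) (abs_l2 (\<lambda>x. vector_derivative \<phi> (at x)))
          = - cinner_l2 (interval_class L f) (abs_l2 \<phi>)"
        using sq square_integrable_test_function[OF t]
          square_integrable_test_function[OF test_function_derivative[OF t]]
        by (simp add: interval_class_def cinner_abs_l2 cong g_def)
    qed
  qed
qed

lemma has_weak_derivative_test_function:
  assumes "0 < L" "test_function L \<phi>"
  shows "has_weak_derivative L (abs_l2 \<phi>) (abs_l2 (\<lambda>x. vector_derivative \<phi> (at x)))"
proof -
  have s: "smooth \<phi>" using assms(2) by (simp add: test_function_def)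
  show ?thesis
    unfolding abs_l2_test_function[OF assms(2)]
      abs_l2_test_function[OF test_function_derivative[OF assms(2)]]
    by (intro has_weak_derivative_classical assms smooth_derivative[OF s] smooth_continuous)
qed

text \<open>
  If \<open>u\<close> is a test function, this is the definition of the weak derivative of \<open>w\<close>; both sides are
  continuous in \<open>u\<close> for the norm of \<open>H1\<close>.
\<close>

lemma integration_by_parts_H10:
  assumes "0 < L" "w \<in> H1 L" "u \<in> H10 L"
  shows "cinner_l2 (weak_derivative L w) u = - cinner_l2 w (weak_derivative L u)"
proof -
  obtain \<phi> where \<phi>: "\<And>n. test_function L (\<phi> n)" "(\<lambda>n. abs_l2 (\<phi> n)) \<longlonglongrightarrow> u"
    "(\<lambda>n. weak_derivative L (abs_l2 (\<phi> n))) \<longlonglongrightarrow> weak_derivative L u"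
    using assms(3) by (auto simp: H10_def)
  have "cinner_l2 (weak_derivative L w) (abs_l2 (\<phi> n))
      = - cinner_l2 w (weak_derivative L (abs_l2 (\<phi> n)))" for n
    using assms(2) \<phi>(1)[of n] weak_derivative_eq[OF has_weak_derivative_test_function[OF assms(1) \<phi>(1)[of n]]]
    unfolding H1_has_weak_derivative has_weak_derivative_def integrates_by_parts_iff by simp
  moreover have "(\<lambda>n. cinner_l2 (weak_derivative L w) (abs_l2 (\<phi> n)))
      \<longlonglongrightarrow> cinner_l2 (weak_derivative L w) u"
    by (intro tendsto_cinner_l2 tendsto_const \<phi>)
  moreover have "(\<lambda>n. - cinner_l2 w (weak_derivative L (abs_l2 (\<phi> n))))
      \<longlonglongrightarrow> - cinner_l2 w (weak_derivative L u)"
    by (intro tendsto_cinner_l2 tendsto_const tendsto_minus \<phi>)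
  ultimately show ?thesis using LIMSEQ_unique by simp
qed

section \<open>The sine basis\<close>

definition frequency :: "real \<Rightarrow> nat \<Rightarrow> real"
  where "frequency L n = real (Suc n) * pi / L"

definition sine_class :: "real \<Rightarrow> nat \<Rightarrow> l2"
  where "sine_class L n = interval_class L (\<lambda>x. complex_of_real (sin (frequency L n * x)))"

definition cosine_class :: "real \<Rightarrow> nat \<Rightarrow> l2"
  where "cosine_class L n = interval_class L (\<lambda>x. complex_of_real (cos (frequency L n * x)))"

lemma frequency_pos: "0 < L \<Longrightarrow> 0 < frequency L n"
  by (simp add: frequency_def)

lemma sin_frequency_end: "0 < L \<Longrightarrow> sin (frequency L n * L) = 0"
  using sin_npi[of "Suc n"] by (simp add: frequency_def del: sin_npi of_nat_Suc)

lemma interval_class_scaleR: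
  "square_integrable (\<lambda>x. indicator {0<..<L} x *\<^sub>R f x) \<Longrightarrow>
    interval_class L (\<lambda>x. complex_of_real r * f x) = r *\<^sub>R interval_class L f"
  by (simp add: interval_class_def scaleR_scaleC abs_l2_scaleC scaleR_conv_of_real mult_ac)

lemma trig_has_vector_derivative:
  "((\<lambda>x. complex_of_real (sin (a * x))) has_vector_derivative
      complex_of_real a * complex_of_real (cos (a * x))) (at x)"
  "((\<lambda>x. complex_of_real (cos (a * x))) has_vector_derivative
      complex_of_real (- a) * complex_of_real (sin (a * x))) (at x)"
proof -
  have "((\<lambda>x. sin (a * x)) has_real_derivative a * cos (a * x)) (at x)"
    "((\<lambda>x. cos (a * x)) has_real_derivative - a * sin (a * x)) (at x)"
    by (auto intro!: derivative_eq_intros)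
  note this[unfolded has_real_derivative_iff_has_vector_derivative]
  from this[THEN bounded_linear.has_vector_derivative[OF bounded_linear_of_real]]
  show "((\<lambda>x. complex_of_real (sin (a * x))) has_vector_derivative
      complex_of_real a * complex_of_real (cos (a * x))) (at x)"
    "((\<lambda>x. complex_of_real (cos (a * x))) has_vector_derivative
      complex_of_real (- a) * complex_of_real (sin (a * x))) (at x)"
    by simp_all
qed

lemma square_integrable_trig:
  "square_integrable (\<lambda>x. indicator {0<..<L} x *\<^sub>R complex_of_real (sin (a * x)))"
  "square_integrable (\<lambda>x. indicator {0<..<L} x *\<^sub>R complex_of_real (cos (a * x)))"
  by (intro square_integrable_interval_continuous continuous_intros)+

lemma has_weak_derivative_sine:
  assumes "0 < L"
  shows "has_weak_derivative L (sine_class L n) (frequency L n *\<^sub>R cosine_class L n)"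
    and "has_weak_derivative L (cosine_class L n) (- frequency L n *\<^sub>R sine_class L n)"
proof -
  show "has_weak_derivative L (sine_class L n) (frequency L n *\<^sub>R cosine_class L n)"
    unfolding sine_class_def cosine_class_def interval_class_scaleR[OF square_integrable_trig(2), symmetric]
    by (intro has_weak_derivative_classical assms trig_has_vector_derivative continuous_intros)
  show "has_weak_derivative L (cosine_class L n) (- frequency L n *\<^sub>R sine_class L n)"
    unfolding sine_class_def cosine_class_def interval_class_scaleR[OF square_integrable_trig(1), symmetric]
    by (intro has_weak_derivative_classical assms trig_has_vector_derivative continuous_intros)
qed

lemma smooth_sin: "smooth (\<lambda>x. complex_of_real (sin (a * x)))"
proof -
  let ?s = "\<lambda>x. complex_of_real (sin (a * x))" and ?c = "\<lambda>x. complex_of_real (cos (a * x))"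
  have "ring_hull ({?s, ?c} \<union> range (\<lambda>c _. c)) ?s" by (rule ring_hull.base) simp
  then show ?thesis
  proof (rule smooth_ring_hull)
    let ?A = "{?s, ?c} \<union> range (\<lambda>c _. c)"
    have r: "ring_hull ?A (\<lambda>x. complex_of_real r * ?s x)"
      "ring_hull ?A (\<lambda>x. complex_of_real r * ?c x)" "ring_hull ?A (\<lambda>_. 0)" for r
      by (intro ring_hull.mult ring_hull.base; simp)+
    fix g assume "g \<in> ?A"
    then consider "g = ?s" | "g = ?c" | c where "g = (\<lambda>_. c)" by auto
    then show "\<exists>h. ring_hull ?A h \<and> (\<forall>x. (g has_vector_derivative h x) (at x))"
    proof cases
      case 1
      then show ?thesis using r(2)[of a] trig_has_vector_derivative(1)[of a] by blast
    next
      case 2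
      then show ?thesis using r(1)[of "- a"] trig_has_vector_derivative(2)[of a] by blast
    next
      case 3
      then show ?thesis using r(3) by (intro exI[of _ "\<lambda>_. 0"]) simp
    qed
  qed
qed

lemma abs_sin_le: "\<bar>sin x\<bar> \<le> \<bar>x :: real\<bar>"
proof -
  have "\<bar>sin x - sin 0\<bar> \<le> 1 * \<bar>x - 0\<bar>"
    using field_differentiable_bound[of UNIV sin cos 1 x 0]
    by (auto intro!: derivative_eq_intros)
  then show ?thesis by simp
qed

text \<open>
  Cutting a sine off within distance \<open>1/k\<close> of the end points costs a derivative of size \<open>k\<close>, which is
  compensated by the zeros of the sine there; so the cut off sines converge in the norm of \<open>H1\<close>.
\<close>

lemma sine_class_in_H10:
  assumes L: "0 < L"
  shows "sine_class L n \<in> H10 L"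
proof -
  obtain \<eta> \<eta>' M where \<eta>: "smooth (\<lambda>x. complex_of_real (\<eta> x))"
    "\<And>x. ((\<lambda>x. complex_of_real (\<eta> x)) has_vector_derivative \<eta>' x) (at x)"
    "\<And>x. x \<le> 1 \<Longrightarrow> \<eta> x = (0::real)" "\<And>x. x \<ge> 2 \<Longrightarrow> \<eta> x = 1" "\<And>x. 0 \<le> \<eta> x" "\<And>x. \<eta> x \<le> 1"
    "\<And>x. cmod (\<eta>' x) \<le> M" "\<And>x. x < 1 \<Longrightarrow> \<eta>' x = 0" "\<And>x. x > 2 \<Longrightarrow> \<eta>' x = 0"
    by (rule smooth_step_exists) blast
  define a where "a = frequency L n"
  have a: "a > 0" using frequency_pos[OF L] by (simp add: a_def)
  define s where "s x = complex_of_real (sin (a * x))" for x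
  define c where "c x = complex_of_real a * complex_of_real (cos (a * x))" for x
  have s_bound: "cmod (s x) \<le> a * \<bar>x\<bar>" "cmod (s x) \<le> a * \<bar>L - x\<bar>" for x
  proof -
    show "cmod (s x) \<le> a * \<bar>x\<bar>"
      using abs_sin_le[of "a * x"] a by (simp add: s_def abs_mult)
    have "sin (a * (L - x)) = - cos (a * L) * sin (a * x)"
      using sin_frequency_end[OF L, of n] by (simp add: a_def right_diff_distrib sin_diff)
    moreover have "\<bar>cos (a * L)\<bar> = 1"
      using sin_frequency_end[OF L, of n] sin_cos_squared_add[of "a * L"]
      by (simp add: a_def abs_square_eq_1)
    ultimately have "\<bar>sin (a * x)\<bar> = \<bar>sin (a * (L - x))\<bar>" by (simp add: abs_mult)
    then show "cmod (s x) \<le> a * \<bar>L - x\<bar>"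
      using abs_sin_le[of "a * (L - x)"] a by (simp add: s_def abs_mult)
  qed
  define N where "N k = real (Suc k)" for k
  have N: "N k > 0" for k by (simp add: N_def)
  define p where "p k x = complex_of_real (\<eta> (N k * x))" for k x
  define q where "q k x = complex_of_real (\<eta> (N k * (L - x)))" for k x
  define p' where "p' k x = N k *\<^sub>R \<eta>' (N k * x)" for k x
  define q' where "q' k x = - N k *\<^sub>R \<eta>' (N k * (L - x))" for k x
  define \<phi> where "\<phi> k x = p k x * q k x * s x" for k x
  define \<phi>' where "\<phi>' k x = p k x * q k x * c x + (p k x * q' k x + p' k x * q k x) * s x" for k x
  have sm: "smooth (p k)" "smooth (q k)" "smooth s" for k
    using smooth_affine[OF \<eta>(1), of "N k" 0] smooth_affine[OF \<eta>(1), of "- N k" "N k * L"]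
      smooth_sin[of a]
    by (simp_all add: p_def[abs_def] q_def[abs_def] s_def[abs_def] algebra_simps)
  have dp: "(p k has_vector_derivative p' k x) (at x)" for k x
  proof -
    have "((\<lambda>x. N k * x) has_vector_derivative N k) (at x)"
      by (auto intro!: derivative_eq_intros simp: has_real_derivative_iff_has_vector_derivative[symmetric])
    from vector_diff_chain_at[OF this \<eta>(2)]
    show ?thesis by (simp add: o_def p_def[abs_def] p'_def)
  qed
  have dq: "(q k has_vector_derivative q' k x) (at x)" for k x
  proof -
    have "((\<lambda>x. N k * (L - x)) has_vector_derivative - N k) (at x)"
      by (auto intro!: derivative_eq_intros simp: has_real_derivative_iff_has_vector_derivative[symmetric])
    from vector_diff_chain_at[OF this \<eta>(2)]
    show ?thesis by (simp add: o_def q_def[abs_def] q'_def)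
  qed
  have ds: "(s has_vector_derivative c x) (at x)" for x
    unfolding s_def[abs_def] c_def by (rule trig_has_vector_derivative)
  have d\<phi>: "(\<phi> k has_vector_derivative \<phi>' k x) (at x)" for k x
    unfolding \<phi>_def[abs_def] \<phi>'_def
    by (intro has_vector_derivative_mult dp dq ds)
  have t: "test_function L (\<phi> k)" for k
    unfolding test_function_def
  proof (intro conjI exI allI impI)
    show "smooth (\<phi> k)" unfolding \<phi>_def[abs_def] by (intro smooth_mult sm)
    show "0 < 1 / N k" "L - 1 / N k < L" using N[of k] by auto
    fix x assume "x \<notin> {1 / N k..L - 1 / N k}"
    then have "x < 1 / N k \<or> L - x < 1 / N k" by auto
    then have "N k * x \<le> 1 \<or> N k * (L - x) \<le> 1"
      using N[of k] by (auto simp: field_simps)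
    then show "\<phi> k x = 0" by (auto simp: \<phi>_def p_def q_def \<eta>(3))
  qed
  have pq: "cmod (p k x) \<le> 1" "cmod (q k x) \<le> 1" for k x
    using \<eta>(5,6) by (auto simp: p_def q_def)
  have M: "M \<ge> 0" using \<eta>(7)[of 0] norm_ge_zero order_trans by blast
  have p's: "cmod (p' k x * s x) \<le> 2 * a * M" for k x
  proof (cases "N k * \<bar>x\<bar> \<le> 2")
    case True
    have "cmod (p' k x * s x) \<le> (N k * M) * (a * \<bar>x\<bar>)"
      unfolding norm_mult using N[of k] \<eta>(7) M a s_bound(1)
      by (intro mult_mono) (auto simp: p'_def intro!: mult_left_mono)
    also have "\<dots> = (N k * \<bar>x\<bar>) * (a * M)" by simp
    also have "\<dots> \<le> 2 * (a * M)" using True a M by (intro mult_right_mono) auto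
    finally show ?thesis by simp
  next
    case False
    then have "\<bar>N k * x\<bar> > 2" using N[of k] by (simp add: abs_mult)
    then have "N k * x > 2 \<or> N k * x < - 2" by linarith
    then have "\<eta>' (N k * x) = 0" using \<eta>(8,9) by auto
    then show ?thesis using a M by (simp add: p'_def)
  qed
  have q's: "cmod (q' k x * s x) \<le> 2 * a * M" for k x
  proof (cases "N k * \<bar>L - x\<bar> \<le> 2")
    case True
    have "cmod (q' k x * s x) \<le> (N k * M) * (a * \<bar>L - x\<bar>)"
      unfolding norm_mult using N[of k] \<eta>(7) M a s_bound(2)
      by (intro mult_mono) (auto simp: q'_def intro!: mult_left_mono)
    also have "\<dots> = (N k * \<bar>L - x\<bar>) * (a * M)" by simp
    also have "\<dots> \<le> 2 * (a * M)" using True a M by (intro mult_right_mono) auto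
    finally show ?thesis by simp
  next
    case False
    then have "\<bar>N k * (L - x)\<bar> > 2" using N[of k] by (simp add: abs_mult)
    then have "N k * (L - x) > 2 \<or> N k * (L - x) < - 2" by linarith
    then have "\<eta>' (N k * (L - x)) = 0" using \<eta>(8,9) by auto
    then show ?thesis using a M by (simp add: q'_def)
  qed
  have b1: "cmod (\<phi> k x) \<le> 1" for k x
  proof -
    have "cmod (p k x) * cmod (q k x) * cmod (s x) \<le> 1 * 1 * 1"
      by (intro mult_mono pq) (auto simp: s_def)
    then show ?thesis by (simp add: \<phi>_def norm_mult)
  qed
  have b2: "cmod (\<phi>' k x) \<le> a + 4 * a * M" for k x
  proof -
    have "cmod (p k x * q k x * c x) \<le> 1 * 1 * a"
      unfolding norm_mult using a
      by (intro mult_mono pq) (auto simp: c_def norm_mult mult_left_le)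
    moreover have "cmod (p k x * (q' k x * s x)) \<le> 1 * (2 * a * M)"
      unfolding norm_mult[of "p k x"] by (intro mult_mono pq q's) auto
    moreover have "cmod (q k x * (p' k x * s x)) \<le> 1 * (2 * a * M)"
      unfolding norm_mult[of "q k x"] by (intro mult_mono pq p's) auto
    moreover have eq: "\<phi>' k x = p k x * q k x * c x + p k x * (q' k x * s x) + q k x * (p' k x * s x)"
      by (simp add: \<phi>'_def algebra_simps)
    ultimately show ?thesis
      unfolding eq
      using norm_triangle_ineq[of "p k x * q k x * c x + p k x * (q' k x * s x)" "q k x * (p' k x * s x)"]
        norm_triangle_ineq[of "p k x * q k x * c x" "p k x * (q' k x * s x)"] by linarith
  qed
  have ev: "\<forall>\<^sub>F k in sequentially. \<phi> k x = s x \<and> \<phi>' k x = c x" if x: "x \<in> {0<..<L}" for x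
  proof -
    obtain K where K: "real K > max (2 / x) (2 / (L - x))"
      using reals_Archimedean2 by blast
    have "\<phi> k x = s x \<and> \<phi>' k x = c x" if "k \<ge> K" for k
    proof -
      have "N k > 2 / x" "N k > 2 / (L - x)" using K that by (auto simp: N_def)
      then have "N k * x > 2" "N k * (L - x) > 2" using x by (auto simp: field_simps)
      then show ?thesis
        using \<eta>(4,9) by (simp add: \<phi>_def \<phi>'_def p_def q_def p'_def q'_def)
    qed
    then show ?thesis by (auto simp: eventually_sequentially)
  qed
  have der: "vector_derivative (\<phi> k) (at x) = \<phi>' k x" for k x
    by (rule vector_derivative_at[OF d\<phi>])
  note t' = test_function_derivative[OF t, unfolded der]
  have meas: "f \<in> borel_measurable borel" if "smooth f" for f
    by (rule smooth_measurable(1)[OF that])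
  have conv1: "(\<lambda>k. interval_class L (\<phi> k)) \<longlonglongrightarrow> interval_class L s"
  proof (rule interval_class_dominated_convergence[OF _ _ b1])
    show "\<phi> k \<in> borel_measurable borel" "s \<in> borel_measurable borel" for k
      using t[of k] sm(3) by (auto simp: test_function_def intro: meas)
    show "(\<lambda>k. \<phi> k x) \<longlonglongrightarrow> s x" if "x \<in> {0<..<L}" for x
      using ev[OF that] by (intro tendsto_eventually) (auto elim: eventually_mono)
  qed
  have conv2: "(\<lambda>k. interval_class L (\<phi>' k)) \<longlonglongrightarrow> interval_class L c"
  proof (rule interval_class_dominated_convergence[OF _ _ b2])
    show "\<phi>' k \<in> borel_measurable borel" for k
      using t'[of k] by (auto simp: test_function_def intro: meas)
    show "c \<in> borel_measurable borel"
      unfolding c_def[abs_def] by (intro borel_measurable_continuous_onI continuous_intros)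
    show "(\<lambda>k. \<phi>' k x) \<longlonglongrightarrow> c x" if "x \<in> {0<..<L}" for x
      using ev[OF that] by (intro tendsto_eventually) (auto elim: eventually_mono)
  qed
  have wd: "weak_derivative L (sine_class L n) = interval_class L c"
    using weak_derivative_eq[OF has_weak_derivative_sine(1)[OF L]]
    unfolding c_def[abs_def] a_def cosine_class_def interval_class_scaleR[OF square_integrable_trig(2)] .
  have wd\<phi>: "weak_derivative L (abs_l2 (\<phi> k)) = interval_class L (\<phi>' k)" for k
    using weak_derivative_eq[OF has_weak_derivative_test_function[OF L t[of k]]]
    unfolding der abs_l2_test_function[OF t'] .
  show ?thesis
    unfolding H10_def
  proof (intro CollectI conjI exI[of _ \<phi>] allI t)
    show "sine_class L n \<in> H1 L" using has_weak_derivative_sine(1)[OF L] by (auto simp: H1_def)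
    show "(\<lambda>n. abs_l2 (\<phi> n)) \<longlonglongrightarrow> sine_class L n"
      using conv1 by (simp add: abs_l2_test_function[OF t] sine_class_def s_def[abs_def] a_def)
    show "(\<lambda>k. weak_derivative L (abs_l2 (\<phi> k))) \<longlonglongrightarrow> weak_derivative L (sine_class L n)"
      using conv2 by (simp add: wd wd\<phi>)
  qed
qed

definition eigenvalue :: "real \<Rightarrow> nat \<Rightarrow> real"
  where "eigenvalue L n = (frequency L n)\<^sup>2"

lemma eigenvalue_pos: "0 < L \<Longrightarrow> 0 < eigenvalue L n"
  using frequency_pos[of L n] by (simp add: eigenvalue_def)

lemma eigenvalue_mono: "0 < L \<Longrightarrow> m \<le> n \<Longrightarrow> eigenvalue L m \<le> eigenvalue L n"
  unfolding eigenvalue_def using frequency_pos[of L m]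
  by (intro power_mono) (auto simp: frequency_def field_simps)

lemma inj_eigenvalue: "0 < L \<Longrightarrow> inj (eigenvalue L)"
proof (rule injI)
  fix m n assume L: "0 < L" and "eigenvalue L m = eigenvalue L n"
  then have "frequency L m = frequency L n"
    using frequency_pos[OF L, of m] frequency_pos[OF L, of n]
    unfolding eigenvalue_def by (meson less_imp_le power2_eq_imp_eq)
  then show "m = n" using L by (simp add: frequency_def)
qed

lemma sine_class_eigenvector:
  assumes "0 < L"
  shows "sine_class L n \<in> dom_A L" "op_A L (sine_class L n) = eigenvalue L n *\<^sub>R sine_class L n"
proof -
  have 1: "weak_derivative L (sine_class L n) = frequency L n *\<^sub>R cosine_class L n"
    by (rule weak_derivative_eq[OF has_weak_derivative_sine(1)[OF assms]])
  have c: "cosine_class L n \<in> H1 L"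
    using has_weak_derivative_sine(2)[OF assms] by (auto simp: H1_def)
  have 2: "weak_derivative L (cosine_class L n) = - frequency L n *\<^sub>R sine_class L n"
    by (rule weak_derivative_eq[OF has_weak_derivative_sine(2)[OF assms]])
  show "sine_class L n \<in> dom_A L"
    using sine_class_in_H10[OF assms, of n] weak_derivative_scaleR(1)[OF c]
    by (auto simp: dom_A_def H2_def 1 H10_def)
  show "op_A L (sine_class L n) = eigenvalue L n *\<^sub>R sine_class L n"
    by (simp add: op_A_def 1 weak_derivative_scaleR[OF c] 2 eigenvalue_def power2_eq_square)
qed

lemma op_A_form:
  assumes "0 < L" "u \<in> dom_A L" "v \<in> H10 L"
  shows "cinner_l2 (op_A L u) v = cinner_l2 (weak_derivative L u) (weak_derivative L v)"
  using integration_by_parts_H10[OF assms(1) _ assms(3), of "weak_derivative L u"] assms(2)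
  by (simp add: dom_A_def H2_def op_A_def cinner_l2_minus_left)

lemma op_A_symmetric:
  assumes "0 < L" "u \<in> dom_A L" "v \<in> dom_A L"
  shows "cinner_l2 (op_A L u) v = cinner_l2 u (op_A L v)"
proof -
  have "cinner_l2 (op_A L u) v = cinner_l2 (weak_derivative L u) (weak_derivative L v)"
    using op_A_form[OF assms(1,2)] assms(3) by (simp add: dom_A_def)
  also have "\<dots> = cnj (cinner_l2 (op_A L v) u)"
    using op_A_form[OF assms(1,3), of u] assms(2) cinner_l2_commute[of "weak_derivative L u"]
    by (simp add: dom_A_def)
  also have "\<dots> = cinner_l2 u (op_A L v)" by (rule cinner_l2_commute[symmetric])
  finally show ?thesis .
qed

lemma eigenvectors_orthogonal:
  assumes "0 < L" "u \<in> dom_A L" "op_A L u = l *\<^sub>R u" "v \<in> dom_A L" "op_A L v = m *\<^sub>R v" "l \<noteq> m"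
  shows "cinner_l2 u v = 0"
  using op_A_symmetric[OF assms(1,2,4)] assms(3,5,6)
  by (simp add: cinner_l2_scaleR_left cinner_l2_scaleR_right)

text \<open>
  If the class of a sine vanished, so would its derivative, a multiple of the class of the cosine. But the
  squared norms of the two add up to \<open>L\<close>.
\<close>

lemma sine_class_nonzero:
  assumes L: "0 < L"
  shows "sine_class L n \<noteq> 0"
proof
  assume s: "sine_class L n = 0"
  have "has_weak_derivative L 0 (0 :: l2)"
    using has_weak_derivative_scaleR[OF has_weak_derivative_sine(1)[OF L], of 0] by simp
  with has_weak_derivative_sine(1)[OF L, of n] s
  have "frequency L n *\<^sub>R cosine_class L n = 0" using has_weak_derivative_unique by metis
  then have c: "cosine_class L n = 0" using frequency_pos[OF L, of n] by simp
  let ?i = "\<lambda>f x. indicator {0<..<L} x *\<^sub>R complex_of_real (f (frequency L n * x))"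
  have int: "integrable lborel (\<lambda>x. (cmod (?i sin x))\<^sup>2)" "integrable lborel (\<lambda>x. (cmod (?i cos x))\<^sup>2)"
    using square_integrable_trig by (auto simp: square_integrable_def)
  have "(\<lambda>x. (cmod (?i sin x))\<^sup>2 + (cmod (?i cos x))\<^sup>2) = indicator {0<..<L}"
    by (auto split: split_indicator)
  then have "(LINT x|lborel. (cmod (?i sin x))\<^sup>2) + (LINT x|lborel. (cmod (?i cos x))\<^sup>2)
      = (LINT x|lborel. indicator {0<..<L} x)"
    using Bochner_Integration.integral_add[OF int] by (simp only:)
  also have "\<dots> = L" using L by simp
  finally have "(norm (sine_class L n))\<^sup>2 + (norm (cosine_class L n))\<^sup>2 = L"
    unfolding sine_class_def cosine_class_def interval_class_def
    by (simp add: norm_abs_l2 square_integrable_trig)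
  then show False using s c L by simp
qed

text \<open>
  By the addition theorem, a function \<open>f\<close> that is orthogonal to all sines is orthogonal to
  \<open>sin (\<omega> x) P(cos (\<omega> x))\<close> for every polynomial \<open>P\<close>, and by the theorem of Weierstrass to
  \<open>sin (\<omega> x) G(cos (\<omega> x))\<close> for every continuous \<open>G\<close>. The cosine is injective on \<open>(0, \<pi>)\<close>, so every test
  function has the form \<open>G(cos (\<omega> x))\<close>, and the fundamental lemma applies to \<open>f sin (\<omega> x)\<close>.
\<close>

lemma sine_class_complete:
  assumes L: "0 < L" and u: "u \<in> L2 L" and orth: "\<And>n. cinner_l2 u (sine_class L n) = 0"
  shows "u = 0"
proof -
  obtain f where f: "square_integrable f" "u = abs_l2 f" by (rule l2_representative)
  define \<omega> where "\<omega> = pi / L"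
  define g where "g x = f x * indicator {0<..<L} x" for x
  have ii: "integrable lborel (\<lambda>x. f x * cnj (indicator {0<..<L} x *\<^sub>R h x))"
    if "continuous_on UNIV h" for h
    by (rule square_integrable_product[OF f(1) square_integrable_interval_continuous[OF that]])
  define I where "I h = (LINT x|lborel. g x * complex_of_real (h x))" for h
  have gh: "integrable lborel (\<lambda>x. g x * complex_of_real (h x))"
    if "continuous_on UNIV h" for h :: "real \<Rightarrow> real"
  proof -
    have "(\<lambda>x. f x * cnj (indicator {0<..<L} x *\<^sub>R complex_of_real (h x)))
        = (\<lambda>x. g x * complex_of_real (h x))"
      by (auto simp: g_def split: split_indicator)
    then show ?thesis using ii[of "\<lambda>x. complex_of_real (h x)"] that by (simp add: continuous_on_of_real)
  qed
  have gi: "integrable lborel g" using gh[of "\<lambda>_. 1"] by simp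
  have base: "I (\<lambda>x. sin (real m * (\<omega> * x))) = 0" for m
  proof (cases m)
    case (Suc n)
    have "(\<lambda>x. f x * cnj (indicator {0<..<L} x *\<^sub>R complex_of_real (sin (frequency L n * x))))
        = (\<lambda>x. g x * complex_of_real (sin (real m * (\<omega> * x))))"
      by (auto simp: g_def Suc frequency_def \<omega>_def mult_ac split: split_indicator)
    moreover have "(LINT x|lborel. f x * cnj (indicator {0<..<L} x *\<^sub>R complex_of_real (sin (frequency L n * x)))) = 0"
      using orth[of n] by (simp add: f sine_class_def interval_class_def cinner_abs_l2 square_integrable_trig)
    ultimately show ?thesis by (simp add: I_def)
  qed (simp add: I_def)
  have pow: "I (\<lambda>x. sin (real m * (\<omega> * x)) * cos (\<omega> * x) ^ k) = 0" for m k
  proof (induction k arbitrary: m)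
    case 0
    then show ?case using base[of m] by simp
  next
    case (Suc k)
    show ?case
    proof (cases m)
      case 0
      then show ?thesis by (simp add: I_def)
    next
      case m: (Suc m')
      have tr: "sin (real m * (\<omega> * x)) * cos (\<omega> * x) ^ Suc k
          = (sin (real (m + 1) * (\<omega> * x)) * cos (\<omega> * x) ^ k + sin (real m' * (\<omega> * x)) * cos (\<omega> * x) ^ k) / 2"
        for x
      proof -
        have e: "real (m + 1) * (\<omega> * x) = real m * (\<omega> * x) + \<omega> * x"
          "real m' * (\<omega> * x) = real m * (\<omega> * x) - \<omega> * x"
          by (auto simp: m algebra_simps)
        show ?thesis
          unfolding e sin_add sin_diff by (simp add: algebra_simps)
      qed
      have i: "integrable lborel (\<lambda>x. g x * complex_of_real (sin (real j * (\<omega> * x)) * cos (\<omega> * x) ^ k))" for j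
        by (intro gh continuous_intros)
      have "I (\<lambda>x. sin (real m * (\<omega> * x)) * cos (\<omega> * x) ^ Suc k)
          = (LINT x|lborel. (g x * complex_of_real (sin (real (m + 1) * (\<omega> * x)) * cos (\<omega> * x) ^ k)
            + g x * complex_of_real (sin (real m' * (\<omega> * x)) * cos (\<omega> * x) ^ k)) / 2)"
        unfolding I_def tr by (simp add: distrib_left)
      also have "\<dots> = (I (\<lambda>x. sin (real (m + 1) * (\<omega> * x)) * cos (\<omega> * x) ^ k)
            + I (\<lambda>x. sin (real m' * (\<omega> * x)) * cos (\<omega> * x) ^ k)) / 2"
        unfolding I_def using i by (simp only: integral_divide_zero Bochner_Integration.integral_add)
      also have "\<dots> = 0" by (simp only: Suc) simp
      finally show ?thesis .
    qed
  qed
  have poly: "I (\<lambda>x. sin (\<omega> * x) * P (cos (\<omega> * x))) = 0" if rp: "real_polynomial_function P" for P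
  proof -
    obtain a n where P: "P = (\<lambda>x. \<Sum>i\<le>n. a i * x ^ i)"
      using rp unfolding real_polynomial_function_iff_sum by (elim exE)
    have i: "integrable lborel (\<lambda>x. g x * complex_of_real (sin (\<omega> * x) * cos (\<omega> * x) ^ j))" for j
      by (intro gh continuous_intros)
    have "I (\<lambda>x. sin (\<omega> * x) * P (cos (\<omega> * x)))
        = (LINT x|lborel. (\<Sum>j\<le>n. complex_of_real (a j) * (g x * complex_of_real (sin (\<omega> * x) * cos (\<omega> * x) ^ j))))"
      unfolding I_def P by (simp add: sum_distrib_left mult_ac)
    also have "\<dots> = (\<Sum>j\<le>n. LINT x|lborel. complex_of_real (a j) * (g x * complex_of_real (sin (\<omega> * x) * cos (\<omega> * x) ^ j)))"
      by (intro Bochner_Integration.integral_sum integrable_mult_right i)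
    also have "\<dots> = (\<Sum>j\<le>n. complex_of_real (a j) * I (\<lambda>x. sin (\<omega> * x) * cos (\<omega> * x) ^ j))"
      unfolding I_def by (simp only: integral_mult_right_zero)
    also have "\<dots> = 0" using pow[of 1] by simp
    finally show ?thesis .
  qed
  have cont: "I (\<lambda>x. sin (\<omega> * x) * G (cos (\<omega> * x))) = 0"
    if G: "continuous_on {-1..1} G" for G :: "real \<Rightarrow> real"
  proof -
    have gh': "integrable lborel (\<lambda>x. g x * complex_of_real (sin (\<omega> * x) * H (cos (\<omega> * x))))"
      if "continuous_on {-1..1} H" for H :: "real \<Rightarrow> real"
      by (intro gh continuous_intros continuous_on_compose2[OF that]) auto
    have le: "cmod (I (\<lambda>x. sin (\<omega> * x) * G (cos (\<omega> * x)))) \<le> e * (LINT x|lborel. cmod (g x))"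
      if e: "e > 0" for e
    proof -
      obtain P where P: "polynomial_function P" "\<And>y. y \<in> {-1..1} \<Longrightarrow> norm (G y - P y) < e"
        using Stone_Weierstrass_polynomial_function[OF _ G e] by auto
      have rp: "real_polynomial_function P" using P(1) real_polynomial_function_eq by blast
      have cP: "continuous_on {-1..1} P"
        using P(1) continuous_on_polymonial_function by blast
      have "I (\<lambda>x. sin (\<omega> * x) * G (cos (\<omega> * x)))
          = (LINT x|lborel. g x * complex_of_real (sin (\<omega> * x) * (G (cos (\<omega> * x)) - P (cos (\<omega> * x)))))"
        using Bochner_Integration.integral_diff[OF gh'[OF G] gh'[OF cP]] poly[OF rp]
        unfolding I_def by (simp add: right_diff_distrib)
      also have "cmod \<dots> \<le> (LINT x|lborel. cmod (g x * complex_of_real (sin (\<omega> * x) * (G (cos (\<omega> * x)) - P (cos (\<omega> * x))))))"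
        by (rule integral_norm_bound)
      also have "\<dots> \<le> (LINT x|lborel. e * cmod (g x))"
      proof (rule Bochner_Integration.integral_mono)
        show "integrable lborel (\<lambda>x. cmod (g x * complex_of_real (sin (\<omega> * x) * (G (cos (\<omega> * x)) - P (cos (\<omega> * x))))))"
          using gh'[of "\<lambda>y. G y - P y"] G cP
          by (intro Bochner_Integration.integrable_norm) (simp add: continuous_on_diff)
        fix x
        have "\<bar>sin (\<omega> * x)\<bar> * \<bar>G (cos (\<omega> * x)) - P (cos (\<omega> * x))\<bar> \<le> 1 * e"
          using P(2)[of "cos (\<omega> * x)"] e by (intro mult_mono) auto
        then have "cmod (g x) * (\<bar>sin (\<omega> * x)\<bar> * \<bar>G (cos (\<omega> * x)) - P (cos (\<omega> * x))\<bar>) \<le> cmod (g x) * e"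
          by (intro mult_left_mono) auto
        then show "cmod (g x * complex_of_real (sin (\<omega> * x) * (G (cos (\<omega> * x)) - P (cos (\<omega> * x))))) \<le> e * cmod (g x)"
          by (simp only: norm_mult norm_of_real abs_mult mult.commute[of e])
      qed (use gi in auto)
      finally show ?thesis by simp
    qed
    let ?c = "cmod (I (\<lambda>x. sin (\<omega> * x) * G (cos (\<omega> * x))))" and ?m = "LINT x|lborel. cmod (g x)"
    have m: "?m \<ge> 0" by simp
    have "?c \<le> 0"
    proof (rule field_le_epsilon)
      fix e :: real assume "e > 0"
      have m1: "?m + 1 > 0" using m by linarith
      have "?c \<le> (e / (?m + 1)) * ?m" by (rule le[OF divide_pos_pos[OF \<open>e > 0\<close> m1]])
      also have "\<dots> = e * (?m / (?m + 1))" by simp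
      also have "?m / (?m + 1) \<le> 1" by (subst divide_le_eq_1_pos[OF m1]) simp
      then have "e * (?m / (?m + 1)) \<le> e * 1" using \<open>e > 0\<close> by (intro mult_left_mono) simp_all
      finally show "?c \<le> 0 + e" by simp
    qed
    then show ?thesis by simp
  qed
  have "AE x in lborel. x \<in> {0<..<L} \<longrightarrow> g x * complex_of_real (sin (\<omega> * x)) = 0"
  proof (rule fundamental_lemma)
    have "integrable lborel (\<lambda>x. g x * complex_of_real (sin (\<omega> * x)))"
      by (intro gh continuous_intros)
    then show "set_integrable lborel {0<..<L} (\<lambda>x. g x * complex_of_real (sin (\<omega> * x)))"
      unfolding set_integrable_def by (rule integrable_mult_indicator[rotated]) simp
    fix \<psi> assume t: "test_function L (\<lambda>x. complex_of_real (\<psi> x))"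
    then have "continuous_on UNIV (\<lambda>x. Re (complex_of_real (\<psi> x)))"
      by (intro continuous_on_Re smooth_continuous) (simp add: test_function_def)
    then have c\<psi>: "continuous_on UNIV \<psi>" by simp
    define G where "G y = \<psi> (L / pi * arccos y)" for y
    have "continuous_on {-1..1} G"
      unfolding G_def
      by (rule continuous_on_compose2[OF c\<psi>]) (intro continuous_intros continuous_on_arccos', auto)
    then have 0: "I (\<lambda>x. sin (\<omega> * x) * G (cos (\<omega> * x))) = 0" by (rule cont)
    have "indicator {0<..<L} x *\<^sub>R (g x * complex_of_real (sin (\<omega> * x)) * complex_of_real (\<psi> x))
        = g x * complex_of_real (sin (\<omega> * x) * G (cos (\<omega> * x)))" for x
    proof (cases "x \<in> {0<..<L}")
      case True
      then have "0 \<le> \<omega> * x" "\<omega> * x \<le> pi" using L by (auto simp: \<omega>_def field_simps)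
      then have "G (cos (\<omega> * x)) = \<psi> x" using L by (simp add: G_def arccos_cos \<omega>_def)
      then show ?thesis using True by simp
    qed (simp add: g_def)
    then show "(LINT x:{0<..<L}|lborel. g x * complex_of_real (sin (\<omega> * x)) * complex_of_real (\<psi> x)) = 0"
      using 0 by (simp add: set_lebesgue_integral_def I_def)
  qed
  moreover have "AE x in lborel. x \<notin> {0<..<L} \<longrightarrow> f x = 0"
    using u f by (simp add: abs_l2_in_L2_iff)
  ultimately have "AE x in lborel. f x = 0"
  proof eventually_elim
    case (elim x)
    show ?case
    proof (cases "x \<in> {0<..<L}")
      case True
      then have "0 < \<omega> * x" "\<omega> * x < pi" using L by (auto simp: \<omega>_def field_simps)
      then have "sin (\<omega> * x) \<noteq> 0" using sin_gt_zero by force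
      then show ?thesis using elim True by (simp add: g_def)
    qed (use elim in simp)
  qed
  then show "u = 0"
    by (simp add: f zero_l2_def abs_l2_eq_iff square_integrable_zero)
qed

section \<open>Fourier expansion\<close>

lemma norm_sum_orthogonal:
  fixes x :: "'i \<Rightarrow> 'a :: real_inner"
  assumes "finite F" "\<And>i j. i \<in> F \<Longrightarrow> j \<in> F \<Longrightarrow> i \<noteq> j \<Longrightarrow> inner (x i) (x j) = 0"
  shows "(norm (sum x F))\<^sup>2 = (\<Sum>i\<in>F. (norm (x i))\<^sup>2)"
  using assms
proof (induction F rule: finite_induct)
  case (insert a F)
  have "inner (x a) (sum x F) = 0"
    using insert.hyps insert.prems by (auto simp: inner_sum_right intro!: sum.neutral)
  then show ?case
    using insert by (simp add: power2_norm_eq_inner inner_add_left inner_add_right inner_commute)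
qed simp

text \<open>The tails of an orthogonal series are controlled by the tails of the series of squares.\<close>

lemma orthogonal_summable_on:
  fixes x :: "'i \<Rightarrow> 'a :: {real_inner, complete_space}"
  assumes orth: "\<And>i j. i \<in> A \<Longrightarrow> j \<in> A \<Longrightarrow> i \<noteq> j \<Longrightarrow> inner (x i) (x j) = 0"
    and sq: "(\<lambda>i. (norm (x i))\<^sup>2) summable_on A"
  shows "x summable_on A"
proof -
  let ?f = "\<lambda>i. (norm (x i))\<^sup>2"
  have "\<exists>P. eventually P (finite_subsets_at_top A) \<and>
      (\<forall>F F'. P F \<and> P F' \<longrightarrow> dist (sum x F) (sum x F') < e)" if e: "e > 0" for e
  proof -
    have "(sum ?f \<longlongrightarrow> infsum ?f A) (finite_subsets_at_top A)"
      using sq has_sum_def has_sum_infsum by blast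
    then have "\<forall>\<^sub>F F in finite_subsets_at_top A. dist (sum ?f F) (infsum ?f A) < (e / 4)\<^sup>2"
      by (rule tendstoD) (use e in simp)
    then obtain X where X: "finite X" "X \<subseteq> A"
      and dX': "\<forall>F. finite F \<and> X \<subseteq> F \<and> F \<subseteq> A \<longrightarrow> dist (sum ?f F) (infsum ?f A) < (e / 4)\<^sup>2"
      unfolding eventually_finite_subsets_at_top by (elim exE conjE)
    have dX: "dist (sum ?f F) (infsum ?f A) < (e / 4)\<^sup>2" if "finite F" "X \<subseteq> F" "F \<subseteq> A" for F
      using dX' that by simp
    have close: "norm (sum x F - sum x X) < e / 2" if F: "finite F" "X \<subseteq> F" "F \<subseteq> A" for F
    proof -
      have "sum x F - sum x X = sum x (F - X)"
        using F X by (simp add: sum_diff)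
      moreover have "(norm (sum x (F - X)))\<^sup>2 = sum ?f (F - X)"
        using F by (intro norm_sum_orthogonal orth) auto
      moreover have "sum ?f (F - X) = sum ?f F - sum ?f X"
        using F X by (simp add: sum_diff)
      moreover have "sum ?f F - sum ?f X < (e / 2)\<^sup>2"
      proof -
        have "(e / 2)\<^sup>2 = 4 * (e / 4)\<^sup>2" by (simp add: power2_eq_square)
        then show ?thesis
          using dX[OF F] dX[OF X(1) order_refl X(2)] zero_le_power2[of "e / 4"]
          unfolding dist_real_def by linarith
      qed
      ultimately show ?thesis
        using e by (intro power2_less_imp_less[of _ "e / 2"]) auto
    qed
    show ?thesis
    proof (intro exI[of _ "\<lambda>F. finite F \<and> X \<subseteq> F \<and> F \<subseteq> A"] conjI allI impI; (elim conjE)?)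
      show "\<forall>\<^sub>F F in finite_subsets_at_top A. finite F \<and> X \<subseteq> F \<and> F \<subseteq> A"
        using X unfolding eventually_finite_subsets_at_top by blast
      fix F F' assume "finite F" "X \<subseteq> F" "F \<subseteq> A" "finite F'" "X \<subseteq> F'" "F' \<subseteq> A"
      then have "norm (sum x F - sum x X) < e / 2" "norm (sum x F' - sum x X) < e / 2"
        using close by blast+
      then show "dist (sum x F) (sum x F') < e"
        using norm_triangle_ineq4[of "sum x F - sum x X" "sum x F' - sum x X"]
        by (simp add: dist_norm)
    qed
  qed
  then have "cauchy_filter (filtermap (sum x) (finite_subsets_at_top A))"
    by (simp add: cauchy_filter_metric_filtermap)
  moreover have "complete (UNIV :: 'a set)"
    by (meson Cauchy_convergent UNIV_I complete_def convergent_def)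
  ultimately obtain l where "(sum x \<longlongrightarrow> l) (finite_subsets_at_top A)"
    using complete_uniform[where S = UNIV] by (force simp add: filterlim_def)
  then show ?thesis
    using summable_on_def has_sum_def by blast
qed

lemma H10_scaleC:
  assumes "0 < L" "u \<in> H10 L"
  shows "c *\<^sub>C u \<in> H10 L"
proof -
  obtain \<phi> where \<phi>: "\<And>n. test_function L (\<phi> n)" "(\<lambda>n. abs_l2 (\<phi> n)) \<longlonglongrightarrow> u"
    "(\<lambda>n. weak_derivative L (abs_l2 (\<phi> n))) \<longlonglongrightarrow> weak_derivative L u" and u: "u \<in> H1 L"
    using assms(2) by (auto simp: H10_def)
  have h: "abs_l2 (\<phi> n) \<in> H1 L" for n
    using has_weak_derivative_test_function[OF assms(1) \<phi>(1)] by (auto simp: H1_def)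
  have t: "test_function L (\<lambda>x. c * \<phi> n x)" for n
    using test_function_mult[OF \<phi>(1) smooth_const[of c], of n] by (simp add: mult.commute)
  have eq: "abs_l2 (\<lambda>x. c * \<phi> n x) = c *\<^sub>C abs_l2 (\<phi> n)" for n
    using square_integrable_test_function[OF \<phi>(1)] by (simp add: abs_l2_scaleC)
  show ?thesis
    unfolding H10_def
  proof (intro CollectI conjI exI[of _ "\<lambda>n x. c * \<phi> n x"] allI t weak_derivative_scaleC u)
    show "(\<lambda>n. abs_l2 (\<lambda>x. c * \<phi> n x)) \<longlonglongrightarrow> c *\<^sub>C u"
      unfolding eq by (rule bounded_linear.tendsto[OF bounded_linear_scaleC \<phi>(2)])
    show "(\<lambda>n. weak_derivative L (abs_l2 (\<lambda>x. c * \<phi> n x))) \<longlonglongrightarrow> weak_derivative L (c *\<^sub>C u)"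
      unfolding eq weak_derivative_scaleC(2)[OF h] weak_derivative_scaleC(2)[OF u]
      by (rule bounded_linear.tendsto[OF bounded_linear_scaleC \<phi>(3)])
  qed
qed

lemma dom_A_scaleC:
  assumes "0 < L" "u \<in> dom_A L"
  shows "c *\<^sub>C u \<in> dom_A L" "op_A L (c *\<^sub>C u) = c *\<^sub>C op_A L u"
  using assms H10_scaleC[OF assms(1), of u c]
  by (auto simp: dom_A_def H2_def op_A_def weak_derivative_scaleC scaleC_minus_right)

lemma dom_A_in_L2: "u \<in> dom_A L \<Longrightarrow> u \<in> L2 L"
  by (simp add: dom_A_def H10_def H1_in_L2)

definition basis :: "real \<Rightarrow> nat \<Rightarrow> l2"
  where "basis L n = sine_class L n /\<^sub>R norm (sine_class L n)"

definition fourier :: "real \<Rightarrow> nat \<Rightarrow> l2 \<Rightarrow> complex"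
  where "fourier L n u = cinner_l2 u (basis L n)"

lemma fourier_linear:
  "fourier L n (u + v) = fourier L n u + fourier L n v"
  "fourier L n (u - v) = fourier L n u - fourier L n v"
  "fourier L n (- u) = - fourier L n u"
  "fourier L n (c *\<^sub>C u) = c * fourier L n u"
  "fourier L n (r *\<^sub>R u) = complex_of_real r * fourier L n u"
  "fourier L n 0 = 0"
  by (simp_all add: fourier_def cinner_l2_add_left cinner_l2_diff_left cinner_l2_minus_left
      cinner_l2_scaleC_left cinner_l2_scaleR_left)

text \<open>
  The condition that singles out the domain of \<open>A\<^sup>\<nu>\<close> within \<open>L\<^sup>2(0,L)\<close>.
\<close>

definition pow_summable :: "real \<Rightarrow> real \<Rightarrow> l2 \<Rightarrow> bool"
  where "pow_summable L \<nu> u \<longleftrightarrow> (\<lambda>n. (eigenvalue L n powr \<nu> * cmod (fourier L n u))\<^sup>2) summable_on UNIV"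

context
  fixes L :: real
  assumes L: "0 < L"
begin

lemma basis_eigenvector:
  "basis L n \<in> dom_A L" "op_A L (basis L n) = eigenvalue L n *\<^sub>R basis L n"
  unfolding basis_def scaleR_scaleC
  using dom_A_scaleC[OF L sine_class_eigenvector(1)[OF L]] sine_class_eigenvector(2)[OF L]
  by (simp_all add: scaleR_scaleC scaleC_scaleC mult.commute)

lemma basis_in_L2: "basis L n \<in> L2 L"
  by (rule dom_A_in_L2[OF basis_eigenvector(1)])

lemma norm_basis: "norm (basis L n) = 1"
  using sine_class_nonzero[OF L] by (simp add: basis_def)

lemma basis_orthonormal: "cinner_l2 (basis L m) (basis L n) = (if m = n then 1 else 0)"
proof (cases "m = n")
  case False
  then have "eigenvalue L m \<noteq> eigenvalue L n" using inj_eigenvalue[OF L] by (auto dest: injD)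
  then show ?thesis
    using eigenvectors_orthogonal[OF L basis_eigenvector[of m] basis_eigenvector[of n]] False by simp
qed (simp add: cinner_l2_self_norm norm_basis)

lemma basis_complete:
  assumes "u \<in> L2 L" "\<And>n. fourier L n u = 0"
  shows "u = 0"
proof (rule sine_class_complete[OF L assms(1)])
  fix n
  show "cinner_l2 u (sine_class L n) = 0"
    using assms(2)[of n] sine_class_nonzero[OF L]
    by (simp add: fourier_def basis_def cinner_l2_scaleR_right)
qed

lemma fourier_eqI:
  assumes "u \<in> L2 L" "v \<in> L2 L" "\<And>n. fourier L n u = fourier L n v"
  shows "u = v"
  using basis_complete[of "u - v"] assms by (simp add: L2_diff fourier_linear)

lemma fourier_basis: "fourier L m (c *\<^sub>C basis L n) = (if m = n then c else 0)"
  by (simp add: fourier_def cinner_l2_scaleC_left basis_orthonormal)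

lemma basis_multiples_orthogonal:
  "m \<noteq> n \<Longrightarrow> inner (a *\<^sub>C basis L m) (c *\<^sub>C basis L n) = 0"
  by (simp add: inner_l2_def cinner_l2_scaleC_left cinner_l2_scaleC_right basis_orthonormal)

lemma norm_basis_multiple: "norm (c *\<^sub>C basis L n) = cmod c"
  by (simp add: norm_scaleC norm_basis)

lemma bessel: "(\<lambda>n. (cmod (fourier L n u))\<^sup>2) summable_on UNIV"
proof (rule nonneg_bounded_partial_sums_imp_summable_on[where C = "(norm u)\<^sup>2"])
  show "\<forall>\<^sub>F F in finite_subsets_at_top UNIV. (\<Sum>n\<in>F. (cmod (fourier L n u))\<^sup>2) \<le> (norm u)\<^sup>2"
  proof (rule eventually_finite_subsets_at_top_weakI)
    fix F :: "nat set" assume F: "finite F"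
    define p where "p = (\<Sum>n\<in>F. fourier L n u *\<^sub>C basis L n)"
    have "(norm p)\<^sup>2 = (\<Sum>n\<in>F. (cmod (fourier L n u))\<^sup>2)"
      unfolding p_def using F
      by (subst norm_sum_orthogonal) (auto simp: basis_multiples_orthogonal norm_basis_multiple)
    moreover have "inner u p = (\<Sum>n\<in>F. (cmod (fourier L n u))\<^sup>2)"
      unfolding p_def inner_sum_right
    proof (rule sum.cong)
      fix n
      have "cinner_l2 u (fourier L n u *\<^sub>C basis L n) = complex_of_real ((cmod (fourier L n u))\<^sup>2)"
        by (simp only: cinner_l2_scaleC_right complex_norm_square fourier_def mult.commute)
      then show "inner u (fourier L n u *\<^sub>C basis L n) = (cmod (fourier L n u))\<^sup>2"
        by (simp add: inner_l2_def)
    qed simp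
    moreover have "0 \<le> inner (u - p) (u - p)" by simp
    then have "0 \<le> (norm u)\<^sup>2 - 2 * inner u p + (norm p)\<^sup>2"
      by (simp add: power2_norm_eq_inner inner_diff_left inner_diff_right inner_commute)
    ultimately show "(\<Sum>n\<in>F. (cmod (fourier L n u))\<^sup>2) \<le> (norm u)\<^sup>2" by linarith
  qed
qed simp

lemma fourier_series_summable:
  assumes "(\<lambda>n. (cmod (c n))\<^sup>2) summable_on UNIV"
  shows "(\<lambda>n. c n *\<^sub>C basis L n) summable_on UNIV"
  using assms
  by - (rule orthogonal_summable_on, simp_all add: basis_multiples_orthogonal norm_basis_multiple)

lemma has_sum_in_L2:
  assumes "(f has_sum s) A" "\<And>n. n \<in> A \<Longrightarrow> f n \<in> L2 L"
  shows "s \<in> L2 L"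
proof (rule Lim_in_closed_set[OF L2_closed])
  show "(sum f \<longlongrightarrow> s) (finite_subsets_at_top A)" using assms(1) by (simp add: has_sum_def)
  show "\<forall>\<^sub>F F in finite_subsets_at_top A. sum f F \<in> L2 L"
  proof (rule eventually_finite_subsets_at_top_weakI)
    fix F assume "finite F" "F \<subseteq> A"
    then show "sum f F \<in> L2 L"
      by (induction F rule: finite_induct) (auto simp: L2_zero L2_add assms(2))
  qed
qed simp

lemma fourier_series:
  assumes "(\<lambda>n. (cmod (c n))\<^sup>2) summable_on UNIV"
  shows "(\<Sum>\<^sub>\<infinity>n. c n *\<^sub>C basis L n) \<in> L2 L" "fourier L m (\<Sum>\<^sub>\<infinity>n. c n *\<^sub>C basis L n) = c m"
proof -
  have hs: "((\<lambda>n. c n *\<^sub>C basis L n) has_sum (\<Sum>\<^sub>\<infinity>n. c n *\<^sub>C basis L n)) UNIV"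
    by (rule has_sum_infsum[OF fourier_series_summable[OF assms]])
  then show "(\<Sum>\<^sub>\<infinity>n. c n *\<^sub>C basis L n) \<in> L2 L"
    by (rule has_sum_in_L2) (simp add: L2_scaleC basis_in_L2)
  have "bounded_linear (fourier L m)"
    unfolding fourier_def by (rule bounded_bilinear.bounded_linear_left[OF bounded_bilinear_cinner_l2])
  from has_sum_bounded_linear[OF this hs]
  have "fourier L m (\<Sum>\<^sub>\<infinity>n. c n *\<^sub>C basis L n) = (\<Sum>\<^sub>\<infinity>n. fourier L m (c n *\<^sub>C basis L n))"
    by (simp add: infsumI o_def)
  also have "\<dots> = (\<Sum>\<^sub>\<infinity>n. if m = n then c n else 0)" by (simp only: fourier_basis)
  also have "\<dots> = infsum c {m}" by (rule infsum_cong_neutral) auto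
  also have "\<dots> = c m" by simp
  finally show "fourier L m (\<Sum>\<^sub>\<infinity>n. c n *\<^sub>C basis L n) = c m" .
qed

lemma fourier_expansion:
  assumes "u \<in> L2 L"
  shows "((\<lambda>n. fourier L n u *\<^sub>C basis L n) has_sum u) UNIV"
proof -
  have "(\<Sum>\<^sub>\<infinity>n. fourier L n u *\<^sub>C basis L n) = u"
    by (rule fourier_eqI) (use fourier_series[OF bessel] assms in auto)
  then show ?thesis
    using has_sum_infsum[OF fourier_series_summable[OF bessel[of u]]] by simp
qed

lemma parseval:
  assumes "v \<in> L2 L"
  shows "((\<lambda>n. fourier L n u * cnj (fourier L n v)) has_sum cinner_l2 u v) UNIV"
proof -
  have "bounded_linear (cinner_l2 u)"
    by (rule bounded_bilinear.bounded_linear_right[OF bounded_bilinear_cinner_l2])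
  from has_sum_bounded_linear[OF this fourier_expansion[OF assms]]
  show ?thesis
    by (simp add: o_def cinner_l2_scaleC_right mult.commute flip: fourier_def)
qed

lemma parseval_norm:
  assumes "u \<in> L2 L"
  shows "((\<lambda>n. (cmod (fourier L n u))\<^sup>2) has_sum (norm u)\<^sup>2) UNIV"
proof -
  have "((\<lambda>n. complex_of_real ((cmod (fourier L n u))\<^sup>2)) has_sum complex_of_real ((norm u)\<^sup>2)) UNIV"
    using parseval[OF assms, of u] by (simp only: complex_norm_square cinner_l2_self_norm)
  from has_sum_bounded_linear[OF bounded_linear_Re this] show ?thesis by (simp add: o_def)
qed

section \<open>Fractional powers in Fourier coordinates\<close>

text \<open>
  An eigenvector is orthogonal to the basis vectors that belong to other eigenvalues, so that only one of
  its Fourier coefficients can be different from zero.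
\<close>

lemma eigenspace_eigenvalue: "eigenspace_A L (eigenvalue L n) = range (\<lambda>c. c *\<^sub>C basis L n)"
proof (intro equalityI subsetI)
  fix u assume "u \<in> eigenspace_A L (eigenvalue L n)"
  then have u: "u \<in> dom_A L" "op_A L u = eigenvalue L n *\<^sub>R u" by (auto simp: eigenspace_A_def)
  have "u = fourier L n u *\<^sub>C basis L n"
  proof (rule fourier_eqI)
    fix m
    have "fourier L m u = 0" if "m \<noteq> n"
      unfolding fourier_def using that inj_eigenvalue[OF L]
      by (intro eigenvectors_orthogonal[OF L u basis_eigenvector]) (auto dest: injD)
    then show "fourier L m u = fourier L m (fourier L n u *\<^sub>C basis L n)"
      by (cases "m = n") (auto simp: fourier_basis)
  qed (use u in \<open>auto simp: dom_A_in_L2 L2_scaleC basis_in_L2\<close>)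
  then show "u \<in> range (\<lambda>c. c *\<^sub>C basis L n)" by blast
next
  fix u assume "u \<in> range (\<lambda>c. c *\<^sub>C basis L n)"
  then show "u \<in> eigenspace_A L (eigenvalue L n)"
    by (auto simp: eigenspace_A_def dom_A_scaleC[OF L basis_eigenvector(1)] basis_eigenvector scaleC_scaleR)
qed

text \<open>An eigenvector for any other eigenvalue would be orthogonal to the whole basis.\<close>

lemma eigenvalues_A_eq: "eigenvalues_A L = range (eigenvalue L)"
proof (intro equalityI subsetI)
  fix l assume "l \<in> eigenvalues_A L"
  then obtain u where u: "u \<in> dom_A L" "op_A L u = l *\<^sub>R u" "u \<noteq> 0"
    by (auto simp: eigenvalues_A_def eigenspace_A_def)
  show "l \<in> range (eigenvalue L)"
  proof (rule ccontr)
    assume "l \<notin> range (eigenvalue L)"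
    then have "fourier L n u = 0" for n
      unfolding fourier_def by (intro eigenvectors_orthogonal[OF L u(1,2) basis_eigenvector]) auto
    then have "u = 0" using u by (intro basis_complete dom_A_in_L2)
    then show False using u by simp
  qed
next
  fix l assume "l \<in> range (eigenvalue L)"
  then obtain n where n: "l = eigenvalue L n" by blast
  have "basis L n \<noteq> 0" using norm_basis[of n] by auto
  moreover have "basis L n \<in> eigenspace_A L l"
    using basis_eigenvector by (simp add: n eigenspace_A_def)
  ultimately show "l \<in> eigenvalues_A L" by (auto simp: eigenvalues_A_def)
qed

lemma eigenprojection_eq: "eigenprojection_A L (eigenvalue L n) u = fourier L n u *\<^sub>C basis L n"
  unfolding eigenprojection_A_def eigenspace_eigenvalue
proof (rule the_equality)
  show "fourier L n u *\<^sub>C basis L n \<in> range (\<lambda>c. c *\<^sub>C basis L n) \<and>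
    (\<forall>v\<in>range (\<lambda>c. c *\<^sub>C basis L n). cinner_l2 (u - fourier L n u *\<^sub>C basis L n) v = 0)"
    by (auto simp: cinner_l2_diff_left cinner_l2_scaleC_left cinner_l2_scaleC_right
        basis_orthonormal fourier_def)
  fix p assume p: "p \<in> range (\<lambda>c. c *\<^sub>C basis L n) \<and>
    (\<forall>v\<in>range (\<lambda>c. c *\<^sub>C basis L n). cinner_l2 (u - p) v = 0)"
  then obtain c where c: "p = c *\<^sub>C basis L n" by blast
  have "cinner_l2 (u - p) (1 *\<^sub>C basis L n) = 0" using p by blast
  then have "c = fourier L n u"
    by (simp add: c cinner_l2_diff_left cinner_l2_scaleC_left basis_orthonormal fourier_def)
  then show "p = fourier L n u *\<^sub>C basis L n" by (simp add: c)
qed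

lemma dom_A_pow_iff: "u \<in> dom_A_pow L \<nu> \<longleftrightarrow> u \<in> L2 L \<and> pow_summable L \<nu> u"
  unfolding dom_A_pow_def pow_summable_def eigenvalues_A_eq
  by (subst summable_on_reindex[OF inj_eigenvalue[OF L]])
    (simp add: o_def eigenprojection_eq norm_basis_multiple)

lemma op_A_pow_eq:
  "op_A_pow L \<nu> u = (\<Sum>\<^sub>\<infinity>n. (complex_of_real (eigenvalue L n powr \<nu>) * fourier L n u) *\<^sub>C basis L n)"
  unfolding op_A_pow_def eigenvalues_A_eq
  by (subst infsum_reindex[OF inj_eigenvalue[OF L]])
    (simp add: o_def eigenprojection_eq scaleR_scaleC scaleC_scaleC)

lemma fourier_op_A_pow:
  assumes "pow_summable L \<nu> u"
  shows "op_A_pow L \<nu> u \<in> L2 L"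
    and "fourier L n (op_A_pow L \<nu> u) = complex_of_real (eigenvalue L n powr \<nu>) * fourier L n u"
proof -
  have "(\<lambda>n. (cmod (complex_of_real (eigenvalue L n powr \<nu>) * fourier L n u))\<^sup>2) summable_on UNIV"
    using assms by (simp add: pow_summable_def norm_mult)
  from fourier_series[OF this]
  show "op_A_pow L \<nu> u \<in> L2 L"
    "fourier L n (op_A_pow L \<nu> u) = complex_of_real (eigenvalue L n powr \<nu>) * fourier L n u"
    by (simp_all add: op_A_pow_eq)
qed

lemma pow_summable_add:
  assumes "pow_summable L \<nu> u" "pow_summable L \<nu> v"
  shows "pow_summable L \<nu> (u + v)"
  unfolding pow_summable_def
proof (rule summable_on_comparison_test)
  let ?a = "\<lambda>u n. eigenvalue L n powr \<nu> * cmod (fourier L n u)"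
  show "(\<lambda>n. 2 * (?a u n)\<^sup>2 + 2 * (?a v n)\<^sup>2) summable_on UNIV"
    using assms unfolding pow_summable_def by (intro summable_on_add summable_on_cmult_right)
  fix n
  have "?a (u + v) n \<le> ?a u n + ?a v n"
    using norm_triangle_ineq[of "fourier L n u" "fourier L n v"]
    by (simp add: fourier_linear mult_left_mono flip: distrib_left)
  then have "(?a (u + v) n)\<^sup>2 \<le> (?a u n + ?a v n)\<^sup>2" by (intro power_mono) auto
  also have "\<dots> \<le> 2 * (?a u n)\<^sup>2 + 2 * (?a v n)\<^sup>2"
    using zero_le_power2[of "?a u n - ?a v n"] by (simp add: power2_eq_square algebra_simps)
  finally show "(?a (u + v) n)\<^sup>2 \<le> 2 * (?a u n)\<^sup>2 + 2 * (?a v n)\<^sup>2" .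
qed simp

lemma pow_summable_scaleC:
  assumes "pow_summable L \<nu> u"
  shows "pow_summable L \<nu> (c *\<^sub>C u)"
proof -
  have "(\<lambda>n. (cmod c)\<^sup>2 * (eigenvalue L n powr \<nu> * cmod (fourier L n u))\<^sup>2) summable_on UNIV"
    using assms unfolding pow_summable_def by (rule summable_on_cmult_right)
  then show ?thesis
    by (simp add: pow_summable_def fourier_linear norm_mult power_mult_distrib mult_ac)
qed

lemma op_A_pow_add:
  assumes "pow_summable L \<nu> u" "pow_summable L \<nu> v"
  shows "op_A_pow L \<nu> (u + v) = op_A_pow L \<nu> u + op_A_pow L \<nu> v"
  using assms
  by (intro fourier_eqI)
    (simp_all add: fourier_op_A_pow pow_summable_add L2_add fourier_linear distrib_left)

lemma op_A_pow_scaleC: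
  assumes "pow_summable L \<nu> u"
  shows "op_A_pow L \<nu> (c *\<^sub>C u) = c *\<^sub>C op_A_pow L \<nu> u"
  using assms
  by (intro fourier_eqI)
    (simp_all add: fourier_op_A_pow pow_summable_scaleC L2_scaleC fourier_linear)

lemma norm_op_A_pow:
  assumes "pow_summable L \<nu> u"
  shows "((\<lambda>n. (eigenvalue L n powr \<nu> * cmod (fourier L n u))\<^sup>2) has_sum (norm (op_A_pow L \<nu> u))\<^sup>2) UNIV"
  using parseval_norm[OF fourier_op_A_pow(1)[OF assms]]
  by (simp add: fourier_op_A_pow(2)[OF assms] norm_mult)

lemma eigenvalue_powr_bound:
  assumes "r \<le> s"
  shows "eigenvalue L n powr r \<le> eigenvalue L 0 powr (r - s) * eigenvalue L n powr s"
proof -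
  have "eigenvalue L n powr (r - s) \<le> eigenvalue L 0 powr (r - s)"
    using assms eigenvalue_pos[OF L] eigenvalue_mono[OF L] by (intro powr_mono2') auto
  then have "eigenvalue L n powr (r - s) * eigenvalue L n powr s
      \<le> eigenvalue L 0 powr (r - s) * eigenvalue L n powr s"
    by (intro mult_right_mono) auto
  then show ?thesis by (simp flip: powr_add)
qed

lemma pow_summable_mono:
  assumes "r \<le> s" "pow_summable L s u"
  shows "pow_summable L r u"
    and "norm (op_A_pow L r u) \<le> eigenvalue L 0 powr (r - s) * norm (op_A_pow L s u)"
proof -
  let ?K = "eigenvalue L 0 powr (r - s)"
  let ?a = "\<lambda>r n. eigenvalue L n powr r * cmod (fourier L n u)"
  have le: "(?a r n)\<^sup>2 \<le> ?K\<^sup>2 * (?a s n)\<^sup>2" for n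
  proof -
    have "?a r n \<le> (?K * eigenvalue L n powr s) * cmod (fourier L n u)"
      using eigenvalue_powr_bound[OF assms(1)] by (intro mult_right_mono) auto
    then have "(?a r n)\<^sup>2 \<le> (?K * ?a s n)\<^sup>2" by (intro power_mono) (auto simp: mult_ac)
    then show ?thesis by (simp add: power_mult_distrib)
  qed
  have hs: "((\<lambda>n. ?K\<^sup>2 * (?a s n)\<^sup>2) has_sum ?K\<^sup>2 * (norm (op_A_pow L s u))\<^sup>2) UNIV"
    by (rule has_sum_cmult_right[OF norm_op_A_pow[OF assms(2)]])
  show r: "pow_summable L r u"
    unfolding pow_summable_def using has_sum_imp_summable[OF hs] le
    by (rule summable_on_comparison_test) simp
  have "(norm (op_A_pow L r u))\<^sup>2 \<le> ?K\<^sup>2 * (norm (op_A_pow L s u))\<^sup>2"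
    by (rule has_sum_mono[OF norm_op_A_pow[OF r] hs le])
  then have "(norm (op_A_pow L r u))\<^sup>2 \<le> (?K * norm (op_A_pow L s u))\<^sup>2"
    by (simp add: power_mult_distrib)
  then show "norm (op_A_pow L r u) \<le> ?K * norm (op_A_pow L s u)"
    by (rule power2_le_imp_le) simp
qed

lemma pow_summable_0: "pow_summable L 0 u"
  using bessel eigenvalue_pos[OF L] by (simp add: pow_summable_def powr_zero_eq_one less_imp_neq[symmetric])

lemma pow_summable_nonpos: "\<nu> \<le> 0 \<Longrightarrow> pow_summable L \<nu> u"
  by (rule pow_summable_mono(1)[OF _ pow_summable_0])

lemma op_A_pow_0: "u \<in> L2 L \<Longrightarrow> op_A_pow L 0 u = u"
  using eigenvalue_pos[OF L]
  by (intro fourier_eqI) (simp_all add: fourier_op_A_pow pow_summable_0 less_imp_neq[symmetric])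

text \<open>
  On classes that do not vanish outside \<open>(0,L)\<close>, the operator \<open>A\<^sup>0\<close> is the orthogonal projection onto
  \<open>L\<^sup>2(0,L)\<close>.
\<close>

lemma norm_op_A_pow_0: "norm (op_A_pow L 0 u) \<le> norm u"
proof -
  let ?p = "op_A_pow L 0 u"
  have f: "fourier L n ?p = fourier L n u" for n
    using eigenvalue_pos[OF L, of n] by (simp add: fourier_op_A_pow pow_summable_0)
  have "cinner_l2 u ?p = cinner_l2 ?p ?p"
    using parseval[OF fourier_op_A_pow(1)[OF pow_summable_0], of u u]
      parseval[OF fourier_op_A_pow(1)[OF pow_summable_0], of ?p u]
    by (auto simp: f intro: has_sum_unique)
  then have "(norm ?p)\<^sup>2 \<le> norm u * norm ?p"
    using cinner_l2_bound[of u ?p] by (simp add: cinner_l2_self_norm norm_power)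
  then show ?thesis by (cases "norm ?p = 0") (auto simp: power2_eq_square)
qed

lemma norm_op_A_pow_nonpos:
  "\<nu> \<le> 0 \<Longrightarrow> norm (op_A_pow L \<nu> u) \<le> eigenvalue L 0 powr \<nu> * norm u"
  using pow_summable_mono(2)[OF _ pow_summable_0, of \<nu> u] norm_op_A_pow_0[of u]
  by (smt (verit) diff_zero mult_left_mono powr_ge_zero)

lemma op_A_pow_compose:
  assumes "pow_summable L s u" "pow_summable L (r + s) u"
  shows "pow_summable L r (op_A_pow L s u)" "op_A_pow L r (op_A_pow L s u) = op_A_pow L (r + s) u"
proof -
  show r: "pow_summable L r (op_A_pow L s u)"
    using assms(2)
    by (simp add: pow_summable_def fourier_op_A_pow(2)[OF assms(1)] norm_mult powr_add mult.assoc)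
  show "op_A_pow L r (op_A_pow L s u) = op_A_pow L (r + s) u"
    using assms r by (intro fourier_eqI) (simp_all add: fourier_op_A_pow powr_add mult.assoc)
qed

text \<open>
  In Fourier coordinates both sides are the series with the weights \<open>\<lambda>\<^sup>r\<^sup>+\<^sup>s\<close>.
\<close>

lemma op_A_pow_shift:
  assumes "pow_summable L r u" "pow_summable L s v" "pow_summable L r' u" "pow_summable L s' v" "r + s = r' + s'"
  shows "cinner_l2 (op_A_pow L r u) (op_A_pow L s v) = cinner_l2 (op_A_pow L r' u) (op_A_pow L s' v)"
proof -
  have hs: "((\<lambda>n. complex_of_real (eigenvalue L n powr (r + s)) * (fourier L n u * cnj (fourier L n v)))
      has_sum cinner_l2 (op_A_pow L r u) (op_A_pow L s v)) UNIV"
    if "pow_summable L r u" "pow_summable L s v" for r s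
    using parseval[OF fourier_op_A_pow(1)[OF that(2)], of "op_A_pow L r u"]
    by (simp add: fourier_op_A_pow(2)[OF that(1)] fourier_op_A_pow(2)[OF that(2)] powr_add mult_ac)
  show ?thesis
    using hs[OF assms(1,2)] hs[OF assms(3,4)] assms(5) has_sum_unique by auto
qed

text \<open>
  Symmetry moves \<open>A\<close> to the basis vectors, which yields the Fourier coefficients of \<open>A u\<close>.
\<close>

lemma dom_A_pow_1:
  assumes "u \<in> dom_A L"
  shows "pow_summable L 1 u" "op_A L u = op_A_pow L 1 u"
proof -
  have f: "fourier L n (op_A L u) = complex_of_real (eigenvalue L n) * fourier L n u" for n
    unfolding fourier_def op_A_symmetric[OF L assms basis_eigenvector(1)]
    by (simp add: basis_eigenvector(2) cinner_l2_scaleR_right)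
  show 1: "pow_summable L 1 u"
    using bessel[of "op_A L u"] eigenvalue_pos[OF L]
    by (simp add: pow_summable_def f norm_mult less_imp_le)
  have "op_A L u \<in> L2 L"
    using assms by (simp add: dom_A_def H2_def op_A_def L2_minus weak_derivative_in_L2)
  then show "op_A L u = op_A_pow L 1 u"
    using 1 eigenvalue_pos[OF L]
    by (intro fourier_eqI) (simp_all add: fourier_op_A_pow f less_imp_le)
qed

text \<open>
  The derivatives of the basis vectors are again orthogonal, with squared norms the eigenvalues, so
  that the Fourier series of a vector in the domain of the square root of \<open>A\<close> may be differentiated
  term by term.
\<close>

lemma form_domain_derivative:
  assumes "u \<in> dom_A_pow L (1/2)"
  shows "u \<in> H1 L" "norm (weak_derivative L u) = norm (op_A_pow L (1/2) u)"
    and "w \<in> H1 L \<Longrightarrow> cinner_l2 (weak_derivative L w) u = - cinner_l2 w (weak_derivative L u)"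
proof -
  have u: "u \<in> L2 L" "pow_summable L (1/2) u" using assms by (auto simp: dom_A_pow_iff)
  let ?c = "\<lambda>n. fourier L n u" and ?d = "\<lambda>n. weak_derivative L (basis L n)"
  have b10: "basis L n \<in> H10 L" for n using basis_eigenvector(1) by (simp add: dom_A_def)
  then have b1: "basis L n \<in> H1 L" for n by (simp add: H10_def)
  have dd: "cinner_l2 (?d m) (?d n) = (if m = n then complex_of_real (eigenvalue L m) else 0)" for m n
    unfolding op_A_form[OF L basis_eigenvector(1) b10, of m n, symmetric]
    by (simp add: basis_eigenvector(2) cinner_l2_scaleR_left basis_orthonormal)
  have nd: "(norm (?d n))\<^sup>2 = eigenvalue L n" for n
    using dd[of n n] unfolding cinner_l2_self_norm if_P[OF refl] by (simp only: of_real_eq_iff)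
  have sq: "(norm (?c n *\<^sub>C ?d n))\<^sup>2 = (eigenvalue L n powr (1/2) * cmod (?c n))\<^sup>2" for n
    using eigenvalue_pos[OF L, of n]
    by (simp add: norm_scaleC power_mult_distrib nd powr_half_sqrt)
  have orth: "inner (?c m *\<^sub>C ?d m) (?c n *\<^sub>C ?d n) = 0" if "m \<noteq> n" for m n
    using that by (simp add: inner_l2_def cinner_l2_scaleC_left cinner_l2_scaleC_right dd)
  have "(\<lambda>n. ?c n *\<^sub>C ?d n) summable_on UNIV"
    by (rule orthogonal_summable_on) (use orth u(2) in \<open>simp_all add: sq pow_summable_def\<close>)
  then have hs: "((\<lambda>n. ?c n *\<^sub>C ?d n) has_sum (\<Sum>\<^sub>\<infinity>n. ?c n *\<^sub>C ?d n)) UNIV" by simp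
  let ?v = "\<Sum>\<^sub>\<infinity>n. ?c n *\<^sub>C ?d n"
  have lim_u: "(\<lambda>N. \<Sum>n<N. ?c n *\<^sub>C basis L n) \<longlonglongrightarrow> u"
    using has_sum_imp_sums[OF fourier_expansion[OF u(1)]] by (simp add: sums_def)
  have lim_v: "(\<lambda>N. \<Sum>n<N. ?c n *\<^sub>C ?d n) \<longlonglongrightarrow> ?v"
    using has_sum_imp_sums[OF hs] by (simp add: sums_def)
  have hw0: "has_weak_derivative L 0 0"
    using has_weak_derivative_scaleC[OF b1[unfolded H1_has_weak_derivative], of 0] by simp
  have partial: "has_weak_derivative L (\<Sum>n<N. ?c n *\<^sub>C basis L n) (\<Sum>n<N. ?c n *\<^sub>C ?d n)" for N
    by (induction N)
      (auto intro!: hw0 has_weak_derivative_add has_weak_derivative_scaleC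
        simp: b1[unfolded H1_has_weak_derivative])
  have wd: "has_weak_derivative L u ?v"
    by (rule has_weak_derivative_limit[OF partial lim_u lim_v])
  then have Du: "weak_derivative L u = ?v" by (rule weak_derivative_eq)
  show "u \<in> H1 L" using wd by (auto simp: H1_def)
  have lim_norm: "(\<lambda>N. (norm (\<Sum>n<N. ?c n *\<^sub>C ?d n))\<^sup>2) \<longlonglongrightarrow> (norm ?v)\<^sup>2"
    by (intro tendsto_intros lim_v)
  have eq_norm: "(norm (\<Sum>n<N. ?c n *\<^sub>C ?d n))\<^sup>2
      = (\<Sum>n<N. (eigenvalue L n powr (1/2) * cmod (?c n))\<^sup>2)" for N
    unfolding sq[symmetric] by (rule norm_sum_orthogonal) (use orth in auto)
  have "(\<lambda>N. \<Sum>n<N. (eigenvalue L n powr (1/2) * cmod (?c n))\<^sup>2)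
      \<longlonglongrightarrow> (norm (op_A_pow L (1/2) u))\<^sup>2"
    using has_sum_imp_sums[OF norm_op_A_pow[OF u(2)]] by (simp add: sums_def)
  then have "(norm ?v)\<^sup>2 = (norm (op_A_pow L (1/2) u))\<^sup>2"
    by (rule LIMSEQ_unique[OF lim_norm[unfolded eq_norm]])
  then show "norm (weak_derivative L u) = norm (op_A_pow L (1/2) u)"
    by (simp add: Du power2_eq_iff_nonneg)
  assume w: "w \<in> H1 L"
  have "cinner_l2 (weak_derivative L w) (\<Sum>n<N. ?c n *\<^sub>C basis L n) = - cinner_l2 w (\<Sum>n<N. ?c n *\<^sub>C ?d n)" for N
    by (induction N)
      (simp_all add: cinner_l2_add_right cinner_l2_scaleC_right integration_by_parts_H10[OF L w b10])
  moreover have "(\<lambda>N. cinner_l2 (weak_derivative L w) (\<Sum>n<N. ?c n *\<^sub>C basis L n)) \<longlonglongrightarrow> cinner_l2 (weak_derivative L w) u"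
    by (intro tendsto_cinner_l2 tendsto_const lim_u)
  moreover have "(\<lambda>N. - cinner_l2 w (\<Sum>n<N. ?c n *\<^sub>C ?d n)) \<longlonglongrightarrow> - cinner_l2 w ?v"
    by (intro tendsto_minus tendsto_cinner_l2 tendsto_const lim_v)
  ultimately show "cinner_l2 (weak_derivative L w) u = - cinner_l2 w (weak_derivative L u)"
    unfolding Du using LIMSEQ_unique by simp
qed

section \<open>The derivative in the scale of fractional powers\<close>

text \<open>
  Logarithmic convexity means that the quotients of successive terms increase; if the first one exceeded
  \<open>1\<close>, the sequence would grow geometrically.
\<close>

lemma log_convex_bounded_antimono:
  fixes a :: "nat \<Rightarrow> real"
  assumes "\<And>k. 0 \<le> a k" "\<And>k. (a (Suc k))\<^sup>2 \<le> a k * a (Suc (Suc k))" "\<And>k. a k \<le> M"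
  shows "a 1 \<le> a 0"
proof (rule ccontr)
  assume "\<not> a 1 \<le> a 0"
  then have less: "a 0 < a 1" by simp
  have a0: "a 0 > 0"
  proof (rule ccontr)
    assume "\<not> a 0 > 0"
    then have "a 0 = 0" using assms(1)[of 0] by simp
    then have "(a 1)\<^sup>2 \<le> 0" using assms(2)[of 0] by simp
    then show False using less assms(1)[of 0] by simp
  qed
  define r where "r = a 1 / a 0"
  have r: "r > 1" using less a0 by (simp add: r_def)
  have step: "a k > 0 \<and> a (Suc k) \<ge> r * a k" for k
  proof (induction k)
    case 0
    then show ?case using a0 by (simp add: r_def)
  next
    case (Suc k)
    have pos: "a (Suc k) > 0" using Suc r by (smt (verit) mult_pos_pos)
    have "r * a (Suc k) * a k \<le> a (Suc k) * a (Suc k)"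
      using mult_right_mono[of "r * a k" "a (Suc k)" "a (Suc k)"] Suc pos by (simp add: mult_ac)
    also have "\<dots> \<le> a (Suc (Suc k)) * a k"
      using assms(2)[of k] by (simp add: power2_eq_square mult.commute)
    finally have "r * a (Suc k) \<le> a (Suc (Suc k))" using Suc by (simp add: mult_le_cancel_right)
    then show ?case using pos by simp
  qed
  have growth: "a k \<ge> r ^ k * a 0" for k
  proof (induction k)
    case (Suc k)
    have "r ^ Suc k * a 0 = r * (r ^ k * a 0)" by simp
    also have "\<dots> \<le> r * a k" using Suc r by (intro mult_left_mono) auto
    also have "\<dots> \<le> a (Suc k)" using step by blast
    finally show ?case .
  qed simp
  obtain k where "M / a 0 < r ^ k" using real_arch_pow[OF r] by blast
  then have "M < r ^ k * a 0" using a0 by (simp add: field_simps)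
  then show False using growth[of k] assms(3)[of k] by linarith
qed

text \<open>
  The operator \<open>G = A\<^sup>-\<^sup>1\<^sup>/\<^sup>2 \<partial>\<^sub>x\<close> is an isometry for the norm of the form domain and skew symmetric for the
  weaker norm \<open>\<bar>u\<bar> = \<parallel>A\<^sup>1\<^sup>/\<^sup>4 u\<parallel>\<close>. Skew symmetry makes the numbers \<open>\<bar>G\<^sup>k u\<bar>\<close> logarithmically convex in
  \<open>k\<close>; being bounded, they cannot increase. So \<open>G\<close> is a contraction also for the weaker norm, which
  is an interpolation estimate obtained without interpolation theory.
\<close>

lemma derivative_quarter_bound:
  assumes u: "u \<in> dom_A_pow L (1/2)" and v: "v \<in> dom_A_pow L (1/2)"
  shows "cmod (cinner_l2 (weak_derivative L u) v)
    \<le> norm (op_A_pow L (1/4) u) * norm (op_A_pow L (1/4) v)"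
proof -
  define G where "G u = op_A_pow L (- (1/2)) (weak_derivative L u)" for u
  have half: "pow_summable L (1/2) u" "pow_summable L (1/4) u" "u \<in> H1 L" "u \<in> L2 L"
    if "u \<in> dom_A_pow L (1/2)" for u
    using that pow_summable_mono(1)[of "1/4" "1/2" u] form_domain_derivative(1)[OF that]
    by (auto simp: dom_A_pow_iff)
  have G: "G u \<in> dom_A_pow L (1/2)" "op_A_pow L (1/2) (G u) = weak_derivative L u"
    if "u \<in> dom_A_pow L (1/2)" for u
  proof -
    let ?D = "weak_derivative L u"
    have D: "pow_summable L (- (1/2)) ?D" "pow_summable L (1/2 + - (1/2)) ?D" "?D \<in> L2 L"
      using pow_summable_nonpos[of "- (1/2)" ?D] pow_summable_0 weak_derivative_in_L2[OF half(3)[OF that]]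
      by auto
    show "G u \<in> dom_A_pow L (1/2)"
      unfolding G_def dom_A_pow_iff using op_A_pow_compose(1)[OF D(1,2)] fourier_op_A_pow(1)[OF D(1)] by simp
    show "op_A_pow L (1/2) (G u) = ?D"
      unfolding G_def op_A_pow_compose(2)[OF D(1,2)] using D(3) by (simp add: op_A_pow_0)
  qed
  have form: "cinner_l2 (op_A_pow L (1/4) (G u)) (op_A_pow L (1/4) v) = cinner_l2 (weak_derivative L u) v"
    if "u \<in> dom_A_pow L (1/2)" "v \<in> dom_A_pow L (1/2)" for u v
  proof -
    have "cinner_l2 (op_A_pow L (1/4) (G u)) (op_A_pow L (1/4) v)
        = cinner_l2 (op_A_pow L (1/2) (G u)) (op_A_pow L 0 v)"
      using half[OF G(1)[OF that(1)]] half[OF that(2)] pow_summable_0 by (intro op_A_pow_shift) auto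
    then show ?thesis using G(2)[OF that(1)] op_A_pow_0[OF half(4)[OF that(2)]] by simp
  qed
  have skew: "cinner_l2 (op_A_pow L (1/4) (G u)) (op_A_pow L (1/4) v)
      = - cinner_l2 (op_A_pow L (1/4) u) (op_A_pow L (1/4) (G v))"
    if "u \<in> dom_A_pow L (1/2)" "v \<in> dom_A_pow L (1/2)" for u v
  proof -
    have "cinner_l2 (weak_derivative L u) v = - cinner_l2 u (weak_derivative L v)"
      by (rule form_domain_derivative(3)[OF that(2) half(3)[OF that(1)]])
    also have "cinner_l2 u (weak_derivative L v) = cnj (cinner_l2 (weak_derivative L v) u)"
      by (rule cinner_l2_commute)
    also have "\<dots> = cinner_l2 (op_A_pow L (1/4) u) (op_A_pow L (1/4) (G v))"
      unfolding form[OF that(2,1), symmetric] by (rule cinner_l2_commute[symmetric])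
    finally show ?thesis using form[OF that] by simp
  qed
  have Gk: "(G ^^ k) u \<in> dom_A_pow L (1/2)" for k
    by (induction k) (simp_all add: u G(1))
  define a where "a k = norm (op_A_pow L (1/4) ((G ^^ k) u))" for k
  have "a 1 \<le> a 0"
  proof (rule log_convex_bounded_antimono)
    show "(a (Suc k))\<^sup>2 \<le> a k * a (Suc (Suc k))" for k
    proof -
      let ?w = "(G ^^ k) u"
      have "complex_of_real ((a (Suc k))\<^sup>2) = - cinner_l2 (op_A_pow L (1/4) ?w) (op_A_pow L (1/4) (G (G ?w)))"
        unfolding a_def using skew[OF Gk G(1)[OF Gk], of k k] by (simp add: cinner_l2_self_norm)
      then have "\<bar>(a (Suc k))\<^sup>2\<bar> = cmod (cinner_l2 (op_A_pow L (1/4) ?w) (op_A_pow L (1/4) (G (G ?w))))"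
        by (metis norm_minus_cancel norm_of_real)
      also have "\<dots> \<le> a k * a (Suc (Suc k))"
        unfolding a_def using cinner_l2_bound by simp
      finally show ?thesis by simp
    qed
    have iso: "norm (op_A_pow L (1/2) ((G ^^ k) u)) = norm (op_A_pow L (1/2) u)" for k
    proof (induction k)
      case (Suc k)
      then show ?case using G(2)[OF Gk[of k]] form_domain_derivative(2)[OF Gk[of k]] by simp
    qed simp
    show "a k \<le> eigenvalue L 0 powr (1/4 - 1/2) * norm (op_A_pow L (1/2) u)" for k
      unfolding a_def iso[of k, symmetric]
      by (rule pow_summable_mono(2)) (use half(1)[OF Gk] in auto)
  qed (simp add: a_def)
  then have "norm (op_A_pow L (1/4) (G u)) \<le> norm (op_A_pow L (1/4) u)" by (simp add: a_def)
  have "cmod (cinner_l2 (weak_derivative L u) v) \<le> norm (op_A_pow L (1/4) (G u)) * norm (op_A_pow L (1/4) v)"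
    unfolding form[OF u v, symmetric] by (rule cinner_l2_bound)
  also have "\<dots> \<le> norm (op_A_pow L (1/4) u) * norm (op_A_pow L (1/4) v)"
    using \<open>norm (op_A_pow L (1/4) (G u)) \<le> norm (op_A_pow L (1/4) u)\<close> by (intro mult_right_mono) auto
  finally show ?thesis .
qed

end

section \<open>The sectorial form of the Timoshenko system\<close>

text \<open>
  A common bound for the embeddings of the domain of \<open>A\<^sup>s\<close> into that of \<open>A\<^sup>r\<close> with \<open>r \<le> s \<le> r + 1\<close>, in
  their homogeneous norms.
\<close>

definition embedding_const :: "real \<Rightarrow> real"
  where "embedding_const L = max 1 (1 / eigenvalue L 0)"

text \<open>The condition that the domain of the operator imposes on each of its three components.\<close>

definition wave_pair :: "real \<Rightarrow> real \<Rightarrow> l2 \<Rightarrow> l2 \<Rightarrow> bool"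
  where "wave_pair L \<tau> \<phi> \<Phi> \<longleftrightarrow> \<phi> \<in> dom_A L \<and> \<Phi> \<in> dom_A_pow L (1/2) \<and> \<Phi> \<in> dom_A_pow L \<tau>"

text \<open>
  The polarised energy of one wave equation in the coordinates \<open>v = A\<^sup>1\<^sup>/\<^sup>2 \<phi>\<close> and \<open>w = \<Phi>\<close>, with its
  correction: as \<open>A\<^sup>1\<^sup>/\<^sup>2\<^sup>-\<^sup>\<tau> v = A\<^sup>1\<^sup>-\<^sup>\<tau> \<phi>\<close>, the last summand is the polarisation of
  \<open>2 \<epsilon> \<rho> Re \<langle>A\<^sup>1\<^sup>-\<^sup>\<tau> \<phi>, \<Phi>\<rangle>\<close>.
\<close>

definition wave_form :: "real \<Rightarrow> real \<Rightarrow> real \<Rightarrow> real \<Rightarrow> real \<Rightarrow> l2 \<Rightarrow> l2 \<Rightarrow> l2 \<Rightarrow> l2 \<Rightarrow> real"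
  where "wave_form L \<rho> k \<epsilon> \<tau> v w v' w' = \<rho> * inner w w' + k * inner v v'
    + \<epsilon> * \<rho> * (inner (op_A_pow L (1/2 - \<tau>) v) w' + inner w (op_A_pow L (1/2 - \<tau>) v'))"

text \<open>
  A force \<open>F\<close> in the equation enters the form as the inner product of \<open>F\<close> with this vector.
\<close>

definition multiplier :: "real \<Rightarrow> real \<Rightarrow> real \<Rightarrow> l2 \<Rightarrow> l2 \<Rightarrow> l2"
  where "multiplier L \<epsilon> \<tau> \<phi> \<Phi> = \<Phi> + \<epsilon> *\<^sub>R op_A_pow L (1 - \<tau>) \<phi>"

context
  fixes L :: real
  assumes L: "0 < L"
begin

lemma embedding_const_ge_1: "1 \<le> embedding_const L"
  by (simp add: embedding_const_def)

lemma eigenvalue_powr_le_embedding_const: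
  assumes "-1 \<le> s" "s \<le> 0"
  shows "eigenvalue L 0 powr s \<le> embedding_const L"
proof (cases "eigenvalue L 0 \<le> 1")
  case True
  then have "eigenvalue L 0 powr s \<le> eigenvalue L 0 powr (-1)"
    using assms eigenvalue_pos[OF L, of 0] by (intro powr_mono') auto
  also have "\<dots> = 1 / eigenvalue L 0" using eigenvalue_pos[OF L, of 0] by (simp add: powr_minus_divide)
  finally show ?thesis by (simp add: embedding_const_def)
next
  case False
  then have "eigenvalue L 0 powr s \<le> eigenvalue L 0 powr 0"
    using assms by (intro powr_mono) auto
  then show ?thesis using False by (simp add: embedding_const_def)
qed

lemma norm_op_A_pow_embedding:
  assumes "r \<le> s" "s \<le> r + 1" "pow_summable L s u"
  shows "norm (op_A_pow L r u) \<le> embedding_const L * norm (op_A_pow L s u)"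
  using pow_summable_mono(2)[OF L assms(1,3)] eigenvalue_powr_le_embedding_const[of "r - s"] assms
  by (smt (verit) mult_right_mono norm_ge_zero)

lemma norm_op_A_pow_negative:
  assumes "-1 \<le> s" "s \<le> 0"
  shows "norm (op_A_pow L s u) \<le> embedding_const L * norm u"
  using norm_op_A_pow_nonpos[OF L assms(2), of u] eigenvalue_powr_le_embedding_const[OF assms]
  by (smt (verit) mult_right_mono norm_ge_zero)

lemma inner_shift:
  assumes "pow_summable L r u" "pow_summable L s v" "pow_summable L r' u" "pow_summable L s' v" "r + s = r' + s'"
  shows "inner (op_A_pow L r u) (op_A_pow L s v) = inner (op_A_pow L r' u) (op_A_pow L s' v)"
  using op_A_pow_shift[OF L assms] by (simp add: inner_l2_def)

lemma inner_bound: "\<bar>inner u v\<bar> \<le> norm u * norm (v :: l2)"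
  by (rule Cauchy_Schwarz_ineq2)

lemma wave_pair_summable:
  assumes "wave_pair L \<tau> \<phi> \<Phi>"
  shows "s \<le> 1 \<Longrightarrow> pow_summable L s \<phi>" "s \<le> 1/2 \<or> s \<le> \<tau> \<Longrightarrow> pow_summable L s \<Phi>"
    "\<phi> \<in> L2 L" "\<Phi> \<in> L2 L" "\<phi> \<in> dom_A_pow L (1/2)" "\<Phi> \<in> dom_A_pow L (1/2)"
proof -
  have 1: "pow_summable L 1 \<phi>" using dom_A_pow_1[OF L] assms by (simp add: wave_pair_def)
  show p: "s \<le> 1 \<Longrightarrow> pow_summable L s \<phi>" for s by (rule pow_summable_mono(1)[OF L _ 1])
  show "\<phi> \<in> L2 L" using assms dom_A_in_L2 by (simp add: wave_pair_def)
  then show "\<phi> \<in> dom_A_pow L (1/2)" using p[of "1/2"] by (simp add: dom_A_pow_iff[OF L])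
  show "\<Phi> \<in> dom_A_pow L (1/2)" "\<Phi> \<in> L2 L" "s \<le> 1/2 \<or> s \<le> \<tau> \<Longrightarrow> pow_summable L s \<Phi>"
    using assms pow_summable_mono(1)[OF L, of s "1/2" \<Phi>] pow_summable_mono(1)[OF L, of s \<tau> \<Phi>]
    by (auto simp: wave_pair_def dom_A_pow_iff[OF L])
qed

text \<open>
  For one damped wave equation everything is expressed by \<open>A\<^sup>1\<^sup>-\<^sup>\<tau>\<^sup>/\<^sup>2 \<phi>\<close> and \<open>A\<^sup>\<tau>\<^sup>/\<^sup>2 \<Phi>\<close>. The damping
  dissipates the square of the latter; the correction of the energy with the small factor \<open>\<epsilon>\<close>
  dissipates the square of the former.
\<close>

lemma wave_form_generator:
  assumes \<tau>: "1/2 \<le> \<tau>" "\<tau> \<le> 1" and \<rho>: "\<rho> \<noteq> 0"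
    and U: "wave_pair L \<tau> \<phi> \<Phi>" and U': "wave_pair L \<tau> \<phi>' \<Phi>'"
  defines "x \<equiv> op_A_pow L (1 - \<tau>/2) \<phi>" and "y \<equiv> op_A_pow L (\<tau>/2) \<Phi>"
    and "x' \<equiv> op_A_pow L (1 - \<tau>/2) \<phi>'" and "y' \<equiv> op_A_pow L (\<tau>/2) \<Phi>'"
  shows "wave_form L \<rho> k \<epsilon> \<tau> (op_A_pow L (1/2) \<Phi>)
      ((1 / \<rho>) *\<^sub>R (F - k *\<^sub>R op_A L \<phi> - d *\<^sub>R op_A_pow L \<tau> \<Phi>)) (op_A_pow L (1/2) \<phi>') \<Phi>'
    = - k * inner x y' + k * inner y x' - d * inner y y' - \<epsilon> * k * inner x x' - \<epsilon> * d * inner y x'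
      + \<epsilon> * \<rho> * inner (op_A_pow L (1/2 - \<tau>/2) \<Phi>) (op_A_pow L (1/2 - \<tau>/2) \<Phi>')
      + inner F (multiplier L \<epsilon> \<tau> \<phi>' \<Phi>')"
proof -
  note s = wave_pair_summable[OF U] and s' = wave_pair_summable[OF U']
  have A: "op_A L \<phi> = op_A_pow L 1 \<phi>" using dom_A_pow_1[OF L] U by (simp add: wave_pair_def)
  have \<Phi>0: "op_A_pow L 0 \<Phi>' = \<Phi>'" by (rule op_A_pow_0[OF L s'(4)])
  have c: "op_A_pow L (1/2 - \<tau>) (op_A_pow L (1/2) \<Phi>) = op_A_pow L (1 - \<tau>) \<Phi>"
    "op_A_pow L (1/2 - \<tau>) (op_A_pow L (1/2) \<phi>') = op_A_pow L (1 - \<tau>) \<phi>'"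
    using op_A_pow_compose(2)[OF L, of "1/2" \<Phi> "1/2 - \<tau>"] op_A_pow_compose(2)[OF L, of "1/2" \<phi>' "1/2 - \<tau>"]
      s(2) s'(1) \<tau> by auto
  have e1: "inner (op_A_pow L 1 \<phi>) \<Phi>' = inner x y'"
    using inner_shift[of 1 \<phi> 0 \<Phi>' "1 - \<tau>/2" "\<tau>/2"] s(1) s'(2) \<tau> by (simp add: \<Phi>0 x_def y'_def)
  have e2: "inner (op_A_pow L \<tau> \<Phi>) \<Phi>' = inner y y'"
    using inner_shift[of \<tau> \<Phi> 0 \<Phi>' "\<tau>/2" "\<tau>/2"] s(2) s'(2) \<tau> by (simp add: \<Phi>0 y_def y'_def)
  have e3: "inner (op_A_pow L (1/2) \<Phi>) (op_A_pow L (1/2) \<phi>') = inner y x'"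
    unfolding y_def x'_def using s(2) s'(1) \<tau> by (intro inner_shift) auto
  have e4: "inner (op_A_pow L 1 \<phi>) (op_A_pow L (1 - \<tau>) \<phi>') = inner x x'"
    unfolding x_def x'_def using s(1) s'(1) \<tau> by (intro inner_shift) auto
  have e5: "inner (op_A_pow L \<tau> \<Phi>) (op_A_pow L (1 - \<tau>) \<phi>') = inner y x'"
    unfolding y_def x'_def using s(2) s'(1) \<tau> by (intro inner_shift) auto
  have e6: "inner (op_A_pow L (1 - \<tau>) \<Phi>) \<Phi>'
      = inner (op_A_pow L (1/2 - \<tau>/2) \<Phi>) (op_A_pow L (1/2 - \<tau>/2) \<Phi>')"
    using inner_shift[of "1 - \<tau>" \<Phi> 0 \<Phi>' "1/2 - \<tau>/2" "1/2 - \<tau>/2"] s(2) s'(2) \<tau> by (simp add: \<Phi>0)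
  show ?thesis
    unfolding wave_form_def c A multiplier_def e3[symmetric]
    using \<rho>
    by (simp add: inner_diff_left inner_add_right e1 e2 e4 e5 e6 e3[symmetric] algebra_simps)
qed

lemma wave_form_diagonal:
  assumes \<tau>: "1/2 \<le> \<tau>" "\<tau> \<le> 1" and pos: "0 < \<rho>" "0 \<le> d" "0 \<le> \<epsilon>" and U: "wave_pair L \<tau> \<phi> \<Phi>"
  defines "X \<equiv> norm (op_A_pow L (1 - \<tau>/2) \<phi>)" and "Y \<equiv> norm (op_A_pow L (\<tau>/2) \<Phi>)"
  shows "wave_form L \<rho> k \<epsilon> \<tau> (op_A_pow L (1/2) \<Phi>)
      ((1 / \<rho>) *\<^sub>R (F - k *\<^sub>R op_A L \<phi> - d *\<^sub>R op_A_pow L \<tau> \<Phi>)) (op_A_pow L (1/2) \<phi>) \<Phi>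
    \<le> - d * Y\<^sup>2 - \<epsilon> * k * X\<^sup>2 + \<epsilon> * (d * X * Y) + \<epsilon> * (\<rho> * (embedding_const L)\<^sup>2 * Y\<^sup>2) + inner F (multiplier L \<epsilon> \<tau> \<phi> \<Phi>)"
proof -
  let ?x = "op_A_pow L (1 - \<tau>/2) \<phi>" and ?y = "op_A_pow L (\<tau>/2) \<Phi>"
  let ?z = "op_A_pow L (1/2 - \<tau>/2) \<Phi>"
  have "norm ?z \<le> embedding_const L * Y"
    unfolding Y_def using wave_pair_summable(2)[OF U] \<tau> by (intro norm_op_A_pow_embedding) auto
  then have "(norm ?z)\<^sup>2 \<le> (embedding_const L * Y)\<^sup>2" by (intro power_mono) auto
  then have z: "\<epsilon> * \<rho> * inner ?z ?z \<le> \<epsilon> * (\<rho> * (embedding_const L)\<^sup>2 * Y\<^sup>2)"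
    using pos mult_left_mono[of "(norm ?z)\<^sup>2" "(embedding_const L * Y)\<^sup>2" "\<epsilon> * \<rho>"]
    by (simp add: power2_norm_eq_inner power_mult_distrib mult.assoc)
  have "- inner ?y ?x \<le> X * Y"
    using inner_bound[of ?y ?x] by (simp add: X_def Y_def mult.commute)
  then have xy: "\<epsilon> * d * (- inner ?y ?x) \<le> \<epsilon> * d * (X * Y)"
    using pos by (intro mult_left_mono) auto
  show ?thesis
    unfolding wave_form_generator[OF \<tau> less_imp_neq[OF pos(1), symmetric] U U]
    using z xy by (simp add: X_def Y_def power2_norm_eq_inner inner_commute[of ?x ?y] algebra_simps)
qed

text \<open>
  By the choice of the exponents, each term is a product of a quantity of the first pair and one of the
  second, both of which are dissipated.
\<close>

lemma wave_form_bounded: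
  assumes \<tau>: "1/2 \<le> \<tau>" "\<tau> \<le> 1" and pos: "0 < \<rho>" "0 \<le> d" "0 \<le> k" "0 \<le> \<epsilon>" "\<epsilon> \<le> 1"
    and U: "wave_pair L \<tau> \<phi> \<Phi>" and U': "wave_pair L \<tau> \<phi>' \<Phi>'"
    and S: "norm (op_A_pow L (1 - \<tau>/2) \<phi>) \<le> S" "norm (op_A_pow L (\<tau>/2) \<Phi>) \<le> S"
    and S': "norm (op_A_pow L (1 - \<tau>/2) \<phi>') \<le> S'" "norm (op_A_pow L (\<tau>/2) \<Phi>') \<le> S'"
  shows "\<bar>wave_form L \<rho> k \<epsilon> \<tau> (op_A_pow L (1/2) \<Phi>)
      ((1 / \<rho>) *\<^sub>R (F - k *\<^sub>R op_A L \<phi> - d *\<^sub>R op_A_pow L \<tau> \<Phi>)) (op_A_pow L (1/2) \<phi>') \<Phi>'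
      - inner F (multiplier L \<epsilon> \<tau> \<phi>' \<Phi>')\<bar>
    \<le> (3 * k + 2 * d + \<rho> * (embedding_const L)\<^sup>2) * (S * S')"
proof -
  let ?x = "op_A_pow L (1 - \<tau>/2) \<phi>" and ?y = "op_A_pow L (\<tau>/2) \<Phi>"
  let ?x' = "op_A_pow L (1 - \<tau>/2) \<phi>'" and ?y' = "op_A_pow L (\<tau>/2) \<Phi>'"
  let ?z = "op_A_pow L (1/2 - \<tau>/2) \<Phi>" and ?z' = "op_A_pow L (1/2 - \<tau>/2) \<Phi>'"
  have S0: "0 \<le> S" "0 \<le> S'" using S S' norm_ge_zero order_trans by blast+
  have b: "\<bar>inner u v\<bar> \<le> S * S'" if "norm u \<le> S" "norm v \<le> S'" for u v :: l2
    using inner_bound[of u v] mult_mono[OF that S0(1) norm_ge_zero] by linarith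
  have z: "norm ?z \<le> embedding_const L * norm ?y" "norm ?z' \<le> embedding_const L * norm ?y'"
    using wave_pair_summable(2)[OF U] wave_pair_summable(2)[OF U'] \<tau>
    by (auto intro!: norm_op_A_pow_embedding)
  have K0: "0 \<le> embedding_const L" using embedding_const_ge_1 by simp
  have z1: "norm ?z \<le> embedding_const L * S" using z(1) mult_left_mono[OF S(2) K0] by linarith
  have z2: "norm ?z' \<le> embedding_const L * S'" using z(2) mult_left_mono[OF S'(2) K0] by linarith
  have "\<bar>inner ?z ?z'\<bar> \<le> (embedding_const L * S) * (embedding_const L * S')"
    by (rule order_trans[OF inner_bound mult_mono[OF z1 z2]]) (use K0 S0 in auto)
  then have bz: "\<bar>inner ?z ?z'\<bar> \<le> (embedding_const L)\<^sup>2 * (S * S')" by (simp add: power2_eq_square mult_ac)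
  have le: "\<bar>c * t\<bar> \<le> c' * P" if "\<bar>t\<bar> \<le> P" "\<bar>c\<bar> \<le> c'" for c c' t P :: real
    unfolding abs_mult using that by (intro mult_mono) auto
  have \<epsilon>: "\<epsilon> * k \<le> k" "\<epsilon> * d \<le> d" "\<epsilon> * \<rho> \<le> \<rho>" using pos by (auto intro: mult_left_le_one_le)
  let ?P = "S * S'"
  have t: "\<bar>- k * inner ?x ?y'\<bar> \<le> k * ?P" "\<bar>k * inner ?y ?x'\<bar> \<le> k * ?P" "\<bar>d * inner ?y ?y'\<bar> \<le> d * ?P"
    "\<bar>\<epsilon> * k * inner ?x ?x'\<bar> \<le> k * ?P" "\<bar>\<epsilon> * d * inner ?y ?x'\<bar> \<le> d * ?P"
    "\<bar>\<epsilon> * \<rho> * inner ?z ?z'\<bar> \<le> \<rho> * ((embedding_const L)\<^sup>2 * ?P)"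
    using pos \<epsilon> S S' bz by (auto intro!: le b)
  show ?thesis
    unfolding wave_form_generator[OF \<tau> less_imp_neq[OF pos(1), symmetric] U U'] abs_le_iff
    using t unfolding abs_le_iff by (simp add: distrib_right mult.assoc)
qed

text \<open>
  The exponent of the damping has to be at least \<open>1/2\<close> here: then \<open>1/4 \<le> \<tau>/2\<close> and
  \<open>1/4 + (1 - \<tau>) \<le> 1 - \<tau>/2\<close>, so that the coupling of first order, which is bounded by norms of \<open>A\<^sup>1\<^sup>/\<^sup>4\<close>,
  is controlled by the dissipation.
\<close>

lemma multiplier_bounds:
  assumes \<tau>: "1/2 \<le> \<tau>" "\<tau> \<le> 1" and \<epsilon>: "0 \<le> \<epsilon>" "\<epsilon> \<le> 1" and U: "wave_pair L \<tau> \<phi> \<Phi>"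
  shows "op_A_pow L (1 - \<tau>) \<phi> \<in> dom_A_pow L (1/2)" "multiplier L \<epsilon> \<tau> \<phi> \<Phi> \<in> dom_A_pow L (1/2)"
    and "norm (multiplier L \<epsilon> \<tau> \<phi> \<Phi>) \<le> norm \<Phi> + embedding_const L * norm (op_A_pow L (1/2) \<phi>)"
    and "norm (op_A_pow L (1/4) (op_A_pow L (1 - \<tau>) \<phi>)) \<le> embedding_const L * norm (op_A_pow L (1 - \<tau>/2) \<phi>)"
    and "norm (op_A_pow L (1/4) \<Phi>) \<le> embedding_const L * norm (op_A_pow L (\<tau>/2) \<Phi>)"
    and "norm (op_A_pow L (1/4) (multiplier L \<epsilon> \<tau> \<phi> \<Phi>))
      \<le> embedding_const L * (norm (op_A_pow L (\<tau>/2) \<Phi>) + norm (op_A_pow L (1 - \<tau>/2) \<phi>))"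
proof -
  note s = wave_pair_summable[OF U]
  let ?w = "op_A_pow L (1 - \<tau>) \<phi>"
  have c: "pow_summable L r ?w" "op_A_pow L r ?w = op_A_pow L (r + (1 - \<tau>)) \<phi>" if "r \<le> 1/2" for r
    using op_A_pow_compose[OF L, of "1 - \<tau>" \<phi> r] s(1) \<tau> that by auto
  show w: "?w \<in> dom_A_pow L (1/2)"
    using c(1)[of "1/2"] fourier_op_A_pow(1)[OF L s(1), of "1 - \<tau>"] \<tau> by (simp add: dom_A_pow_iff[OF L])
  have \<epsilon>w: "pow_summable L r (\<epsilon> *\<^sub>R ?w)" if "r \<le> 1/2" for r
    unfolding scaleR_scaleC by (rule pow_summable_scaleC[OF L c(1)[OF that]])
  show "multiplier L \<epsilon> \<tau> \<phi> \<Phi> \<in> dom_A_pow L (1/2)"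
    using w s(4,6) \<epsilon>w[of "1/2"] unfolding multiplier_def dom_A_pow_iff[OF L]
    by (auto intro: L2_add L2_scaleR pow_summable_add[OF L])
  have "norm ?w \<le> embedding_const L * norm (op_A_pow L (1/2) \<phi>)"
    using s(1) \<tau> by (intro norm_op_A_pow_embedding) auto
  moreover have "\<epsilon> * norm ?w \<le> norm ?w" using \<epsilon> by (intro mult_left_le_one_le) auto
  ultimately show "norm (multiplier L \<epsilon> \<tau> \<phi> \<Phi>) \<le> norm \<Phi> + embedding_const L * norm (op_A_pow L (1/2) \<phi>)"
    unfolding multiplier_def using norm_triangle_ineq[of \<Phi> "\<epsilon> *\<^sub>R ?w"] \<epsilon> by simp
  show w4: "norm (op_A_pow L (1/4) ?w) \<le> embedding_const L * norm (op_A_pow L (1 - \<tau>/2) \<phi>)"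
    using c(2)[of "1/4"] s(1)[of "1 - \<tau>/2"] \<tau> by (simp, intro norm_op_A_pow_embedding) auto
  show \<Phi>4: "norm (op_A_pow L (1/4) \<Phi>) \<le> embedding_const L * norm (op_A_pow L (\<tau>/2) \<Phi>)"
    using s(2) \<tau> by (intro norm_op_A_pow_embedding) auto
  have "op_A_pow L (1/4) (multiplier L \<epsilon> \<tau> \<phi> \<Phi>) = op_A_pow L (1/4) \<Phi> + \<epsilon> *\<^sub>R op_A_pow L (1/4) ?w"
    unfolding multiplier_def using op_A_pow_add[OF L s(2)[of "1/4"] \<epsilon>w[of "1/4"]]
      op_A_pow_scaleC[OF L c(1)[of "1/4"], of "complex_of_real \<epsilon>"] by (simp add: scaleR_scaleC)
  moreover have "\<epsilon> * norm (op_A_pow L (1/4) ?w) \<le> norm (op_A_pow L (1/4) ?w)"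
    using \<epsilon> by (intro mult_left_le_one_le) auto
  ultimately show "norm (op_A_pow L (1/4) (multiplier L \<epsilon> \<tau> \<phi> \<Phi>))
      \<le> embedding_const L * (norm (op_A_pow L (\<tau>/2) \<Phi>) + norm (op_A_pow L (1 - \<tau>/2) \<phi>))"
    using norm_triangle_ineq[of "op_A_pow L (1/4) \<Phi>" "\<epsilon> *\<^sub>R op_A_pow L (1/4) ?w"] w4 \<Phi>4 \<epsilon>
    by (simp add: distrib_left)
qed

lemma coupling_bound:
  assumes "u \<in> dom_A_pow L (1/2)" "v \<in> dom_A_pow L (1/2)"
  shows "\<bar>inner (weak_derivative L u) v\<bar> \<le> norm (op_A_pow L (1/4) u) * norm (op_A_pow L (1/4) v)"
  using derivative_quarter_bound[OF L assms] abs_Re_le_cmod[of "cinner_l2 (weak_derivative L u) v"]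
  by (simp add: inner_l2_def)

lemma coupling_skew:
  assumes "u \<in> dom_A_pow L (1/2)" "v \<in> dom_A_pow L (1/2)"
  shows "inner (weak_derivative L u) v + inner (weak_derivative L v) u = 0"
proof -
  have "inner (weak_derivative L u) v = - inner u (weak_derivative L v)"
    using form_domain_derivative(3)[OF L assms(2) form_domain_derivative(1)[OF L assms(1)]]
    by (simp add: inner_l2_def)
  then show ?thesis by (simp add: inner_commute)
qed

lemma op_A_pow_neg_bounded_linear:
  assumes "s \<le> 0"
  shows "bounded_linear (op_A_pow L s)"
proof (rule bounded_linear_intro[where K = "eigenvalue L 0 powr s"])
  note s = pow_summable_nonpos[OF L assms]
  show "op_A_pow L s (u + v) = op_A_pow L s u + op_A_pow L s v" for u v
    by (rule op_A_pow_add[OF L s s])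
  show "op_A_pow L s (r *\<^sub>R u) = r *\<^sub>R op_A_pow L s u" for r u
    unfolding scaleR_scaleC by (rule op_A_pow_scaleC[OF L s])
  show "norm (op_A_pow L s u) \<le> norm u * eigenvalue L 0 powr s" for u
    using norm_op_A_pow_nonpos[OF L assms, of u] by (simp add: mult.commute)
qed

text \<open>
  As \<open>1/2 - \<tau> \<le> 0\<close>, the correction is bounded by the energy and small with \<open>\<epsilon>\<close>.
\<close>

lemma wave_form_coercive:
  assumes \<tau>: "1/2 \<le> \<tau>" "\<tau> \<le> 1" and pos: "0 < \<rho>" "0 < k" "0 \<le> \<epsilon>"
    and small: "4 * \<epsilon>\<^sup>2 * \<rho> * (embedding_const L)\<^sup>2 \<le> k"
  shows "\<rho> / 2 * (norm w)\<^sup>2 + k / 2 * (norm v)\<^sup>2 \<le> wave_form L \<rho> k \<epsilon> \<tau> v w v w"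
proof -
  let ?z = "op_A_pow L (1/2 - \<tau>) v"
  let ?K = "embedding_const L"
  have z: "norm ?z \<le> ?K * norm v" using \<tau> by (intro norm_op_A_pow_negative) auto
  have "2 * \<epsilon> * \<bar>inner ?z w\<bar> \<le> 2 * \<epsilon> * ((?K * norm v) * norm w)"
    using pos z by (intro mult_left_mono order_trans[OF inner_bound] mult_right_mono) auto
  also have "\<dots> = (2 * \<epsilon> * ?K * norm v) * norm w" by simp
  also have "\<dots> \<le> (2 * \<epsilon> * ?K * norm v)\<^sup>2 / 2 + (norm w)\<^sup>2 / 2"
    using zero_le_power2[of "2 * \<epsilon> * ?K * norm v - norm w"] by (simp add: power2_diff)
  finally have "\<rho> * (2 * \<epsilon> * \<bar>inner ?z w\<bar>) \<le> \<rho> * ((2 * \<epsilon> * ?K * norm v)\<^sup>2 / 2 + (norm w)\<^sup>2 / 2)"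
    using pos by (intro mult_left_mono) auto
  also have "\<dots> = (4 * \<epsilon>\<^sup>2 * \<rho> * ?K\<^sup>2) * (norm v)\<^sup>2 / 2 + \<rho> / 2 * (norm w)\<^sup>2"
    by (simp add: power_mult_distrib algebra_simps)
  finally have 1: "\<rho> * (2 * \<epsilon> * \<bar>inner ?z w\<bar>)
      \<le> (4 * \<epsilon>\<^sup>2 * \<rho> * ?K\<^sup>2) * (norm v)\<^sup>2 / 2 + \<rho> / 2 * (norm w)\<^sup>2" .
  have 2: "(4 * \<epsilon>\<^sup>2 * \<rho> * ?K\<^sup>2) * (norm v)\<^sup>2 \<le> k * (norm v)\<^sup>2"
    using small by (rule mult_right_mono) simp
  have 3: "\<rho> * (2 * \<epsilon> * (- inner ?z w)) \<le> \<rho> * (2 * \<epsilon> * \<bar>inner ?z w\<bar>)"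
    using pos by (intro mult_left_mono) auto
  have "wave_form L \<rho> k \<epsilon> \<tau> v w v w = \<rho> * (norm w)\<^sup>2 + k * (norm v)\<^sup>2 - \<rho> * (2 * \<epsilon> * (- inner ?z w))"
    by (simp add: wave_form_def power2_norm_eq_inner inner_commute[of w ?z] algebra_simps)
  then show ?thesis using 1 2 3 by linarith
qed

end

lemma bounded_bilinear_add:
  assumes "bounded_bilinear f" "bounded_bilinear g"
  shows "bounded_bilinear (\<lambda>x y. f x y + g x y)"
proof
  obtain K K' where K: "\<And>x y. norm (f x y) \<le> norm x * norm y * K" "\<And>x y. norm (g x y) \<le> norm x * norm y * K'"
    using bounded_bilinear.bounded[OF assms(1)] bounded_bilinear.bounded[OF assms(2)] by blast
  have "norm (f x y + g x y) \<le> norm x * norm y * (K + K')" for x y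
    using norm_triangle_ineq[of "f x y" "g x y"] K[of x y] by (simp add: distrib_left)
  then show "\<exists>K. \<forall>x y. norm (f x y + g x y) \<le> norm x * norm y * K" by blast
qed (simp_all add: bounded_bilinear.add_left[OF assms(1)] bounded_bilinear.add_left[OF assms(2)]
    bounded_bilinear.add_right[OF assms(1)] bounded_bilinear.add_right[OF assms(2)]
    bounded_bilinear.scaleR_left[OF assms(1)] bounded_bilinear.scaleR_left[OF assms(2)]
    bounded_bilinear.scaleR_right[OF assms(1)] bounded_bilinear.scaleR_right[OF assms(2)]
    scaleR_add_right add_ac)

lemma wave_form_bounded_bilinear:
  fixes f g :: "'a :: real_normed_vector \<Rightarrow> l2"
  assumes "0 < L" "1/2 \<le> \<tau>" "bounded_linear f" "bounded_linear g"
  shows "bounded_bilinear (\<lambda>x y. wave_form L \<rho> k \<epsilon> \<tau> (f x) (g x) (f y) (g y))"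
proof -
  have bl: "bounded_linear (\<lambda>x. op_A_pow L (1/2 - \<tau>) (f x))"
    using assms by (intro bounded_linear_compose[OF op_A_pow_neg_bounded_linear]) simp_all
  have ib: "bounded_bilinear (\<lambda>x y. c * inner (f x) (g y))"
    if "bounded_linear f" "bounded_linear g" for c and f g :: "'a \<Rightarrow> l2"
    using bounded_bilinear.comp[OF bounded_bilinear_inner bounded_linear_compose[OF bounded_linear_scaleR_right that(1)] that(2), of c]
    by simp
  show ?thesis
    unfolding wave_form_def distrib_left
    by (intro bounded_bilinear_add ib assms bl)
qed

text \<open>In these coordinates the energy norm is equivalent to the norm of the Hilbert space of states.\<close>

definition coords :: "real \<Rightarrow> state \<Rightarrow> state"
  where "coords L = (\<lambda>(\<phi>, \<Phi>, \<psi>, \<Psi>, \<theta>, \<Theta>).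
    (op_A_pow L (1/2) \<phi>, \<Phi>, op_A_pow L (1/2) \<psi>, \<Psi>, op_A_pow L (1/2) \<theta>, \<Theta>))"

text \<open>
  Of the dissipation \<open>k x\<^sup>2\<close>, one quarter absorbs a mixed term of one wave equation and another quarter a
  mixed term of the coupling; the remaining squares of \<open>y\<close> are left to the damping.
\<close>

lemma young_absorb:
  fixes x y c k :: real
  assumes "0 < k"
  shows "c * x * y \<le> k / 4 * x\<^sup>2 + c\<^sup>2 / k * y\<^sup>2"
proof -
  have "0 \<le> (k / 2 * x - c * y)\<^sup>2 / k" using assms by simp
  also have "\<dots> = k / 4 * x\<^sup>2 - c * x * y + c\<^sup>2 / k * y\<^sup>2"
    using assms by (simp add: power2_diff power_mult_distrib power_divide diff_divide_distrib add_divide_distrib)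
      (simp add: power2_eq_square)
  finally show ?thesis by simp
qed

definition energy_form ::
    "real \<Rightarrow> real \<Rightarrow> real \<Rightarrow> real \<Rightarrow> real \<Rightarrow> real \<Rightarrow> real \<Rightarrow> real \<Rightarrow> real \<Rightarrow> real \<Rightarrow> real \<Rightarrow> state \<Rightarrow> state \<Rightarrow> real"
  where "energy_form L \<rho>\<^sub>1 \<rho>\<^sub>2 \<rho>\<^sub>3 \<kappa> b \<delta> \<tau> \<sigma> \<xi> \<epsilon> x y =
    wave_form L \<rho>\<^sub>1 \<kappa> \<epsilon> \<tau> (fst x) (fst (snd x)) (fst y) (fst (snd y))
    + wave_form L \<rho>\<^sub>2 b \<epsilon> \<sigma> (fst (snd (snd x))) (fst (snd (snd (snd x))))
        (fst (snd (snd y))) (fst (snd (snd (snd y))))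
    + wave_form L \<rho>\<^sub>3 \<delta> \<epsilon> \<xi> (fst (snd (snd (snd (snd x))))) (snd (snd (snd (snd (snd x)))))
        (fst (snd (snd (snd (snd y))))) (snd (snd (snd (snd (snd y)))))"

lemma energy_form_bounded_bilinear:
  assumes "0 < L" "1/2 \<le> \<tau>" "1/2 \<le> \<sigma>" "1/2 \<le> \<xi>"
  shows "bounded_bilinear (energy_form L \<rho>\<^sub>1 \<rho>\<^sub>2 \<rho>\<^sub>3 \<kappa> b \<delta> \<tau> \<sigma> \<xi> \<epsilon>)"
proof -
  note bl = bounded_linear_fst_comp bounded_linear_snd_comp bounded_linear_fst bounded_linear_snd
  have "bounded_bilinear (\<lambda>x y. energy_form L \<rho>\<^sub>1 \<rho>\<^sub>2 \<rho>\<^sub>3 \<kappa> b \<delta> \<tau> \<sigma> \<xi> \<epsilon> x y)"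
    unfolding energy_form_def
    by (intro bounded_bilinear_add wave_form_bounded_bilinear assms bl)
  then show ?thesis .
qed

lemma wave_form_sym: "wave_form L \<rho> k \<epsilon> \<tau> v w v' w' = wave_form L \<rho> k \<epsilon> \<tau> v' w' v w"
  by (simp add: wave_form_def inner_commute add.commute)

lemma energy_form_sym:
  "energy_form L \<rho>\<^sub>1 \<rho>\<^sub>2 \<rho>\<^sub>3 \<kappa> b \<delta> \<tau> \<sigma> \<xi> \<epsilon> x y = energy_form L \<rho>\<^sub>1 \<rho>\<^sub>2 \<rho>\<^sub>3 \<kappa> b \<delta> \<tau> \<sigma> \<xi> \<epsilon> y x"
  unfolding energy_form_def by (subst (1 2 3) wave_form_sym) (rule refl)

lemma norm_state:
  "(norm (x :: state))\<^sup>2 = (norm (fst x))\<^sup>2 + (norm (fst (snd x)))\<^sup>2 + (norm (fst (snd (snd x))))\<^sup>2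
    + (norm (fst (snd (snd (snd x)))))\<^sup>2 + (norm (fst (snd (snd (snd (snd x))))))\<^sup>2
    + (norm (snd (snd (snd (snd (snd x))))))\<^sup>2"
  by (simp add: norm_prod_def)

lemma energy_form_coercive:
  assumes "0 < L" "1/2 \<le> \<tau>" "\<tau> \<le> 1" "1/2 \<le> \<sigma>" "\<sigma> \<le> 1" "1/2 \<le> \<xi>" "\<xi> \<le> 1"
    and pos: "0 < \<rho>\<^sub>1" "0 < \<rho>\<^sub>2" "0 < \<rho>\<^sub>3" "0 < \<kappa>" "0 < b" "0 < \<delta>" "0 \<le> \<epsilon>"
    and small: "4 * \<epsilon>\<^sup>2 * \<rho>\<^sub>1 * (embedding_const L)\<^sup>2 \<le> \<kappa>" "4 * \<epsilon>\<^sup>2 * \<rho>\<^sub>2 * (embedding_const L)\<^sup>2 \<le> b"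
      "4 * \<epsilon>\<^sup>2 * \<rho>\<^sub>3 * (embedding_const L)\<^sup>2 \<le> \<delta>"
    and m: "2 * m \<le> \<rho>\<^sub>1" "2 * m \<le> \<rho>\<^sub>2" "2 * m \<le> \<rho>\<^sub>3" "2 * m \<le> \<kappa>" "2 * m \<le> b" "2 * m \<le> \<delta>"
  shows "m * (norm x)\<^sup>2 \<le> energy_form L \<rho>\<^sub>1 \<rho>\<^sub>2 \<rho>\<^sub>3 \<kappa> b \<delta> \<tau> \<sigma> \<xi> \<epsilon> x x"
proof -
  have c: "m * (norm w)\<^sup>2 + m * (norm v)\<^sup>2 \<le> wave_form L \<rho> k \<epsilon> \<tau> v w v w"
    if "1/2 \<le> \<tau>" "\<tau> \<le> 1" "0 < \<rho>" "0 < k" "4 * \<epsilon>\<^sup>2 * \<rho> * (embedding_const L)\<^sup>2 \<le> k" "2 * m \<le> \<rho>" "2 * m \<le> k"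
    for \<rho> k \<tau> v w
  proof -
    have "m * (norm w)\<^sup>2 \<le> \<rho> / 2 * (norm w)\<^sup>2" "m * (norm v)\<^sup>2 \<le> k / 2 * (norm v)\<^sup>2"
      by (rule mult_right_mono, use that in linarith, simp)+
    then show ?thesis
      using wave_form_coercive[OF assms(1) that(1-4) pos(7) that(5), of w v] by linarith
  qed
  show ?thesis
    unfolding energy_form_def norm_state distrib_left
    using c[OF assms(2,3) pos(1,4) small(1) m(1,4), of "fst (snd x)" "fst x"]
      c[OF assms(4,5) pos(2,5) small(2) m(2,5), of "fst (snd (snd (snd x)))" "fst (snd (snd x))"]
      c[OF assms(6,7) pos(3,6) small(3) m(3,6), of "snd (snd (snd (snd (snd x))))" "fst (snd (snd (snd (snd x))))"]
    by linarith
qed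

locale timoshenko =
  fixes L \<rho>\<^sub>1 \<rho>\<^sub>2 \<rho>\<^sub>3 \<kappa> b \<gamma> \<delta> \<mu> \<mu>\<^sub>1 \<mu>\<^sub>2 \<tau> \<sigma> \<xi> :: real
  assumes L: "0 < L"
    and pos: "0 < \<rho>\<^sub>1" "0 < \<rho>\<^sub>2" "0 < \<rho>\<^sub>3" "0 < \<kappa>" "0 < b" "0 < \<gamma>" "0 < \<delta>" "0 < \<mu>" "0 < \<mu>\<^sub>1" "0 < \<mu>\<^sub>2"
    and \<tau>: "1/2 \<le> \<tau>" "\<tau> \<le> 1" and \<sigma>: "1/2 \<le> \<sigma>" "\<sigma> \<le> 1" and \<xi>: "1/2 \<le> \<xi>" "\<xi> \<le> 1"
begin

abbreviation "domB \<equiv> dom_B2 L \<tau> \<sigma> \<xi>"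
abbreviation "opB \<equiv> B2 L \<rho>\<^sub>1 \<rho>\<^sub>2 \<rho>\<^sub>3 \<kappa> b \<gamma> \<delta> \<mu> \<mu>\<^sub>1 \<mu>\<^sub>2 \<tau> \<sigma> \<xi>"
abbreviation "form \<equiv> energy_form L \<rho>\<^sub>1 \<rho>\<^sub>2 \<rho>\<^sub>3 \<kappa> b \<delta> \<tau> \<sigma> \<xi>"
abbreviation "Kc \<equiv> embedding_const L"

text \<open>The quantities that the corrected energy dissipates.\<close>

definition size_sq :: "state \<Rightarrow> real"
  where "size_sq = (\<lambda>(\<phi>, \<Phi>, \<psi>, \<Psi>, \<theta>, \<Theta>).
    (norm (op_A_pow L (1 - \<tau>/2) \<phi>))\<^sup>2 + (norm (op_A_pow L (\<tau>/2) \<Phi>))\<^sup>2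
    + (norm (op_A_pow L (1 - \<sigma>/2) \<psi>))\<^sup>2 + (norm (op_A_pow L (\<sigma>/2) \<Psi>))\<^sup>2
    + (norm (op_A_pow L (1 - \<xi>/2) \<theta>))\<^sup>2 + (norm (op_A_pow L (\<xi>/2) \<Theta>))\<^sup>2)"

definition lower_const :: real
  where "lower_const = (2 * \<kappa> + \<kappa> * Kc + 2 * \<mu>) * (2 * Kc)"

lemma dom_iff: "(\<phi>, \<Phi>, \<psi>, \<Psi>, \<theta>, \<Theta>) \<in> domB \<longleftrightarrow>
    wave_pair L \<tau> \<phi> \<Phi> \<and> wave_pair L \<sigma> \<psi> \<Psi> \<and> wave_pair L \<xi> \<theta> \<Theta>"
  by (auto simp: dom_B2_def wave_pair_def)

text \<open>
  Each component is brought to the form to which the estimates for a single wave equation apply: the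
  principal part and the damping are separated from the coupling, which is treated as a force.
\<close>

lemma form_op:
  assumes "(\<phi>, \<Phi>, \<psi>, \<Psi>, \<theta>, \<Theta>) \<in> domB"
  shows "form \<epsilon> (coords L (opB (\<phi>, \<Phi>, \<psi>, \<Psi>, \<theta>, \<Theta>))) (coords L (\<phi>', \<Phi>', \<psi>', \<Psi>', \<theta>', \<Theta>')) =
    wave_form L \<rho>\<^sub>1 \<kappa> \<epsilon> \<tau> (op_A_pow L (1/2) \<Phi>)
      ((1 / \<rho>\<^sub>1) *\<^sub>R ((\<kappa> *\<^sub>R weak_derivative L \<psi> - \<mu> *\<^sub>R weak_derivative L \<Theta>)
        - \<kappa> *\<^sub>R op_A L \<phi> - \<mu>\<^sub>1 *\<^sub>R op_A_pow L \<tau> \<Phi>)) (op_A_pow L (1/2) \<phi>') \<Phi>'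
    + wave_form L \<rho>\<^sub>2 b \<epsilon> \<sigma> (op_A_pow L (1/2) \<Psi>)
      ((1 / \<rho>\<^sub>2) *\<^sub>R ((\<mu> *\<^sub>R \<Theta> - \<kappa> *\<^sub>R weak_derivative L \<phi> - \<kappa> *\<^sub>R \<psi>)
        - b *\<^sub>R op_A L \<psi> - \<mu>\<^sub>2 *\<^sub>R op_A_pow L \<sigma> \<Psi>)) (op_A_pow L (1/2) \<psi>') \<Psi>'
    + wave_form L \<rho>\<^sub>3 \<delta> \<epsilon> \<xi> (op_A_pow L (1/2) \<Theta>)
      ((1 / \<rho>\<^sub>3) *\<^sub>R ((- \<mu> *\<^sub>R weak_derivative L \<Phi> - \<mu> *\<^sub>R \<Psi>)
        - \<delta> *\<^sub>R op_A L \<theta> - \<gamma> *\<^sub>R op_A_pow L \<xi> \<Theta>)) (op_A_pow L (1/2) \<theta>') \<Theta>'"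
proof -
  have h: "weak_derivative L \<phi> \<in> H1 L" "\<psi> \<in> H1 L"
    using assms by (auto simp: dom_B2_def dom_A_def H2_def H10_def)
  have "weak_derivative L (weak_derivative L \<phi> + \<psi>) = weak_derivative L \<psi> - op_A L \<phi>"
    by (simp add: weak_derivative_add(2)[OF h] op_A_def)
  then have w1: "\<kappa> *\<^sub>R weak_derivative L (weak_derivative L \<phi> + \<psi>) - \<mu> *\<^sub>R weak_derivative L \<Theta> - \<mu>\<^sub>1 *\<^sub>R op_A_pow L \<tau> \<Phi>
      = (\<kappa> *\<^sub>R weak_derivative L \<psi> - \<mu> *\<^sub>R weak_derivative L \<Theta>) - \<kappa> *\<^sub>R op_A L \<phi> - \<mu>\<^sub>1 *\<^sub>R op_A_pow L \<tau> \<Phi>"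
    by (simp add: scaleR_diff_right)
  have w2: "- (b *\<^sub>R op_A L \<psi>) - \<kappa> *\<^sub>R (weak_derivative L \<phi> + \<psi>) + \<mu> *\<^sub>R \<Theta> - \<mu>\<^sub>2 *\<^sub>R op_A_pow L \<sigma> \<Psi>
      = (\<mu> *\<^sub>R \<Theta> - \<kappa> *\<^sub>R weak_derivative L \<phi> - \<kappa> *\<^sub>R \<psi>) - b *\<^sub>R op_A L \<psi> - \<mu>\<^sub>2 *\<^sub>R op_A_pow L \<sigma> \<Psi>"
    by (simp add: scaleR_add_right)
  have w3: "- (\<delta> *\<^sub>R op_A L \<theta>) - \<mu> *\<^sub>R (weak_derivative L \<Phi> + \<Psi>) - \<gamma> *\<^sub>R op_A_pow L \<xi> \<Theta>
      = (- \<mu> *\<^sub>R weak_derivative L \<Phi> - \<mu> *\<^sub>R \<Psi>) - \<delta> *\<^sub>R op_A L \<theta> - \<gamma> *\<^sub>R op_A_pow L \<xi> \<Theta>"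
    by (simp add: scaleR_add_right)
  show ?thesis
    by (simp only: energy_form_def coords_def B2_def prod.case fst_conv snd_conv w1 w2 w3)
qed

lemma coords_components:
  fixes \<phi> \<Phi> \<psi> \<Psi> \<theta> \<Theta> :: l2
  defines "n \<equiv> norm (coords L (\<phi>, \<Phi>, \<psi>, \<Psi>, \<theta>, \<Theta>))"
  shows "norm (op_A_pow L (1/2) \<phi>) \<le> n" "norm \<Phi> \<le> n" "norm (op_A_pow L (1/2) \<psi>) \<le> n" "norm \<Psi> \<le> n"
    "norm (op_A_pow L (1/2) \<theta>) \<le> n" "norm \<Theta> \<le> n"
  unfolding n_def by (rule power2_le_imp_le; simp add: norm_state coords_def)+

lemma multiplier_norm:
  assumes "1/2 \<le> s" "s \<le> 1" "0 \<le> \<epsilon>" "\<epsilon> \<le> 1" "wave_pair L s \<phi> \<Phi>"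
    "norm \<Phi> \<le> n" "norm (op_A_pow L (1/2) \<phi>) \<le> n"
  shows "norm (multiplier L \<epsilon> s \<phi> \<Phi>) \<le> 2 * Kc * n"
proof -
  have K: "1 \<le> Kc" by (rule embedding_const_ge_1[OF L])
  have "Kc * norm (op_A_pow L (1/2) \<phi>) \<le> Kc * n" using K assms(7) by (intro mult_left_mono) auto
  moreover have "1 * n \<le> Kc * n"
    using K assms(6) norm_ge_zero[of \<Phi>] by (intro mult_right_mono) linarith+
  ultimately show ?thesis
    using multiplier_bounds(3)[OF L assms(1-5)] assms(6) by linarith
qed

text \<open>
  The last summand cancels the two coupling terms \<open>\<Theta>\<^sub>x\<close> and \<open>\<Phi>\<^sub>x\<close>, which involve derivatives of
  velocities. What remains of the coupling is bounded in the energy norm.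
\<close>

lemma lower_order_bound:
  assumes U: "(\<phi>, \<Phi>, \<psi>, \<Psi>, \<theta>, \<Theta>) \<in> domB" and U': "(\<phi>', \<Phi>', \<psi>', \<Psi>', \<theta>', \<Theta>') \<in> domB"
    and \<epsilon>: "0 \<le> \<epsilon>" "\<epsilon> \<le> 1"
  defines "n \<equiv> norm (coords L (\<phi>, \<Phi>, \<psi>, \<Psi>, \<theta>, \<Theta>))"
    and "n' \<equiv> norm (coords L (\<phi>', \<Phi>', \<psi>', \<Psi>', \<theta>', \<Theta>'))"
    and "Z1 \<equiv> multiplier L \<epsilon> \<tau> \<phi>' \<Phi>'" and "Z2 \<equiv> multiplier L \<epsilon> \<sigma> \<psi>' \<Psi>'" and "Z3 \<equiv> multiplier L \<epsilon> \<xi> \<theta>' \<Theta>'"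
  shows "\<bar>inner (\<kappa> *\<^sub>R weak_derivative L \<psi> - \<mu> *\<^sub>R weak_derivative L \<Theta>) Z1
      + inner (\<mu> *\<^sub>R \<Theta> - \<kappa> *\<^sub>R weak_derivative L \<phi> - \<kappa> *\<^sub>R \<psi>) Z2
      + inner (- \<mu> *\<^sub>R weak_derivative L \<Phi> - \<mu> *\<^sub>R \<Psi>) Z3
      + \<mu> * (inner (weak_derivative L \<Theta>) Z1 + inner (weak_derivative L \<Phi>) Z3)\<bar>
    \<le> lower_const * (n * n')"
proof -
  have w: "wave_pair L \<tau> \<phi> \<Phi>" "wave_pair L \<sigma> \<psi> \<Psi>" "wave_pair L \<xi> \<theta> \<Theta>"
    "wave_pair L \<tau> \<phi>' \<Phi>'" "wave_pair L \<sigma> \<psi>' \<Psi>'" "wave_pair L \<xi> \<theta>' \<Theta>'"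
    using U U' by (auto simp: dom_iff)
  note c = coords_components[where \<phi> = \<phi> and \<Phi> = \<Phi> and \<psi> = \<psi> and \<Psi> = \<Psi> and \<theta> = \<theta> and \<Theta> = \<Theta>, folded n_def]
  note c' = coords_components[where \<phi> = \<phi>' and \<Phi> = \<Phi>' and \<psi> = \<psi>' and \<Psi> = \<Psi>' and \<theta> = \<theta>' and \<Theta> = \<Theta>', folded n'_def]
  have K: "1 \<le> Kc" by (rule embedding_const_ge_1[OF L])
  have n: "0 \<le> n" "0 \<le> n'" by (simp_all add: n_def n'_def)
  have Z: "norm Z1 \<le> 2 * Kc * n'" "norm Z2 \<le> 2 * Kc * n'" "norm Z3 \<le> 2 * Kc * n'"
    unfolding Z1_def Z2_def Z3_def
    by (rule multiplier_norm[OF \<tau> \<epsilon> w(4) c'(2,1)] multiplier_norm[OF \<sigma> \<epsilon> w(5) c'(4,3)]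
        multiplier_norm[OF \<xi> \<epsilon> w(6) c'(6,5)])+
  have d: "norm (weak_derivative L \<phi>) \<le> n" "norm (weak_derivative L \<psi>) \<le> n"
    using form_domain_derivative(2)[OF L wave_pair_summable(5)[OF L w(1)]]
      form_domain_derivative(2)[OF L wave_pair_summable(5)[OF L w(2)]] c by auto
  have \<psi>: "norm \<psi> \<le> Kc * n"
  proof -
    have "norm (op_A_pow L 0 \<psi>) \<le> Kc * norm (op_A_pow L (1/2) \<psi>)"
      using wave_pair_summable(1)[OF L w(2), of "1/2"] by (intro norm_op_A_pow_embedding[OF L]) auto
    also have "\<dots> \<le> Kc * n" using K c(3) by (intro mult_left_mono) auto
    finally show ?thesis using op_A_pow_0[OF L wave_pair_summable(3)[OF L w(2)]] by simp
  qed
  have ib: "r * \<bar>inner u z\<bar> \<le> (r * a) * (2 * Kc) * (n * n')"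
    if "0 \<le> r" "norm u \<le> a * n" "norm z \<le> 2 * Kc * n'" "0 \<le> a" for r a and u z :: l2
  proof -
    have "\<bar>inner u z\<bar> \<le> (a * n) * (2 * Kc * n')"
      by (rule order_trans[OF Cauchy_Schwarz_ineq2 mult_mono]) (use that n in auto)
    from mult_left_mono[OF this that(1)] show ?thesis by (simp add: mult_ac)
  qed
  let ?E = "\<kappa> * inner (weak_derivative L \<psi>) Z1 + \<mu> * inner \<Theta> Z2 - \<kappa> * inner (weak_derivative L \<phi>) Z2
    - \<kappa> * inner \<psi> Z2 - \<mu> * inner \<Psi> Z3"
  have "inner (\<kappa> *\<^sub>R weak_derivative L \<psi> - \<mu> *\<^sub>R weak_derivative L \<Theta>) Z1
      + inner (\<mu> *\<^sub>R \<Theta> - \<kappa> *\<^sub>R weak_derivative L \<phi> - \<kappa> *\<^sub>R \<psi>) Z2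
      + inner (- \<mu> *\<^sub>R weak_derivative L \<Phi> - \<mu> *\<^sub>R \<Psi>) Z3
      + \<mu> * (inner (weak_derivative L \<Theta>) Z1 + inner (weak_derivative L \<Phi>) Z3) = ?E"
    by (simp add: inner_diff_left algebra_simps)
  moreover have "\<bar>?E\<bar> \<le> \<kappa> * \<bar>inner (weak_derivative L \<psi>) Z1\<bar> + \<mu> * \<bar>inner \<Theta> Z2\<bar>
      + \<kappa> * \<bar>inner (weak_derivative L \<phi>) Z2\<bar> + \<kappa> * \<bar>inner \<psi> Z2\<bar> + \<mu> * \<bar>inner \<Psi> Z3\<bar>"
  proof -
    have *: "\<bar>r * t\<bar> = r * \<bar>t\<bar>" if "0 < r" for r t :: real using that by (simp add: abs_mult)
    show ?thesis unfolding *[OF pos(4), symmetric] *[OF pos(8), symmetric] by linarith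
  qed
  moreover have "\<kappa> * \<bar>inner (weak_derivative L \<psi>) Z1\<bar> \<le> (\<kappa> * 1) * (2 * Kc) * (n * n')"
    "\<mu> * \<bar>inner \<Theta> Z2\<bar> \<le> (\<mu> * 1) * (2 * Kc) * (n * n')"
    "\<kappa> * \<bar>inner (weak_derivative L \<phi>) Z2\<bar> \<le> (\<kappa> * 1) * (2 * Kc) * (n * n')"
    "\<kappa> * \<bar>inner \<psi> Z2\<bar> \<le> (\<kappa> * Kc) * (2 * Kc) * (n * n')"
    "\<mu> * \<bar>inner \<Psi> Z3\<bar> \<le> (\<mu> * 1) * (2 * Kc) * (n * n')"
    by (rule ib; (use pos K d \<psi> c Z in simp))+
  ultimately show ?thesis unfolding lower_const_def by (simp add: distrib_right)
qed

definition total_size :: "state \<Rightarrow> real"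
  where "total_size U = sqrt (size_sq U + (norm (coords L U))\<^sup>2)"

lemma total_size_sq: "(total_size U)\<^sup>2 = size_sq U + (norm (coords L U))\<^sup>2"
proof -
  have "0 \<le> size_sq U" by (simp add: size_sq_def split: prod.split)
  then show ?thesis by (simp add: total_size_def)
qed

lemma total_size_nonneg: "0 \<le> total_size U"
proof -
  have "0 \<le> size_sq U" by (simp add: size_sq_def split: prod.split)
  then show ?thesis by (simp add: total_size_def)
qed

lemma total_size_components:
  fixes \<phi> \<Phi> \<psi> \<Psi> \<theta> \<Theta> :: l2
  defines "S \<equiv> total_size (\<phi>, \<Phi>, \<psi>, \<Psi>, \<theta>, \<Theta>)"
  shows "norm (op_A_pow L (1 - \<tau>/2) \<phi>) \<le> S" "norm (op_A_pow L (\<tau>/2) \<Phi>) \<le> S"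
    "norm (op_A_pow L (1 - \<sigma>/2) \<psi>) \<le> S" "norm (op_A_pow L (\<sigma>/2) \<Psi>) \<le> S"
    "norm (op_A_pow L (1 - \<xi>/2) \<theta>) \<le> S" "norm (op_A_pow L (\<xi>/2) \<Theta>) \<le> S"
  unfolding S_def
  by (rule power2_le_imp_le[OF _ total_size_nonneg]; simp add: total_size_sq size_sq_def)+

lemma coords_le_total_size: "norm (coords L U) \<le> total_size U"
  by (rule power2_le_imp_le[OF _ total_size_nonneg])
    (simp add: total_size_sq size_sq_def split: prod.split)

definition bound_const :: real
  where "bound_const = (3 * \<kappa> + 2 * \<mu>\<^sub>1 + \<rho>\<^sub>1 * Kc\<^sup>2) + (3 * b + 2 * \<mu>\<^sub>2 + \<rho>\<^sub>2 * Kc\<^sup>2)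
    + (3 * \<delta> + 2 * \<gamma> + \<rho>\<^sub>3 * Kc\<^sup>2) + lower_const + 4 * \<mu> * Kc\<^sup>2"

text \<open>
  The principal parts are bounded by the lemma on a single wave equation and the bounded couplings by the
  energy norm; for \<open>\<Theta>\<^sub>x\<close> and \<open>\<Phi>\<^sub>x\<close>, which are neither, the estimate in the scale of \<open>A\<^sup>1\<^sup>/\<^sup>4\<close> is used.
\<close>

lemma form_bounded:
  assumes U: "U \<in> domB" and U': "U' \<in> domB" and \<epsilon>: "0 \<le> \<epsilon>" "\<epsilon> \<le> 1"
  shows "\<bar>form \<epsilon> (coords L (opB U)) (coords L U')\<bar> \<le> bound_const * (total_size U * total_size U')"
proof -
  obtain \<phi> \<Phi> \<psi> \<Psi> \<theta> \<Theta> where Ueq: "U = (\<phi>, \<Phi>, \<psi>, \<Psi>, \<theta>, \<Theta>)" by (cases U)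
  obtain \<phi>' \<Phi>' \<psi>' \<Psi>' \<theta>' \<Theta>' where Ueq': "U' = (\<phi>', \<Phi>', \<psi>', \<Psi>', \<theta>', \<Theta>')" by (cases U')
  have w: "wave_pair L \<tau> \<phi> \<Phi>" "wave_pair L \<sigma> \<psi> \<Psi>" "wave_pair L \<xi> \<theta> \<Theta>"
    "wave_pair L \<tau> \<phi>' \<Phi>'" "wave_pair L \<sigma> \<psi>' \<Psi>'" "wave_pair L \<xi> \<theta>' \<Theta>'"
    using U U' by (auto simp: dom_iff Ueq Ueq')
  define S where "S = total_size U"
  define S' where "S' = total_size U'"
  have S0: "0 \<le> S" "0 \<le> S'" by (simp_all add: S_def S'_def total_size_nonneg)
  note t = total_size_components[where \<phi> = \<phi> and \<Phi> = \<Phi> and \<psi> = \<psi> and \<Psi> = \<Psi> and \<theta> = \<theta> and \<Theta> = \<Theta>, folded Ueq S_def]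
  note t' = total_size_components[where \<phi> = \<phi>' and \<Phi> = \<Phi>' and \<psi> = \<psi>' and \<Psi> = \<Psi>' and \<theta> = \<theta>' and \<Theta> = \<Theta>', folded Ueq' S'_def]
  have K: "1 \<le> Kc" by (rule embedding_const_ge_1[OF L])
  let ?Z1 = "multiplier L \<epsilon> \<tau> \<phi>' \<Phi>'" and ?Z3 = "multiplier L \<epsilon> \<xi> \<theta>' \<Theta>'"
  have main: "\<bar>inner (weak_derivative L \<Theta>) ?Z1\<bar> \<le> 2 * Kc\<^sup>2 * (S * S')"
    "\<bar>inner (weak_derivative L \<Phi>) ?Z3\<bar> \<le> 2 * Kc\<^sup>2 * (S * S')"
  proof -
    have *: "\<bar>inner (weak_derivative L u) z\<bar> \<le> 2 * Kc\<^sup>2 * (S * S')"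
      if "u \<in> dom_A_pow L (1/2)" "z \<in> dom_A_pow L (1/2)" "norm (op_A_pow L (1/4) u) \<le> Kc * y" "y \<le> S"
        "norm (op_A_pow L (1/4) z) \<le> Kc * (y' + x')" "y' \<le> S'" "x' \<le> S'" for u z y y' x'
    proof -
      have "Kc * y \<le> Kc * S" "Kc * (y' + x') \<le> Kc * (2 * S')"
        using that K by (auto intro!: mult_left_mono)
      then have "norm (op_A_pow L (1/4) u) \<le> Kc * S" "norm (op_A_pow L (1/4) z) \<le> Kc * (2 * S')"
        using that(3,5) by linarith+
      then have "norm (op_A_pow L (1/4) u) * norm (op_A_pow L (1/4) z) \<le> (Kc * S) * (Kc * (2 * S'))"
        using K S0 by (intro mult_mono) auto
      then show ?thesis using coupling_bound[OF L that(1,2)] by (simp add: power2_eq_square mult_ac)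
    qed
    show "\<bar>inner (weak_derivative L \<Theta>) ?Z1\<bar> \<le> 2 * Kc\<^sup>2 * (S * S')"
      by (rule *[OF wave_pair_summable(6)[OF L w(3)] multiplier_bounds(2)[OF L \<tau> \<epsilon> w(4)]
            multiplier_bounds(5)[OF L \<xi> \<epsilon> w(3)] t(6) multiplier_bounds(6)[OF L \<tau> \<epsilon> w(4)] t'(2,1)])
    show "\<bar>inner (weak_derivative L \<Phi>) ?Z3\<bar> \<le> 2 * Kc\<^sup>2 * (S * S')"
      by (rule *[OF wave_pair_summable(6)[OF L w(1)] multiplier_bounds(2)[OF L \<xi> \<epsilon> w(6)]
            multiplier_bounds(5)[OF L \<tau> \<epsilon> w(1)] t(2) multiplier_bounds(6)[OF L \<xi> \<epsilon> w(6)] t'(6,5)])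
  qed
  have "lower_const * (norm (coords L U) * norm (coords L U')) \<le> lower_const * (S * S')"
    using pos K S0 unfolding S_def S'_def lower_const_def
    by (intro mult_left_mono mult_mono coords_le_total_size) auto
  note low = order_trans[OF lower_order_bound[OF U[unfolded Ueq] U'[unfolded Ueq'] \<epsilon>, folded Ueq Ueq'] this]
  have m: "\<mu> * \<bar>inner (weak_derivative L \<Theta>) ?Z1 + inner (weak_derivative L \<Phi>) ?Z3\<bar> \<le> \<mu> * (4 * Kc\<^sup>2 * (S * S'))"
    using main pos(8) by (intro mult_left_mono) auto
  have m': "\<bar>\<mu> * (inner (weak_derivative L \<Theta>) ?Z1 + inner (weak_derivative L \<Phi>) ?Z3)\<bar> \<le> 4 * \<mu> * Kc\<^sup>2 * (S * S')"
    using m pos(8) by (simp add: abs_mult mult_ac)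
  note wb = wave_form_bounded[OF L \<tau> pos(1) less_imp_le[OF pos(9)] less_imp_le[OF pos(4)] \<epsilon> w(1,4) t(1,2) t'(1,2)]
    wave_form_bounded[OF L \<sigma> pos(2) less_imp_le[OF pos(10)] less_imp_le[OF pos(5)] \<epsilon> w(2,5) t(3,4) t'(3,4)]
    wave_form_bounded[OF L \<xi> pos(3) less_imp_le[OF pos(6)] less_imp_le[OF pos(7)] \<epsilon> w(3,6) t(5,6) t'(5,6)]
  have arith: "\<bar>a1 + a2 + a3\<bar> \<le> (c1 + c2 + c3 + l + e) * P"
    if "\<bar>a1 - i1\<bar> \<le> c1 * P" "\<bar>a2 - i2\<bar> \<le> c2 * P" "\<bar>a3 - i3\<bar> \<le> c3 * P" "\<bar>i1 + i2 + i3 + j\<bar> \<le> l * P" "\<bar>j\<bar> \<le> e * P"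
    for a1 a2 a3 i1 i2 i3 j c1 c2 c3 l e P :: real
    using that unfolding distrib_right by linarith
  show ?thesis
    unfolding Ueq Ueq' form_op[OF U[unfolded Ueq]] unfolding Ueq[symmetric] Ueq'[symmetric] S_def[symmetric] S'_def[symmetric] bound_const_def
    by (rule arith[OF wb low m'])
qed

text \<open>
  The coefficient with which, after applying Young's inequality with the parameter \<open>k\<close>, the squares of the
  velocity terms reappear in the part of the form that carries the factor \<open>\<epsilon>\<close>.
\<close>

definition absorb_const :: "real \<Rightarrow> real"
  where "absorb_const k = (\<rho>\<^sub>1 + \<rho>\<^sub>2 + \<rho>\<^sub>3) * Kc\<^sup>2 + (\<mu>\<^sub>1\<^sup>2 + \<mu>\<^sub>2\<^sup>2 + \<gamma>\<^sup>2) / k + (\<mu> * Kc\<^sup>2)\<^sup>2 / k"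

text \<open>
  The first order coupling between displacement and temperature is skew, so that only its pairing
  with the correction of the energy survives in the quadratic form, where it carries the factor \<open>\<epsilon>\<close>.
\<close>

lemma form_diagonal:
  assumes U: "U \<in> domB" and \<epsilon>: "0 \<le> \<epsilon>" "\<epsilon> \<le> 1"
    and k: "0 < k" "k \<le> \<kappa>" "k \<le> b" "k \<le> \<delta>" and d: "d \<le> \<mu>\<^sub>1" "d \<le> \<mu>\<^sub>2" "d \<le> \<gamma>"
    and small: "\<epsilon> * absorb_const k \<le> d / 2" and c: "c \<le> d / 2" "c \<le> \<epsilon> * k / 2"
  shows "form \<epsilon> (coords L (opB U)) (coords L U) \<le> - c * size_sq U + lower_const * (norm (coords L U))\<^sup>2"
proof -
  obtain \<phi> \<Phi> \<psi> \<Psi> \<theta> \<Theta> where Ueq: "U = (\<phi>, \<Phi>, \<psi>, \<Psi>, \<theta>, \<Theta>)" by (cases U)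
  have w: "wave_pair L \<tau> \<phi> \<Phi>" "wave_pair L \<sigma> \<psi> \<Psi>" "wave_pair L \<xi> \<theta> \<Theta>"
    using U by (auto simp: dom_iff Ueq)
  have K: "1 \<le> Kc" by (rule embedding_const_ge_1[OF L])
  define X1 Y1 X2 Y2 X3 Y3 where "X1 = norm (op_A_pow L (1 - \<tau>/2) \<phi>)" "Y1 = norm (op_A_pow L (\<tau>/2) \<Phi>)"
    "X2 = norm (op_A_pow L (1 - \<sigma>/2) \<psi>)" "Y2 = norm (op_A_pow L (\<sigma>/2) \<Psi>)"
    "X3 = norm (op_A_pow L (1 - \<xi>/2) \<theta>)" "Y3 = norm (op_A_pow L (\<xi>/2) \<Theta>)"
  note XY = this
  have XY0: "0 \<le> X1" "0 \<le> Y1" "0 \<le> X3" "0 \<le> Y3" by (simp_all add: XY)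
  let ?Z1 = "multiplier L \<epsilon> \<tau> \<phi> \<Phi>" and ?Z3 = "multiplier L \<epsilon> \<xi> \<theta> \<Theta>"
  let ?a = "op_A_pow L (1 - \<tau>) \<phi>" and ?t = "op_A_pow L (1 - \<xi>) \<theta>"
  have cross: "\<bar>inner (weak_derivative L \<Theta>) ?a\<bar> \<le> Kc\<^sup>2 * X1 * Y3" "\<bar>inner (weak_derivative L \<Phi>) ?t\<bar> \<le> Kc\<^sup>2 * X3 * Y1"
  proof -
    have *: "\<bar>inner (weak_derivative L u) z\<bar> \<le> Kc\<^sup>2 * x * y"
      if "u \<in> dom_A_pow L (1/2)" "z \<in> dom_A_pow L (1/2)" "norm (op_A_pow L (1/4) u) \<le> Kc * y"
        "norm (op_A_pow L (1/4) z) \<le> Kc * x" "0 \<le> y" for u z y x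
    proof -
      have "norm (op_A_pow L (1/4) u) * norm (op_A_pow L (1/4) z) \<le> (Kc * y) * (Kc * x)"
        using that K by (intro mult_mono) auto
      then show ?thesis using coupling_bound[OF L that(1,2)] by (simp add: power2_eq_square mult_ac)
    qed
    show "\<bar>inner (weak_derivative L \<Theta>) ?a\<bar> \<le> Kc\<^sup>2 * X1 * Y3"
      using multiplier_bounds(5)[OF L \<xi> \<epsilon> w(3)] multiplier_bounds(4)[OF L \<tau> \<epsilon> w(1)] XY0(4)
      unfolding XY
      by (rule *[OF wave_pair_summable(6)[OF L w(3)] multiplier_bounds(1)[OF L \<tau> \<epsilon> w(1)]])
    show "\<bar>inner (weak_derivative L \<Phi>) ?t\<bar> \<le> Kc\<^sup>2 * X3 * Y1"
      using multiplier_bounds(5)[OF L \<tau> \<epsilon> w(1)] multiplier_bounds(4)[OF L \<xi> \<epsilon> w(3)] XY0(2)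
      unfolding XY
      by (rule *[OF wave_pair_summable(6)[OF L w(1)] multiplier_bounds(1)[OF L \<xi> \<epsilon> w(3)]])
  qed
  have "inner (weak_derivative L \<Theta>) ?Z1 + inner (weak_derivative L \<Phi>) ?Z3
      = \<epsilon> * (inner (weak_derivative L \<Theta>) ?a + inner (weak_derivative L \<Phi>) ?t)"
    using coupling_skew[OF L wave_pair_summable(6)[OF L w(3)] wave_pair_summable(6)[OF L w(1)]]
    by (simp add: multiplier_def inner_add_right distrib_left)
  moreover have "\<epsilon> * (- (inner (weak_derivative L \<Theta>) ?a + inner (weak_derivative L \<Phi>) ?t))
      \<le> \<epsilon> * (Kc\<^sup>2 * X1 * Y3 + Kc\<^sup>2 * X3 * Y1)"
    using cross \<epsilon>(1) by (intro mult_left_mono) linarith+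
  ultimately have "- (inner (weak_derivative L \<Theta>) ?Z1 + inner (weak_derivative L \<Phi>) ?Z3)
      \<le> \<epsilon> * (Kc\<^sup>2 * X1 * Y3 + Kc\<^sup>2 * X3 * Y1)" by linarith
  from mult_left_mono[OF this less_imp_le[OF pos(8)]]
  have m: "- (\<mu> * (inner (weak_derivative L \<Theta>) ?Z1 + inner (weak_derivative L \<Phi>) ?Z3))
      \<le> \<epsilon> * (\<mu> * Kc\<^sup>2 * X1 * Y3 + \<mu> * Kc\<^sup>2 * X3 * Y1)" by (simp add: algebra_simps)
  note low = lower_order_bound[OF U[unfolded Ueq] U[unfolded Ueq] \<epsilon>, folded Ueq]
  note wd = wave_form_diagonal[OF L \<tau> pos(1) less_imp_le[OF pos(9)] \<epsilon>(1) w(1), folded XY]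
    wave_form_diagonal[OF L \<sigma> pos(2) less_imp_le[OF pos(10)] \<epsilon>(1) w(2), folded XY]
    wave_form_diagonal[OF L \<xi> pos(3) less_imp_le[OF pos(6)] \<epsilon>(1) w(3), folded XY]
  define N where "N = norm (coords L U) * norm (coords L U)"
  have total: "form \<epsilon> (coords L (opB U)) (coords L U)
    \<le> (- \<mu>\<^sub>1 * Y1\<^sup>2 - \<epsilon> * \<kappa> * X1\<^sup>2 + \<epsilon> * (\<mu>\<^sub>1 * X1 * Y1) + \<epsilon> * (\<rho>\<^sub>1 * Kc\<^sup>2 * Y1\<^sup>2))
    + (- \<mu>\<^sub>2 * Y2\<^sup>2 - \<epsilon> * b * X2\<^sup>2 + \<epsilon> * (\<mu>\<^sub>2 * X2 * Y2) + \<epsilon> * (\<rho>\<^sub>2 * Kc\<^sup>2 * Y2\<^sup>2))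
    + (- \<gamma> * Y3\<^sup>2 - \<epsilon> * \<delta> * X3\<^sup>2 + \<epsilon> * (\<gamma> * X3 * Y3) + \<epsilon> * (\<rho>\<^sub>3 * Kc\<^sup>2 * Y3\<^sup>2))
    + \<epsilon> * (\<mu> * Kc\<^sup>2 * X1 * Y3 + \<mu> * Kc\<^sup>2 * X3 * Y1) + lower_const * N"
  proof -
    have arith: "a1 + a2 + a3 \<le> c1 + c2 + c3 + e + l"
      if "a1 \<le> c1 + i1" "a2 \<le> c2 + i2" "a3 \<le> c3 + i3" "\<bar>i1 + i2 + i3 + j\<bar> \<le> l" "- j \<le> e"
      for a1 a2 a3 i1 i2 i3 j c1 c2 c3 l e :: real
      using that by linarith
    show ?thesis
      unfolding Ueq form_op[OF U[unfolded Ueq]] unfolding Ueq[symmetric] N_def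
      by (rule arith[OF wd low m])
  qed
  define q where "q = (\<mu> * Kc\<^sup>2)\<^sup>2 / k"
  have q0: "0 \<le> q" using k by (simp add: q_def)
  have comp: "- m * Y\<^sup>2 - \<epsilon> * h * X\<^sup>2 + \<epsilon> * (m * X * Y) + \<epsilon> * (r * Kc\<^sup>2 * Y\<^sup>2)
      \<le> - d * Y\<^sup>2 - \<epsilon> * k * X\<^sup>2 + \<epsilon> * (k / 4 * X\<^sup>2 + m\<^sup>2 / k * Y\<^sup>2) + \<epsilon> * (r * Kc\<^sup>2 * Y\<^sup>2)"
    if "d \<le> m" "k \<le> h" for m h r X Y :: real
  proof -
    have "d * Y\<^sup>2 \<le> m * Y\<^sup>2" "\<epsilon> * k * X\<^sup>2 \<le> \<epsilon> * h * X\<^sup>2"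
      using that \<epsilon>(1) by (auto intro!: mult_right_mono mult_left_mono)
    moreover have "\<epsilon> * (m * X * Y) \<le> \<epsilon> * (k / 4 * X\<^sup>2 + m\<^sup>2 / k * Y\<^sup>2)"
      using young_absorb[OF k(1)] \<epsilon>(1) by (intro mult_left_mono)
    moreover have "- m * Y\<^sup>2 \<le> - d * Y\<^sup>2" using calculation(1) by simp
    ultimately show ?thesis by (intro add_mono diff_mono order_refl)
  qed
  have mix: "\<epsilon> * (\<mu> * Kc\<^sup>2 * X1 * Y3 + \<mu> * Kc\<^sup>2 * X3 * Y1)
      \<le> \<epsilon> * ((k / 4 * X1\<^sup>2 + q * Y3\<^sup>2) + (k / 4 * X3\<^sup>2 + q * Y1\<^sup>2))"
    unfolding q_def using young_absorb[OF k(1)] \<epsilon>(1) by (intro mult_left_mono add_mono)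
  have absorb: "- d * Y\<^sup>2 + \<epsilon> * (s * Y\<^sup>2) \<le> - c * Y\<^sup>2" if "s \<le> absorb_const k" for s Y :: real
  proof -
    have "\<epsilon> * s \<le> \<epsilon> * absorb_const k" using that \<epsilon>(1) by (intro mult_left_mono)
    then have "- d + \<epsilon> * s \<le> - c" using small c(1) by linarith
    then have "(- d + \<epsilon> * s) * Y\<^sup>2 \<le> - c * Y\<^sup>2" by (intro mult_right_mono) auto
    then show ?thesis by (simp add: algebra_simps)
  qed
  have keep: "- \<epsilon> * k * X\<^sup>2 + \<epsilon> * (k / 2 * X\<^sup>2) \<le> - c * X\<^sup>2" for X :: real
    using mult_right_mono[OF c(2), of "X\<^sup>2"] by (simp add: algebra_simps)
  have s1: "\<rho>\<^sub>1 * Kc\<^sup>2 + \<mu>\<^sub>1\<^sup>2 / k + q \<le> absorb_const k" "\<rho>\<^sub>2 * Kc\<^sup>2 + \<mu>\<^sub>2\<^sup>2 / k \<le> absorb_const k"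
    "\<rho>\<^sub>3 * Kc\<^sup>2 + \<gamma>\<^sup>2 / k + q \<le> absorb_const k"
  proof -
    have "0 \<le> \<rho>\<^sub>1 * Kc\<^sup>2" "0 \<le> \<rho>\<^sub>2 * Kc\<^sup>2" "0 \<le> \<rho>\<^sub>3 * Kc\<^sup>2" "0 \<le> \<mu>\<^sub>1\<^sup>2 / k" "0 \<le> \<mu>\<^sub>2\<^sup>2 / k" "0 \<le> \<gamma>\<^sup>2 / k"
      using pos k by auto
    then show "\<rho>\<^sub>1 * Kc\<^sup>2 + \<mu>\<^sub>1\<^sup>2 / k + q \<le> absorb_const k" "\<rho>\<^sub>2 * Kc\<^sup>2 + \<mu>\<^sub>2\<^sup>2 / k \<le> absorb_const k"
      "\<rho>\<^sub>3 * Kc\<^sup>2 + \<gamma>\<^sup>2 / k + q \<le> absorb_const k"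
      using q0 unfolding absorb_const_def q_def[symmetric] add_divide_distrib distrib_right by linarith+
  qed
  have keep2: "- \<epsilon> * k * X2\<^sup>2 + \<epsilon> * (k / 4 * X2\<^sup>2) \<le> - c * X2\<^sup>2"
  proof -
    have "\<epsilon> * (k / 4 * X2\<^sup>2) \<le> \<epsilon> * (k / 2 * X2\<^sup>2)"
      using \<epsilon>(1) k(1) by (intro mult_left_mono mult_right_mono) auto
    then show ?thesis using keep[of X2] by linarith
  qed
  have "size_sq U = X1\<^sup>2 + Y1\<^sup>2 + X2\<^sup>2 + Y2\<^sup>2 + X3\<^sup>2 + Y3\<^sup>2" by (simp add: size_sq_def Ueq XY)
  then have e1: "- c * size_sq U = - c * X1\<^sup>2 + - c * Y1\<^sup>2 + - c * X2\<^sup>2 + - c * Y2\<^sup>2 + - c * X3\<^sup>2 + - c * Y3\<^sup>2"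
    by (simp add: distrib_left)
  have e2: "(norm (coords L U))\<^sup>2 = N" by (simp add: N_def power2_eq_square)
  show ?thesis
    unfolding e1 e2
    using total comp[OF d(1) k(2), of Y1 X1 \<rho>\<^sub>1] comp[OF d(2) k(3), of Y2 X2 \<rho>\<^sub>2] comp[OF d(3) k(4), of Y3 X3 \<rho>\<^sub>3]
      mix absorb[OF s1(1), of Y1] absorb[OF s1(2), of Y2] absorb[OF s1(3), of Y3] keep[of X1] keep2 keep[of X3]
    by (simp add: distrib_left distrib_right)
qed

text \<open>
  Let \<open>S\<close> denote \<open>total_size\<close>. Shifting by \<open>\<omega>\<close> compensates the bounded couplings and leaves a dissipation of
  at least \<open>c S(U)\<^sup>2\<close>; since the form is bounded by a multiple of \<open>S(U) S(U')\<close>, it is sectorial.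
\<close>

theorem sectorial_estimates:
  obtains p :: "state \<Rightarrow> state \<Rightarrow> real" and \<omega> m C :: real
  where "bounded_bilinear p" "\<And>x y. p x y = p y x" "0 < m" "\<And>x. m * (norm x)\<^sup>2 \<le> p x x" "0 \<le> C" "0 \<le> \<omega>"
    and "\<And>U. U \<in> domB \<Longrightarrow> p (coords L (opB U) - \<omega> *\<^sub>R coords L U) (coords L U) \<le> 0"
    and "\<And>U U'. U \<in> domB \<Longrightarrow> U' \<in> domB \<Longrightarrow>
      (p (coords L (opB U) - \<omega> *\<^sub>R coords L U) (coords L U'))\<^sup>2
        \<le> C * (- p (coords L (opB U) - \<omega> *\<^sub>R coords L U) (coords L U))
          * (- p (coords L (opB U') - \<omega> *\<^sub>R coords L U') (coords L U'))"
proof -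
  have K: "1 \<le> Kc" by (rule embedding_const_ge_1[OF L])
  define k where "k = min \<kappa> (min b \<delta>)"
  define d where "d = min \<mu>\<^sub>1 (min \<mu>\<^sub>2 \<gamma>)"
  define r where "r = min \<rho>\<^sub>1 (min \<rho>\<^sub>2 \<rho>\<^sub>3)"
  define Q where "Q = absorb_const k"
  define R where "R = 4 * (\<rho>\<^sub>1 + \<rho>\<^sub>2 + \<rho>\<^sub>3) * Kc\<^sup>2"
  have k: "0 < k" "k \<le> \<kappa>" "k \<le> b" "k \<le> \<delta>" using pos by (auto simp: k_def)
  have d: "0 < d" "d \<le> \<mu>\<^sub>1" "d \<le> \<mu>\<^sub>2" "d \<le> \<gamma>" using pos by (auto simp: d_def)
  have r: "0 < r" "r \<le> \<rho>\<^sub>1" "r \<le> \<rho>\<^sub>2" "r \<le> \<rho>\<^sub>3" using pos by (auto simp: r_def)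
  have R: "0 < R" using pos K by (simp add: R_def)
  have "0 < (\<rho>\<^sub>1 + \<rho>\<^sub>2 + \<rho>\<^sub>3) * Kc\<^sup>2" "0 \<le> (\<mu>\<^sub>1\<^sup>2 + \<mu>\<^sub>2\<^sup>2 + \<gamma>\<^sup>2) / k" "0 \<le> (\<mu> * Kc\<^sup>2)\<^sup>2 / k"
    using pos K k by auto
  then have Q: "0 < Q" unfolding Q_def absorb_const_def by linarith
  \<comment> \<open>The second bound lets the damping absorb the errors of the correction, the third keeps the form coercive.\<close>
  define \<epsilon> where "\<epsilon> = min 1 (min (d / (2 * Q)) (k / R))"
  have \<epsilon>: "0 < \<epsilon>" "\<epsilon> \<le> 1" "\<epsilon> \<le> d / (2 * Q)" "\<epsilon> \<le> k / R"
    using d k Q R by (auto simp: \<epsilon>_def)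
  have small: "\<epsilon> * absorb_const k \<le> d / 2" using \<epsilon>(3) Q by (simp add: Q_def field_simps)
  have \<epsilon>R: "\<epsilon> * R \<le> k" using \<epsilon>(4) R by (simp add: field_simps)
  have small': "4 * \<epsilon>\<^sup>2 * \<rho> * Kc\<^sup>2 \<le> h" if "0 < \<rho>" "\<rho> \<le> \<rho>\<^sub>1 + \<rho>\<^sub>2 + \<rho>\<^sub>3" "k \<le> h" for \<rho> h
  proof -
    have "\<epsilon>\<^sup>2 \<le> \<epsilon>" using \<epsilon> by (simp add: power2_eq_square mult_left_le)
    then have "\<epsilon>\<^sup>2 * (4 * \<rho> * Kc\<^sup>2) \<le> \<epsilon> * (4 * (\<rho>\<^sub>1 + \<rho>\<^sub>2 + \<rho>\<^sub>3) * Kc\<^sup>2)"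
      using that \<epsilon>(1) by (intro mult_mono mult_right_mono) auto
    then show ?thesis using \<epsilon>R that(3) by (simp add: R_def mult_ac)
  qed
  define m where "m = min r k / 2"
  have m: "0 < m" "2 * m \<le> r" "2 * m \<le> k" using r k by (auto simp: m_def)
  define c where "c = min (d / 2) (\<epsilon> * k / 2)"
  have c: "0 < c" "c \<le> d / 2" "c \<le> \<epsilon> * k / 2" using d \<epsilon> k by (auto simp: c_def)
  have low0: "0 \<le> lower_const" using pos K by (simp add: lower_const_def)
  define \<omega> where "\<omega> = (lower_const + c) / m"
  have \<omega>: "0 \<le> \<omega>" "\<omega> * m = lower_const + c" using low0 c m by (auto simp: \<omega>_def)
  let ?p = "form \<epsilon>"
  interpret p: bounded_bilinear ?p
    by (rule energy_form_bounded_bilinear[OF L \<tau>(1) \<sigma>(1) \<xi>(1)])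
  have coercive: "m * (norm x)\<^sup>2 \<le> ?p x x" for x
    by (rule energy_form_coercive[OF L \<tau> \<sigma> \<xi> pos(1-5,7) less_imp_le[OF \<epsilon>(1)]
          small'[OF pos(1)] small'[OF pos(2)] small'[OF pos(3)]]) (use r k m pos in linarith)+
  obtain P where P: "0 < P" "\<And>x y. norm (?p x y) \<le> norm x * norm y * P" using p.pos_bounded by blast
  define B where "B = bound_const + \<omega> * P"
  have bound0: "0 \<le> bound_const" using pos K low0 by (simp add: bound_const_def)
  have B: "0 \<le> B" using bound0 \<omega> P by (simp add: B_def)
  define J where "J = coords L"
  define q where "q U = - ?p (J (opB U) - \<omega> *\<^sub>R J U) (J U)" for U
  have expand: "?p (J (opB U) - \<omega> *\<^sub>R J U) (J U') = ?p (J (opB U)) (J U') - \<omega> * ?p (J U) (J U')" for U U'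
    by (simp add: p.diff_left p.scaleR_left)
  have q: "c * (total_size U)\<^sup>2 \<le> q U" if U: "U \<in> domB" for U
  proof -
    have "(lower_const + c) * (norm (J U))\<^sup>2 \<le> \<omega> * ?p (J U) (J U)"
      using mult_left_mono[OF coercive[of "J U"] \<omega>(1)] \<omega>(2) by (simp add: mult.assoc[symmetric])
    moreover have "?p (J (opB U)) (J U) \<le> - c * size_sq U + lower_const * (norm (J U))\<^sup>2"
      unfolding J_def
      by (rule form_diagonal[OF U less_imp_le[OF \<epsilon>(1)] \<epsilon>(2) k d(2-4) small c(2,3)])
    moreover have "q U = \<omega> * ?p (J U) (J U) - ?p (J (opB U)) (J U)" by (simp add: q_def expand)
    ultimately show ?thesis by (simp add: total_size_sq J_def algebra_simps)
  qed
  have bnd: "\<bar>?p (J (opB U) - \<omega> *\<^sub>R J U) (J U')\<bar> \<le> B * (total_size U * total_size U')"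
    if U: "U \<in> domB" and U': "U' \<in> domB" for U U'
  proof -
    have 1: "\<bar>?p (J (opB U)) (J U')\<bar> \<le> bound_const * (total_size U * total_size U')"
      unfolding J_def by (rule form_bounded[OF U U' less_imp_le[OF \<epsilon>(1)] \<epsilon>(2)])
    have "\<bar>?p (J U) (J U')\<bar> \<le> norm (J U) * norm (J U') * P" using P(2) by simp
    also have "\<dots> \<le> total_size U * total_size U' * P"
      using P(1) total_size_nonneg unfolding J_def
      by (intro mult_right_mono mult_mono coords_le_total_size) auto
    finally have "\<omega> * \<bar>?p (J U) (J U')\<bar> \<le> \<omega> * (total_size U * total_size U' * P)"
      using \<omega>(1) by (rule mult_left_mono)
    then have 2: "\<bar>\<omega> * ?p (J U) (J U')\<bar> \<le> \<omega> * P * (total_size U * total_size U')"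
      using \<omega>(1) by (simp add: abs_mult mult_ac)
    show ?thesis unfolding expand B_def distrib_right using 1 2 by linarith
  qed
  show ?thesis
  proof (rule that[of ?p m "(B / c)\<^sup>2" \<omega>])
    fix U U' assume U: "U \<in> domB" and U': "U' \<in> domB"
    have q0: "0 \<le> c * (total_size U)\<^sup>2" "0 \<le> c * (total_size U')\<^sup>2" using c by auto
    show "?p (coords L (opB U) - \<omega> *\<^sub>R coords L U) (coords L U) \<le> 0"
      using q[OF U] q0 by (simp add: q_def J_def)
    have "(?p (J (opB U) - \<omega> *\<^sub>R J U) (J U'))\<^sup>2 \<le> (B * (total_size U * total_size U'))\<^sup>2"
      using bnd[OF U U'] by (metis abs_ge_zero power2_abs power_mono)
    also have "\<dots> = (B / c)\<^sup>2 * ((c * (total_size U)\<^sup>2) * (c * (total_size U')\<^sup>2))"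
      using c(1) by (simp add: power_mult_distrib power_divide power2_eq_square)
    also have "\<dots> \<le> (B / c)\<^sup>2 * (q U * q U')"
      using q[OF U] q[OF U'] q0 by (intro mult_left_mono mult_mono) auto
    finally show "(?p (coords L (opB U) - \<omega> *\<^sub>R coords L U) (coords L U'))\<^sup>2
        \<le> (B / c)\<^sup>2 * (- ?p (coords L (opB U) - \<omega> *\<^sub>R coords L U) (coords L U))
          * (- ?p (coords L (opB U') - \<omega> *\<^sub>R coords L U') (coords L U'))"
      by (simp add: q_def J_def mult.assoc)
  qed (use p.bounded_bilinear_axioms energy_form_sym m coercive \<omega> in auto)
qed

end

section \<open>Generators of degenerate semigroups\<close>

definition semigroup_generator :: "(real \<Rightarrow> 'a \<Rightarrow> 'a :: real_normed_vector) \<Rightarrow> ('a \<times> 'a) set"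
  where "semigroup_generator R = {(u, v). ((\<lambda>h. (R h u - u) /\<^sub>R h) \<longlongrightarrow> v) (at_right 0)}"

lemma eventually_at_right_0I: "(\<And>h :: real. 0 < h \<Longrightarrow> P h) \<Longrightarrow> \<forall>\<^sub>F h in at_right 0. P h"
  by (auto simp: eventually_at_right_field intro: exI[of _ 1])

lemma semigroup_generatorI:
  assumes "(f \<longlongrightarrow> v) (at_right 0)" "\<And>h. 0 < h \<Longrightarrow> f h = (R h u - u) /\<^sub>R h"
  shows "(u, v) \<in> semigroup_generator R"
  unfolding semigroup_generator_def using assms
  by (auto intro: Lim_transform_eventually eventually_at_right_0I)

lemma right_difference_quotient:
  fixes F :: "real \<Rightarrow> 'a :: real_normed_vector"
  assumes "(F has_vector_derivative d) (at t within {t..t + 1})"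
  shows "((\<lambda>k. (F (t + k) - F t) /\<^sub>R k) \<longlongrightarrow> d) (at_right 0)"
proof (rule tendstoI)
  fix e :: real assume e: "e > 0"
  then have "e / 2 > 0" by simp
  then obtain \<delta> where \<delta>: "\<delta> > 0"
    "\<And>y. y \<in> {t..t + 1} \<Longrightarrow> norm (y - t) < \<delta> \<Longrightarrow> norm (F y - F t - (y - t) *\<^sub>R d) \<le> e / 2 * norm (y - t)"
    using assms unfolding has_vector_derivative_def has_derivative_within_alt by blast
  have "dist ((F (t + k) - F t) /\<^sub>R k) d < e" if k: "0 < k" "k < min \<delta> 1" for k
  proof -
    let ?Y = "F (t + k) - F t - k *\<^sub>R d"
    have eq: "(F (t + k) - F t) /\<^sub>R k - d = ?Y /\<^sub>R k"
      using k by (simp add: scaleR_diff_right)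
    have "norm ?Y \<le> e / 2 * k" using \<delta>(2)[of "t + k"] k by simp
    then have "norm ?Y / k \<le> e / 2" using k by (simp add: pos_divide_le_eq)
    moreover have "norm (?Y /\<^sub>R k) = norm ?Y / k" using k by (simp add: divide_inverse mult.commute)
    ultimately have "norm ((F (t + k) - F t) /\<^sub>R k - d) \<le> e / 2" unfolding eq by linarith
    then show ?thesis using e by (simp add: dist_norm)
  qed
  then show "\<forall>\<^sub>F k in at_right 0. dist ((F (t + k) - F t) /\<^sub>R k) d < e"
    using \<delta>(1) by (auto simp: eventually_at_right_field intro!: exI[of _ "min \<delta> 1"])
qed

text \<open>
  Degenerate means that \<open>R 0\<close> is only a projection. This allows one to work on a whole Banach type although
  the semigroup of interest lives on a closed subspace of it.
\<close>

locale degenerate_semigroup =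
  fixes R :: "real \<Rightarrow> 'a \<Rightarrow> 'a :: {complex_normed_vector, banach}" and M :: real
  assumes R_add: "0 \<le> t \<Longrightarrow> R t (u + v) = R t u + R t v"
    and R_scaleC: "0 \<le> t \<Longrightarrow> R t (a *\<^sub>C u) = a *\<^sub>C R t u"
    and R_bound: "0 \<le> t \<Longrightarrow> norm (R t u) \<le> M * norm u"
    and M_ge_1: "1 \<le> M"
    and R_semigroup: "0 \<le> s \<Longrightarrow> 0 \<le> t \<Longrightarrow> R (s + t) u = R s (R t u)"
    and R_continuous_0: "((\<lambda>t. R t u) \<longlongrightarrow> R 0 u) (at_right 0)"
begin

abbreviation "gen \<equiv> semigroup_generator R"

lemma R_bounded_linear: "0 \<le> t \<Longrightarrow> bounded_linear (R t)"
  by (rule bounded_linear_intro[where K = M])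
    (use R_bound in \<open>auto simp: R_add R_scaleC scaleR_scaleC mult.commute\<close>)

lemma R_diff: "0 \<le> t \<Longrightarrow> R t (u - v) = R t u - R t v"
  using R_bounded_linear by (simp add: bounded_linear.linear linear_diff)

lemma R_scaleR: "0 \<le> t \<Longrightarrow> R t (r *\<^sub>R u) = r *\<^sub>R R t u"
  by (simp add: scaleR_scaleC R_scaleC)

lemma R_R_0: "0 \<le> t \<Longrightarrow> R t (R 0 u) = R t u"
  using R_semigroup[of t 0 u] by simp

lemma gen_R_0:
  assumes "(u, v) \<in> gen"
  shows "R 0 u = u"
proof -
  have "((\<lambda>h. h *\<^sub>R ((R h u - u) /\<^sub>R h) + u) \<longlongrightarrow> 0 *\<^sub>R v + u) (at_right 0)"
    using assms by (intro tendsto_intros) (simp add: semigroup_generator_def)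
  then have "((\<lambda>h. R h u) \<longlongrightarrow> 0 *\<^sub>R v + u) (at_right 0)"
    by (rule Lim_transform_eventually) (auto intro: eventually_at_right_0I)
  then have "((\<lambda>h. R h u) \<longlongrightarrow> u) (at_right 0)" by simp
  then show ?thesis using R_continuous_0 tendsto_unique trivial_limit_at_right_real by blast
qed

lemma gen_add: "(u, v) \<in> gen \<Longrightarrow> (u', v') \<in> gen \<Longrightarrow> (u + u', v + v') \<in> gen"
  by (rule semigroup_generatorI[where f = "\<lambda>h. (R h u - u) /\<^sub>R h + (R h u' - u') /\<^sub>R h"])
    (auto simp: semigroup_generator_def R_add add_diff_add scaleR_add_right intro: tendsto_add)

lemma gen_scaleC: "(u, v) \<in> gen \<Longrightarrow> (a *\<^sub>C u, a *\<^sub>C v) \<in> gen"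
proof (rule semigroup_generatorI)
  assume "(u, v) \<in> gen"
  then show "((\<lambda>h. a *\<^sub>C ((R h u - u) /\<^sub>R h)) \<longlongrightarrow> a *\<^sub>C v) (at_right 0)"
    by (intro bounded_linear.tendsto[OF bounded_linear_scaleC]) (simp add: semigroup_generator_def)
qed (simp add: R_scaleC scaleC_diff_right scaleC_scaleR)

lemma gen_diff: "(u, v) \<in> gen \<Longrightarrow> (u', v') \<in> gen \<Longrightarrow> (u - u', v - v') \<in> gen"
proof -
  have m: "(-1) *\<^sub>C x = - x" for x :: 'a
    using scaleR_scaleC[of "-1" x] by simp
  assume "(u, v) \<in> gen" "(u', v') \<in> gen"
  then show ?thesis using gen_add[OF _ gen_scaleC[of u' v' "-1"]] by (simp add: m)
qed

lemma gen_R: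
  assumes "(u, v) \<in> gen" "0 \<le> t"
  shows "(R t u, R t v) \<in> gen"
proof (rule semigroup_generatorI)
  show "((\<lambda>h. R t ((R h u - u) /\<^sub>R h)) \<longlongrightarrow> R t v) (at_right 0)"
    using assms
    by (intro bounded_linear.tendsto[OF R_bounded_linear]) (auto simp: semigroup_generator_def)
  fix h :: real assume "0 < h"
  then show "R t ((R h u - u) /\<^sub>R h) = (R h (R t u) - R t u) /\<^sub>R h"
    using R_semigroup[OF assms(2), of h u] R_semigroup[OF _ assms(2), of h u] assms(2)
    by (simp add: R_scaleR R_diff add.commute)
qed

lemma gen_unique: "(u, v) \<in> gen \<Longrightarrow> (u, v') \<in> gen \<Longrightarrow> v = v'"
  using tendsto_unique[OF trivial_limit_at_right_real] by (auto simp: semigroup_generator_def)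

lemma R_increment:
  assumes "0 \<le> s" "s \<le> t"
  shows "norm (R t u - R s u) \<le> M * norm (R (t - s) u - R 0 u)"
proof -
  have "R t u - R s u = R s (R (t - s) u - R 0 u)"
    using assms R_semigroup[of s "t - s" u] by (simp add: R_diff R_R_0)
  then show ?thesis using R_bound[OF assms(1)] by simp
qed

lemma R_continuous: "continuous_on {0..} (\<lambda>t. R t u)"
  unfolding continuous_on_iff
proof (intro ballI allI impI)
  fix t e :: real assume "t \<in> {0..}" and e: "e > 0"
  have "\<forall>\<^sub>F h in at_right 0. dist (R h u) (R 0 u) < e / M"
    by (rule tendstoD[OF R_continuous_0]) (use e M_ge_1 in simp)
  then obtain d where d: "d > 0" "\<And>h. 0 < h \<Longrightarrow> h < d \<Longrightarrow> norm (R h u - R 0 u) < e / M"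
    by (auto simp: eventually_at_right_field dist_norm)
  have d': "M * norm (R h u - R 0 u) < e" if "0 \<le> h" "h < d" for h
    using d(2)[of h] that e M_ge_1 by (cases "h = 0") (auto simp: field_simps)
  show "\<exists>d>0. \<forall>s\<in>{0..}. dist s t < d \<longrightarrow> dist (R s u) (R t u) < e"
  proof (intro exI[of _ d] conjI ballI impI d(1))
    fix s assume s: "s \<in> {0..}" "dist s t < d"
    have "norm (R s u - R t u) < e"
    proof (cases "s \<le> t")
      case True
      then show ?thesis
        using R_increment[of s t u] d'[of "t - s"] s by (simp add: dist_real_def norm_minus_commute)
    next
      case False
      then show ?thesis
        using R_increment[of t s u] d'[of "s - t"] s \<open>t \<in> {0..}\<close> by (simp add: dist_real_def)
    qed
    then show "dist (R s u) (R t u) < e" by (simp add: dist_norm)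
  qed
qed

text \<open>
  The difference quotient to the right of \<open>a\<close> is the image under \<open>R a\<close> of the one at \<open>0\<close>. To the left of \<open>t\<close>
  this is used at \<open>a = s < t\<close>, together with the continuity of \<open>s \<mapsto> R s v\<close>.
\<close>

lemma R_has_vector_derivative:
  assumes g: "(u, v) \<in> gen" and t: "0 \<le> t"
  shows "((\<lambda>t. R t u) has_vector_derivative R t v) (at t within {0..})"
  unfolding has_vector_derivative_def has_derivative_within_alt
proof (intro conjI allI impI)
  show "bounded_linear (\<lambda>x. x *\<^sub>R R t v)" by (rule bounded_linear_scaleR_left)
  fix e :: real assume e: "e > 0"
  have "\<forall>\<^sub>F h in at_right 0. dist ((R h u - u) /\<^sub>R h) v < e / (2 * M)"
    by (rule tendstoD) (use g e M_ge_1 in \<open>auto simp: semigroup_generator_def\<close>)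
  then obtain d1 where d1: "d1 > 0" "\<And>h. 0 < h \<Longrightarrow> h < d1 \<Longrightarrow> norm ((R h u - u) /\<^sub>R h - v) < e / (2 * M)"
    by (auto simp: eventually_at_right_field dist_norm)
  obtain d2 where d2: "d2 > 0" "\<And>s. s \<ge> 0 \<Longrightarrow> \<bar>s - t\<bar> < d2 \<Longrightarrow> norm (R s v - R t v) < e / 2"
  proof -
    have "\<forall>e>0. \<exists>d>0. \<forall>s\<in>{0..}. dist s t < d \<longrightarrow> dist (R s v) (R t v) < e"
      using R_continuous[of v] t unfolding continuous_on_iff by simp
    then obtain d where "d > 0" "\<forall>s\<in>{0..}. dist s t < d \<longrightarrow> dist (R s v) (R t v) < e / 2"
      using e half_gt_zero by blast
    then show ?thesis using that[of d] by (simp add: dist_norm)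
  qed
  have step: "norm (R b u - R a u - (b - a) *\<^sub>R R a v) \<le> e / 2 * (b - a)"
    if "0 \<le> a" "a < b" "b - a < d1" for a b
  proof -
    let ?h = "b - a"
    have "?h *\<^sub>R R a ((R ?h u - u) /\<^sub>R ?h - v) = R a (R ?h u) - R a u - ?h *\<^sub>R R a v"
      using that by (simp add: R_diff R_scaleR scaleR_diff_right)
    also have "R a (R ?h u) = R b u"
      using that R_semigroup[of a ?h u] by simp
    finally have eq: "R b u - R a u - ?h *\<^sub>R R a v = ?h *\<^sub>R R a ((R ?h u - u) /\<^sub>R ?h - v)"
      by simp
    have "norm (R a ((R ?h u - u) /\<^sub>R ?h - v)) \<le> M * norm ((R ?h u - u) /\<^sub>R ?h - v)"
      by (rule R_bound[OF that(1)])
    also have "\<dots> \<le> M * (e / (2 * M))"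
      using d1(2)[of ?h] that M_ge_1 by (intro mult_left_mono less_imp_le) auto
    also have "M * (e / (2 * M)) = e / 2" using M_ge_1 by simp
    finally have "?h * norm (R a ((R ?h u - u) /\<^sub>R ?h - v)) \<le> ?h * (e / 2)"
      using that by (intro mult_left_mono) auto
    then show ?thesis unfolding eq using that by (simp add: mult.commute)
  qed
  show "\<exists>d>0. \<forall>s\<in>{0..}. norm (s - t) < d \<longrightarrow> norm (R s u - R t u - (s - t) *\<^sub>R R t v) \<le> e * norm (s - t)"
  proof (intro exI[of _ "min d1 d2"] conjI ballI impI)
    fix s assume s: "s \<in> {0..}" "norm (s - t) < min d1 d2"
    consider "s = t" | "t < s" | "s < t" by linarith
    then show "norm (R s u - R t u - (s - t) *\<^sub>R R t v) \<le> e * norm (s - t)"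
    proof cases
      case 2
      then have "norm (R s u - R t u - (s - t) *\<^sub>R R t v) \<le> e / 2 * (s - t)"
        using step[of t s] t s by auto
      also have "\<dots> \<le> e * (s - t)" using 2 e by (intro mult_right_mono) auto
      finally show ?thesis using 2 by simp
    next
      case 3
      let ?A = "R t u - R s u - (t - s) *\<^sub>R R s v" and ?B = "(t - s) *\<^sub>R (R s v - R t v)"
      have "R s u - R t u - (s - t) *\<^sub>R R t v = - ?A - ?B"
        by (simp add: algebra_simps)
      then have "norm (R s u - R t u - (s - t) *\<^sub>R R t v) \<le> norm ?A + norm ?B"
        using norm_triangle_ineq4[of "- ?A" ?B] by (simp only: norm_minus_cancel)
      also have "\<dots> \<le> e / 2 * (t - s) + (t - s) * (e / 2)"
      proof (rule add_mono)
        show "norm ?A \<le> e / 2 * (t - s)" using step[of s t] 3 s by auto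
        have "norm (R s v - R t v) \<le> e / 2" using d2(2)[of s] 3 s by simp
        then have "(t - s) * norm (R s v - R t v) \<le> (t - s) * (e / 2)"
          using 3 by (intro mult_left_mono) auto
        then show "norm ?B \<le> (t - s) * (e / 2)" using 3 by simp
      qed
      also have "\<dots> = e * norm (s - t)" using 3 by (simp add: field_simps)
      finally show ?thesis .
    qed simp
  qed (use d1 d2 in auto)
qed

lemma R_has_vector_derivative_at:
  assumes "(u, v) \<in> gen" "0 < t"
  shows "((\<lambda>t. R t u) has_vector_derivative R t v) (at t)"
  using R_has_vector_derivative[OF assms(1), of t] assms(2)
  by (simp add: at_within_interior[of t "{0..}"] interior_real_atLeast)

text \<open>
  As \<open>R k\<close> shifts the interval of integration by \<open>k\<close>, the difference quotient of the integral is the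
  difference of two means of the orbit over intervals of length \<open>k\<close>, at \<open>h\<close> and at \<open>0\<close>.
\<close>

lemma integral_mean_in_generator:
  assumes h: "0 < h"
  shows "(integral {0..h} (\<lambda>s. R s u), R h u - R 0 u) \<in> gen"
proof -
  define F where "F t = integral {0..t} (\<lambda>s. R s u)" for t
  have cont: "continuous_on {a..b} (\<lambda>s. R s u)" if "0 \<le> a" for a b
    using that by (intro continuous_on_subset[OF R_continuous]) auto
  have int: "(\<lambda>s. R s u) integrable_on {a..b}" if "0 \<le> a" for a b
    by (rule integrable_continuous_real[OF cont[OF that]])
  have dF: "((\<lambda>k. (F (t + k) - F t) /\<^sub>R k) \<longlongrightarrow> R t u) (at_right 0)" if "0 \<le> t" for t
  proof (rule right_difference_quotient)
    have "(F has_vector_derivative R t u) (at t within {0..t + 1})"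
      unfolding F_def using that by (intro integral_has_vector_derivative cont) auto
    then show "(F has_vector_derivative R t u) (at t within {t..t + 1})"
      by (rule has_vector_derivative_within_subset) (use that in auto)
  qed
  have shift: "R k (F h) = F (h + k) - F k" if k: "0 \<le> k" for k
  proof -
    have d: "((\<lambda>s. F (s + k)) has_vector_derivative R (s + k) u) (at s within {0..h})"
      if "s \<in> {0..h}" for s
    proof -
      have "(F has_vector_derivative R (s + k) u) (at (s + k) within {0..h + k})"
        unfolding F_def using that k by (intro integral_has_vector_derivative cont) auto
      then have "(F has_vector_derivative R (s + k) u) (at (s + k) within (\<lambda>s. s + k) ` {0..h})"
        by (rule has_vector_derivative_within_subset) (use k in auto)
      moreover have "((\<lambda>s. s + k) has_vector_derivative 1) (at s within {0..h})"
        by (auto intro!: derivative_eq_intros simp: has_real_derivative_iff_has_vector_derivative[symmetric])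
      ultimately show ?thesis
        using vector_diff_chain_within[of "\<lambda>s. s + k" 1 s "{0..h}" F] by (simp add: o_def)
    qed
    have "R k (F h) = integral {0..h} (R k \<circ> (\<lambda>s. R s u))"
      unfolding F_def by (rule integral_linear[symmetric, OF int R_bounded_linear[OF k]]) simp
    also have "\<dots> = integral {0..h} (\<lambda>s. R (s + k) u)"
      by (rule integral_cong) (use k in \<open>simp add: R_semigroup add.commute[of _ k]\<close>)
    also have "\<dots> = F (h + k) - F (0 + k)"
      using h d by (intro integral_unique fundamental_theorem_of_calculus) auto
    finally show ?thesis by simp
  qed
  show ?thesis
    unfolding F_def[symmetric]
  proof (rule semigroup_generatorI)
    show "((\<lambda>k. (F (h + k) - F h) /\<^sub>R k - (F (0 + k) - F 0) /\<^sub>R k) \<longlongrightarrow> R h u - R 0 u) (at_right 0)"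
      using h by (intro tendsto_diff dF) auto
    fix k :: real assume "0 < k"
    then show "(F (h + k) - F h) /\<^sub>R k - (F (0 + k) - F 0) /\<^sub>R k = (R k (F h) - F h) /\<^sub>R k"
      using shift[of k] by (simp add: F_def flip: scaleR_diff_right)
  qed
qed

lemma domain_dense:
  assumes "R 0 u = u" "e > 0"
  shows "\<exists>w v. (w, v) \<in> gen \<and> norm (w - u) < e"
proof -
  have cont: "continuous_on {0..1} (\<lambda>s. R s u)"
    by (intro continuous_on_subset[OF R_continuous]) auto
  have "((\<lambda>t. integral {0..t} (\<lambda>s. R s u)) has_vector_derivative R 0 u) (at 0 within {0..1})"
    by (intro integral_has_vector_derivative cont) auto
  then have "((\<lambda>s. integral {0..s} (\<lambda>s. R s u) /\<^sub>R s) \<longlongrightarrow> u) (at_right 0)"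
    using right_difference_quotient[of "\<lambda>t. integral {0..t} (\<lambda>s. R s u)" "R 0 u" 0] assms(1) by simp
  then have "\<forall>\<^sub>F s in at_right 0. dist (integral {0..s} (\<lambda>s. R s u) /\<^sub>R s) u < e"
    by (rule tendstoD) (rule assms(2))
  then obtain b where b: "b > 0" "\<And>s. 0 < s \<Longrightarrow> s < b \<Longrightarrow> dist (integral {0..s} (\<lambda>s. R s u) /\<^sub>R s) u < e"
    by (auto simp: eventually_at_right_field)
  let ?s = "b / 2"
  have "(integral {0..?s} (\<lambda>s. R s u) /\<^sub>R ?s, (R ?s u - R 0 u) /\<^sub>R ?s) \<in> gen"
    unfolding scaleR_scaleC using b by (intro gen_scaleC integral_mean_in_generator) simp
  moreover have "norm (integral {0..?s} (\<lambda>s. R s u) /\<^sub>R ?s - u) < e"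
    using b(2)[of ?s] b(1) by (simp add: dist_norm)
  ultimately show ?thesis by blast
qed

end

section \<open>Smoothing of sectorial semigroups\<close>

lemma power_over_fact_le_exp: "real n ^ n / fact n \<le> exp (real n)"
proof -
  have "(\<lambda>k. real n ^ k / fact k) sums exp (real n)"
    using exp_converges[of "real n"] by (simp add: divide_inverse mult.commute)
  then have "sum (\<lambda>k. real n ^ k / fact k) {n} \<le> exp (real n)"
    by (metis (no_types, lifting) sum_le_suminf sums_iff finite.emptyI finite.insertI
        divide_nonneg_nonneg fact_ge_zero of_nat_0_le_iff zero_le_power)
  then show ?thesis by simp
qed

lemma four_mult_le_square_sum: "4 * x * y \<le> (x + y)\<^sup>2" for x y :: real
  using zero_le_power2[of "x - y"] by (simp add: power2_eq_square algebra_simps)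

locale sectorial_semigroup = degenerate_semigroup R M
  for R :: "real \<Rightarrow> 'a \<Rightarrow> 'a :: {complex_normed_vector, banach}" and M +
  fixes p :: "'a \<Rightarrow> 'a \<Rightarrow> real" and m C :: real
  assumes p_bilinear: "bounded_bilinear p"
    and p_sym: "p u v = p v u"
    and m_pos: "0 < m"
    and p_coercive: "m * (norm u)\<^sup>2 \<le> p u u"
    and C_nonneg: "0 \<le> C"
    and dissipative: "(u, v) \<in> semigroup_generator R \<Longrightarrow> p v u \<le> 0"
    and sectorial: "(u, v) \<in> semigroup_generator R \<Longrightarrow> (u', v') \<in> semigroup_generator R \<Longrightarrow>
      (p v u')\<^sup>2 \<le> C * (- p v u) * (- p v' u')"
begin

interpretation p: bounded_bilinear p by (rule p_bilinear)

lemma p_nonneg: "0 \<le> p u u"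
  using p_coercive[of u] m_pos by (smt (verit) mult_nonneg_nonneg zero_le_power2)

lemma p_has_derivative:
  assumes "(f has_vector_derivative f') (at t within S)" "(g has_vector_derivative g') (at t within S)"
  shows "((\<lambda>t. p (f t) (g t)) has_real_derivative p (f t) g' + p f' (g t)) (at t within S)"
  using p.has_vector_derivative[OF assms] by (simp add: has_real_derivative_iff_has_vector_derivative)

text \<open>
  The energy argument: for \<open>y = R h u - u\<close> the function \<open>t\<^sup>2 p(R t y, R t y)\<close> grows at a rate
  bounded by a multiple of the decrease of the energy of \<open>R t u\<close> over a time step \<open>h\<close>, because the sectorial estimate bounds
  the mixed term \<open>p(K R s u, R t y)\<close> by the geometric mean of the two dissipation rates. Working with
  increments instead of derivatives avoids the domain of the square of the generator.
\<close>

lemma increment_energy_bound: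
  assumes g: "(u, v) \<in> gen" and T: "0 < T" and h: "0 < h"
  shows "T\<^sup>2 * p (R T (R h u - u)) (R T (R h u - u)) \<le> C / 4 * h\<^sup>2 * p u u"
proof -
  define y where "y = R h u - u"
  define z where "z = R h v - v"
  have yz: "(y, z) \<in> gen" unfolding y_def z_def using gen_diff[OF gen_R[OF g] g, of h] h by simp
  define E where "E t = p (R t u) (R t u)" for t
  define a where "a t = t\<^sup>2 * p (R t y) (R t y)" for t
  define W where "W t = integral {0..t} E" for t
  have q: "p (R t v) (R t u) \<le> 0" "p (R t z) (R t y) \<le> 0" if "0 \<le> t" for t
    using dissipative[OF gen_R[OF g that]] dissipative[OF gen_R[OF yz that]] by auto
  have Ec: "continuous_on {0..} E"
    unfolding E_def by (intro p.continuous_on R_continuous)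
  have dE: "(E has_real_derivative 2 * p (R t v) (R t u)) (at t)" if "0 < t" for t
    using p_has_derivative[OF R_has_vector_derivative_at[OF g that] R_has_vector_derivative_at[OF g that]]
    unfolding E_def by (simp add: p_sym[of "R t u"])
  have E_mono: "E b \<le> E a" if "0 \<le> a" "a \<le> b" for a b
  proof (rule DERIV_nonpos_imp_decreasing_open[OF that(2)])
    show "continuous_on {a..b} E" by (rule continuous_on_subset[OF Ec]) (use that in auto)
    fix t assume "a < t" "t < b"
    then show "\<exists>y. (E has_real_derivative y) (at t) \<and> y \<le> 0"
      using dE[of t] q(1)[of t] that by (intro exI[of _ "2 * p (R t v) (R t u)"]) auto
  qed
  have dW: "(W has_real_derivative E t) (at t)" if "0 < t" for t
  proof -
    have "(W has_real_derivative E t) (at t within {0..t + 1})"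
      unfolding W_def using that
      by (intro integral_has_real_derivative continuous_on_subset[OF Ec]) auto
    then show ?thesis using that by (simp add: at_within_Icc_at)
  qed
  have key: "p (R t y) (R t y) \<le> t * (- p (R t z) (R t y)) + C * h / (8 * t) * (E t - E (t + h))"
    if t: "0 < t" for t
  proof -
    define Y where "Y = R t y"
    define Q where "Q = - p (R t z) (R t y)"
    \<comment> \<open>This weight in Young's inequality turns the term with \<open>Q\<close> into \<open>t Q\<close> after integration over a step of length \<open>h\<close>.\<close>
    define \<eta> where "\<eta> = t / h"
    have \<eta>: "\<eta> > 0" using t h by (simp add: \<eta>_def)
    define f where "f s = p (R s u) Y - \<eta> * Q * s + C / (8 * \<eta>) * E s" for s
    have "f (t + h) \<le> f t"
    proof (rule DERIV_nonpos_imp_nonincreasing[where f = f and a = t and b = "t + h"])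
      fix s assume s: "t \<le> s" "s \<le> t + h"
      then have s0: "0 < s" using t by simp
      let ?q = "- p (R s v) (R s u)"
      have q0: "?q \<ge> 0" "Q \<ge> 0" using q(1)[of s] q(2)[of t] s0 t by (auto simp: Q_def)
      have "((\<lambda>s. p (R s u) Y) has_real_derivative p (R s u) 0 + p (R s v) Y) (at s)"
        by (rule p_has_derivative[OF R_has_vector_derivative_at[OF g s0]]) simp
      then have d: "(f has_real_derivative p (R s v) Y - \<eta> * Q + C / (8 * \<eta>) * (2 * p (R s v) (R s u))) (at s)"
        unfolding f_def using \<eta> by (auto intro!: derivative_eq_intros dE[OF s0] simp: p.zero_right)
      have "(p (R s v) Y)\<^sup>2 \<le> C * ?q * Q"
        unfolding Y_def Q_def using sectorial[OF gen_R[OF g] gen_R[OF yz], of s t] s0 t by simp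
      also have "\<dots> = 4 * (\<eta> * Q) * (C / (4 * \<eta>) * ?q)" using \<eta> by (simp add: field_simps)
      also have "\<dots> \<le> (\<eta> * Q + C / (4 * \<eta>) * ?q)\<^sup>2"
        by (rule four_mult_le_square_sum)
      finally have "p (R s v) Y \<le> \<eta> * Q + C / (4 * \<eta>) * ?q"
      proof (rule power2_le_imp_le)
        have "0 \<le> \<eta> * Q" using \<eta> q0 by simp
        moreover have "0 \<le> C / (4 * \<eta>) * ?q"
          using \<eta> C_nonneg by (intro mult_nonneg_nonneg[OF _ q0(1)]) simp
        ultimately show "0 \<le> \<eta> * Q + C / (4 * \<eta>) * ?q" by linarith
      qed
      moreover have "C / (8 * \<eta>) * (2 * p (R s v) (R s u)) = - (C / (4 * \<eta>) * ?q)"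
        using \<eta> by (simp add: field_simps)
      ultimately have "p (R s v) Y - \<eta> * Q + C / (8 * \<eta>) * (2 * p (R s v) (R s u)) \<le> 0" by linarith
      then show "\<exists>y. (f has_real_derivative y) (at s) \<and> y \<le> 0" using d by blast
    qed (use h in simp)
    then have le: "p (R (t + h) u) Y - p (R t u) Y \<le> \<eta> * Q * h + C / (8 * \<eta>) * (E t - E (t + h))"
      unfolding f_def right_diff_distrib distrib_left by linarith
    have e1: "p (R (t + h) u) Y - p (R t u) Y = p Y Y"
      using t h by (simp add: Y_def y_def R_diff R_semigroup p.diff_left)
    have e2: "\<eta> * Q * h = t * Q" using h by (simp add: \<eta>_def)
    have e3: "C / (8 * \<eta>) = C * h / (8 * t)" using h t by (simp add: \<eta>_def)
    show ?thesis using le unfolding e1 e2 e3 unfolding Y_def Q_def .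
  qed
  \<comment> \<open>The subtracted term is the integral of the second summand in the last estimate, multiplied by \<open>2 t\<close>.\<close>
  define b where "b t = a t - C * h / 4 * (W t - W (t + h) + W h)" for t
  have "b T \<le> b 0"
  proof (rule DERIV_nonpos_imp_decreasing_open[where f = b and a = 0 and b = T])
    have Wc: "continuous_on {0..T + h} W"
      unfolding W_def using h T
      by (intro indefinite_integral_continuous_1 integrable_continuous_real continuous_on_subset[OF Ec]) auto
    have "continuous_on {0..T} a"
      unfolding a_def
      by (intro continuous_intros p.continuous_on continuous_on_subset[OF R_continuous]) auto
    moreover have "continuous_on {0..T} W" using Wc by (rule continuous_on_subset) (use h in auto)
    moreover have "continuous_on {0..T} (\<lambda>t. W (t + h))"
      by (rule continuous_on_compose2[OF Wc]) (use h in \<open>auto intro!: continuous_intros\<close>)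
    ultimately show "continuous_on {0..T} b"
      unfolding b_def by (intro continuous_intros) auto
    fix t assume t: "0 < t" "t < T"
    let ?P = "p (R t y) (R t y)" and ?Z = "p (R t z) (R t y)"
    have "((\<lambda>t. p (R t y) (R t y)) has_real_derivative 2 * ?Z) (at t)"
      using p_has_derivative[OF R_has_vector_derivative_at[OF yz t(1)] R_has_vector_derivative_at[OF yz t(1)]]
      by (simp add: p_sym[of "R t y"])
    then have da: "(a has_real_derivative 2 * t * ?P + t\<^sup>2 * (2 * ?Z)) (at t)"
      unfolding a_def by (auto intro!: derivative_eq_intros)
    have "((\<lambda>t. W (t + h)) has_real_derivative E (t + h)) (at t)"
      using DERIV_shift[of W "E (t + h)" t h] dW[of "t + h"] t h by (simp add: add.commute)
    then have "(b has_real_derivative 2 * t * ?P + t\<^sup>2 * (2 * ?Z) - C * h / 4 * (E t - E (t + h))) (at t)"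
      unfolding b_def using da dW[OF t(1)] by (auto intro!: derivative_eq_intros)
    moreover have "2 * t * ?P \<le> 2 * t * (t * (- ?Z) + C * h / (8 * t) * (E t - E (t + h)))"
      using key[OF t(1)] t by (intro mult_left_mono) auto
    then have "2 * t * ?P + t\<^sup>2 * (2 * ?Z) - C * h / 4 * (E t - E (t + h)) \<le> 0"
    proof -
      have "2 * t * (t * (- Z) + C * h / (8 * t) * d) = - (t\<^sup>2 * (2 * Z)) + C * h / 4 * d" for Z d
        using t by (simp add: field_simps power2_eq_square)
      from this[of ?Z "E t - E (t + h)"] show ?thesis
        using \<open>2 * t * ?P \<le> 2 * t * (t * (- ?Z) + C * h / (8 * t) * (E t - E (t + h)))\<close> by linarith
    qed
    ultimately show "\<exists>y. (b has_real_derivative y) (at t) \<and> y \<le> 0" by blast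
  qed (use T in simp)
  moreover have "b 0 = 0" by (simp add: b_def a_def W_def)
  ultimately have "a T \<le> C * h / 4 * (W T - W (T + h) + W h)" by (simp add: b_def)
  also have "\<dots> \<le> C * h / 4 * (h * p u u)"
  proof (rule mult_left_mono)
    have int: "E integrable_on {a..b}" if "0 \<le> a" for a b
      by (intro integrable_continuous_real continuous_on_subset[OF Ec]) (use that in auto)
    have "W T + integral {T..T + h} E = W (T + h)"
      unfolding W_def using T h by (intro Henstock_Kurzweil_Integration.integral_combine int) auto
    moreover have "integral {T..T + h} E \<ge> 0"
      by (intro integral_nonneg int) (use T in \<open>auto simp: E_def p_nonneg\<close>)
    moreover have "W h \<le> integral {0..h} (\<lambda>_. E 0)"
      unfolding W_def by (intro integral_le int) (auto intro: E_mono)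
    moreover have "E 0 = p u u" by (simp add: E_def gen_R_0[OF g])
    ultimately show "W T - W (T + h) + W h \<le> h * p u u" using h by simp
  qed (use C_nonneg h in simp)
  finally show ?thesis by (simp add: a_def y_def power2_eq_square algebra_simps)
qed

text \<open>
  Coercivity turns the energy estimate into an estimate of norms, and the latter extends from the dense
  domain by continuity.
\<close>

lemma increment_bound_exists:
  "\<exists>B>0. \<forall>t>0. \<forall>h>0. \<forall>u. norm (R t (R h u - R 0 u)) \<le> B * h / t * norm u"
proof -
  obtain P where P: "P > 0" "\<And>u v. norm (p u v) \<le> norm u * norm v * P"
    using p.pos_bounded by blast
  define B where "B = sqrt (C * P / (4 * m))"
  have B: "B \<ge> 0" using C_nonneg P m_pos by (simp add: B_def)
  have gen_case: "norm (R t (R h u - u)) \<le> B * h / t * norm u"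
    if g: "(u, v) \<in> gen" and t: "0 < t" and h: "0 < h" for u v t h
  proof -
    let ?w = "R t (R h u - u)"
    have "t\<^sup>2 * (m * (norm ?w)\<^sup>2) \<le> t\<^sup>2 * p ?w ?w"
      by (intro mult_left_mono p_coercive) simp
    also have "\<dots> \<le> C / 4 * h\<^sup>2 * p u u" by (rule increment_energy_bound[OF g t h])
    also have "\<dots> \<le> C / 4 * h\<^sup>2 * (norm u * norm u * P)"
      using P(2)[of u u] C_nonneg by (intro mult_left_mono) auto
    finally have "(norm ?w)\<^sup>2 \<le> C / 4 * h\<^sup>2 * (norm u * norm u * P) / (t\<^sup>2 * m)"
      using t m_pos by (simp add: field_simps)
    also have "\<dots> = (C * P / (4 * m)) * (h / t * norm u)\<^sup>2"
      by (simp add: power2_eq_square mult_ac)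
    also have "\<dots> = (B * h / t * norm u)\<^sup>2"
      using C_nonneg P m_pos by (simp add: B_def power_mult_distrib power_divide)
    finally show ?thesis by (rule power2_le_imp_le) (use B t h in simp)
  qed
  have "norm (R t (R h u - R 0 u)) \<le> B * h / t * norm (R 0 u)" if t: "0 < t" and h: "0 < h" for t h u
  proof -
    let ?u = "R 0 u"
    have "\<exists>w v. (w, v) \<in> gen \<and> norm (w - ?u) < 1 / real (Suc n)" for n
      by (rule domain_dense) (simp_all add: R_R_0)
    then obtain w v where w: "\<And>n. (w n, v n) \<in> gen" "\<And>n. norm (w n - ?u) < 1 / real (Suc n)" by metis
    have lim: "w \<longlonglongrightarrow> ?u"
      by (rule LIM_zero_cancel, rule Lim_null_comparison[OF _ LIMSEQ_Suc[OF lim_1_over_n]])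
        (use w(2) in \<open>auto intro!: always_eventually less_imp_le\<close>)
    have bl: "bounded_linear (R t)" "bounded_linear (R h)" using t h by (auto intro: R_bounded_linear)
    have "(\<lambda>n. norm (R t (R h (w n) - w n))) \<longlonglongrightarrow> norm (R t (R h ?u - ?u))"
      by (intro tendsto_intros bounded_linear.tendsto[OF bl(1)] bounded_linear.tendsto[OF bl(2)] lim)
    moreover have "(\<lambda>n. B * h / t * norm (w n)) \<longlonglongrightarrow> B * h / t * norm ?u"
      by (intro tendsto_intros lim)
    ultimately have "norm (R t (R h ?u - ?u)) \<le> B * h / t * norm ?u"
      by (rule LIMSEQ_le) (use gen_case[OF w(1) t h] in blast)
    then show ?thesis using t h by (simp add: R_R_0)
  qed
  note bound = this
  have "norm (R t (R h u - R 0 u)) \<le> (B * M + 1) * h / t * norm u" if "0 < t" "0 < h" for t h u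
  proof -
    have "norm (R t (R h u - R 0 u)) \<le> B * h / t * norm (R 0 u)" by (rule bound[OF that])
    also have "\<dots> \<le> B * h / t * (M * norm u)"
      using B that by (intro mult_left_mono R_bound) auto
    also have "\<dots> = (B * M) * (h / t * norm u)" by simp
    also have "\<dots> \<le> (B * M + 1) * (h / t * norm u)" using that by (intro mult_right_mono) auto
    finally show ?thesis by simp
  qed
  moreover have "B * M + 1 > 0" using B M_ge_1 by (simp add: add_nonneg_pos)
  ultimately show ?thesis by blast
qed

definition B where
  "B = (SOME B. 0 < B \<and> (\<forall>t>0. \<forall>h>0. \<forall>u. norm (R t (R h u - R 0 u)) \<le> B * h / t * norm u))"

lemma B_pos: "0 < B"
  and increment_bound: "0 < t \<Longrightarrow> 0 < h \<Longrightarrow> norm (R t (R h u - R 0 u)) \<le> B * h / t * norm u"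
  using someI_ex[OF increment_bound_exists] unfolding B_def by blast+

text \<open>
  The difference quotients of \<open>R t u\<close> are bounded by \<open>B/t \<parallel>u\<parallel>\<close>, uniformly in the increment. They converge
  for \<open>u\<close> in the dense domain, hence for all \<open>u\<close>.
\<close>

lemma smoothing:
  assumes t: "0 < t"
  shows "\<exists>v. (R t u, v) \<in> gen \<and> norm v \<le> B / t * norm u"
proof -
  define Q where "Q h u = (R h (R t u) - R t u) /\<^sub>R h" for h u
  have Q_diff: "Q h u - Q h u' = Q h (u - u')" if "0 < h" for h u u'
    using t that by (simp add: Q_def R_diff scaleR_diff_right)
  have Q_bound: "norm (Q h u) \<le> B / t * norm u" if h: "0 < h" for h u
  proof -
    have "R h (R t u) - R t u = R t (R h u - R 0 u)"
      using t h R_semigroup[of h t u] R_semigroup[of t h u] by (simp add: R_diff R_R_0 add.commute)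
    then have "norm (R h (R t u) - R t u) / h \<le> B * h / t * norm u / h"
      using increment_bound[OF t h, of u] h by (intro divide_right_mono) simp_all
    moreover have "B * h / t * norm u / h = B / t * norm u" using h by simp
    moreover have "norm (Q h u) = norm (R h (R t u) - R t u) / h"
      using h by (simp add: Q_def divide_inverse mult.commute)
    ultimately show ?thesis by linarith
  qed
  have Q_R_0: "Q h (R 0 u) = Q h u" for h u using t by (simp add: Q_def R_R_0)
  have "\<exists>w v. (w, v) \<in> gen \<and> norm (w - R 0 u) < 1 / real (Suc n)" for n
    by (rule domain_dense) (simp_all add: R_R_0)
  then obtain w v where w: "\<And>n. (w n, v n) \<in> gen" "\<And>n. norm (w n - R 0 u) < 1 / real (Suc n)" by metis
  have lim: "w \<longlonglongrightarrow> R 0 u"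
    by (rule LIM_zero_cancel, rule Lim_null_comparison[OF _ LIMSEQ_Suc[OF lim_1_over_n]])
      (use w(2) in \<open>auto intro!: always_eventually less_imp_le\<close>)
  have Qw: "((\<lambda>h. Q h (w n)) \<longlongrightarrow> R t (v n)) (at_right 0)" for n
    using gen_R[OF w(1), of t n] t by (simp add: semigroup_generator_def Q_def)
  have dist_v: "norm (R t (v n) - R t (v k)) \<le> B / t * norm (w n - w k)" for n k
  proof (rule tendsto_upperbound)
    show "((\<lambda>h. norm (Q h (w n) - Q h (w k))) \<longlongrightarrow> norm (R t (v n) - R t (v k))) (at_right 0)"
      by (intro tendsto_intros Qw)
    show "\<forall>\<^sub>F h in at_right 0. norm (Q h (w n) - Q h (w k)) \<le> B / t * norm (w n - w k)"
      by (rule eventually_at_right_0I) (simp only: Q_diff Q_bound)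
  qed simp
  have "Cauchy (\<lambda>n. R t (v n))"
  proof (rule metric_CauchyI)
    fix e :: real assume e: "e > 0"
    have "Cauchy w" by (rule LIMSEQ_imp_Cauchy[OF lim])
    then obtain N where N: "\<And>n k. n \<ge> N \<Longrightarrow> k \<ge> N \<Longrightarrow> norm (w n - w k) < e * t / B"
      using metric_CauchyD[of w "e * t / B"] e t B_pos by (auto simp: dist_norm)
    have "norm (R t (v n) - R t (v k)) < e" if "n \<ge> N" "k \<ge> N" for n k
    proof -
      have "B / t * norm (w n - w k) < B / t * (e * t / B)"
        using N[OF that] B_pos t by (intro mult_strict_left_mono) auto
      then show ?thesis using dist_v[of n k] B_pos t by simp
    qed
    then show "\<exists>N. \<forall>n\<ge>N. \<forall>k\<ge>N. dist (R t (v n)) (R t (v k)) < e" by (auto simp: dist_norm)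
  qed
  then obtain g where g: "(\<lambda>n. R t (v n)) \<longlonglongrightarrow> g"
    using Cauchy_convergent convergent_def by blast
  have "((\<lambda>h. Q h u) \<longlongrightarrow> g) (at_right 0)"
  proof (rule tendstoI)
    fix e :: real assume e: "e > 0"
    have "\<forall>\<^sub>F n in sequentially. dist (R t (v n)) g < e / 3"
      by (rule tendstoD[OF g]) (use e in simp)
    moreover have "\<forall>\<^sub>F n in sequentially. dist (w n) (R 0 u) < e / 3 * (t / B)"
      by (rule tendstoD[OF lim]) (use e t B_pos in simp)
    ultimately have "\<forall>\<^sub>F n in sequentially. dist (R t (v n)) g < e / 3 \<and> dist (w n) (R 0 u) < e / 3 * (t / B)"
      by (rule eventually_conj)
    then obtain n where n: "norm (R t (v n) - g) < e / 3" "norm (w n - R 0 u) < e / 3 * (t / B)"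
      using eventually_happens'[OF sequentially_bot] unfolding dist_norm by blast
    have "\<forall>\<^sub>F h in at_right 0. dist (Q h (w n)) (R t (v n)) < e / 3"
      by (rule tendstoD[OF Qw]) (use e in simp)
    then have "\<forall>\<^sub>F h in at_right 0. dist (Q h (w n)) (R t (v n)) < e / 3 \<and> 0 < h"
      by (rule eventually_conj[OF _ eventually_at_right_less])
    then show "\<forall>\<^sub>F h in at_right 0. dist (Q h u) g < e"
    proof (rule eventually_mono, elim conjE)
      fix h assume h: "dist (Q h (w n)) (R t (v n)) < e / 3" "0 < h"
      have "norm (Q h u - Q h (w n)) = norm (Q h (R 0 u - w n))"
        using Q_diff[OF h(2), of "R 0 u"] by (simp add: Q_R_0)
      also have "\<dots> \<le> B / t * norm (R 0 u - w n)" by (rule Q_bound[OF h(2)])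
      also have "\<dots> < B / t * (e / 3 * (t / B))"
        using n(2) B_pos t by (intro mult_strict_left_mono) (auto simp: norm_minus_commute)
      also have "\<dots> = e / 3" using B_pos t by simp
      finally have "dist (Q h u) (Q h (w n)) < e / 3" by (simp add: dist_norm)
      then show "dist (Q h u) g < e"
        using h(1) n(1) dist_triangle[of "Q h u" g "Q h (w n)"]
          dist_triangle[of "Q h (w n)" g "R t (v n)"] by (simp add: dist_norm)
    qed
  qed
  then have gen: "(R t u, g) \<in> gen" by (simp add: semigroup_generator_def Q_def)
  have "norm g \<le> B / t * norm u"
  proof (rule tendsto_upperbound)
    show "((\<lambda>h. norm (Q h u)) \<longlongrightarrow> norm g) (at_right 0)"
      using gen by (intro tendsto_norm) (simp add: semigroup_generator_def Q_def)
    show "\<forall>\<^sub>F h in at_right 0. norm (Q h u) \<le> B / t * norm u"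
      by (rule eventually_at_right_0I) (rule Q_bound)
  qed simp
  then show ?thesis using gen by blast
qed

end

section \<open>Taylor series of the orbits\<close>

lemma inverse_one_minus_le_2: "q \<le> 1 / 2 \<Longrightarrow> 1 / (1 - q) \<le> 2" for q :: real
  by (simp add: divide_le_eq)

context sectorial_semigroup
begin

definition K :: "'a \<Rightarrow> 'a"
  where "K u = (THE v. (u, v) \<in> gen)"

definition dom_K :: "'a set"
  where "dom_K = {u. \<exists>v. (u, v) \<in> gen}"

lemma K_eq: "(u, v) \<in> gen \<Longrightarrow> K u = v"
  unfolding K_def using gen_unique by blast

lemma dom_KI: "(u, v) \<in> gen \<Longrightarrow> u \<in> dom_K \<and> K u = v"
  unfolding dom_K_def using K_eq[of u v] by blast

lemma dom_KD: "u \<in> dom_K \<Longrightarrow> (u, K u) \<in> gen"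
  unfolding dom_K_def by (elim CollectE exE) (simp add: K_eq)

lemma K_add: "u \<in> dom_K \<Longrightarrow> v \<in> dom_K \<Longrightarrow> u + v \<in> dom_K \<and> K (u + v) = K u + K v"
  by (intro dom_KI gen_add dom_KD)

lemma K_scaleC: "u \<in> dom_K \<Longrightarrow> a *\<^sub>C u \<in> dom_K \<and> K (a *\<^sub>C u) = a *\<^sub>C K u"
  by (intro dom_KI gen_scaleC dom_KD)

lemma K_R: "u \<in> dom_K \<Longrightarrow> 0 \<le> t \<Longrightarrow> R t u \<in> dom_K \<and> K (R t u) = R t (K u)"
  by (intro dom_KI gen_R dom_KD)

lemma R_in_dom_K: "0 < t \<Longrightarrow> R t u \<in> dom_K"
  using smoothing[of t u] dom_KI by blast

lemma norm_K_R: "0 < t \<Longrightarrow> norm (K (R t u)) \<le> B / t * norm u"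
  using smoothing[of t u] K_eq by blast

text \<open>The \<open>n\<close>-th derivative of the orbit of \<open>u\<close> at time \<open>x\<close>.\<close>

definition D :: "nat \<Rightarrow> real \<Rightarrow> 'a \<Rightarrow> 'a"
  where "D n x u = (K ^^ n) (R x u)"

lemma D_0: "D 0 x u = R x u" by (simp add: D_def)

lemma D_Suc: "D (Suc n) x u = K (D n x u)" by (simp add: D_def)

text \<open>
  Both claims are proved together: the second one makes \<open>K\<close> applicable once more, and splitting the time in
  halves reduces it to the smoothing property.
\<close>

lemma D_shift_dom:
  "0 < x \<Longrightarrow> 0 < y \<Longrightarrow> D n (x + y) u = R x (D n y u)"
  "0 < y \<Longrightarrow> D n y u \<in> dom_K"
proof -
  have "(\<forall>x>0. \<forall>y>0. D n (x + y) u = R x (D n y u)) \<and> (\<forall>y>0. D n y u \<in> dom_K)"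
  proof (induction n)
    case 0
    then show ?case by (simp add: D_0 R_semigroup R_in_dom_K)
  next
    case (Suc n)
    have s: "D (Suc n) (x + y) u = R x (D (Suc n) y u)" if "0 < x" "0 < y" for x y
      using Suc that K_R[of "D n y u" x] by (simp add: D_Suc)
    have "D (Suc n) y u \<in> dom_K" if "0 < y" for y
    proof -
      have "D (Suc n) y u = R (y / 2) (D (Suc n) (y / 2) u)"
        using s[of "y / 2" "y / 2"] that by simp
      then show ?thesis using that by (simp add: R_in_dom_K)
    qed
    with s show ?case by blast
  qed
  then show "0 < x \<Longrightarrow> 0 < y \<Longrightarrow> D n (x + y) u = R x (D n y u)" "0 < y \<Longrightarrow> D n y u \<in> dom_K"
    by blast+
qed

lemma D_gen: "0 < x \<Longrightarrow> (D n x u, D (Suc n) x u) \<in> gen"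
  using dom_KD[OF D_shift_dom(2)[of x n u]] by (simp add: D_Suc)

lemma D_linear:
  assumes "0 < x"
  shows "D n x (u + v) = D n x u + D n x v" "D n x (a *\<^sub>C u) = a *\<^sub>C D n x u"
proof -
  show "D n x (u + v) = D n x u + D n x v"
  proof (induction n)
    case (Suc n)
    then show ?case using K_add[OF D_shift_dom(2)[OF assms] D_shift_dom(2)[OF assms]] by (simp add: D_Suc)
  qed (use assms in \<open>simp add: D_0 R_add\<close>)
  show "D n x (a *\<^sub>C u) = a *\<^sub>C D n x u"
  proof (induction n)
    case (Suc n)
    then show ?case using K_scaleC[OF D_shift_dom(2)[OF assms]] by (simp add: D_Suc)
  qed (use assms in \<open>simp add: D_0 R_scaleC\<close>)
qed

lemma D_D:
  assumes "0 < x" "0 < y"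
  shows "D j x (D k y u) = D (j + k) (x + y) u"
  using D_shift_dom(1)[OF assms, of k u] by (simp add: D_def funpow_add)

lemma D_R_0: "0 < x \<Longrightarrow> D n x (R 0 u) = D n x u"
  by (simp add: D_def R_R_0)

lemma D_K: "(u, v) \<in> gen \<Longrightarrow> 0 < x \<Longrightarrow> D (Suc n) x u = D n x v"
  using K_R[of u x] dom_KI[of u v] by (simp add: D_def funpow_Suc_right del: funpow.simps)

definition \<beta> where "\<beta> = B * exp 1"

lemma \<beta>_pos: "0 < \<beta>" using B_pos by (simp add: \<beta>_def)

text \<open>
  With \<open>n\<close> steps of length \<open>x/n\<close>, the derivative is \<open>(K R(x/n))\<^sup>n u\<close>, which is bounded by
  \<open>(B n/x)\<^sup>n \<parallel>u\<parallel>\<close>; and \<open>n\<^sup>n \<le> n! e\<^sup>n\<close>.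
\<close>

lemma D_bound:
  assumes x: "0 < x"
  shows "norm (D n x u) \<le> M * fact n * (\<beta> / x) ^ n * norm u"
proof (cases "n = 0")
  case True
  then show ?thesis using R_bound[of x u] x by (simp add: D_0)
next
  case False
  define s where "s = x / real n"
  have s: "s > 0" "x = real n * s" using False x by (simp_all add: s_def)
  have step: "norm (D (Suc k) (real (Suc k) * s) u) \<le> (B / s) ^ Suc k * norm u" for k
  proof (induction k)
    case 0
    show ?case using norm_K_R[OF s(1), of u] by (simp add: D_Suc D_0)
  next
    case (Suc k)
    let ?w = "D (Suc k) (real (Suc k) * s) u"
    have "D (Suc (Suc k)) (real (Suc (Suc k)) * s) u = K (D (Suc k) (s + real (Suc k) * s) u)"
      by (simp add: D_Suc algebra_simps)
    also have "\<dots> = K (R s ?w)" using s(1) D_shift_dom(1)[of s "real (Suc k) * s"] by simp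
    finally have "norm (D (Suc (Suc k)) (real (Suc (Suc k)) * s) u) \<le> B / s * norm ?w"
      using norm_K_R[OF s(1)] by simp
    also have "\<dots> \<le> B / s * ((B / s) ^ Suc k * norm u)"
      using Suc B_pos s(1) by (intro mult_left_mono) auto
    finally show ?case by (simp add: mult.assoc)
  qed
  obtain k where k: "n = Suc k" using False by (cases n) auto
  have "norm (D n x u) \<le> (B / s) ^ n * norm u" using step[of k] s(2) by (simp add: k)
  also have "(B / s) ^ n = (B / x) ^ n * real n ^ n"
  proof -
    have "B / s = B / x * real n" using False x by (simp add: s_def)
    then show ?thesis by (simp only: power_mult_distrib)
  qed
  also have "\<dots> \<le> (B / x) ^ n * (fact n * exp 1 ^ n)"
  proof (rule mult_left_mono)
    show "real n ^ n \<le> fact n * exp 1 ^ n"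
      using power_over_fact_le_exp[of n] by (simp add: divide_le_eq exp_of_nat_mult[symmetric] mult.commute)
  qed (use B_pos x in simp)
  also have "\<dots> = fact n * (\<beta> / x) ^ n"
    by (simp add: \<beta>_def power_mult_distrib power_divide)
  finally have "norm (D n x u) \<le> fact n * (\<beta> / x) ^ n * norm u" by (simp add: mult_right_mono)
  also have "\<dots> = 1 * (fact n * (\<beta> / x) ^ n * norm u)" by simp
  also have "\<dots> \<le> M * (fact n * (\<beta> / x) ^ n * norm u)"
    using \<beta>_pos x by (intro mult_right_mono[OF M_ge_1] mult_nonneg_nonneg) auto
  finally show ?thesis by (simp add: mult_ac)
qed

text \<open>The Taylor series of the orbit about the time \<open>x\<close>, at the point \<open>x + z\<close>.\<close>

definition G :: "real \<Rightarrow> complex \<Rightarrow> 'a \<Rightarrow> 'a"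
  where "G x z u = (\<Sum>n. (z ^ n / fact n) *\<^sub>C D n x u)"

lemma G_term_bound:
  assumes "0 < x"
  shows "norm ((z ^ n / fact n) *\<^sub>C D n x u) \<le> M * norm u * (cmod z * \<beta> / x) ^ n"
proof -
  have "norm ((z ^ n / fact n) *\<^sub>C D n x u) = cmod z ^ n / fact n * norm (D n x u)"
    by (simp add: norm_scaleC norm_divide norm_power)
  also have "\<dots> \<le> cmod z ^ n / fact n * (M * fact n * (\<beta> / x) ^ n * norm u)"
    by (intro mult_left_mono D_bound assms) auto
  also have "\<dots> = M * norm u * (cmod z * \<beta> / x) ^ n"
    by (simp add: power_mult_distrib power_divide)
  finally show ?thesis .
qed

lemma G_summable:
  assumes "0 < x" "cmod z * \<beta> < x"
  shows "summable (\<lambda>n. norm ((z ^ n / fact n) *\<^sub>C D n x u))"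
proof (rule summable_comparison_test')
  show "summable (\<lambda>n. M * norm u * (cmod z * \<beta> / x) ^ n)"
    using assms \<beta>_pos by (intro summable_mult summable_geometric) (simp add: abs_mult)
  show "norm (norm ((z ^ n / fact n) *\<^sub>C D n x u)) \<le> M * norm u * (cmod z * \<beta> / x) ^ n" if "n \<ge> 0" for n
    using G_term_bound[OF assms(1)] by simp
qed

lemma G_sums:
  assumes "0 < x" "cmod z * \<beta> < x"
  shows "(\<lambda>n. (z ^ n / fact n) *\<^sub>C D n x u) sums G x z u"
  unfolding G_def by (rule summable_sums[OF summable_norm_cancel[OF G_summable[OF assms]]])

lemma G_bound:
  assumes "0 < x" "2 * cmod z * \<beta> \<le> x"
  shows "norm (G x z u) \<le> 2 * M * norm u"
proof -
  let ?q = "cmod z * \<beta> / x"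
  have q: "0 \<le> ?q" "?q \<le> 1 / 2" using assms \<beta>_pos by (auto simp: field_simps)
  have s: "(\<lambda>n. M * norm u * ?q ^ n) sums (M * norm u * (1 / (1 - ?q)))"
  proof (intro sums_mult geometric_sums)
    show "norm ?q < 1" unfolding real_norm_def using q by linarith
  qed
  have lt: "cmod z * \<beta> < x" using assms by linarith
  have "norm (G x z u) \<le> (\<Sum>n. norm ((z ^ n / fact n) *\<^sub>C D n x u))"
    unfolding G_def by (rule summable_norm[OF G_summable[OF assms(1) lt]])
  also have "\<dots> \<le> (\<Sum>n. M * norm u * ?q ^ n)"
    by (intro suminf_le G_term_bound assms(1) G_summable lt sums_summable[OF s])
  also have "\<dots> = M * norm u * (1 / (1 - ?q))" by (rule sums_unique[OF s, symmetric])
  also have "\<dots> \<le> M * norm u * 2"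
  proof (rule mult_left_mono)
    show "1 / (1 - ?q) \<le> 2" by (rule inverse_one_minus_le_2[OF q(2)])
  qed (use M_ge_1 in simp)
  finally show ?thesis by simp
qed

lemma G_linear:
  assumes "0 < x" "cmod z * \<beta> < x"
  shows "G x z (u + v) = G x z u + G x z v" "G x z (a *\<^sub>C u) = a *\<^sub>C G x z u"
proof -
  have "(\<lambda>n. (z ^ n / fact n) *\<^sub>C D n x u + (z ^ n / fact n) *\<^sub>C D n x v) sums (G x z u + G x z v)"
    by (intro sums_add G_sums assms)
  then show "G x z (u + v) = G x z u + G x z v"
    using G_sums[OF assms, of "u + v"] by (simp add: D_linear[OF assms(1)] scaleC_add_right sums_unique2)
  have "(\<lambda>n. a *\<^sub>C ((z ^ n / fact n) *\<^sub>C D n x u)) sums (a *\<^sub>C G x z u)"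
    by (intro bounded_linear.sums[OF bounded_linear_scaleC] G_sums assms)
  then show "G x z (a *\<^sub>C u) = a *\<^sub>C G x z u"
    using G_sums[OF assms, of "a *\<^sub>C u"]
    by (simp add: D_linear[OF assms(1)] scaleC_scaleC mult.commute sums_unique2)
qed

lemma G_0: "G x 0 u = R x u"
proof -
  have "(\<lambda>n. (0 ^ n / fact n) *\<^sub>C D n x u) sums ((0 ^ 0 / fact 0) *\<^sub>C D 0 x u)"
    using sums_finite[of "{0}" "\<lambda>n. (0 ^ n / fact n) *\<^sub>C D n x u"] by (simp add: power_0_left)
  then show ?thesis by (simp add: G_def sums_unique[symmetric] D_0)
qed

lemma G_R_0: "0 < x \<Longrightarrow> G x z (R 0 u) = G x z u"
  by (simp add: G_def D_R_0)

lemma D_bounded_linear: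
  assumes "0 < x"
  shows "bounded_linear (D n x)"
  by (rule bounded_linear_intro[where K = "M * fact n * (\<beta> / x) ^ n"])
    (use D_bound[OF assms] in \<open>auto simp: D_linear[OF assms] scaleR_scaleC mult_ac\<close>)

text \<open>
  The semigroup law of the Taylor series is the binomial theorem: since \<open>D j x (D k y u)\<close> depends
  only on \<open>j + k\<close> and \<open>x + y\<close>, the double series can be summed along the diagonals.
\<close>

lemma G_G:
  assumes x: "0 < x" "cmod z * \<beta> < x" and y: "0 < y" "cmod w * \<beta> < y"
  shows "G x z (G y w u) = G (x + y) (z + w) u"
proof -
  define f where "f = (\<lambda>(j, k). (z ^ j / fact j * (w ^ k / fact k)) *\<^sub>C D (j + k) (x + y) u)"
  let ?q = "cmod z * \<beta> / x" and ?r = "cmod w * \<beta> / y"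
  have q: "0 \<le> ?q" "?q < 1" "0 \<le> ?r" "?r < 1" using x y \<beta>_pos by auto
  have f_eq: "f (j, k) = (z ^ j / fact j) *\<^sub>C D j x ((w ^ k / fact k) *\<^sub>C D k y u)" for j k
    by (simp add: f_def D_linear(2)[OF x(1)] D_D[OF x(1) y(1)] scaleC_scaleC)
  have f_bound: "norm (f (j, k)) \<le> (M * M * norm u * ?q ^ j) * ?r ^ k" for j k
  proof -
    have "norm (f (j, k)) \<le> M * norm ((w ^ k / fact k) *\<^sub>C D k y u) * ?q ^ j"
      unfolding f_eq by (rule G_term_bound[OF x(1)])
    also have "\<dots> \<le> M * (M * norm u * ?r ^ k) * ?q ^ j"
      using q M_ge_1 by (intro mult_right_mono mult_left_mono G_term_bound y(1)) auto
    finally show ?thesis by (simp add: mult_ac)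
  qed
  have geo: "((\<lambda>k. a * s ^ k) has_sum a * (1 / (1 - s))) UNIV" if "0 \<le> s" "s < 1" "0 \<le> a" for a s :: real
  proof (rule norm_summable_imp_has_sum)
    have "summable (\<lambda>n. a * s ^ n)" using that by (intro summable_mult summable_geometric) simp
    then show "summable (\<lambda>n. norm (a * s ^ n))" using that by simp
    show "(\<lambda>k. a * s ^ k) sums (a * (1 / (1 - s)))" using that by (intro sums_mult geometric_sums) simp
  qed
  have "(\<lambda>(j, k). (M * M * norm u * ?q ^ j) * ?r ^ k) summable_on UNIV \<times> UNIV"
  proof (rule summable_on_SigmaI)
    fix j :: nat
    show "((\<lambda>k. case (j, k) of (j, k) \<Rightarrow> (M * M * norm u * ?q ^ j) * ?r ^ k)
        has_sum (M * M * norm u * ?q ^ j) * (1 / (1 - ?r))) UNIV"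
      using geo[of ?r "M * M * norm u * ?q ^ j"] q M_ge_1 by simp
  next
    have "((\<lambda>j. (M * M * norm u * (1 / (1 - ?r))) * ?q ^ j)
        has_sum (M * M * norm u * (1 / (1 - ?r))) * (1 / (1 - ?q))) UNIV"
      using q M_ge_1 by (intro geo) auto
    then show "(\<lambda>j. (M * M * norm u * ?q ^ j) * (1 / (1 - ?r))) summable_on UNIV"
      by (auto simp: mult_ac dest: has_sum_imp_summable)
  qed (use q M_ge_1 in auto)
  then have "(\<lambda>i. norm (f i)) summable_on UNIV \<times> UNIV"
    by (rule summable_on_comparison_test) (use f_bound in auto)
  then have summ: "f summable_on UNIV \<times> UNIV" by (rule abs_summable_summable)
  have G_has_sum: "((\<lambda>n. (z ^ n / fact n) *\<^sub>C D n x v) has_sum G x z v) UNIV"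
    if "0 < x" "cmod z * \<beta> < x" for x z v
    by (rule norm_summable_imp_has_sum[OF G_summable[OF that] G_sums[OF that]])
  have inner: "((\<lambda>k. f (j, k)) has_sum (z ^ j / fact j) *\<^sub>C D j x (G y w u)) UNIV" for j
  proof -
    have "bounded_linear (\<lambda>v. (z ^ j / fact j) *\<^sub>C D j x v)"
      by (rule bounded_linear_compose[OF bounded_linear_scaleC D_bounded_linear[OF x(1)]])
    from has_sum_bounded_linear[OF this G_has_sum[OF y]]
    show ?thesis by (simp add: f_eq o_def)
  qed
  have S1: "(f has_sum G x z (G y w u)) (UNIV \<times> UNIV)"
    by (rule has_sum_SigmaI[OF inner G_has_sum[OF x] summ])
  have bij: "bij_betw (\<lambda>(n, k). (k, n - k)) (SIGMA n:UNIV. {..n}) (UNIV \<times> (UNIV :: nat set))"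
    by (rule bij_betwI[where g = "\<lambda>(j, k). (j + k, j)"]) auto
  have S2: "((\<lambda>(n, k). f (k, n - k)) has_sum G x z (G y w u)) (SIGMA n:UNIV. {..n})"
    using S1 has_sum_reindex_bij_betw[OF bij, of f] by (simp add: case_prod_unfold)
  have diag: "(\<Sum>k\<le>n. f (k, n - k)) = ((z + w) ^ n / fact n) *\<^sub>C D n (x + y) u" for n
  proof -
    have "z ^ k / fact k * (w ^ (n - k) / fact (n - k)) = of_nat (n choose k) * z ^ k * w ^ (n - k) / fact n"
      if "k \<le> n" for k
      using that by (simp add: binomial_fact field_simps)
    then have "(\<Sum>k\<le>n. f (k, n - k))
        = (\<Sum>k\<le>n. (of_nat (n choose k) * z ^ k * w ^ (n - k) / fact n) *\<^sub>C D n (x + y) u)"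
      by (intro sum.cong) (auto simp: f_def)
    also have "\<dots> = (\<Sum>k\<le>n. of_nat (n choose k) * z ^ k * w ^ (n - k) / fact n) *\<^sub>C D n (x + y) u"
    proof -
      have "sum g A *\<^sub>C v = (\<Sum>a\<in>A. g a *\<^sub>C v)" if "finite A" for g :: "nat \<Rightarrow> complex" and A and v :: 'a
        using that by (induction A rule: finite_induct) (auto simp: scaleC_add_left)
      then show ?thesis by simp
    qed
    also have "(\<Sum>k\<le>n. of_nat (n choose k) * z ^ k * w ^ (n - k) / fact n) = (z + w) ^ n / fact n"
      by (simp add: binomial_ring sum_divide_distrib)
    finally show ?thesis .
  qed
  have "((\<lambda>n. ((z + w) ^ n / fact n) *\<^sub>C D n (x + y) u) has_sum G x z (G y w u)) UNIV"
  proof (rule has_sum_SigmaD[OF S2])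
    fix n :: nat
    show "((\<lambda>k. case (n, k) of (n, k) \<Rightarrow> f (k, n - k)) has_sum ((z + w) ^ n / fact n) *\<^sub>C D n (x + y) u) {..n}"
      unfolding diag[symmetric] by (simp add: has_sum_finite)
  qed
  moreover have "cmod (z + w) * \<beta> < x + y"
  proof -
    have "cmod (z + w) * \<beta> \<le> (cmod z + cmod w) * \<beta>"
      using \<beta>_pos by (intro mult_right_mono norm_triangle_ineq) auto
    then show ?thesis using x(2) y(2) by (simp add: distrib_right)
  qed
  then have "((\<lambda>n. ((z + w) ^ n / fact n) *\<^sub>C D n (x + y) u) has_sum G (x + y) (z + w) u) UNIV"
    using x y by (intro G_has_sum) auto
  ultimately show ?thesis by (rule has_sum_unique)
qed

lemma D_has_vector_derivative:
  assumes "0 < x" "0 \<le> t"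
  shows "((\<lambda>t. D n (x + t) u) has_vector_derivative D (Suc n) (x + t) u) (at t within {0..r})"
proof -
  have eq: "D n (x + s) u = R (x / 2 + s) (D n (x / 2) u)" if "0 \<le> s" for n s
    using D_shift_dom(1)[of "x / 2 + s" "x / 2" n u] assms(1) that by (simp add: algebra_simps)
  have "((\<lambda>s. R s (D n (x / 2) u)) has_vector_derivative R (x / 2 + t) (D (Suc n) (x / 2) u)) (at (x / 2 + t))"
    using assms by (intro R_has_vector_derivative_at D_gen) auto
  moreover have "((\<lambda>s. x / 2 + s) has_vector_derivative 1) (at t)"
    by (auto intro!: derivative_eq_intros simp: has_real_derivative_iff_has_vector_derivative[symmetric])
  ultimately have "((\<lambda>s. R (x / 2 + s) (D n (x / 2) u)) has_vector_derivative D (Suc n) (x + t) u) (at t)"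
    using vector_diff_chain_at[of "\<lambda>s. x / 2 + s" 1 t "\<lambda>s. R s (D n (x / 2) u)"] eq[OF assms(2), of "Suc n"]
    by (simp add: o_def)
  then have "((\<lambda>s. R (x / 2 + s) (D n (x / 2) u)) has_vector_derivative D (Suc n) (x + t) u) (at t within {0..})"
    by (rule has_vector_derivative_at_within)
  then have "((\<lambda>t. D n (x + t) u) has_vector_derivative D (Suc n) (x + t) u) (at t within {0..})"
    by (rule has_vector_derivative_transform[rotated 2]) (use assms eq in auto)
  then show ?thesis by (rule has_vector_derivative_within_subset) auto
qed

text \<open>
  Taylor's theorem for the orbit: the derivative of \<open>t \<mapsto> \<Sum>n\<le>N. (r - t)\<^sup>n / n! D n (x + t) u\<close> telescopes
  to its last term.
\<close>

lemma G_real: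
  assumes x: "0 < x" and r: "0 \<le> r" "r * \<beta> < x"
  shows "G x (complex_of_real r) u = R (x + r) u"
proof -
  define P where "P N t = (\<Sum>n\<le>N. ((r - t) ^ n / fact n) *\<^sub>R D n (x + t) u)" for N t
  define b where "b N = M * norm u * (\<beta> / x) * (real (Suc N) * (r * \<beta> / x) ^ N)" for N
  have dP: "(P N has_vector_derivative ((r - t) ^ N / fact N) *\<^sub>R D (Suc N) (x + t) u) (at t within {0..r})"
    if "t \<in> {0..r}" for N t
  proof (induction N)
    case 0
    then show ?case using that D_has_vector_derivative[OF x, of t 0 u r] by (simp add: P_def)
  next
    case (Suc N)
    have c: "((\<lambda>t. (r - t) ^ Suc N / fact (Suc N)) has_real_derivative - ((r - t) ^ N / fact N)) (at t within {0..r})"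
      by (rule derivative_eq_intros refl | simp)+
    have "((\<lambda>t. ((r - t) ^ Suc N / fact (Suc N)) *\<^sub>R D (Suc N) (x + t) u) has_vector_derivative
        ((r - t) ^ Suc N / fact (Suc N)) *\<^sub>R D (Suc (Suc N)) (x + t) u
        + (- ((r - t) ^ N / fact N)) *\<^sub>R D (Suc N) (x + t) u) (at t within {0..r})"
      by (rule has_vector_derivative_scaleR[OF c D_has_vector_derivative[OF x]]) (use that in simp)
    from has_vector_derivative_add[OF Suc this] show ?case
      by (simp add: P_def del: fact_Suc power_Suc)
  qed
  have bound: "norm (((r - t) ^ N / fact N) *\<^sub>R D (Suc N) (x + t) u) \<le> b N" if "t \<in> {0..r}" for N t
  proof -
    have "norm (D (Suc N) (x + t) u) \<le> M * fact (Suc N) * (\<beta> / (x + t)) ^ Suc N * norm u"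
      using that x by (intro D_bound) auto
    also have "\<dots> \<le> M * fact (Suc N) * (\<beta> / x) ^ Suc N * norm u"
      using that x \<beta>_pos M_ge_1
      by (intro mult_right_mono mult_left_mono power_mono divide_left_mono) auto
    finally have "\<bar>(r - t) ^ N / fact N\<bar> * norm (D (Suc N) (x + t) u)
        \<le> (r ^ N / fact N) * (M * fact (Suc N) * (\<beta> / x) ^ Suc N * norm u)"
      using that r by (intro mult_mono) (auto simp: abs_mult power_abs intro!: divide_right_mono power_mono)
    also have "\<dots> = b N"
    proof -
      have "(r ^ N / F) * (M * (S * F) * q ^ Suc N * U) = M * U * q * (S * (r * q) ^ N)"
        if "F \<noteq> 0" for F S q U :: real
        using that by (simp add: power_mult_distrib)
      from this[of "fact N" "real (Suc N)" "\<beta> / x" "norm u"] show ?thesis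
        unfolding b_def fact_Suc by simp
    qed
    finally show ?thesis by simp
  qed
  have diff: "norm (P N r - P N 0) \<le> b N * r" for N
  proof -
    have "norm (P N r - P N 0) \<le> b N * norm (r - 0)"
    proof (rule differentiable_bound[where S = "{0..r}"])
      fix t assume t: "t \<in> {0..r}"
      show "(P N has_derivative (\<lambda>h. h *\<^sub>R (((r - t) ^ N / fact N) *\<^sub>R D (Suc N) (x + t) u))) (at t within {0..r})"
        using dP[OF t] by (simp add: has_vector_derivative_def)
      have "norm (h *\<^sub>R (((r - t) ^ N / fact N) *\<^sub>R D (Suc N) (x + t) u)) \<le> b N * norm h" for h :: real
        using mult_left_mono[OF bound[OF t, of N], of "\<bar>h\<bar>"] by (simp add: mult.commute abs_mult mult.assoc)
      then show "onorm (\<lambda>h. h *\<^sub>R (((r - t) ^ N / fact N) *\<^sub>R D (Suc N) (x + t) u)) \<le> b N"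
        by (rule onorm_le)
    qed (use r in auto)
    then show ?thesis using r by simp
  qed
  have Pr: "P N r = R (x + r) u" for N
  proof -
    have "P N r = (\<Sum>n\<in>{0}. ((r - r) ^ n / fact n) *\<^sub>R D n (x + r) u)"
      unfolding P_def by (rule sum.mono_neutral_right) (auto simp: power_0_left)
    then show ?thesis by (simp add: D_0)
  qed
  have lim: "(\<lambda>N. P N 0) \<longlonglongrightarrow> G x (complex_of_real r) u"
  proof -
    have "(\<lambda>n. (complex_of_real r ^ n / fact n) *\<^sub>C D n x u) sums G x (complex_of_real r) u"
      using r by (intro G_sums x) simp
    moreover have "(complex_of_real r ^ n / fact n) *\<^sub>C D n x u = (r ^ n / fact n) *\<^sub>R D n x u" for n
      by (simp add: scaleR_scaleC)
    ultimately show ?thesis by (simp add: sums_def_le P_def)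
  qed
  have "b \<longlonglongrightarrow> M * norm u * (\<beta> / x) * (0 + 0)"
  proof -
    let ?q = "r * \<beta> / x"
    have q: "norm ?q < 1" using r x \<beta>_pos by (simp add: abs_mult)
    have "(\<lambda>N. real N * ?q ^ N + ?q ^ N) \<longlonglongrightarrow> 0 + 0"
      by (intro tendsto_add powser_times_n_limit_0[OF q] LIMSEQ_power_zero[OF q])
    then have "(\<lambda>N. real (Suc N) * ?q ^ N) \<longlonglongrightarrow> 0 + 0"
      by (simp add: distrib_right add.commute)
    then show ?thesis unfolding b_def by (rule tendsto_mult_left)
  qed
  then have "(\<lambda>N. b N * r) \<longlonglongrightarrow> 0" using tendsto_mult_right[of b 0 sequentially r] by simp
  then have "(\<lambda>N. R (x + r) u - P N 0) \<longlonglongrightarrow> 0"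
    by (rule Lim_null_comparison[rotated]) (use diff in \<open>simp add: Pr\<close>)
  moreover have "(\<lambda>N. R (x + r) u - P N 0) \<longlonglongrightarrow> R (x + r) u - G x (complex_of_real r) u"
    by (intro tendsto_diff tendsto_const lim)
  ultimately have "R (x + r) u - G x (complex_of_real r) u = 0" using LIMSEQ_unique by blast
  then show ?thesis by simp
qed

text \<open>
  Splitting the centre into two parts, the semigroup law of the series reduces the claim to real
  increments, where the sum of the series is the orbit itself.
\<close>

lemma G_shift:
  assumes x: "0 < x" and r: "0 \<le> r" "cmod z * \<beta> + r * \<beta> < x"
  shows "G x (z + complex_of_real r) u = G (x + r) z u"
proof -
  define d where "d = (x - cmod z * \<beta> - r * \<beta>) / 2"
  define x1 where "x1 = r * \<beta> + d"
  define x2 where "x2 = cmod z * \<beta> + d"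
  have d: "d > 0" using r by (simp add: d_def)
  have x12: "x = x1 + x2" by (simp add: x1_def x2_def d_def)
  have p1: "0 < x1" "r * \<beta> < x1" using d r \<beta>_pos by (auto simp: x1_def intro!: add_nonneg_pos)
  have p2: "0 < x2" "cmod z * \<beta> < x2" using d \<beta>_pos by (auto simp: x2_def intro!: add_nonneg_pos)
  have "G x (z + complex_of_real r) u = G x1 (complex_of_real r) (G x2 z u)"
    unfolding x12 using p1 p2 r by (subst G_G) (auto simp: add.commute)
  also have "\<dots> = G (x1 + r) 0 (G x2 z u)" using G_real[OF p1(1) r(1) p1(2)] by (simp add: G_0)
  also have "\<dots> = G (x + r) z u"
    using p1 p2 r by (subst G_G) (auto simp: x12 add_ac)
  finally show ?thesis .
qed

section \<open>The analytic extension\<close>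

text \<open>
  In this cone the series about the centre \<open>Re z\<close> with the increment \<open>\<i> Im z\<close> is dominated by a geometric
  series of ratio \<open>1/4\<close>.
\<close>

definition cone :: "complex set"
  where "cone = {z. 4 * \<beta> * \<bar>Im z\<bar> < Re z}"

definition extension :: "complex \<Rightarrow> 'a \<Rightarrow> 'a"
  where "extension z u = G (Re z) (\<i> * complex_of_real (Im z)) u"

lemma coneD:
  assumes "z \<in> cone"
  shows "0 < Re z" "cmod (\<i> * complex_of_real (Im z)) * \<beta> < Re z / 4"
proof -
  have "0 \<le> 4 * \<beta> * \<bar>Im z\<bar>" using \<beta>_pos by simp
  then show "0 < Re z" "cmod (\<i> * complex_of_real (Im z)) * \<beta> < Re z / 4"
    using assms by (auto simp: cone_def norm_mult mult_ac)
qed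

lemma extension_real: "extension (complex_of_real t) u = R t u"
  by (simp add: extension_def G_0)

lemma extension_linear:
  assumes "z \<in> cone"
  shows "extension z (u + v) = extension z u + extension z v" "extension z (a *\<^sub>C u) = a *\<^sub>C extension z u"
proof -
  have "cmod (\<i> * complex_of_real (Im z)) * \<beta> < Re z" using coneD[OF assms] by linarith
  from G_linear[OF coneD(1)[OF assms] this]
  show "extension z (u + v) = extension z u + extension z v" "extension z (a *\<^sub>C u) = a *\<^sub>C extension z u"
    by (simp_all add: extension_def)
qed

lemma extension_bound: "z \<in> cone \<Longrightarrow> norm (extension z u) \<le> 2 * M * norm u"
  unfolding extension_def using coneD[of z] by (intro G_bound) auto

lemma extension_R_0: "z \<in> cone \<Longrightarrow> extension z (R 0 u) = extension z u"
  unfolding extension_def by (intro G_R_0 coneD)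

lemma extension_semigroup:
  assumes "z \<in> cone" "w \<in> cone"
  shows "extension (z + w) u = extension z (extension w u)"
  unfolding extension_def
  using coneD[OF assms(1)] coneD[OF assms(2)] by (subst G_G) (auto simp: distrib_left)

text \<open>
  The real part of the increment is moved into the centre; if it is negative, the shift is read backwards.
\<close>

lemma G_recentre:
  assumes "cmod h * (2 * \<beta> + 1) < a"
  shows "0 < a + Re h" "cmod (\<i> * complex_of_real (Im h)) * \<beta> < a + Re h"
    and "G a h v = G (a + Re h) (\<i> * complex_of_real (Im h)) v"
proof -
  have le: "\<bar>Re h\<bar> * \<beta> \<le> cmod h * \<beta>" "\<bar>Im h\<bar> * \<beta> \<le> cmod h * \<beta>" "0 \<le> cmod h * \<beta>"
    using \<beta>_pos abs_Re_le_cmod abs_Im_le_cmod by (auto intro!: mult_right_mono)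
  have lt: "2 * (cmod h * \<beta>) + cmod h < a" using assms by (simp add: algebra_simps)
  have re: "\<bar>Re h\<bar> \<le> cmod h" by (rule abs_Re_le_cmod)
  have a: "a > 0" using lt le norm_ge_zero[of h] by linarith
  show 1: "0 < a + Re h" using lt re le by linarith
  have im: "cmod (\<i> * complex_of_real (Im h)) * \<beta> = \<bar>Im h\<bar> * \<beta>" by (simp add: norm_mult)
  show "cmod (\<i> * complex_of_real (Im h)) * \<beta> < a + Re h"
    unfolding im using lt re le by linarith
  show "G a h v = G (a + Re h) (\<i> * complex_of_real (Im h)) v"
  proof (cases "Re h \<ge> 0")
    case True
    have "cmod (\<i> * complex_of_real (Im h)) * \<beta> + Re h * \<beta> < a"
      using True lt le norm_ge_zero[of h] unfolding im by linarith
    then have "G a (\<i> * complex_of_real (Im h) + complex_of_real (Re h)) v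
        = G (a + Re h) (\<i> * complex_of_real (Im h)) v"
      by (rule G_shift[OF a True])
    then show ?thesis by (simp add: complex_eq[of h, symmetric] add.commute)
  next
    case False
    have "G (a + Re h) (h + complex_of_real (- Re h)) v = G (a + Re h + - Re h) h v"
      using False lt le re by (intro G_shift 1) auto
    moreover have "h + complex_of_real (- Re h) = \<i> * complex_of_real (Im h)"
      by (simp add: complex_eq_iff)
    ultimately show ?thesis by simp
  qed
qed

text \<open>
  Half of \<open>Re z\<close> is spent on the fixed operator \<open>V\<close>. The other half is the centre \<open>a\<close> of a Taylor series in
  the increment \<open>h\<close>, which is applied to \<open>V u\<close> and whose terms from the second order on are \<open>O(\<bar>h\<bar>\<^sup>2)\<close>,
  uniformly in \<open>u\<close>.
\<close>

lemma extension_differentiable: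
  assumes z: "z \<in> cone"
  shows "operator_differentiable_at UNIV norm extension z"
proof -
  define a where "a = Re z / 2"
  define w where "w = \<i> * complex_of_real (Im z)"
  have a: "a > 0" and wa: "cmod w * \<beta> < a / 2" using coneD[OF z] by (auto simp: a_def w_def)
  define V where "V = G a w"
  have wa': "cmod w * \<beta> < a" using wa a by linarith
  have V: "norm (V u) \<le> 2 * M * norm u" for u
    unfolding V_def using wa by (intro G_bound a) simp
  have ext_h: "extension (z + h) u = G a h (V u)" if h: "cmod h * (2 * \<beta> + 1) < a" for h u
  proof -
    have "G a h (V u) = G (a + Re h) (\<i> * complex_of_real (Im h)) (G a w u)"
      unfolding V_def by (rule G_recentre(3)[OF h])
    also have "\<dots> = G (a + Re h + a) (\<i> * complex_of_real (Im h) + w) u"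
      by (rule G_G[OF G_recentre(1,2)[OF h] a wa'])
    finally show ?thesis by (simp add: extension_def a_def w_def distrib_left add_ac)
  qed
  have ext_0: "extension z u = R a (V u)" for u
    using ext_h[of 0 u] a by (simp add: G_0)
  define T' where "T' u = D 1 a (V u)" for u
  have "bounded_operator UNIV norm T'"
    unfolding bounded_operator_def
  proof (intro conjI ballI allI UNIV_I exI)
    fix u v and c :: complex
    show "T' (u + v) = T' u + T' v" "T' (c *\<^sub>C u) = c *\<^sub>C T' u"
      by (simp_all add: T'_def V_def G_linear[OF a wa'] D_linear[OF a])
    have "norm (T' u) \<le> M * fact 1 * (\<beta> / a) ^ 1 * norm (V u)"
      unfolding T'_def by (rule D_bound[OF a])
    also have "\<dots> \<le> M * fact 1 * (\<beta> / a) ^ 1 * (2 * M * norm u)"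
      using M_ge_1 \<beta>_pos a by (intro mult_left_mono V) auto
    finally show "norm (T' u) \<le> M * fact 1 * (\<beta> / a) ^ 1 * (2 * M) * norm u" by (simp add: mult_ac)
  qed
  moreover have "\<forall>\<^sub>F h in at 0. \<forall>u\<in>UNIV.
      norm (inverse h *\<^sub>C (extension (z + h) u - extension z u) - T' u) \<le> e * norm u" if e: "e > 0" for e
  proof -
    define k where "k = 4 * M * M * (\<beta> / a)\<^sup>2"
    have k: "k > 0" using M_ge_1 \<beta>_pos a by (simp add: k_def)
    define d where "d = min (a / (2 * (2 * \<beta> + 1))) (e / k)"
    have d: "d > 0" using a \<beta>_pos e k by (simp add: d_def)
    have "norm (inverse h *\<^sub>C (extension (z + h) u - extension z u) - T' u) \<le> e * norm u"
      if h: "h \<noteq> 0" "cmod h < d" for h u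
    proof -
      have h1: "cmod h * (2 * \<beta> + 1) < a / 2"
        using h(2) \<beta>_pos by (simp add: d_def field_simps)
      then have h2: "cmod h * (2 * \<beta> + 1) < a" using a by linarith
      have "2 * (cmod h * \<beta>) \<le> cmod h * (2 * \<beta> + 1)" by (simp add: algebra_simps)
      moreover have "0 \<le> cmod h * \<beta>" using \<beta>_pos by simp
      ultimately have h3: "cmod h * \<beta> < a / 2" using h1 by linarith
      let ?q = "cmod h * \<beta> / a"
      have q: "0 \<le> ?q" "?q \<le> 1 / 2" using h3 a \<beta>_pos by (auto simp: field_simps)
      define W where "W = G a h (V u) - R a (V u) - h *\<^sub>C D 1 a (V u)"
      have "(\<lambda>n. (h ^ (n + 2) / fact (n + 2)) *\<^sub>C D (n + 2) a (V u)) sums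
          (G a h (V u) - (\<Sum>n<2. (h ^ n / fact n) *\<^sub>C D n a (V u)))"
        using h3 a by (intro sums_split_initial_segment G_sums) auto
      then have W_sums: "(\<lambda>n. (h ^ (n + 2) / fact (n + 2)) *\<^sub>C D (n + 2) a (V u)) sums W"
        by (simp add: W_def lessThan_nat_numeral numeral_2_eq_2 lessThan_Suc D_0 algebra_simps)
      have geo: "(\<lambda>n. M * norm (V u) * ?q\<^sup>2 * ?q ^ n) sums (M * norm (V u) * ?q\<^sup>2 * (1 / (1 - ?q)))"
      proof (intro sums_mult geometric_sums)
        show "norm ?q < 1" unfolding real_norm_def using q by linarith
      qed
      have "norm W \<le> M * norm (V u) * ?q\<^sup>2 * (1 / (1 - ?q))"
      proof (rule norm_sums_le[OF W_sums geo])
        fix n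
        have eq: "X * q ^ (n + 2) = X * q\<^sup>2 * q ^ n" for X q :: real
          by (simp add: power2_eq_square)
        show "norm ((h ^ (n + 2) / fact (n + 2)) *\<^sub>C D (n + 2) a (V u)) \<le> M * norm (V u) * ?q\<^sup>2 * ?q ^ n"
          unfolding eq[symmetric] by (rule G_term_bound[OF a])
      qed
      also have "\<dots> \<le> M * norm (V u) * ?q\<^sup>2 * 2"
      proof (rule mult_left_mono)
        show "1 / (1 - ?q) \<le> 2" by (rule inverse_one_minus_le_2[OF q(2)])
      qed (use M_ge_1 in simp)
      also have "\<dots> \<le> M * (2 * M * norm u) * ?q\<^sup>2 * 2"
        using M_ge_1 by (intro mult_right_mono mult_left_mono V) auto
      also have "\<dots> = cmod h * (cmod h * k * norm u)"
        by (simp add: k_def power2_eq_square)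
      finally have W: "norm W \<le> cmod h * (cmod h * k * norm u)" .
      have "inverse h *\<^sub>C (extension (z + h) u - extension z u) - T' u = inverse h *\<^sub>C W"
        using h(1) by (simp add: ext_h[OF h2] ext_0 T'_def W_def scaleC_diff_right scaleC_scaleC)
      then have "norm (inverse h *\<^sub>C (extension (z + h) u - extension z u) - T' u) = norm W / cmod h"
        by (simp add: norm_scaleC norm_inverse divide_inverse mult.commute)
      also have "\<dots> \<le> cmod h * k * norm u" using W h(1) by (simp add: divide_le_eq mult.commute)
      also have "\<dots> \<le> e * norm u"
      proof (rule mult_right_mono)
        have "cmod h \<le> e / k" using h(2) by (simp add: d_def)
        then show "cmod h * k \<le> e" using k by (simp add: field_simps)
      qed simp
      finally show ?thesis .
    qed
    then show ?thesis
      using d by (auto simp: eventually_at dist_norm)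
  qed
  ultimately show ?thesis unfolding operator_differentiable_at_def by blast
qed

text \<open>
  On the domain, the series without its first term is the increment times a series of the same kind for
  \<open>v = K u\<close>.
\<close>

lemma extension_domain_estimate:
  assumes g: "(u, v) \<in> gen" and z: "z \<in> cone"
  shows "norm (extension z u - R (Re z) u) \<le> 2 * M * norm v * \<bar>Im z\<bar>"
proof -
  define x where "x = Re z"
  define w where "w = \<i> * complex_of_real (Im z)"
  have x: "x > 0" and wx: "cmod w * \<beta> < x / 4" using coneD[OF z] by (auto simp: x_def w_def)
  let ?q = "cmod w * \<beta> / x"
  have q: "0 \<le> ?q" "?q \<le> 1 / 2" using wx x \<beta>_pos by (auto simp: field_simps)
  have "(\<lambda>n. (w ^ (n + 1) / fact (n + 1)) *\<^sub>C D (n + 1) x u) sums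
      (G x w u - (\<Sum>n<1. (w ^ n / fact n) *\<^sub>C D n x u))"
    using wx x by (intro sums_split_initial_segment G_sums) auto
  then have S: "(\<lambda>n. (w ^ (n + 1) / fact (n + 1)) *\<^sub>C D n x v) sums (extension z u - R (Re z) u)"
    using D_K[OF g x] by (simp add: extension_def x_def w_def D_0)
  have geo: "(\<lambda>n. M * norm v * cmod w * ?q ^ n) sums (M * norm v * cmod w * (1 / (1 - ?q)))"
  proof (intro sums_mult geometric_sums)
    show "norm ?q < 1" unfolding real_norm_def using q by linarith
  qed
  have "norm (extension z u - R (Re z) u) \<le> M * norm v * cmod w * (1 / (1 - ?q))"
  proof (rule norm_sums_le[OF S geo])
    fix n
    have "norm ((w ^ (n + 1) / fact (n + 1)) *\<^sub>C D n x v)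
        = cmod w / real (n + 1) * norm ((w ^ n / fact n) *\<^sub>C D n x v)"
      by (simp add: norm_scaleC norm_divide norm_power norm_mult field_simps
          flip: of_nat_Suc)
    also have "\<dots> \<le> cmod w / 1 * norm ((w ^ n / fact n) *\<^sub>C D n x v)"
      by (intro mult_right_mono divide_left_mono) auto
    also have "\<dots> \<le> cmod w / 1 * (M * norm v * ?q ^ n)"
      by (intro mult_left_mono G_term_bound x) auto
    finally show "norm ((w ^ (n + 1) / fact (n + 1)) *\<^sub>C D n x v) \<le> M * norm v * cmod w * ?q ^ n"
      by (simp only: div_by_1 mult_ac)
  qed
  also have "\<dots> \<le> M * norm v * cmod w * 2"
  proof (rule mult_left_mono)
    show "1 / (1 - ?q) \<le> 2" by (rule inverse_one_minus_le_2[OF q(2)])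
  qed (use M_ge_1 in simp)
  finally show ?thesis by (simp add: w_def norm_mult mult_ac)
qed

text \<open>
  On the dense domain this follows from the preceding estimate and the continuity on the half line; the
  uniform bound in the cone extends it to all \<open>u\<close>.
\<close>

lemma extension_continuous_0: "((\<lambda>z. extension z u) \<longlongrightarrow> R 0 u) (at 0 within cone)"
proof (rule tendstoI)
  fix e :: real assume e: "e > 0"
  define e' where "e' = e / (8 * M)"
  have e': "e' > 0" "e' \<le> e / 8" using e M_ge_1 by (auto simp: e'_def field_simps)
  obtain w v where w: "(w, v) \<in> gen" "norm (w - R 0 u) < e'"
    using domain_dense[of "R 0 u", OF R_R_0 e'(1)] by auto
  have "\<forall>\<^sub>F t in at_right 0. dist (R t w) (R 0 w) < e / 4"
    by (rule tendstoD[OF R_continuous_0]) (use e in simp)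
  then obtain b where b: "b > 0" "\<And>t. 0 < t \<Longrightarrow> t < b \<Longrightarrow> dist (R t w) (R 0 w) < e / 4"
    by (auto simp: eventually_at_right_field)
  define k where "k = 2 * M * norm v + 1"
  define c where "c = e / (4 * k)"
  have den: "k > 0" using M_ge_1 by (simp add: k_def add_nonneg_pos)
  have c: "c > 0" using e den by (simp add: c_def)
  have "dist (extension z u) (R 0 u) < e" if z: "z \<in> cone" and d: "dist z 0 < min b c" for z
  proof -
    have zb: "0 < Re z" "Re z < b" "\<bar>Im z\<bar> < c"
      using coneD[OF z] d abs_Re_le_cmod[of z] abs_Im_le_cmod[of z] by (auto simp: dist_norm)
    have "extension z u - extension z w = extension z (R 0 u - w)"
      using extension_linear(1)[OF z, of "R 0 u - w" w] by (simp add: extension_R_0[OF z])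
    then have "norm (extension z u - extension z w) \<le> 2 * M * norm (R 0 u - w)"
      using extension_bound[OF z] by simp
    also have "\<dots> \<le> 2 * M * e'" using w(2) M_ge_1 by (intro mult_left_mono) (auto simp: norm_minus_commute)
    also have "\<dots> = e / 4" using M_ge_1 by (simp add: e'_def)
    finally have 1: "norm (extension z u - extension z w) \<le> e / 4" .
    have "norm (extension z w - R (Re z) w) \<le> 2 * M * norm v * \<bar>Im z\<bar>"
      by (rule extension_domain_estimate[OF w(1) z])
    also have "\<dots> \<le> k * c" using zb M_ge_1 by (intro mult_mono) (auto simp: k_def)
    also have "\<dots> = e / 4" using den by (simp add: c_def)
    finally have 2: "norm (extension z w - R (Re z) w) \<le> e / 4" .
    have 3: "norm (R (Re z) w - R 0 w) < e / 4" using b(2)[OF zb(1,2)] by (simp add: dist_norm)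
    have 4: "norm (R 0 w - R 0 u) < e / 4" using w(2) e' e by (simp add: gen_R_0[OF w(1)])
    have "extension z u - R 0 u = (extension z u - extension z w) + (extension z w - R (Re z) w)
        + (R (Re z) w - R 0 w) + (R 0 w - R 0 u)" by simp
    also have "norm \<dots> < e"
      using 1 2 3 4 norm_triangle_ineq[of "(extension z u - extension z w) + (extension z w - R (Re z) w)
        + (R (Re z) w - R 0 w)" "R 0 w - R 0 u"]
        norm_triangle_ineq[of "(extension z u - extension z w) + (extension z w - R (Re z) w)" "R (Re z) w - R 0 w"]
        norm_triangle_ineq[of "extension z u - extension z w" "extension z w - R (Re z) w"]
      by linarith
    finally show ?thesis by (simp add: dist_norm)
  qed
  then show "\<forall>\<^sub>F z in at 0 within cone. dist (extension z u) (R 0 u) < e"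
    unfolding eventually_at using b(1) c by (intro exI[of _ "min b c"]) auto
qed

end

section \<open>Transfer along coordinates\<close>

lemma operator_differentiable_scale:
  fixes T :: "complex \<Rightarrow> 'a \<Rightarrow> 'a :: complex_normed_vector"
  assumes T: "operator_differentiable_at UNIV norm T z" and Tz: "bounded_operator UNIV norm (T z)"
    and f: "(f has_field_derivative f') (at z)"
  shows "operator_differentiable_at UNIV norm (\<lambda>z u. f z *\<^sub>C T z u) z"
proof -
  obtain T' where T': "bounded_operator UNIV norm T'"
    and diff: "\<And>e. e > 0 \<Longrightarrow> \<forall>\<^sub>F h in at 0. \<forall>u. norm (inverse h *\<^sub>C (T (z + h) u - T z u) - T' u) \<le> e * norm u"
    using T unfolding operator_differentiable_at_def by auto
  obtain M1 where M1: "\<And>u. norm (T z u) \<le> M1 * norm u" using Tz by (auto simp: bounded_operator_def)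
  obtain M2 where M2: "\<And>u. norm (T' u) \<le> M2 * norm u" using T' by (auto simp: bounded_operator_def)
  define m1 where "m1 = \<bar>M1\<bar> + 1"
  define m2 where "m2 = \<bar>M2\<bar> + 1"
  have m: "0 < m1" "0 < m2" by (auto simp: m1_def m2_def)
  have m1: "norm (T z u) \<le> m1 * norm u" for u
    using order_trans[OF M1 mult_right_mono[of M1 m1 "norm u"]] by (simp add: m1_def)
  have m2: "norm (T' u) \<le> m2 * norm u" for u
    using order_trans[OF M2 mult_right_mono[of M2 m2 "norm u"]] by (simp add: m2_def)
  define T'' where "T'' u = f' *\<^sub>C T z u + f z *\<^sub>C T' u" for u
  have "bounded_operator UNIV norm T''"
    unfolding bounded_operator_def
  proof (intro conjI ballI allI UNIV_I exI)
    fix u v and c :: complex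
    show "T'' (u + v) = T'' u + T'' v" "T'' (c *\<^sub>C u) = c *\<^sub>C T'' u"
      using Tz T' by (simp_all add: T''_def bounded_operator_def scaleC_add_right scaleC_scaleC mult.commute)
    have "norm (T'' u) \<le> cmod f' * norm (T z u) + cmod (f z) * norm (T' u)"
      unfolding T''_def using norm_triangle_ineq[of "f' *\<^sub>C T z u" "f z *\<^sub>C T' u"] by (simp add: norm_scaleC)
    also have "\<dots> \<le> cmod f' * (m1 * norm u) + cmod (f z) * (m2 * norm u)"
      by (intro add_mono mult_left_mono m1 m2) auto
    finally show "norm (T'' u) \<le> (cmod f' * m1 + cmod (f z) * m2) * norm u" by (simp add: algebra_simps)
  qed
  moreover have "\<forall>\<^sub>F h in at 0. \<forall>u\<in>UNIV.
      norm (inverse h *\<^sub>C (f (z + h) *\<^sub>C T (z + h) u - f z *\<^sub>C T z u) - T'' u) \<le> e * norm u" if e: "e > 0" for e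
  proof -
    define F where "F = cmod (f z) + 1"
    have F: "F > 0" by (simp add: F_def add_nonneg_pos)
    have lim1: "((\<lambda>h. (f (z + h) - f z) / h) \<longlongrightarrow> f') (at 0)"
      using f by (simp add: DERIV_def)
    have lim2: "((\<lambda>h. f (z + h)) \<longlongrightarrow> f z) (at 0)"
      using DERIV_isCont[OF f] by (simp add: isCont_iff)
    have "\<forall>\<^sub>F h in at 0. dist ((f (z + h) - f z) / h) f' < e / (3 * m1)"
      by (rule tendstoD[OF lim1]) (use e m in simp)
    moreover have "\<forall>\<^sub>F h in at 0. dist (f (z + h)) (f z) < min 1 (e / (3 * m2))"
      by (rule tendstoD[OF lim2]) (use e m in simp)
    moreover have "\<forall>\<^sub>F h in at 0. \<forall>u. norm (inverse h *\<^sub>C (T (z + h) u - T z u) - T' u) \<le> e / (3 * F) * norm u"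
      by (rule diff) (use e F in simp)
    moreover have "\<forall>\<^sub>F h in at (0 :: complex). h \<noteq> 0" by (simp add: eventually_at_filter)
    ultimately show ?thesis
    proof eventually_elim
      case (elim h)
      show ?case
      proof
        fix u
        let ?D = "inverse h *\<^sub>C (T (z + h) u - T z u) - T' u"
        let ?q = "(f (z + h) - f z) / h - f'"
        have "inverse h *\<^sub>C (f (z + h) *\<^sub>C T (z + h) u - f z *\<^sub>C T z u) - T'' u
            = f (z + h) *\<^sub>C ?D + ?q *\<^sub>C T z u + (f (z + h) - f z) *\<^sub>C T' u"
        proof -
          have sub: "(a - b) *\<^sub>C v = a *\<^sub>C v - b *\<^sub>C (v :: 'a)" for a b v
            using scaleC_add_left[of "a - b" b v] by simp
          show ?thesis
            by (simp add: T''_def scaleC_diff_right scaleC_scaleC sub divide_inverse mult.commute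
                scaleC_add_left scaleC_add_right algebra_simps)
        qed
        also have "norm \<dots> \<le> cmod (f (z + h)) * norm ?D + cmod ?q * norm (T z u) + cmod (f (z + h) - f z) * norm (T' u)"
          using norm_triangle_ineq[of "f (z + h) *\<^sub>C ?D + ?q *\<^sub>C T z u" "(f (z + h) - f z) *\<^sub>C T' u"]
            norm_triangle_ineq[of "f (z + h) *\<^sub>C ?D" "?q *\<^sub>C T z u"] by (simp add: norm_scaleC)
        also have "\<dots> \<le> F * (e / (3 * F) * norm u) + e / (3 * m1) * (m1 * norm u) + e / (3 * m2) * (m2 * norm u)"
        proof (intro add_mono mult_mono m1 m2)
          show "cmod (f (z + h)) \<le> F"
            using elim(2) norm_triangle_ineq2[of "f (z + h)" "f z"] by (simp add: F_def dist_norm)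
          show "norm ?D \<le> e / (3 * F) * norm u" using elim(3) by blast
          show "cmod ?q \<le> e / (3 * m1)" using elim(1) by (simp add: dist_norm)
          show "cmod (f (z + h) - f z) \<le> e / (3 * m2)" using elim(2) by (simp add: dist_norm)
        qed (use e F m in auto)
        also have "\<dots> = e * norm u" using F m by simp
        finally show "norm (inverse h *\<^sub>C (f (z + h) *\<^sub>C T (z + h) u - f z *\<^sub>C T z u) - T'' u) \<le> e * norm u" .
      qed
    qed
  qed
  ultimately show ?thesis unfolding operator_differentiable_at_def by blast
qed

lemma sector_subset_cone:
  assumes "0 < c" "z \<in> sector (arctan (1 / c))"
  shows "c * \<bar>Im z\<bar> < Re z"
proof -
  define a where "a = Arg z"
  have z: "z \<noteq> 0" "\<bar>a\<bar> < arctan (1 / c)" using assms(2) by (auto simp: sector_def a_def)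
  have bound: "\<bar>a\<bar> < pi / 2" using z(2) arctan_ubound[of "1 / c"] by linarith
  have "tan \<bar>a\<bar> < tan (arctan (1 / c))"
    using z(2) arctan_ubound[of "1 / c"] bound by (intro tan_monotone) auto
  then have t: "tan \<bar>a\<bar> < 1 / c" by (simp add: tan_arctan)
  have cos: "0 < cos \<bar>a\<bar>" using bound by (intro cos_gt_zero_pi) auto
  have "c * sin \<bar>a\<bar> < cos \<bar>a\<bar>" using t cos assms(1) by (simp add: tan_def field_simps)
  moreover have "sin \<bar>a\<bar> = \<bar>sin a\<bar>"
    using bound sin_ge_zero[of "\<bar>a\<bar>"] by (cases "a \<ge> 0") (auto simp: abs_if)
  ultimately have "cmod z * (c * \<bar>sin a\<bar>) < cmod z * cos a"
    using z(1) by (intro mult_strict_left_mono) auto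
  moreover have "Re z = cmod z * cos a" "Im z = cmod z * sin a"
    using z(1) Arg_eq[of z] by (simp_all add: a_def Re_exp Im_exp flip: cos_of_real sin_of_real)
      (simp_all add: cos_Arg sin_Arg)
  ultimately show ?thesis by (simp add: abs_mult mult_ac)
qed

text \<open>
  An isomorphism \<open>J\<close> of the normed space \<open>(X, N)\<close> with a closed subspace of a Banach space; \<open>J'\<close> is a
  left inverse that is defined on the whole Banach space, so that \<open>J \<circ> J'\<close> is a bounded projection.
\<close>

locale normed_coordinates =
  fixes X :: "'a :: complex_vector set" and N :: "'a \<Rightarrow> real"
    and J :: "'a \<Rightarrow> 'b :: {complex_normed_vector, banach}" and J' :: "'b \<Rightarrow> 'a" and c c' :: real
  assumes X_add: "U \<in> X \<Longrightarrow> V \<in> X \<Longrightarrow> U + V \<in> X"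
    and X_scaleC: "U \<in> X \<Longrightarrow> a *\<^sub>C U \<in> X"
    and J_add: "U \<in> X \<Longrightarrow> V \<in> X \<Longrightarrow> J (U + V) = J U + J V"
    and J_scaleC: "U \<in> X \<Longrightarrow> J (a *\<^sub>C U) = a *\<^sub>C J U"
    and J'_add: "J' (x + y) = J' x + J' y"
    and J'_scaleC: "J' (a *\<^sub>C x) = a *\<^sub>C J' x"
    and J'_X: "J' x \<in> X"
    and J'_J: "U \<in> X \<Longrightarrow> J' (J U) = U"
    and J_bound: "U \<in> X \<Longrightarrow> norm (J U) \<le> c * N U"
    and J'_bound: "N (J' x) \<le> c' * norm x"
    and c_pos: "0 < c" "0 < c'"
begin

lemma uminus_scaleC: "- x = (-1) *\<^sub>C (x :: 'd :: complex_vector)"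
  using scaleR_scaleC[of "-1" x] by simp

lemma X_diff: "U \<in> X \<Longrightarrow> V \<in> X \<Longrightarrow> U - V \<in> X"
  using X_add[of U "- V"] X_scaleC[of V "-1"] by (simp add: uminus_scaleC[symmetric])

lemma J_diff: "U \<in> X \<Longrightarrow> V \<in> X \<Longrightarrow> J (U - V) = J U - J V"
  using J_add[of U "- V"] J_scaleC[of V "-1"] X_scaleC[of V "-1"]
  by (simp add: uminus_scaleC[symmetric])

lemma J'_diff: "J' (x - y) = J' x - J' y"
  using J'_add[of x "- y"] J'_scaleC[of "-1" y] by (simp add: uminus_scaleC[symmetric])

lemma J_scaleR: "U \<in> X \<Longrightarrow> J (r *\<^sub>R U) = r *\<^sub>R J U" and X_scaleR: "U \<in> X \<Longrightarrow> r *\<^sub>R U \<in> X"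
  and J'_scaleR: "J' (r *\<^sub>R x) = r *\<^sub>R J' x"
  by (simp_all add: scaleR_scaleC J_scaleC X_scaleC J'_scaleC)

lemma J_J'_bound: "norm (J (J' x)) \<le> c * c' * norm x"
  using J_bound[OF J'_X, of x] mult_left_mono[OF J'_bound[of x] less_imp_le[OF c_pos(1)]] by (simp add: mult_ac)

lemma J_J'_tendsto:
  assumes "(f \<longlongrightarrow> l) F"
  shows "((\<lambda>t. J (J' (f t))) \<longlongrightarrow> J (J' l)) F"
proof -
  have "bounded_linear (\<lambda>x. J (J' x))"
    by (rule bounded_linear_intro[where K = "c * c'"])
      (use J_J'_bound in \<open>auto simp: J'_add J_add J'_X J'_scaleR J_scaleR mult.commute\<close>)
  then show ?thesis using assms by (rule bounded_linear.tendsto)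
qed

lemma J_tendsto:
  assumes "((\<lambda>t. N (f t - l)) \<longlongrightarrow> 0) F" "\<And>t. f t \<in> X" "l \<in> X"
  shows "((\<lambda>t. J (f t)) \<longlongrightarrow> J l) F"
proof -
  have "((\<lambda>t. c * N (f t - l)) \<longlongrightarrow> 0) F" using tendsto_mult_right_zero[OF assms(1)] by simp
  then have "((\<lambda>t. J (f t) - J l) \<longlongrightarrow> 0) F"
    by (rule Lim_null_comparison[rotated])
      (use J_bound[OF X_diff[OF assms(2,3)]] in \<open>simp add: J_diff assms(2,3)\<close>)
  then show ?thesis by (rule LIM_zero_cancel)
qed

lemma N_nonneg: "U \<in> X \<Longrightarrow> 0 \<le> N U"
  using J_bound[of U] c_pos(1) norm_ge_zero[of "J U"] by (smt (verit) mult_pos_neg)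

lemma N_tendsto:
  assumes "((\<lambda>t. f t) \<longlongrightarrow> J l) F" "\<And>t. g t \<in> X" "l \<in> X" "\<forall>\<^sub>F t in F. J (g t) = f t"
  shows "((\<lambda>t. N (g t - l)) \<longlongrightarrow> 0) F"
proof -
  have "((\<lambda>t. c' * norm (f t - J l)) \<longlongrightarrow> 0) F"
    using tendsto_mult_right_zero[OF tendsto_norm_zero[OF LIM_zero[OF assms(1)]]] by simp
  then show ?thesis
  proof (rule Lim_null_comparison[rotated])
    show "\<forall>\<^sub>F t in F. norm (N (g t - l)) \<le> c' * norm (f t - J l)"
      using assms(4)
    proof eventually_elim
      case (elim t)
      have "g t - l = J' (f t - J l)"
        using elim J'_J[OF X_diff[OF assms(2)[of t] assms(3)]] by (simp add: J_diff assms(2,3))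
      then show ?case using J'_bound[of "f t - J l"] N_nonneg[OF X_diff[OF assms(2)[of t] assms(3)]] by simp
    qed
  qed
qed

text \<open>
  The semigroup in coordinates; the exponential factor shifts its generator by \<open>-\<omega>\<close>.
\<close>

definition pushforward :: "(real \<Rightarrow> 'a \<Rightarrow> 'a) \<Rightarrow> real \<Rightarrow> real \<Rightarrow> 'b \<Rightarrow> 'b"
  where "pushforward S \<omega> t x = exp (- \<omega> * t) *\<^sub>R J (S t (J' x))"

context
  fixes S :: "real \<Rightarrow> 'a \<Rightarrow> 'a" and \<omega> :: real
  assumes S: "contraction_C0_semigroup X N S" and \<omega>: "0 \<le> \<omega>"
begin

lemma S_props:
  "0 \<le> t \<Longrightarrow> U \<in> X \<Longrightarrow> S t U \<in> X"
  "0 \<le> t \<Longrightarrow> U \<in> X \<Longrightarrow> V \<in> X \<Longrightarrow> S t (U + V) = S t U + S t V"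
  "0 \<le> t \<Longrightarrow> U \<in> X \<Longrightarrow> S t (a *\<^sub>C U) = a *\<^sub>C S t U"
  "U \<in> X \<Longrightarrow> S 0 U = U"
  "0 \<le> s \<Longrightarrow> 0 \<le> t \<Longrightarrow> U \<in> X \<Longrightarrow> S (s + t) U = S s (S t U)"
  "U \<in> X \<Longrightarrow> ((\<lambda>t. N (S t U - U)) \<longlongrightarrow> 0) (at_right 0)"
  "0 \<le> t \<Longrightarrow> U \<in> X \<Longrightarrow> N (S t U) \<le> N U"
  using S unfolding contraction_C0_semigroup_def C0_semigroup_def bounded_operator_def by blast+

lemma pushforward_0: "pushforward S \<omega> 0 x = J (J' x)"
  by (simp add: pushforward_def S_props J'_X)

lemma J_S_tendsto:
  assumes "U \<in> X"
  shows "((\<lambda>t. J (S t U)) \<longlongrightarrow> J U) (at_right 0)"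
proof -
  have "((\<lambda>t. J (if 0 \<le> t then S t U else U)) \<longlongrightarrow> J U) (at_right 0)"
  proof (rule J_tendsto)
    show "((\<lambda>t. N ((if 0 \<le> t then S t U else U) - U)) \<longlongrightarrow> 0) (at_right 0)"
      by (rule Lim_transform_eventually[OF S_props(6)[OF assms] eventually_at_right_0I]) simp
  qed (use assms S_props(1) in auto)
  then show ?thesis
    by (rule Lim_transform_eventually) (rule eventually_at_right_0I, simp)
qed

lemma pushforward_degenerate_semigroup: "degenerate_semigroup (pushforward S \<omega>) (max 1 (c * c'))"
proof
  show "1 \<le> max 1 (c * c')" by simp
  fix t :: real and x y :: 'b and a :: complex
  {
    assume t: "0 \<le> t"
    show "pushforward S \<omega> t (x + y) = pushforward S \<omega> t x + pushforward S \<omega> t y"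
      using t by (simp add: pushforward_def J'_add S_props J'_X J_add scaleR_add_right)
    show "pushforward S \<omega> t (a *\<^sub>C x) = a *\<^sub>C pushforward S \<omega> t x"
      using t by (simp add: pushforward_def J'_scaleC S_props J'_X J_scaleC scaleC_scaleR)
    have "norm (pushforward S \<omega> t x) \<le> 1 * norm (J (S t (J' x)))"
      unfolding pushforward_def norm_scaleR using t \<omega> by (intro mult_right_mono) auto
    also have "\<dots> \<le> c * N (S t (J' x))" using J_bound[OF S_props(1)[OF t J'_X]] by simp
    also have "\<dots> \<le> c * (c' * norm x)"
      using order_trans[OF S_props(7)[OF t J'_X] J'_bound] c_pos by (intro mult_left_mono) auto
    also have "\<dots> = c * c' * norm x" by simp
    also have "\<dots> \<le> max 1 (c * c') * norm x" by (rule mult_right_mono) auto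
    finally show "norm (pushforward S \<omega> t x) \<le> max 1 (c * c') * norm x" .
    fix s :: real assume s: "0 \<le> s"
    have "pushforward S \<omega> s (pushforward S \<omega> t x)
        = exp (- \<omega> * s) *\<^sub>R J (S s (exp (- \<omega> * t) *\<^sub>R S t (J' x)))"
      using t by (simp add: pushforward_def J'_scaleR J'_J S_props J'_X)
    also have "\<dots> = (exp (- \<omega> * s) * exp (- \<omega> * t)) *\<^sub>R J (S s (S t (J' x)))"
      using s t by (simp add: scaleR_scaleC S_props J'_X J_scaleC scaleC_scaleC)
    also have "\<dots> = pushforward S \<omega> (s + t) x"
      using s t by (simp add: pushforward_def S_props J'_X exp_add[symmetric] algebra_simps)
    finally show "pushforward S \<omega> (s + t) x = pushforward S \<omega> s (pushforward S \<omega> t x)" by simp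
  }
  have "((\<lambda>t. exp (- \<omega> * t) *\<^sub>R J (S t (J' x))) \<longlongrightarrow> exp (- \<omega> * 0) *\<^sub>R J (J' x)) (at_right 0)"
    by (intro tendsto_intros J_S_tendsto J'_X)
  then show "((\<lambda>t. pushforward S \<omega> t x) \<longlongrightarrow> pushforward S \<omega> 0 x) (at_right 0)"
    unfolding pushforward_0 by (simp add: pushforward_def)
qed

text \<open>
  The difference quotients take their values in the range of \<open>J\<close>, which is closed because it is the range of
  the bounded projection \<open>J \<circ> J'\<close>. So their limits can be pulled back.
\<close>

lemma pushforward_generator:
  assumes g: "(u, v) \<in> semigroup_generator (pushforward S \<omega>)"
  shows "J (J' u) = u" "J (J' (v + \<omega> *\<^sub>R u)) = v + \<omega> *\<^sub>R u"
    "(J' u, J' (v + \<omega> *\<^sub>R u)) \<in> generator_graph X N S"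
proof -
  interpret degenerate_semigroup "pushforward S \<omega>" "max 1 (c * c')" by (rule pushforward_degenerate_semigroup)
  show u: "J (J' u) = u" using gen_R_0[OF g] by (simp add: pushforward_0)
  let ?U = "J' u" and ?v = "v + \<omega> *\<^sub>R u"
  have q: "((\<lambda>h. exp (\<omega> * h) *\<^sub>R ((pushforward S \<omega> h u - u) /\<^sub>R h) + ((exp (\<omega> * h) - 1) / h) *\<^sub>R u)
      \<longlongrightarrow> exp (\<omega> * 0) *\<^sub>R v + \<omega> *\<^sub>R u) (at_right 0)"
  proof (intro tendsto_intros)
    show "((\<lambda>h. (pushforward S \<omega> h u - u) /\<^sub>R h) \<longlongrightarrow> v) (at_right 0)"
      using g by (simp add: semigroup_generator_def)
    have "((\<lambda>h. exp (\<omega> * h)) has_real_derivative \<omega>) (at 0)"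
      by (auto intro!: derivative_eq_intros)
    then have "((\<lambda>h. (exp (\<omega> * h) - 1) / h) \<longlongrightarrow> \<omega>) (at 0)" by (simp add: DERIV_def)
    then show "((\<lambda>h. (exp (\<omega> * h) - 1) / h) \<longlongrightarrow> \<omega>) (at_right 0)"
      by (rule filterlim_mono) (auto simp: at_le)
  qed
  define g where "g h = (if 0 < h then (S h ?U - ?U) /\<^sub>R h else ?U)" for h
  have gX: "g h \<in> X" for h by (auto simp: g_def intro!: X_scaleR X_diff S_props J'_X)
  have Jg: "J (g h) = exp (\<omega> * h) *\<^sub>R ((pushforward S \<omega> h u - u) /\<^sub>R h) + ((exp (\<omega> * h) - 1) / h) *\<^sub>R u"
    if h: "0 < h" for h
  proof -
    have "exp (\<omega> * h) *\<^sub>R pushforward S \<omega> h u = J (S h ?U)"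
      by (simp add: pushforward_def exp_minus)
    moreover have "exp (\<omega> * h) *\<^sub>R ((x - u) /\<^sub>R h) + ((exp (\<omega> * h) - 1) / h) *\<^sub>R u
        = (exp (\<omega> * h) *\<^sub>R x - u) /\<^sub>R h" for x
      by (simp add: scaleR_diff_right divide_inverse algebra_simps)
    moreover have "J (g h) = (J (S h ?U) - u) /\<^sub>R h"
      using h by (simp add: g_def J_scaleR X_diff S_props J'_X J_diff u)
    ultimately show ?thesis by simp
  qed
  have lim: "((\<lambda>h. J (g h)) \<longlongrightarrow> ?v) (at_right 0)"
    by (rule Lim_transform_eventually[OF _ eventually_at_right_0I]) (use q Jg in auto)
  have "((\<lambda>h. J (J' (J (g h)))) \<longlongrightarrow> J (J' ?v)) (at_right 0)" by (rule J_J'_tendsto[OF lim])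
  then have "((\<lambda>h. J (g h)) \<longlongrightarrow> J (J' ?v)) (at_right 0)" by (simp add: J'_J gX)
  then show v: "J (J' ?v) = ?v" using lim tendsto_unique[OF trivial_limit_at_right_real] by blast
  have "((\<lambda>h. N (g h - J' ?v)) \<longlongrightarrow> 0) (at_right 0)"
    by (rule N_tendsto[of "\<lambda>h. J (g h)"]) (use lim v gX J'_X in simp_all)
  then have "((\<lambda>h. N ((S h ?U - ?U) /\<^sub>R h - J' ?v)) \<longlongrightarrow> 0) (at_right 0)"
    by (rule Lim_transform_eventually) (rule eventually_at_right_0I, simp add: g_def)
  then show "(?U, J' ?v) \<in> generator_graph X N S" by (simp add: generator_graph_def J'_X)
qed

text \<open>
  The analytic extension in coordinates is pulled back by \<open>J'\<close>, and the entire function \<open>exp (\<omega> z)\<close> undoes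
  the shift of the generator.
\<close>

theorem analytic_if_sectorial:
  assumes "bounded_bilinear p" "\<And>x y. p x y = p y x" "0 < m" "\<And>x. m * (norm x)\<^sup>2 \<le> p x x" "0 \<le> C"
    and diss: "\<And>U V. (U, V) \<in> generator_graph X N S \<Longrightarrow> p (J V - \<omega> *\<^sub>R J U) (J U) \<le> 0"
    and sect: "\<And>U V U' V'. (U, V) \<in> generator_graph X N S \<Longrightarrow> (U', V') \<in> generator_graph X N S \<Longrightarrow>
      (p (J V - \<omega> *\<^sub>R J U) (J U'))\<^sup>2 \<le> C * (- p (J V - \<omega> *\<^sub>R J U) (J U)) * (- p (J V' - \<omega> *\<^sub>R J U') (J U'))"
  shows "analytic_semigroup X N S"
proof -
  interpret D: degenerate_semigroup "pushforward S \<omega>" "max 1 (c * c')" by (rule pushforward_degenerate_semigroup)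
  have D_diss: "p v u \<le> 0" if g: "(u, v) \<in> semigroup_generator (pushforward S \<omega>)" for u v
    using diss[OF pushforward_generator(3)[OF g]] by (simp add: pushforward_generator(1,2)[OF g])
  have D_sect: "(p v u')\<^sup>2 \<le> C * (- p v u) * (- p v' u')"
    if g: "(u, v) \<in> semigroup_generator (pushforward S \<omega>)" and g': "(u', v') \<in> semigroup_generator (pushforward S \<omega>)"
    for u v u' v'
    using sect[OF pushforward_generator(3)[OF g] pushforward_generator(3)[OF g']]
    by (simp add: pushforward_generator(1,2)[OF g] pushforward_generator(1,2)[OF g'])
  interpret E: sectorial_semigroup "pushforward S \<omega>" "max 1 (c * c')" p m C
    by (rule sectorial_semigroup.intro[OF pushforward_degenerate_semigroup sectorial_semigroup_axioms.intro])
      (fact assms(1-5) D_diss D_sect)+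
  define F where "F z x = exp (complex_of_real \<omega> * z) *\<^sub>C E.extension z x" for z x
  define T where "T z U = J' (F z (J U))" for z U
  define \<alpha> where "\<alpha> = arctan (1 / (4 * E.\<beta>))"
  have \<alpha>: "0 < \<alpha>" "\<alpha> \<le> pi / 2"
    using E.\<beta>_pos arctan_ubound[of "1 / (4 * E.\<beta>)"] by (auto simp: \<alpha>_def zero_less_arctan_iff)
  have cone: "z \<in> E.cone" if "z \<in> sector \<alpha>" for z
    using sector_subset_cone[of "4 * E.\<beta>" z] that E.\<beta>_pos by (simp add: \<alpha>_def E.cone_def)
  have ext_bo: "bounded_operator UNIV norm (E.extension z)" if "z \<in> E.cone" for z
    using E.extension_linear[OF that] E.extension_bound[OF that] by (auto simp: bounded_operator_def)
  have expd: "((\<lambda>z. exp (complex_of_real \<omega> * z)) has_field_derivative exp (complex_of_real \<omega> * z) * complex_of_real \<omega>) (at z)" for z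
    by (auto intro!: derivative_eq_intros)
  have F_add: "F z (x + y) = F z x + F z y" and F_scaleC: "F z (a *\<^sub>C x) = a *\<^sub>C F z x" if "z \<in> E.cone" for z x y a
    using E.extension_linear[OF that] by (simp_all add: F_def scaleC_add_right scaleC_scaleC mult.commute)
  have F_J_J': "F z (J (J' x)) = F z x" if "z \<in> E.cone" for z x
    using E.extension_R_0[OF that, of x] by (simp add: F_def pushforward_0)
  have real: "T (complex_of_real t) U = S t U" if "0 \<le> t" "U \<in> X" for t U
  proof -
    have "F (complex_of_real t) (J U) = exp (\<omega> * t) *\<^sub>R (exp (- \<omega> * t) *\<^sub>R J (S t U))"
      unfolding F_def E.extension_real
      using that by (simp add: pushforward_def J'_J scaleR_scaleC exp_of_real[symmetric])
    also have "\<dots> = J (S t U)" by (simp flip: exp_add)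
    finally show ?thesis using that by (simp add: T_def J'_J S_props)
  qed
  have bounded: "bounded_operator X N (T z)" if z: "z \<in> E.cone" for z
    unfolding bounded_operator_def
  proof (intro conjI ballI allI exI)
    fix U V and a :: complex assume U: "U \<in> X"
    show "T z U \<in> X" by (simp add: T_def J'_X)
    show "T z (a *\<^sub>C U) = a *\<^sub>C T z U" using U z by (simp add: T_def J_scaleC F_scaleC J'_scaleC)
    have "N (T z U) \<le> c' * (cmod (exp (complex_of_real \<omega> * z)) * norm (E.extension z (J U)))"
      using J'_bound[of "F z (J U)"] by (simp add: T_def F_def norm_scaleC)
    also have "\<dots> \<le> c' * (cmod (exp (complex_of_real \<omega> * z)) * (2 * max 1 (c * c') * (c * N U)))"
      using c_pos by (intro mult_left_mono order_trans[OF E.extension_bound[OF z]] J_bound U) auto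
    finally show "N (T z U) \<le> c' * cmod (exp (complex_of_real \<omega> * z)) * 2 * max 1 (c * c') * c * N U"
      by (simp add: mult_ac)
    assume V: "V \<in> X"
    show "T z (U + V) = T z U + T z V" using U V z by (simp add: T_def J_add F_add J'_add)
  qed
  have diff: "operator_differentiable_at X N T z" if z: "z \<in> E.cone" for z
  proof -
    have "operator_differentiable_at UNIV norm F z"
      unfolding F_def[abs_def]
      by (rule operator_differentiable_scale[OF E.extension_differentiable[OF z] ext_bo[OF z] expd])
    then obtain F' where F': "bounded_operator UNIV norm F'"
      and dF: "\<And>e. e > 0 \<Longrightarrow> \<forall>\<^sub>F h in at 0. \<forall>x. norm (inverse h *\<^sub>C (F (z + h) x - F z x) - F' x) \<le> e * norm x"
      unfolding operator_differentiable_at_def by auto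
    obtain M where M: "\<And>x. norm (F' x) \<le> M * norm x" using F' by (auto simp: bounded_operator_def)
    have "bounded_operator X N (\<lambda>U. J' (F' (J U)))"
      unfolding bounded_operator_def
    proof (intro conjI ballI allI exI)
      fix U V and a :: complex assume U: "U \<in> X"
      show "J' (F' (J U)) \<in> X" by (rule J'_X)
      show "J' (F' (J (a *\<^sub>C U))) = a *\<^sub>C J' (F' (J U))"
        using U F' by (simp add: J_scaleC bounded_operator_def J'_scaleC)
      have "N (J' (F' (J U))) \<le> c' * (\<bar>M\<bar> * (c * N U))"
      proof (rule order_trans[OF J'_bound mult_left_mono])
        have "norm (F' (J U)) \<le> \<bar>M\<bar> * norm (J U)" using M[of "J U"] by (smt (verit) mult_right_mono norm_ge_zero)
        also have "\<dots> \<le> \<bar>M\<bar> * (c * N U)" by (intro mult_left_mono J_bound U) auto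
        finally show "norm (F' (J U)) \<le> \<bar>M\<bar> * (c * N U)" .
      qed (use c_pos in simp)
      then show "N (J' (F' (J U))) \<le> c' * \<bar>M\<bar> * c * N U" by (simp add: mult_ac)
      assume V: "V \<in> X"
      show "J' (F' (J (U + V))) = J' (F' (J U)) + J' (F' (J V))"
        using U V F' by (simp add: J_add bounded_operator_def J'_add)
    qed
    moreover have "\<forall>\<^sub>F h in at 0. \<forall>U\<in>X. N (inverse h *\<^sub>C (T (z + h) U - T z U) - J' (F' (J U))) \<le> e * N U"
      if e: "e > 0" for e
    proof -
      have "e / (c * c') > 0" using e c_pos by simp
      from dF[OF this] show ?thesis
      proof eventually_elim
        case (elim h)
        show ?case
        proof
          fix U assume U: "U \<in> X"
          let ?x = "inverse h *\<^sub>C (F (z + h) (J U) - F z (J U)) - F' (J U)"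
          have "N (inverse h *\<^sub>C (T (z + h) U - T z U) - J' (F' (J U))) = N (J' ?x)"
            by (simp add: T_def J'_diff J'_scaleC)
          also have "\<dots> \<le> c' * (e / (c * c') * (c * N U))"
            using elim[rule_format, of "J U"] c_pos e J_bound[OF U]
            by (intro order_trans[OF J'_bound] mult_left_mono order_trans[OF elim[rule_format]]) auto
          also have "\<dots> = e * N U" using c_pos by simp
          finally show "N (inverse h *\<^sub>C (T (z + h) U - T z U) - J' (F' (J U))) \<le> e * N U" .
        qed
      qed
    qed
    ultimately show ?thesis unfolding operator_differentiable_at_def by blast
  qed
  have semigroup: "T (z + w) U = T z (T w U)" if "z \<in> E.cone" "w \<in> E.cone" for z w U
  proof -
    have "T z (T w U) = J' (F z (F w (J U)))" by (simp add: T_def F_J_J'[OF that(1)])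
    also have "F z (F w (J U)) = F (z + w) (J U)"
      using that by (simp add: F_def E.extension_semigroup E.extension_linear scaleC_scaleC distrib_left exp_add)
    finally show ?thesis by (simp add: T_def)
  qed
  have cont: "((\<lambda>z. N (T z U - U)) \<longlongrightarrow> 0) (at 0 within E.cone)" if U: "U \<in> X" for U
  proof -
    have "((\<lambda>z. exp (complex_of_real \<omega> * z) *\<^sub>C E.extension z (J U)) \<longlongrightarrow> J U) (at 0 within E.cone)"
    proof -
      have ext: "((\<lambda>z. E.extension z (J U)) \<longlongrightarrow> J U) (at 0 within E.cone)"
        using E.extension_continuous_0[of "J U"] U by (simp add: pushforward_0 J'_J)
      have "((\<lambda>z. exp (complex_of_real \<omega> * z)) \<longlongrightarrow> exp (complex_of_real \<omega> * 0)) (at 0 within E.cone)"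
        by (intro tendsto_intros)
      then have e: "((\<lambda>z. exp (complex_of_real \<omega> * z) - 1) \<longlongrightarrow> 0) (at 0 within E.cone)"
        by (intro LIM_zero) simp
      have "((\<lambda>z. cmod (exp (complex_of_real \<omega> * z) - 1) * norm (E.extension z (J U))) \<longlongrightarrow> 0 * norm (J U)) (at 0 within E.cone)"
        by (intro tendsto_mult tendsto_norm ext tendsto_norm_zero e)
      then have "((\<lambda>z. (exp (complex_of_real \<omega> * z) - 1) *\<^sub>C E.extension z (J U)) \<longlongrightarrow> 0) (at 0 within E.cone)"
        by - (rule tendsto_norm_zero_cancel, simp add: norm_scaleC)
      from tendsto_add[OF this ext]
      have "((\<lambda>z. (exp (complex_of_real \<omega> * z) - 1) *\<^sub>C E.extension z (J U) + E.extension z (J U)) \<longlongrightarrow> J U) (at 0 within E.cone)"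
        by simp
      moreover have "(a - 1) *\<^sub>C x + x = a *\<^sub>C (x :: 'b)" for a x
        using scaleC_add_left[of "a - 1" 1 x] by simp
      ultimately show ?thesis by simp
    qed
    then have "((\<lambda>z. F z (J U) - J U) \<longlongrightarrow> 0) (at 0 within E.cone)"
      by (intro LIM_zero) (simp add: F_def)
    then have "((\<lambda>z. c' * norm (F z (J U) - J U)) \<longlongrightarrow> 0) (at 0 within E.cone)"
      by (intro tendsto_mult_right_zero tendsto_norm_zero)
    then show ?thesis
    proof (rule Lim_null_comparison[rotated], intro always_eventually allI)
      fix z
      have "T z U - U = J' (F z (J U) - J U)" by (simp add: T_def J'_diff J'_J U)
      moreover have "T z U - U \<in> X" by (simp add: T_def X_diff J'_X U)
      ultimately show "norm (N (T z U - U)) \<le> c' * norm (F z (J U) - J U)"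
        using J'_bound[of "F z (J U) - J U"] N_nonneg[of "T z U - U"] by simp
    qed
  qed
  have sub: "sector \<alpha> \<subseteq> E.cone" using cone by blast
  show ?thesis
    unfolding analytic_semigroup_def
  proof (intro conjI exI[of _ \<alpha>] exI[of _ T] allI impI ballI)
    show "C0_semigroup X N S" using S by (simp add: contraction_C0_semigroup_def)
    show "((\<lambda>z. N (T z U - U)) \<longlongrightarrow> 0) (at 0 within sector \<alpha>)" if "U \<in> X" for U
      by (rule tendsto_within_subset[OF cont[OF that] sub])
  qed (use \<alpha> real bounded diff semigroup cone in auto)
qed

end

end

section \<open>Coordinates of the state space\<close>

text \<open>
  A left inverse of \<open>coords\<close>; the operator \<open>A\<^sup>0\<close> projects onto \<open>L\<^sup>2(0,L)\<close>, so that the values always belong to the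
  state space.
\<close>

definition decoords :: "real \<Rightarrow> state \<Rightarrow> state"
  where "decoords L = (\<lambda>(v\<^sub>1, w\<^sub>1, v\<^sub>2, w\<^sub>2, v\<^sub>3, w\<^sub>3).
    (op_A_pow L (- (1/2)) v\<^sub>1, op_A_pow L 0 w\<^sub>1, op_A_pow L (- (1/2)) v\<^sub>2, op_A_pow L 0 w\<^sub>2,
     op_A_pow L (- (1/2)) v\<^sub>3, op_A_pow L 0 w\<^sub>3))"

context timoshenko
begin

abbreviation "state_space \<equiv> space_H L"
abbreviation "energy_norm \<equiv> norm_H L \<rho>\<^sub>1 \<rho>\<^sub>2 \<rho>\<^sub>3 \<kappa> b \<delta>"

definition upper_const :: real
  where "upper_const = sqrt (\<rho>\<^sub>1 + \<rho>\<^sub>2 + \<kappa> * (1 + Kc)\<^sup>2 + b + \<delta> + \<rho>\<^sub>3)"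

definition inverse_const :: real
  where "inverse_const = sqrt ((2 * Kc\<^sup>2 + 2) / min (min \<rho>\<^sub>1 (min \<rho>\<^sub>2 \<rho>\<^sub>3)) (min \<kappa> (min b \<delta>)))"

lemma state_space_iff: "(\<phi>, \<Phi>, \<psi>, \<Psi>, \<theta>, \<Theta>) \<in> state_space \<longleftrightarrow>
    \<phi> \<in> L2 L \<and> pow_summable L (1/2) \<phi> \<and> \<Phi> \<in> L2 L \<and> \<psi> \<in> L2 L \<and> pow_summable L (1/2) \<psi> \<and> \<Psi> \<in> L2 L
    \<and> \<theta> \<in> L2 L \<and> pow_summable L (1/2) \<theta> \<and> \<Theta> \<in> L2 L"
  by (auto simp: space_H_def dom_A_pow_iff[OF L] pow_summable_0[OF L])

lemma position_bounds:
  assumes "\<phi> \<in> L2 L" "pow_summable L (1/2) \<phi>"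
  shows "norm (weak_derivative L \<phi>) = norm (op_A_pow L (1/2) \<phi>)" "norm \<phi> \<le> Kc * norm (op_A_pow L (1/2) \<phi>)"
  using form_domain_derivative(2)[OF L, of \<phi>] norm_op_A_pow_embedding[OF L, of 0 "1/2" \<phi>] assms
  by (simp_all add: dom_A_pow_iff[OF L] op_A_pow_0[OF L])

lemma energy_norm_le_coords:
  assumes "U \<in> state_space"
  shows "energy_norm U \<le> upper_const * norm (coords L U)"
proof -
  obtain \<phi> \<Phi> \<psi> \<Psi> \<theta> \<Theta> where U: "U = (\<phi>, \<Phi>, \<psi>, \<Psi>, \<theta>, \<Theta>)" by (cases U)
  note X = assms[unfolded U state_space_iff]
  define n where "n = norm (coords L U)"
  note c = coords_components[where \<phi> = \<phi> and \<Phi> = \<Phi> and \<psi> = \<psi> and \<Psi> = \<Psi> and \<theta> = \<theta> and \<Theta> = \<Theta>, folded U, folded n_def]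
  have K: "1 \<le> Kc" by (rule embedding_const_ge_1[OF L])
  have sq: "a * x\<^sup>2 \<le> a * n\<^sup>2" if "0 < a" "0 \<le> x" "x \<le> n" for a x
    using that by (intro mult_left_mono power_mono) auto
  have "norm \<psi> \<le> Kc * norm (op_A_pow L (1/2) \<psi>)" using X by (simp add: position_bounds(2))
  also have "\<dots> \<le> Kc * n" using c(3) K by (intro mult_left_mono) auto
  finally have "norm \<psi> \<le> Kc * n" .
  then have "norm (weak_derivative L \<phi> + \<psi>) \<le> (1 + Kc) * n"
    using norm_triangle_ineq[of "weak_derivative L \<phi>" \<psi>] position_bounds(1)[of \<phi>] X c(1)
    by (simp add: distrib_right)
  then have "(norm (weak_derivative L \<phi> + \<psi>))\<^sup>2 \<le> ((1 + Kc) * n)\<^sup>2" by (rule power_mono) simp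
  then have q: "\<kappa> * (norm (weak_derivative L \<phi> + \<psi>))\<^sup>2 \<le> \<kappa> * (1 + Kc)\<^sup>2 * n\<^sup>2"
    using pos by (simp add: power_mult_distrib)
  have "energy_norm U \<le> sqrt ((\<rho>\<^sub>1 + \<rho>\<^sub>2 + \<kappa> * (1 + Kc)\<^sup>2 + b + \<delta> + \<rho>\<^sub>3) * n\<^sup>2)"
    unfolding U norm_H_def prod.case distrib_right
    by (intro real_sqrt_le_mono add_mono q sq pos norm_ge_zero c)
  also have "\<dots> = upper_const * n" by (simp add: upper_const_def real_sqrt_mult n_def)
  finally show ?thesis by (simp add: n_def)
qed

text \<open>
  The energy contains \<open>\<phi>\<^sub>x\<close> only within \<open>\<phi>\<^sub>x + \<psi>\<close>, but \<open>\<psi>\<close> itself is bounded by \<open>A\<^sup>1\<^sup>/\<^sup>2 \<psi>\<close>.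
\<close>

lemma coords_le_energy_norm:
  assumes "U \<in> state_space"
  shows "norm (coords L U) \<le> inverse_const * energy_norm U"
proof -
  obtain \<phi> \<Phi> \<psi> \<Psi> \<theta> \<Theta> where U: "U = (\<phi>, \<Phi>, \<psi>, \<Psi>, \<theta>, \<Theta>)" by (cases U)
  note X = assms[unfolded U state_space_iff]
  define s where "s = min (min \<rho>\<^sub>1 (min \<rho>\<^sub>2 \<rho>\<^sub>3)) (min \<kappa> (min b \<delta>))"
  have s: "0 < s" "s \<le> \<rho>\<^sub>1" "s \<le> \<rho>\<^sub>2" "s \<le> \<rho>\<^sub>3" "s \<le> \<kappa>" "s \<le> b" "s \<le> \<delta>" using pos by (auto simp: s_def)
  let ?q = "norm (weak_derivative L \<phi> + \<psi>)" and ?y = "norm (op_A_pow L (1/2) \<psi>)"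
  let ?N = "\<rho>\<^sub>1 * (norm \<Phi>)\<^sup>2 + \<rho>\<^sub>2 * (norm \<Psi>)\<^sup>2 + \<kappa> * ?q\<^sup>2 + b * ?y\<^sup>2
      + \<delta> * (norm (op_A_pow L (1/2) \<theta>))\<^sup>2 + \<rho>\<^sub>3 * (norm \<Theta>)\<^sup>2"
  have "norm (op_A_pow L (1/2) \<phi>) \<le> ?q + Kc * ?y"
    using norm_triangle_ineq4[of "weak_derivative L \<phi> + \<psi>" \<psi>] position_bounds(1)[of \<phi>] position_bounds(2)[of \<psi>] X
    by simp
  then have "(norm (op_A_pow L (1/2) \<phi>))\<^sup>2 \<le> (?q + Kc * ?y)\<^sup>2" by (rule power_mono) simp
  also have "\<dots> \<le> 2 * ?q\<^sup>2 + 2 * Kc\<^sup>2 * ?y\<^sup>2"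
    using zero_le_power2[of "?q - Kc * ?y"] by (simp add: power2_eq_square algebra_simps)
  finally have \<phi>: "(norm (op_A_pow L (1/2) \<phi>))\<^sup>2 \<le> 2 * ?q\<^sup>2 + 2 * Kc\<^sup>2 * ?y\<^sup>2" .
  let ?S = "(norm \<Phi>)\<^sup>2 + (norm \<Psi>)\<^sup>2 + ?q\<^sup>2 + ?y\<^sup>2 + (norm (op_A_pow L (1/2) \<theta>))\<^sup>2 + (norm \<Theta>)\<^sup>2"
  have nn: "0 \<le> Kc\<^sup>2 * x\<^sup>2" for x by simp
  have S: "?S \<le> ?N / s"
  proof -
    have "s * ?S \<le> ?N"
      unfolding distrib_left by (intro add_mono mult_right_mono s) simp_all
    then show ?thesis using s(1) by (simp add: pos_le_divide_eq mult.commute)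
  qed
  have "(norm (coords L U))\<^sup>2 \<le> (2 * Kc\<^sup>2 + 2) * ?S"
    unfolding norm_state U coords_def prod.case fst_conv snd_conv
    using \<phi> nn[of "norm \<Phi>"] nn[of "norm \<Psi>"] nn[of ?q] nn[of "norm (op_A_pow L (1/2) \<theta>)"] nn[of "norm \<Theta>"]
      zero_le_power2[of "norm \<Phi>"] zero_le_power2[of "norm \<Psi>"] zero_le_power2[of ?y]
      zero_le_power2[of "norm (op_A_pow L (1/2) \<theta>)"] zero_le_power2[of "norm \<Theta>"]
    by (simp only: distrib_left distrib_right)
  also have "\<dots> \<le> (2 * Kc\<^sup>2 + 2) * (?N / s)" by (rule mult_left_mono[OF S]) simp
  finally have "sqrt ((norm (coords L U))\<^sup>2) \<le> sqrt ((2 * Kc\<^sup>2 + 2) / s * ?N)"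
    by (intro real_sqrt_le_mono) simp
  then show ?thesis
    unfolding real_sqrt_mult by (simp add: inverse_const_def s_def norm_H_def U)
qed

lemma coords_decoords: "norm (coords L (decoords L x)) \<le> norm x"
proof (rule power2_le_imp_le)
  have p: "op_A_pow L (1/2) (op_A_pow L (- (1/2)) v) = op_A_pow L 0 v" for v
    using op_A_pow_compose(2)[OF L, of "- (1/2)" v "1/2"] by (simp add: pow_summable_nonpos[OF L])
  have le: "(norm (op_A_pow L 0 v))\<^sup>2 \<le> (norm v)\<^sup>2" for v
    by (rule power_mono[OF norm_op_A_pow_0[OF L] norm_ge_zero])
  show "(norm (coords L (decoords L x)))\<^sup>2 \<le> (norm x)\<^sup>2"
    unfolding norm_state by (cases x) (auto simp: coords_def decoords_def p intro!: add_mono le)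
qed simp

sublocale coordinates: normed_coordinates state_space energy_norm "coords L" "decoords L" inverse_const upper_const
proof
  have K: "1 \<le> Kc" by (rule embedding_const_ge_1[OF L])
  show "0 < inverse_const"
    using pos K by (auto simp: inverse_const_def intro!: divide_pos_pos add_nonneg_pos)
  show upper: "0 < upper_const"
    using pos K by (auto simp: upper_const_def intro!: add_pos_pos add_pos_nonneg)
  have p0: "pow_summable L s v" if "s \<le> 0" for s v by (rule pow_summable_nonpos[OF L that])
  fix U V x y :: state and a :: complex
  show "decoords L (x + y) = decoords L x + decoords L y"
    by (cases x; cases y) (simp add: decoords_def op_A_pow_add[OF L] p0)
  show "decoords L (a *\<^sub>C x) = a *\<^sub>C decoords L x"
    by (cases x) (simp add: decoords_def scaleC_prod_def op_A_pow_scaleC[OF L] p0)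
  show x: "decoords L x \<in> state_space"
    using op_A_pow_compose(1)[OF L, of "- (1/2)" _ "1/2"]
    by (cases x) (simp add: decoords_def state_space_iff fourier_op_A_pow(1)[OF L] p0)
  show "energy_norm (decoords L x) \<le> upper_const * norm x"
    using energy_norm_le_coords[OF x] mult_left_mono[OF coords_decoords[of x] less_imp_le[OF upper]] by linarith
  {
    assume U: "U \<in> state_space"
    show "norm (coords L U) \<le> inverse_const * energy_norm U" by (rule coords_le_energy_norm[OF U])
    show "a *\<^sub>C U \<in> state_space" "coords L (a *\<^sub>C U) = a *\<^sub>C coords L U"
      using U by (cases U; simp add: state_space_iff coords_def scaleC_prod_def L2_scaleC pow_summable_scaleC[OF L]
        op_A_pow_scaleC[OF L])+
    have "op_A_pow L (- (1/2)) (op_A_pow L (1/2) v) = v" if "v \<in> L2 L" "pow_summable L (1/2) v" for v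
      using op_A_pow_compose(2)[OF L that(2), of "- (1/2)"] by (simp add: pow_summable_0[OF L] op_A_pow_0[OF L that(1)])
    then show "decoords L (coords L U) = U"
      using U by (cases U) (simp add: state_space_iff coords_def decoords_def op_A_pow_0[OF L])
    assume V: "V \<in> state_space"
    show "U + V \<in> state_space" "coords L (U + V) = coords L U + coords L V"
      using U V by (cases U; cases V; simp add: state_space_iff coords_def L2_add pow_summable_add[OF L]
        op_A_pow_add[OF L])+
  }
qed

lemma dom_subset_space: "U \<in> domB \<Longrightarrow> U \<in> state_space"
  by (cases U) (auto simp: dom_iff wave_pair_def state_space_iff dom_A_pow_iff[OF L] dom_A_in_L2
      intro: pow_summable_mono(1)[OF L _ dom_A_pow_1(1)[OF L]])

lemma op_in_space:
  assumes "U \<in> domB"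
  shows "opB U \<in> state_space"
proof -
  obtain \<phi> \<Phi> \<psi> \<Psi> \<theta> \<Theta> where U: "U = (\<phi>, \<Phi>, \<psi>, \<Psi>, \<theta>, \<Theta>)" by (cases U)
  note D = assms[unfolded U dom_iff wave_pair_def]
  have L2: "weak_derivative L \<Phi> \<in> L2 L" "weak_derivative L \<Theta> \<in> L2 L" "\<Theta> \<in> L2 L" "\<Psi> \<in> L2 L" "\<psi> \<in> L2 L"
      "op_A_pow L \<tau> \<Phi> \<in> L2 L" "op_A_pow L \<sigma> \<Psi> \<in> L2 L" "op_A_pow L \<xi> \<Theta> \<in> L2 L" "op_A L \<psi> \<in> L2 L" "op_A L \<theta> \<in> L2 L"
    using D by (auto simp: dom_A_pow_iff[OF L] fourier_op_A_pow(1)[OF L] dom_A_pow_1[OF L] dom_A_in_L2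
      intro!: weak_derivative_in_L2 form_domain_derivative(1)[OF L])
  have H1: "weak_derivative L \<phi> \<in> H1 L" "\<psi> \<in> H1 L" using D by (auto simp: dom_A_def H2_def H10_def)
  then have "weak_derivative L \<phi> \<in> L2 L" "weak_derivative L (weak_derivative L \<phi> + \<psi>) \<in> L2 L"
    using D weak_derivative_add[of "weak_derivative L \<phi>" L \<psi>]
    by (auto simp: dom_A_def H2_def L2_add weak_derivative_in_L2)
  with L2 D show ?thesis
    by (simp add: U B2_def state_space_iff dom_A_pow_iff[OF L] L2_add L2_diff L2_minus L2_scaleR)
qed

text \<open>
  The generator is the closure of \<open>B2\<close>, and the sectorial estimates are continuous in the coordinates of
  \<open>U\<close> and of its image, so they hold for the generator.
\<close>

theorem semigroup_analytic:
  assumes S: "contraction_C0_semigroup state_space energy_norm S"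
    and gen: "generated_by state_space energy_norm S domB opB"
  shows "analytic_semigroup state_space energy_norm S"
proof -
  show ?thesis
  proof (rule sectorial_estimates)
    fix p :: "state \<Rightarrow> state \<Rightarrow> real" and \<omega> m C :: real
    assume p: "bounded_bilinear p" "\<And>x y. p x y = p y x" "0 < m" "\<And>x. m * (norm x)\<^sup>2 \<le> p x x"
      and C: "0 \<le> C" and \<omega>: "0 \<le> \<omega>"
      and diss: "\<And>U. U \<in> domB \<Longrightarrow> p (coords L (opB U) - \<omega> *\<^sub>R coords L U) (coords L U) \<le> 0"
      and sect: "\<And>U U'. U \<in> domB \<Longrightarrow> U' \<in> domB \<Longrightarrow>
        (p (coords L (opB U) - \<omega> *\<^sub>R coords L U) (coords L U'))\<^sup>2
          \<le> C * (- p (coords L (opB U) - \<omega> *\<^sub>R coords L U) (coords L U))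
            * (- p (coords L (opB U') - \<omega> *\<^sub>R coords L U') (coords L U'))"
    let ?J = "coords L"
    let ?q = "\<lambda>U V. p (?J V - \<omega> *\<^sub>R ?J U)"
    have approx: "\<exists>W. (\<forall>n. W n \<in> domB) \<and> (\<lambda>n. ?J (W n)) \<longlonglongrightarrow> ?J U \<and>
        (\<lambda>n. ?J (opB (W n)) - \<omega> *\<^sub>R ?J (W n)) \<longlonglongrightarrow> ?J V - \<omega> *\<^sub>R ?J U"
      if g: "(U, V) \<in> generator_graph state_space energy_norm S" for U V
    proof -
      have UV: "U \<in> state_space" "V \<in> state_space" using g by (auto simp: generator_graph_def)
      obtain w where w: "\<And>n. w n \<in> {(u, opB u) | u. u \<in> domB}"
        "(\<lambda>n. energy_norm (fst (w n) - U)) \<longlonglongrightarrow> 0" "(\<lambda>n. energy_norm (snd (w n) - V)) \<longlonglongrightarrow> 0"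
        using g gen by (auto simp: generated_by_def graph_closure_def)
      have W: "fst (w n) \<in> domB" "snd (w n) = opB (fst (w n))" for n using w(1)[of n] by auto
      have 1: "(\<lambda>n. ?J (fst (w n))) \<longlonglongrightarrow> ?J U"
        by (rule coordinates.J_tendsto[OF w(2) dom_subset_space[OF W(1)] UV(1)])
      have 2: "(\<lambda>n. ?J (opB (fst (w n)))) \<longlonglongrightarrow> ?J V"
        by (rule coordinates.J_tendsto[OF w(3)[unfolded W(2)] op_in_space[OF W(1)] UV(2)])
      show ?thesis
        by (rule exI[of _ "\<lambda>n. fst (w n)"]) (intro conjI allI W(1) 1 tendsto_diff 2 tendsto_scaleR tendsto_const)
    qed
    show ?thesis
    proof (rule coordinates.analytic_if_sectorial[OF S \<omega> p C])
      note lim = bounded_bilinear.tendsto[OF p(1)]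
      fix U V assume g: "(U, V) \<in> generator_graph state_space energy_norm S"
      obtain W where W: "\<And>n. W n \<in> domB" "(\<lambda>n. ?J (W n)) \<longlonglongrightarrow> ?J U"
        "(\<lambda>n. ?J (opB (W n)) - \<omega> *\<^sub>R ?J (W n)) \<longlonglongrightarrow> ?J V - \<omega> *\<^sub>R ?J U"
        using approx[OF g] by blast
      show "p (?J V - \<omega> *\<^sub>R ?J U) (?J U) \<le> 0"
        by (rule tendsto_upperbound[OF lim[OF W(3,2)]]) (simp_all add: diss W(1))
      fix U' V' assume g': "(U', V') \<in> generator_graph state_space energy_norm S"
      obtain W' where W': "\<And>n. W' n \<in> domB" "(\<lambda>n. ?J (W' n)) \<longlonglongrightarrow> ?J U'"
        "(\<lambda>n. ?J (opB (W' n)) - \<omega> *\<^sub>R ?J (W' n)) \<longlonglongrightarrow> ?J V' - \<omega> *\<^sub>R ?J U'"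
        using approx[OF g'] by blast
      show "(?q U V (?J U'))\<^sup>2 \<le> C * (- ?q U V (?J U)) * (- ?q U' V' (?J U'))"
      proof (rule LIMSEQ_le)
        show "(\<lambda>n. (p (?J (opB (W n)) - \<omega> *\<^sub>R ?J (W n)) (?J (W' n)))\<^sup>2) \<longlonglongrightarrow> (?q U V (?J U'))\<^sup>2"
          by (intro tendsto_power lim W(3) W'(2))
        show "(\<lambda>n. C * (- p (?J (opB (W n)) - \<omega> *\<^sub>R ?J (W n)) (?J (W n)))
            * (- p (?J (opB (W' n)) - \<omega> *\<^sub>R ?J (W' n)) (?J (W' n)))) \<longlonglongrightarrow> C * (- ?q U V (?J U)) * (- ?q U' V' (?J U'))"
          by (intro tendsto_mult tendsto_minus tendsto_const lim W(2,3) W'(2,3))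
      qed (use sect W(1) W'(1) in blast)
    qed
  qed
qed

end

theorem theorem16:
  fixes L \<rho>\<^sub>1 \<rho>\<^sub>2 \<rho>\<^sub>3 \<kappa> b \<gamma> \<delta> \<mu> \<mu>\<^sub>1 \<mu>\<^sub>2 \<tau> \<sigma> \<xi> :: real
    and S :: "real \<Rightarrow> state \<Rightarrow> state"
  assumes "0 < L" "0 < \<rho>\<^sub>1" "0 < \<rho>\<^sub>2" "0 < \<rho>\<^sub>3" "0 < \<kappa>" "0 < b" "0 < \<gamma>" "0 < \<delta>"
    and "0 < \<mu>" "0 < \<mu>\<^sub>1" "0 < \<mu>\<^sub>2"
    and "contraction_C0_semigroup (space_H L) (norm_H L \<rho>\<^sub>1 \<rho>\<^sub>2 \<rho>\<^sub>3 \<kappa> b \<delta>) S"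
    and "generated_by (space_H L) (norm_H L \<rho>\<^sub>1 \<rho>\<^sub>2 \<rho>\<^sub>3 \<kappa> b \<delta>) S (dom_B2 L \<tau> \<sigma> \<xi>)
           (B2 L \<rho>\<^sub>1 \<rho>\<^sub>2 \<rho>\<^sub>3 \<kappa> b \<gamma> \<delta> \<mu> \<mu>\<^sub>1 \<mu>\<^sub>2 \<tau> \<sigma> \<xi>)"
    and "\<tau> \<in> {1/2..1}" "\<sigma> \<in> {1/2..1}" "\<xi> \<in> {1/2..1}" "\<tau> = \<xi>"
  shows "analytic_semigroup (space_H L) (norm_H L \<rho>\<^sub>1 \<rho>\<^sub>2 \<rho>\<^sub>3 \<kappa> b \<delta>) S"
proof -
  interpret timoshenko L \<rho>\<^sub>1 \<rho>\<^sub>2 \<rho>\<^sub>3 \<kappa> b \<gamma> \<delta> \<mu> \<mu>\<^sub>1 \<mu>\<^sub>2 \<tau> \<sigma> \<xi>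
    using assms(1-11) assms(14-16) by unfold_locales auto
  show ?thesis by (rule semigroup_analytic[OF assms(12,13)])
qed

end
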